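(* Let $G=(V,E)$ be a finite connected loopless multigraph and $\alpha'>0$. Let $S\subseteq V$ be nonempty with $G[S]$ connected, and let $K_1,\ldots,K_r$ be the connected components of the graph $G\setminus S$ induced on $V\setminus S$ ($r=0$ if $S=V$). Then the meromorphic continuation of $\mathcal I_G^{\mathrm{zono}}(\alpha')$ in the energies satisfies $$\operatorname*{Res}_{X_S=0}\mathcal I_G^{\mathrm{zono}}(\alpha')=2\,\mathcal C_S(\alpha')\prod_{j=1}^r\mathcal J_{K_j}^{S}(\alpha'),$$ and on $X_S=0$ the internal block $\mathcal C_S(\alpha')$ does not depend on the choice of the reference vertex used to define it.
   Context: Loopless means no self-loops; cycles and parallel edges are allowed. The energies are $x_v$ ($v\in V$) and $y_e$ ($e\in E$). For $x_v,y_e>0$, $$\mathcal I_G^{\mathrm{zono}}(\alpha')=(\alpha')^{|V|}\int_{\mathbb R^{V}}\prod_{v\in V}\mathrm d\tau_v\prod_{v\in V}(2\cosh\tau_v)^{-\alpha' x_v}\prod_{e=uv\in E}(2\cosh(\tau_u-\tau_v))^{-\alpha' y_e},$$ and it is then continued meromorphically in $(x,y)$. Let $\partial_G(S)$ be the set of edges with exactly one endpoint in $S$, and $X_S=\sum_{v\in S}x_v+\sum_{e\in\partial_G(S)}y_e$. The residue at the simple pole $X_S=0$ is the restriction of $X_S\,\mathcal I_G^{\mathrm{zono}}(\alpha')$ to $X_S=0$. For every vertex $v\in V$ put $\eta_v^S=\sum_{e}y_e$, the sum over edges $e\in\partial_G(S)$ incident to $v$. The shifted component blocks are $$\mathcal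 J_{K_j}^{S}(\alpha')=(\alpha')^{|V(K_j)|}\int_{\mathbb R^{V(K_j)}}\prod_{v\in V(K_j)}\mathrm d\tau_v\prod_{v\in V(K_j)}(2\cosh\tau_v)^{-\alpha' x_v}\prod_{e=uv\in E(K_j)}(2\cosh(\tau_u-\tau_v))^{-\alpha' y_e}\exp\Big[\alpha'\sum_{v\in V(K_j)}\eta_v^S\tau_v\Big].$$ For a reference vertex $a_\star\in S$, with $\tau_{a_\star}:=0$, the internal block is $$\mathcal C_S(\alpha')=(\alpha')^{|S|-1}\int_{\mathbb R^{S\setminus\{a_\star\}}}\prod_{v\in S\setminus\{a_\star\}}\mathrm d\tau_v\,\exp\Big[-\alpha'\sum_{v\in S}(x_v+\eta_v^S)\tau_v\Big]\prod_{e=uv\in E(G[S])}(2\cosh(\tau_u-\tau_v))^{-\alpha' y_e},$$ evaluated on $X_S=0$. All integrals are understood by meromorphic continuation in the energies; if $|S|=1$ then $\mathcal C_S=1$. *)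

theory Defs
  imports "HOL-Analysis.Analysis" "Graph_Theory.Digraph_Component"
begin

text \<open>
  A finite multigraph is given by a finite digraph (library record \<^type>\<open>pre_digraph\<close>): every
  undirected edge is one arc, oriented arbitrarily. All notions below are insensitive to the
  orientation; in particular \<^const>\<open>Digraph_Component.connected\<close> is connectedness of the
  underlying undirected graph and includes non-emptiness.

  Vertices and edges live in finite types, but \<open>verts G\<close> and \<open>arcs G\<close> may be proper subsets (there
  may be no edge at all). The energies \<open>(x, y)\<close> range over the complex vector space
  \<open>energy_space G\<close>, where the coordinates not belonging to \<open>G\<close> are zero.
\<close>

type_synonym ('v, 'e) energy = "(complex ^ 'v) \<times> (complex ^ 'e)"

definition energy_space :: "('v::finite, 'e::finite) pre_digraph \<Rightarrow> ('v, 'e) energy set" where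
  "energy_space G = {(x, y). (\<forall>v. v \<notin> verts G \<longrightarrow> x $ v = 0) \<and> (\<forall>e. e \<notin> arcs G \<longrightarrow> y $ e = 0)}"

definition positive_energies :: "('v::finite, 'e::finite) pre_digraph \<Rightarrow> ('v, 'e) energy set" where
  "positive_energies G = {(x, y) \<in> energy_space G.
     (\<forall>v\<in>verts G. x $ v \<in> \<real> \<and> 0 < Re (x $ v)) \<and> (\<forall>e\<in>arcs G. y $ e \<in> \<real> \<and> 0 < Re (y $ e))}"


section \<open>Meromorphic functions of several variables\<close>

text \<open>
  The sets \<open>A\<close> below are relatively open subsets of complex linear subspaces. The derivative is
  taken within \<open>A\<close>, so only tangent directions matter, and it has to be complex linear.
\<close>

definition holomorphic_within ::
    "('v::finite, 'e::finite) energy set \<Rightarrow> (('v, 'e) energy \<Rightarrow> complex) \<Rightarrow> bool" where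
  "holomorphic_within A f \<longleftrightarrow> (\<forall>p\<in>A. \<exists>D. (f has_derivative D) (at p within A) \<and>
     (\<forall>c h. D (c *s fst h, c *s snd h) = c * D h))"

definition nondegenerate_on ::
    "('v::finite, 'e::finite) energy set \<Rightarrow> (('v, 'e) energy \<Rightarrow> complex) \<Rightarrow> bool" where
  "nondegenerate_on A h \<longleftrightarrow> A \<subseteq> closure {q \<in> A. h q \<noteq> 0}"

text \<open>
  A meromorphic function is locally a quotient \<open>g / h\<close> of holomorphic functions with \<open>h\<close> not
  vanishing identically anywhere. It is represented by a total function whose values on the
  zero sets of the local denominators are arbitrary, so that equality of meromorphic functions
  is equality off such zero sets.
\<close>

definition meromorphic_within ::
    "('v::finite, 'e::finite) energy set \<Rightarrow> (('v, 'e) energy \<Rightarrow> complex) \<Rightarrow> bool" where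
  "meromorphic_within A f \<longleftrightarrow> (\<forall>p\<in>A. \<exists>U g h. open U \<and> p \<in> U \<and>
     holomorphic_within (A \<inter> U) g \<and> holomorphic_within (A \<inter> U) h \<and> nondegenerate_on (A \<inter> U) h \<and>
     (\<forall>q\<in>A \<inter> U. h q \<noteq> 0 \<longrightarrow> f q = g q / h q))"

definition meromorphic_eq :: "('v::finite, 'e::finite) energy set \<Rightarrow>
    (('v, 'e) energy \<Rightarrow> complex) \<Rightarrow> (('v, 'e) energy \<Rightarrow> complex) \<Rightarrow> bool" where
  "meromorphic_eq A f f' \<longleftrightarrow> (\<forall>p\<in>A. \<exists>U h. open U \<and> p \<in> U \<and>
     holomorphic_within (A \<inter> U) h \<and> nondegenerate_on (A \<inter> U) h \<and>
     (\<forall>q\<in>A \<inter> U. h q \<noteq> 0 \<longrightarrow> f q = f' q))"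

text \<open>
  \<open>R\<close> is the restriction of the meromorphic function \<open>f\<close> on \<open>A\<close> to a complex hyperplane \<open>H\<close> of \<open>A\<close>
  that is not contained in the polar set of \<open>f\<close>: near every point of \<open>H\<close>, \<open>f = k / l\<close> with \<open>l\<close> not
  vanishing identically on any piece of \<open>H\<close>, and \<open>R = k / l\<close> on \<open>H\<close>. The points of \<open>H\<close> are excluded
  from the equation for \<open>f\<close> because the representing total function may have arbitrary values there.
\<close>

definition is_restriction :: "('v::finite, 'e::finite) energy set \<Rightarrow> ('v, 'e) energy set \<Rightarrow>
    (('v, 'e) energy \<Rightarrow> complex) \<Rightarrow> (('v, 'e) energy \<Rightarrow> complex) \<Rightarrow> bool" where
  "is_restriction A H f R \<longleftrightarrow> (\<forall>p\<in>H. \<exists>U k l. open U \<and> p \<in> U \<and>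
     holomorphic_within (A \<inter> U) k \<and> holomorphic_within (A \<inter> U) l \<and> nondegenerate_on (H \<inter> U) l \<and>
     (\<forall>q\<in>A \<inter> U - H. l q \<noteq> 0 \<longrightarrow> f q = k q / l q) \<and>
     (\<forall>q\<in>H \<inter> U. l q \<noteq> 0 \<longrightarrow> R q = k q / l q))"

definition meromorphic_continuation :: "('v::finite, 'e::finite) energy set \<Rightarrow> ('v, 'e) energy set \<Rightarrow>
    (('v, 'e) energy \<Rightarrow> complex) \<Rightarrow> (('v, 'e) energy \<Rightarrow> complex) \<Rightarrow> bool" where
  "meromorphic_continuation A D f F \<longleftrightarrow> meromorphic_within A F \<and> (\<forall>p\<in>D. F p = f p)"


section \<open>Graph combinatorics\<close>

definition boundary :: "('v, 'e) pre_digraph \<Rightarrow> 'v set \<Rightarrow> 'e set" where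
  "boundary G S = {e \<in> arcs G. (tail G e \<in> S) \<noteq> (head G e \<in> S)}"

definition Xform :: "('v::finite, 'e::finite) pre_digraph \<Rightarrow> 'v set \<Rightarrow> ('v, 'e) energy \<Rightarrow> complex" where
  "Xform G S p = (\<Sum>v\<in>S. fst p $ v) + (\<Sum>e\<in>boundary G S. snd p $ e)"

definition eta ::
    "('v::finite, 'e::finite) pre_digraph \<Rightarrow> 'v set \<Rightarrow> ('v, 'e) energy \<Rightarrow> 'v \<Rightarrow> complex" where
  "eta G S p v = (\<Sum>e | e \<in> boundary G S \<and> (tail G e = v \<or> head G e = v). snd p $ e)"

definition graph_components :: "('v, 'e) pre_digraph \<Rightarrow> ('v, 'e) pre_digraph set" where
  "graph_components G = {K. pre_digraph.max_subgraph G Digraph_Component.connected K}"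

definition hyperplane ::
    "('v::finite, 'e::finite) pre_digraph \<Rightarrow> 'v set \<Rightarrow> ('v, 'e) energy set" where
  "hyperplane G S = {p \<in> energy_space G. Xform G S p = 0}"


section \<open>The integrals\<close>

definition two_cosh :: "real \<Rightarrow> complex" where
  "two_cosh t = of_real (2 * cosh t)"

definition edge_factor ::
    "('v::finite, 'e::finite) pre_digraph \<Rightarrow> real \<Rightarrow> ('v, 'e) energy \<Rightarrow> ('v \<Rightarrow> real) \<Rightarrow> complex" where
  "edge_factor G \<alpha> p \<tau> =
     (\<Prod>e\<in>arcs G. two_cosh (\<tau> (tail G e) - \<tau> (head G e)) powr (- (of_real \<alpha> * snd p $ e)))"

definition zono_integrand ::
    "('v::finite, 'e::finite) pre_digraph \<Rightarrow> real \<Rightarrow> ('v, 'e) energy \<Rightarrow> ('v \<Rightarrow> real) \<Rightarrow> complex" where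
  "zono_integrand G \<alpha> p \<tau> =
     (\<Prod>v\<in>verts G. two_cosh (\<tau> v) powr (- (of_real \<alpha> * fst p $ v))) * edge_factor G \<alpha> p \<tau>"

definition zono_integral ::
    "('v::finite, 'e::finite) pre_digraph \<Rightarrow> real \<Rightarrow> ('v, 'e) energy \<Rightarrow> complex" where
  "zono_integral G \<alpha> p = of_real \<alpha> ^ card (verts G) *
     (\<integral>\<tau>. zono_integrand G \<alpha> p \<tau> \<partial>(Pi\<^sub>M (verts G) (\<lambda>_. lborel)))"

definition shifted_integrand :: "('v::finite, 'e::finite) pre_digraph \<Rightarrow> real \<Rightarrow> 'v set \<Rightarrow>
    ('v, 'e) pre_digraph \<Rightarrow> ('v, 'e) energy \<Rightarrow> ('v \<Rightarrow> real) \<Rightarrow> complex" where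
  "shifted_integrand G \<alpha> S K p \<tau> =
     zono_integrand K \<alpha> p \<tau> * exp (of_real \<alpha> * (\<Sum>v\<in>verts K. eta G S p v * of_real (\<tau> v)))"

definition shifted_integral :: "('v::finite, 'e::finite) pre_digraph \<Rightarrow> real \<Rightarrow> 'v set \<Rightarrow>
    ('v, 'e) pre_digraph \<Rightarrow> ('v, 'e) energy \<Rightarrow> complex" where
  "shifted_integral G \<alpha> S K p = of_real \<alpha> ^ card (verts K) *
     (\<integral>\<tau>. shifted_integrand G \<alpha> S K p \<tau> \<partial>(Pi\<^sub>M (verts K) (\<lambda>_. lborel)))"

definition internal_integrand :: "('v::finite, 'e::finite) pre_digraph \<Rightarrow> real \<Rightarrow> 'v set \<Rightarrow> 'v \<Rightarrow>
    ('v, 'e) energy \<Rightarrow> ('v \<Rightarrow> real) \<Rightarrow> complex" where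
  "internal_integrand G \<alpha> S a p \<tau> = (let \<sigma> = \<tau>(a := 0) in
     exp (- of_real \<alpha> * (\<Sum>v\<in>S. (fst p $ v + eta G S p v) * of_real (\<sigma> v))) *
     edge_factor (G \<restriction> S) \<alpha> p \<sigma>)"

definition internal_integral :: "('v::finite, 'e::finite) pre_digraph \<Rightarrow> real \<Rightarrow> 'v set \<Rightarrow> 'v \<Rightarrow>
    ('v, 'e) energy \<Rightarrow> complex" where
  "internal_integral G \<alpha> S a p = of_real \<alpha> ^ (card S - 1) *
     (\<integral>\<tau>. internal_integrand G \<alpha> S a p \<tau> \<partial>(Pi\<^sub>M (S - {a}) (\<lambda>_. lborel)))"


section \<open>Their meromorphic continuations\<close>

definition zono_function :: "('v::finite, 'e::finite) pre_digraph \<Rightarrow> real \<Rightarrow>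
    (('v, 'e) energy \<Rightarrow> complex) \<Rightarrow> bool" where
  "zono_function G \<alpha> F \<longleftrightarrow>
     meromorphic_continuation (energy_space G) (positive_energies G) (zono_integral G \<alpha>) F"

text \<open>
  The shifted blocks are continued from the region of absolute convergence in the space of all
  energies, the internal block from the one in \<open>X\<^sub>S = 0\<close>, where alone it is considered.
\<close>

definition shifted_block :: "('v::finite, 'e::finite) pre_digraph \<Rightarrow> real \<Rightarrow> 'v set \<Rightarrow>
    ('v, 'e) pre_digraph \<Rightarrow> (('v, 'e) energy \<Rightarrow> complex) \<Rightarrow> bool" where
  "shifted_block G \<alpha> S K J \<longleftrightarrow> meromorphic_continuation (energy_space G)
     {p \<in> energy_space G. integrable (Pi\<^sub>M (verts K) (\<lambda>_. lborel)) (shifted_integrand G \<alpha> S K p)}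
     (shifted_integral G \<alpha> S K) J"

definition internal_block :: "('v::finite, 'e::finite) pre_digraph \<Rightarrow> real \<Rightarrow> 'v set \<Rightarrow> 'v \<Rightarrow>
    (('v, 'e) energy \<Rightarrow> complex) \<Rightarrow> bool" where
  "internal_block G \<alpha> S a C \<longleftrightarrow> meromorphic_continuation (hyperplane G S)
     {p \<in> hyperplane G S. integrable (Pi\<^sub>M (S - {a}) (\<lambda>_. lborel)) (internal_integrand G \<alpha> S a p)}
     (internal_integral G \<alpha> S a) C"

definition is_residue :: "('v::finite, 'e::finite) pre_digraph \<Rightarrow> 'v set \<Rightarrow>
    (('v, 'e) energy \<Rightarrow> complex) \<Rightarrow> (('v, 'e) energy \<Rightarrow> complex) \<Rightarrow> bool" where
  "is_residue G S F R \<longleftrightarrow>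
     is_restriction (energy_space G) (hyperplane G S) (\<lambda>p. Xform G S p * F p) R"

end

theory Submission
  imports Defs "HOL-Complex_Analysis.Conformal_Mappings"
begin

text \<open>
  Near a suitable base point of the hyperplane \<open>X\<^sub>S = 0\<close> the integrals \<open>\<C>\<^sub>S\<close> and \<open>\<J>\<^sub>K\<close> converge absolutely,
  and \<open>\<I>\<close> converges after \<open>x\<^sub>a\<close>, for some \<open>a \<in> S\<close>, is raised by any \<open>t > 0\<close>. Then \<open>X\<^sub>S = t\<close>, and splitting off
  the common translation \<open>s\<close> of the vertices of \<open>S\<close> turns \<open>\<I>\<close> into a multiple of the integral of
  \<open>(2 cosh s) powr (- \<alpha> t) \<Psi> s\<close>, with \<open>\<Psi>\<close> bounded and even. As \<open>2 cosh (s + c) \<sim> exp (s + c)\<close>, dominated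
  convergence shows that \<open>\<Psi> s\<close> tends to the product of the block integrals for \<open>s \<rightarrow> \<infinity>\<close>. An Abelian
  argument gives \<open>t \<I> \<rightarrow> 2 / \<alpha> * lim \<Psi>\<close> for \<open>t \<rightarrow> 0\<close>, the factor 2 counting the two ends of the line.

  All integrals are instances of one exponential integral. Integrating the derivative of its
  integrand along a translation by an indicator function expresses it by values at shifted energies,
  divided by the linear form vanishing on the corresponding polar hyperplane; iterating this gives the
  continuation. The identity theorem, applied after powers of \<open>X\<^sub>S\<close> are split off numerator and
  denominator, spreads the limit formula from the base point to the whole hyperplane.

  For the reference vertex, the integrand of \<open>\<C>\<^sub>S\<close> with no vertex pinned is invariant under common
  translations of \<open>S\<close> when \<open>X\<^sub>S = 0\<close>; multiplied by the indicator of
  \<open>0 \<le> \<tau> a \<le> 1\<close>, its integral over all of \<open>S\<close> equals the internal integral for either reference vertex.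
\<close>

section \<open>Complex linear structure of the energy space\<close>

text \<open>A meromorphic function is represented by a total function with arbitrary values on its
  polar set, so pointwise equations say little there. Equations are therefore cross-multiplied into
  equations between local numerators and denominators, which are holomorphic and obey the identity
  theorem. At the hyperplane both may vanish; only without their powers of X_S can they be
  restricted to it and their orders compared. One base point with X_S = 0 has to serve all integrals
  at once: x = - eta on S kills the linear weights of the internal block, and x = eta + 1 off S
  beats the exponential shift of the other blocks. Since ln (2 cosh t) is |t| up to a bounded error,
  convergence is a piecewise linear question, decided by finitely many inequalities, one for each
  signed indicator function. That these describe integrability exactly matters: the blocks are
  continued from the region of integrability, so a constructed continuation has to agree with the
  integral wherever the latter converges.\<close>

definition cscale :: "complex \<Rightarrow> ('v::finite, 'e::finite) energy \<Rightarrow> ('v, 'e) energy" where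
  "cscale c h = (c *s fst h, c *s snd h)"

lemma fst_cscale [simp]: "fst (cscale c h) $ v = c * fst h $ v"
  and snd_cscale [simp]: "snd (cscale c h) $ e = c * snd h $ e"
  by (simp_all add: cscale_def)

lemma energy_eqI: "(\<And>v. fst p $ v = fst q $ v) \<Longrightarrow> (\<And>e. snd p $ e = snd q $ e) \<Longrightarrow> p = q"
  by (simp add: prod_eq_iff vec_eq_iff)

lemma cscale_simps [simp]:
  "cscale c (a + b) = cscale c a + cscale c b" "cscale c (a - b) = cscale c a - cscale c b"
  "cscale (c + d) a = cscale c a + cscale d a" "cscale (c - d) a = cscale c a - cscale d a"
  "cscale c (cscale d a) = cscale (c * d) a" "cscale 1 a = a" "cscale 0 a = 0" "cscale c 0 = 0"
  by (auto intro!: energy_eqI simp: algebra_simps)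

lemma scaleR_eq_cscale: "r *\<^sub>R h = cscale (of_real r) h"
  by (intro energy_eqI) (simp_all add: scaleR_conv_of_real[where 'a = complex])

lemma norm_cscale: "norm (cscale c h) = norm c * norm h"
proof -
  have *: "norm (c *s x) = norm c * norm x" for x :: "complex ^ 'n::finite"
    by (simp add: norm_vec_def L2_set_def norm_mult power_mult_distrib real_sqrt_mult
        flip: sum_distrib_left)
  show ?thesis
    by (simp add: cscale_def norm_prod_def * power_mult_distrib real_sqrt_mult
        flip: distrib_left)
qed

lemma bounded_bilinear_cscale: "bounded_bilinear cscale"
proof
  show "\<exists>K. \<forall>a b. norm (cscale a b) \<le> norm a * norm b * K"
    by (rule exI[of _ 1]) (simp add: norm_cscale)
qed (auto simp: scaleR_eq_cscale scaleR_conv_of_real mult.commute)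

lemmas bounded_linear_cscale_left = bounded_bilinear.bounded_linear_left[OF bounded_bilinear_cscale]
lemmas continuous_on_cscale [continuous_intros] =
  bounded_bilinear.continuous_on[OF bounded_bilinear_cscale]

section \<open>Complex subspaces, linear forms and linear maps\<close>

definition csubspace :: "('v::finite, 'e::finite) energy set \<Rightarrow> bool" where
  "csubspace E \<longleftrightarrow> 0 \<in> E \<and> (\<forall>a\<in>E. \<forall>b\<in>E. a + b \<in> E) \<and> (\<forall>c. \<forall>a\<in>E. cscale c a \<in> E)"

lemma csubspaceD:
  assumes "csubspace E"
  shows "0 \<in> E" "\<And>a b. a \<in> E \<Longrightarrow> b \<in> E \<Longrightarrow> a + b \<in> E" "\<And>c a. a \<in> E \<Longrightarrow> cscale c a \<in> E"
    "\<And>a b. a \<in> E \<Longrightarrow> b \<in> E \<Longrightarrow> a - b \<in> E"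
proof -
  show *: "0 \<in> E" "\<And>a b. a \<in> E \<Longrightarrow> b \<in> E \<Longrightarrow> a + b \<in> E" "\<And>c a. a \<in> E \<Longrightarrow> cscale c a \<in> E"
    using assms by (auto simp: csubspace_def)
  fix a b assume "a \<in> E" "b \<in> E"
  then have "a + cscale (-1) b \<in> E" using * by auto
  moreover have "a + cscale (-1) b = a - b" by (auto intro!: energy_eqI)
  ultimately show "a - b \<in> E" by simp
qed

lemma csubspace_convex: "csubspace E \<Longrightarrow> convex E"
  by (auto simp: convex_def scaleR_eq_cscale csubspaceD)

lemma csubspace_UNIV: "csubspace UNIV"
  by (simp add: csubspace_def)

definition cform :: "(('v::finite, 'e::finite) energy \<Rightarrow> complex) \<Rightarrow> bool" where
  "cform X \<longleftrightarrow> bounded_linear X \<and> (\<forall>c h. X (cscale c h) = c * X h)"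

definition cmap :: "(('v::finite, 'e::finite) energy \<Rightarrow> ('w::finite, 'f::finite) energy) \<Rightarrow> bool" where
  "cmap L \<longleftrightarrow> bounded_linear L \<and> (\<forall>c h. L (cscale c h) = cscale c (L h))"

lemma bounded_linear_fst_nth: "bounded_linear (\<lambda>p. fst p $ v)"
  and bounded_linear_snd_nth: "bounded_linear (\<lambda>p. snd p $ v)"
  using bounded_linear_compose[OF bounded_linear_vec_nth bounded_linear_fst]
    bounded_linear_compose[OF bounded_linear_vec_nth bounded_linear_snd] by auto

lemma cform_fst: "cform (\<lambda>p. fst p $ v)" and cform_snd: "cform (\<lambda>p. snd p $ e)"
  by (auto simp: cform_def bounded_linear_fst_nth bounded_linear_snd_nth)

lemma cform_add: "cform X \<Longrightarrow> cform Y \<Longrightarrow> cform (\<lambda>p. X p + Y p)"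
  by (auto simp: cform_def algebra_simps intro: bounded_linear_add)

lemma cform_zero: "cform (\<lambda>_. 0)" by (auto simp: cform_def)

lemma cform_cmult: "cform X \<Longrightarrow> cform (\<lambda>p. c * X p)"
  by (auto simp: cform_def algebra_simps intro: bounded_linear_const_mult)

lemma cform_sum: "(\<And>i. i \<in> I \<Longrightarrow> cform (X i)) \<Longrightarrow> cform (\<lambda>p. \<Sum>i\<in>I. X i p)"
  by (induction I rule: infinite_finite_induct) (auto intro: cform_zero cform_add)

lemma cform_linear: assumes "cform X"
  shows "X (a + b) = X a + X b" "X (a - b) = X a - X b" "X (cscale c a) = c * X a" "X 0 = 0"
  using assms linear_simps[of X] unfolding cform_def by blast+

lemma cform_continuous: "cform X \<Longrightarrow> continuous_on A X"
  by (simp add: cform_def linear_continuous_on)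

lemma cmap_linear: assumes "cmap L"
  shows "L (a + b) = L a + L b" "L (a - b) = L a - L b" "L (cscale c a) = cscale c (L a)" "L 0 = 0"
  using assms linear_simps[of L] unfolding cmap_def by blast+

lemma cmap_continuous: "cmap X \<Longrightarrow> continuous_on A X"
  by (simp add: cmap_def linear_continuous_on)

lemma cmapI:
  assumes "\<And>v. cform (\<lambda>p. fst (L p) $ v)" "\<And>e. cform (\<lambda>p. snd (L p) $ e)"
  shows "cmap (L :: ('v::finite, 'e::finite) energy \<Rightarrow> ('w::finite, 'f::finite) energy)"
proof -
  have lin: "L (a + b) = L a + L b" and sc: "L (cscale c a) = cscale c (L a)" for a b c
    by (auto intro!: energy_eqI simp del: split_paired_All
        simp: cform_linear(1,3)[OF assms(1)] cform_linear(1,3)[OF assms(2)])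
  then have "linear L" by (intro linearI) (auto simp: scaleR_eq_cscale)
  then show ?thesis using sc by (auto simp: cmap_def linear_conv_bounded_linear)
qed


section \<open>Holomorphic functions on open subsets of complex subspaces\<close>

lemma holomorphic_within_alt: "holomorphic_within A f \<longleftrightarrow> (\<forall>p\<in>A. \<exists>D. (f has_derivative D) (at p within A) \<and>
     (\<forall>c h. D (cscale c h) = c * D h))"
  by (simp add: holomorphic_within_def cscale_def)

lemma holomorphic_withinE:
  assumes "holomorphic_within A f" "p \<in> A"
  obtains D where "(f has_derivative D) (at p within A)" "\<And>c h. D (cscale c h) = c * D h"
  using assms unfolding holomorphic_within_alt by blast

lemma holomorphic_within_subset:
  assumes "holomorphic_within A f" "B \<subseteq> A"
  shows "holomorphic_within B f"
  unfolding holomorphic_within_alt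
proof
  fix p assume "p \<in> B"
  then have p: "p \<in> A" using assms(2) by blast
  obtain D where D: "(f has_derivative D) (at p within A)" "\<And>c h. D (cscale c h) = c * D h"
    by (rule holomorphic_withinE[OF assms(1) p]) blast
  have "(f has_derivative D) (at p within B)"
    by (rule has_derivative_subset[OF D(1) assms(2)])
  then show "\<exists>D. (f has_derivative D) (at p within B) \<and> (\<forall>c h. D (cscale c h) = c * D h)"
    using D(2) by blast
qed

lemma holomorphic_within_cong:
  assumes "\<And>p. p \<in> A \<Longrightarrow> f p = g p"
  shows "holomorphic_within A f \<longleftrightarrow> holomorphic_within A g"
proof -
  have "(f has_derivative D) (at p within A) \<longleftrightarrow> (g has_derivative D) (at p within A)" if "p \<in> A" for p D
    using assms that has_derivative_transform[of p A f g D] has_derivative_transform[of p A g f D] by metis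
  then show ?thesis unfolding holomorphic_within_alt by simp
qed

lemma holomorphic_within_continuous: "holomorphic_within A f \<Longrightarrow> continuous_on A f"
  unfolding holomorphic_within_alt continuous_on_eq_continuous_within
  using has_derivative_continuous by blast

lemma holomorphic_within_const: "holomorphic_within A (\<lambda>_. c)"
  unfolding holomorphic_within_alt by (auto intro!: exI[of _ "\<lambda>_. 0"])

lemma holomorphic_within_add:
  assumes "holomorphic_within A f" "holomorphic_within A g"
  shows "holomorphic_within A (\<lambda>p. f p + g p)"
  unfolding holomorphic_within_alt
proof
  fix p assume p: "p \<in> A"
  obtain D where D: "(f has_derivative D) (at p within A)" "\<And>c h. D (cscale c h) = c * D h"
    by (rule holomorphic_withinE[OF assms(1) p]) blast
  obtain D' where "(g has_derivative D') (at p within A)" "\<And>c h. D' (cscale c h) = c * D' h"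
    by (rule holomorphic_withinE[OF assms(2) p]) blast
  with D show "\<exists>D. ((\<lambda>p. f p + g p) has_derivative D) (at p within A) \<and> (\<forall>c h. D (cscale c h) = c * D h)"
    by (intro exI[of _ "\<lambda>h. D h + D' h"]) (simp add: has_derivative_add distrib_left)
qed

lemma holomorphic_within_mult:
  assumes "holomorphic_within A f" "holomorphic_within A g"
  shows "holomorphic_within A (\<lambda>p. f p * g p)"
  unfolding holomorphic_within_alt
proof
  fix p assume p: "p \<in> A"
  obtain D where D: "(f has_derivative D) (at p within A)" "\<And>c h. D (cscale c h) = c * D h"
    by (rule holomorphic_withinE[OF assms(1) p]) blast
  obtain D' where "(g has_derivative D') (at p within A)" "\<And>c h. D' (cscale c h) = c * D' h"
    by (rule holomorphic_withinE[OF assms(2) p]) blast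
  with D show "\<exists>D. ((\<lambda>p. f p * g p) has_derivative D) (at p within A) \<and> (\<forall>c h. D (cscale c h) = c * D h)"
    by (intro exI[of _ "\<lambda>h. f p * D' h + D h * g p"])
      (simp add: has_derivative_mult distrib_left mult.left_commute mult.assoc)
qed

lemma holomorphic_within_diff:
  assumes "holomorphic_within A f" "holomorphic_within A g"
  shows "holomorphic_within A (\<lambda>p. f p - g p)"
  using holomorphic_within_add[OF assms(1) holomorphic_within_mult[OF holomorphic_within_const[of _ "-1"] assms(2)]]
  by simp

lemma holomorphic_within_sum:
  "(\<And>i. i \<in> I \<Longrightarrow> holomorphic_within A (f i)) \<Longrightarrow> holomorphic_within A (\<lambda>p. \<Sum>i\<in>I. f i p)"
  by (induction I rule: infinite_finite_induct) (auto intro: holomorphic_within_const holomorphic_within_add)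

lemma holomorphic_within_prod:
  "(\<And>i. i \<in> I \<Longrightarrow> holomorphic_within A (f i)) \<Longrightarrow> holomorphic_within A (\<lambda>p. \<Prod>i\<in>I. f i p)"
  by (induction I rule: infinite_finite_induct) (auto intro: holomorphic_within_const holomorphic_within_mult)

lemma holomorphic_within_power: "holomorphic_within A f \<Longrightarrow> holomorphic_within A (\<lambda>p. f p ^ n)"
  by (induction n) (auto intro: holomorphic_within_const holomorphic_within_mult)

lemma holomorphic_within_cform: "cform X \<Longrightarrow> holomorphic_within A X"
  unfolding holomorphic_within_alt cform_def using bounded_linear_imp_has_derivative by blast

lemma holomorphic_within_inverse:
  assumes "holomorphic_within A f" "\<And>p. p \<in> A \<Longrightarrow> f p \<noteq> 0"
  shows "holomorphic_within A (\<lambda>p. inverse (f p))"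
  unfolding holomorphic_within_alt
proof
  fix p assume p: "p \<in> A"
  obtain D where "(f has_derivative D) (at p within A)" "\<And>c h. D (cscale c h) = c * D h"
    by (rule holomorphic_withinE[OF assms(1) p]) blast
  note D = this
  show "\<exists>D. ((\<lambda>p. inverse (f p)) has_derivative D) (at p within A) \<and> (\<forall>c h. D (cscale c h) = c * D h)"
    by (intro exI conjI allI, rule Deriv.has_derivative_inverse[OF assms(2)[OF p] D(1)])
      (simp add: D(2) mult.left_commute)
qed

lemma holomorphic_within_divide:
  assumes "holomorphic_within A f" "holomorphic_within A g" "\<And>p. p \<in> A \<Longrightarrow> g p \<noteq> 0"
  shows "holomorphic_within A (\<lambda>p. f p / g p)"
  using holomorphic_within_mult[OF assms(1) holomorphic_within_inverse[OF assms(2,3)]]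
  by (simp add: divide_inverse)

lemma holomorphic_within_affine:
  assumes "holomorphic_within B f" "cmap L" "\<And>p. p \<in> A \<Longrightarrow> c + L p \<in> B"
  shows "holomorphic_within A (\<lambda>p. f (c + L p))"
  unfolding holomorphic_within_alt
proof
  fix p assume p: "p \<in> A"
  obtain D where D: "(f has_derivative D) (at (c + L p) within B)" "\<And>c h. D (cscale c h) = c * D h"
    by (rule holomorphic_withinE[OF assms(1) assms(3)[OF p]]) blast
  have "((\<lambda>p. c + L p) has_derivative L) (at p within A)"
    using assms(2) by (auto simp: cmap_def intro!: derivative_eq_intros bounded_linear_imp_has_derivative)
  moreover have "(f has_derivative D) (at (c + L p) within (\<lambda>p. c + L p) ` A)"
    using assms(3) by (intro has_derivative_subset[OF D(1)]) auto
  ultimately have "((\<lambda>p. f (c + L p)) has_derivative (\<lambda>h. D (L h))) (at p within A)"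
    by (rule has_derivative_in_compose)
  then show "\<exists>D. ((\<lambda>p. f (c + L p)) has_derivative D) (at p within A) \<and> (\<forall>c h. D (cscale c h) = c * D h)"
    using D(2) cmap_linear(3)[OF assms(2)] by (intro exI[of _ "\<lambda>h. D (L h)"]) simp
qed

lemma holomorphic_within_cmap:
  assumes "holomorphic_within B f" "cmap L" "\<And>p. p \<in> A \<Longrightarrow> L p \<in> B"
  shows "holomorphic_within A (\<lambda>p. f (L p))"
  using holomorphic_within_affine[of B f L A 0] assms by simp

lemma holomorphic_within_local:
  assumes "\<And>p. p \<in> A \<Longrightarrow> \<exists>U. open U \<and> p \<in> U \<and> holomorphic_within (A \<inter> U) f"
  shows "holomorphic_within A f"
  unfolding holomorphic_within_alt
proof
  fix p assume p: "p \<in> A"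
  then obtain U where U: "open U" "p \<in> U" "holomorphic_within (A \<inter> U) f" using assms by blast
  have "at p within (A \<inter> U) = at p within A"
    using at_within_nhd[of p U "A \<inter> U" A] U by auto
  then show "\<exists>D. (f has_derivative D) (at p within A) \<and> (\<forall>c h. D (cscale c h) = c * D h)"
    using U(3) p U(2) unfolding holomorphic_within_alt by (metis IntI)
qed

section \<open>Restriction to complex lines and the identity theorem\<close>

lemma holomorphic_within_line:
  assumes "holomorphic_within A f" "\<And>t. t \<in> T \<Longrightarrow> p + cscale t v \<in> A"
  shows "(\<lambda>t. f (p + cscale t v)) holomorphic_on T"
  unfolding holomorphic_on_def field_differentiable_def
proof
  fix t assume t: "t \<in> T"
  obtain D where D: "(f has_derivative D) (at (p + cscale t v) within A)" "\<And>c h. D (cscale c h) = c * D h"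
    by (rule holomorphic_withinE[OF assms(1) assms(2)[OF t]]) blast
  have "((\<lambda>t. p + cscale t v) has_derivative (\<lambda>h. cscale h v)) (at t within T)"
    by (auto intro!: derivative_eq_intros bounded_linear_imp_has_derivative bounded_linear_cscale_left)
  moreover have "(f has_derivative D) (at (p + cscale t v) within (\<lambda>t. p + cscale t v) ` T)"
    using assms(2) by (intro has_derivative_subset[OF D(1)]) auto
  ultimately have "((\<lambda>t. f (p + cscale t v)) has_derivative (\<lambda>h. D (cscale h v))) (at t within T)"
    by (rule has_derivative_in_compose)
  then show "\<exists>f'. ((\<lambda>t. f (p + cscale t v)) has_field_derivative f') (at t within T)"
    unfolding has_field_derivative_def D(2) by (intro exI[of _ "D v"]) (simp add: mult.commute[of _ "D v"])
qed

lemma line_preimage: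
  fixes U :: "('v::finite, 'e::finite) energy set"
  assumes "open U" "convex U"
  shows "open {t. p + cscale t v \<in> U}" "convex {t. p + cscale t v \<in> U}"
proof -
  have "continuous_on UNIV (\<lambda>t. p + cscale t v)" by (intro continuous_intros)
  then have "open ((\<lambda>t. p + cscale t v) -` U)" using assms(1) open_vimage by blast
  then show "open {t. p + cscale t v \<in> U}" by (simp add: vimage_def)
  show "convex {t. p + cscale t v \<in> U}"
    unfolding convex_def
  proof (clarsimp)
    fix s t and u w :: real assume *: "p + cscale s v \<in> U" "p + cscale t v \<in> U" "0 \<le> u" "0 \<le> w" "u + w = 1"
    then have "u *\<^sub>R (p + cscale s v) + w *\<^sub>R (p + cscale t v) \<in> U"
      using assms(2) by (simp add: convex_def)
    moreover have "u *\<^sub>R (p + cscale s v) + w *\<^sub>R (p + cscale t v) =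
        (u + w) *\<^sub>R p + (cscale (u *\<^sub>R s) v + cscale (w *\<^sub>R t) v)"
      by (simp add: scaleR_eq_cscale scaleR_conv_of_real algebra_simps scaleR_add_left)
    ultimately show "p + (cscale (u *\<^sub>R s) v + cscale (w *\<^sub>R t) v) \<in> U" using * by simp
  qed
qed

text \<open>The identity theorem is reduced to one variable along the lines through \<open>p\<close>.\<close>

lemma holomorphic_within_zero_line:
  fixes E U :: "('v::finite, 'e::finite) energy set"
  assumes "csubspace E" "open U" "convex U" "holomorphic_within (E \<inter> U) f"
    and "p \<in> E \<inter> U" "v \<in> E" "0 islimpt {t. p + cscale t v \<in> U \<and> f (p + cscale t v) = 0}"
    and "p + cscale w v \<in> U"
  shows "f (p + cscale w v) = 0"
proof -
  let ?T = "{t. p + cscale t v \<in> U}"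
  let ?Z = "{t. p + cscale t v \<in> U \<and> f (p + cscale t v) = 0}"
  have "p + cscale t v \<in> E" for t
    using csubspaceD[OF assms(1)] assms(5,6) by blast
  then have hol: "(\<lambda>t. f (p + cscale t v)) holomorphic_on ?T"
    by (intro holomorphic_within_line[OF assms(4)]) simp
  show ?thesis
    by (rule analytic_continuation[OF hol line_preimage(1)[OF assms(2,3)]
          convex_connected[OF line_preimage(2)[OF assms(2,3)]], where U = ?Z and \<xi> = 0])
      (use assms(5,7,8) in \<open>simp_all add: subset_eq\<close>)
qed

lemma holomorphic_within_identity:
  fixes E U :: "('v::finite, 'e::finite) energy set"
  assumes E: "csubspace E" and U: "open U" "convex U" and f: "holomorphic_within (E \<inter> U) f"
    and p: "p \<in> E \<inter> U" and B: "open B" "p \<in> B" and z: "\<And>q. q \<in> E \<inter> U \<inter> B \<Longrightarrow> f q = 0"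
    and q: "q \<in> E \<inter> U"
  shows "f q = 0"
proof -
  let ?v = "q - p"
  have v: "?v \<in> E" using p q E by (auto intro: csubspaceD)
  have "continuous_on UNIV (\<lambda>t. p + cscale t ?v)" by (intro continuous_intros)
  then have "open ((\<lambda>t. p + cscale t ?v) -` (U \<inter> B))" using U B open_vimage by blast
  moreover have "0 \<in> (\<lambda>t. p + cscale t ?v) -` (U \<inter> B)" using p B by simp
  ultimately have "0 islimpt (\<lambda>t. p + cscale t ?v) -` (U \<inter> B)"
    by (metis interior_open interior_limit_point)
  then have "0 islimpt {t. p + cscale t ?v \<in> U \<and> f (p + cscale t ?v) = 0}"
  proof (rule islimpt_subset, intro subsetI)
    fix t assume "t \<in> (\<lambda>t. p + cscale t ?v) -` (U \<inter> B)"
    moreover have "p + cscale t ?v \<in> E" using csubspaceD[OF E] p v by blast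
    ultimately show "t \<in> {t. p + cscale t ?v \<in> U \<and> f (p + cscale t ?v) = 0}"
      using z by (simp del: cscale_simps)
  qed
  from holomorphic_within_zero_line[OF E U f p v this, of 1] q show ?thesis by simp
qed

text \<open>A set of uniqueness at \<open>p\<close>, for all convex neighbourhoods. It is not
  restricted to open sets \<open>D\<close>, because the original integral is given only for real
  positive energies, a totally real set.\<close>

definition determining :: "('v::finite, 'e::finite) energy set \<Rightarrow> ('v, 'e) energy set \<Rightarrow> ('v, 'e) energy \<Rightarrow> bool" where
  "determining E D p \<longleftrightarrow> p \<in> E \<and> (\<forall>U f. open U \<and> convex U \<and> p \<in> U \<and> holomorphic_within (E \<inter> U) f \<and>
     (\<forall>q\<in>E \<inter> U \<inter> D. f q = 0) \<longrightarrow> (\<forall>q\<in>E \<inter> U. f q = 0))"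

lemma determining_open:
  assumes "csubspace E" "open B" "p \<in> B" "p \<in> E" "E \<inter> B \<subseteq> D"
  shows "determining E D p"
  unfolding determining_def
proof (intro conjI allI impI ballI)
  fix U f q
  assume *: "open U \<and> convex U \<and> p \<in> U \<and> holomorphic_within (E \<inter> U) f \<and> (\<forall>q\<in>E \<inter> U \<inter> D. f q = 0)"
    and q: "q \<in> E \<inter> U"
  show "f q = 0"
    by (rule holomorphic_within_identity[OF assms(1) _ _ _ _ assms(2,3) _ q]) (use * assms in auto)
qed fact

section \<open>Functions that vanish on no open piece of a set\<close>

lemma nondegenerate_on_alt:
  "nondegenerate_on A h \<longleftrightarrow> (\<forall>q\<in>A. \<forall>V. open V \<and> q \<in> V \<longrightarrow> (\<exists>q'\<in>A \<inter> V. h q' \<noteq> 0))"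
proof -
  have "q \<in> closure B \<longleftrightarrow> (\<forall>V. open V \<and> q \<in> V \<longrightarrow> (\<exists>q'\<in>B. q' \<in> V))" for q and B :: "('a, 'b) energy set"
    unfolding closure_iff_nhds_not_empty by blast
  then show ?thesis
    unfolding nondegenerate_on_def subset_eq by (simp add: Bex_def conj_ac)
qed

lemma nondegenerate_on_subset:
  assumes "nondegenerate_on (E \<inter> U) h" "open B" "B \<subseteq> U"
  shows "nondegenerate_on (E \<inter> B) h"
  unfolding nondegenerate_on_alt
proof (intro ballI allI impI)
  fix q V assume "q \<in> E \<inter> B" "open V \<and> q \<in> V"
  then have "q \<in> E \<inter> U" "open (V \<inter> B) \<and> q \<in> V \<inter> B" using assms by auto
  then obtain q' where "q' \<in> E \<inter> U \<inter> (V \<inter> B)" "h q' \<noteq> 0"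
    using assms(1) unfolding nondegenerate_on_alt by blast
  then show "\<exists>q'\<in>E \<inter> B \<inter> V. h q' \<noteq> 0" by blast
qed

text \<open>If \<open>h\<close> vanished on an open piece of the convex set, the identity theorem
  would make it vanish everywhere, also at \<open>q\<close>.\<close>

lemma nondegenerate_on_convex:
  assumes "csubspace E" "open U" "convex U" "holomorphic_within (E \<inter> U) h" "q \<in> E \<inter> U" "h q \<noteq> 0"
  shows "nondegenerate_on (E \<inter> U) h"
  unfolding nondegenerate_on_alt
proof (intro ballI allI impI, rule ccontr)
  fix q' V assume *: "q' \<in> E \<inter> U" "open V \<and> q' \<in> V" "\<not> (\<exists>q'\<in>E \<inter> U \<inter> V. h q' \<noteq> 0)"
  have "h q = 0"
    by (rule holomorphic_within_identity[OF assms(1-4) *(1) _ _ _ assms(5), of V]) (use * in auto)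
  then show False using assms by simp
qed

lemma nonzero_open:
  assumes "continuous_on (E \<inter> U) h" "open U" "q \<in> E \<inter> U" "(h q :: complex) \<noteq> 0"
  obtains V where "open V" "q \<in> V" "V \<subseteq> U" "\<And>q'. q' \<in> E \<inter> V \<Longrightarrow> h q' \<noteq> 0"
proof -
  have "openin (top_of_set (E \<inter> U)) (E \<inter> U \<inter> h -` (- {0}))"
    by (rule continuous_openin_preimage_gen[OF assms(1)]) auto
  then obtain T where "open T" "E \<inter> U \<inter> h -` (- {0}) = E \<inter> U \<inter> T" by (auto simp: openin_open)
  then show ?thesis using assms by (intro that[of "U \<inter> T"]) auto
qed

text \<open>First move to a point where \<open>h\<close> is nonzero, then, inside a neighbourhood on
  which \<open>h\<close> stays nonzero, to a point where \<open>k\<close> is nonzero.\<close>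

lemma nondegenerate_on_mult:
  assumes "open U" "continuous_on (E \<inter> U) h" "nondegenerate_on (E \<inter> U) h" "nondegenerate_on (E \<inter> U) k"
  shows "nondegenerate_on (E \<inter> U) (\<lambda>p. h p * k p)"
  unfolding nondegenerate_on_alt
proof (intro ballI allI impI)
  fix q V assume "q \<in> E \<inter> U" "open V \<and> q \<in> V"
  then obtain q1 where q1: "q1 \<in> E \<inter> U \<inter> V" "h q1 \<noteq> 0" using assms(3) unfolding nondegenerate_on_alt by blast
  obtain V1 where "open V1" "q1 \<in> V1" "V1 \<subseteq> U" "\<And>q'. q' \<in> E \<inter> V1 \<Longrightarrow> h q' \<noteq> 0"
    using nonzero_open[OF assms(2,1), of q1] q1 by auto
  moreover from this have "open (V1 \<inter> V) \<and> q1 \<in> V1 \<inter> V" using q1 \<open>open V \<and> q \<in> V\<close> by auto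
  then obtain q2 where q2: "q2 \<in> E \<inter> U \<inter> (V1 \<inter> V)" "k q2 \<noteq> 0"
    using assms(4) q1 unfolding nondegenerate_on_alt by (meson IntD1)
  ultimately have "h q2 * k q2 \<noteq> 0" by (metis IntD1 IntD2 IntI mult_eq_0_iff)
  then show "\<exists>q'\<in>E \<inter> U \<inter> V. h q' * k q' \<noteq> 0" using q2 by blast
qed

lemma nondegenerate_on_one: "nondegenerate_on A (\<lambda>_. 1)"
  by (auto simp: nondegenerate_on_alt)

lemma nondegenerate_on_prod:
  assumes "finite I" "open U" "\<And>i. i \<in> I \<Longrightarrow> continuous_on (E \<inter> U) (h i)"
     "\<And>i. i \<in> I \<Longrightarrow> nondegenerate_on (E \<inter> U) (h i)"
  shows "nondegenerate_on (E \<inter> U) (\<lambda>p. \<Prod>i\<in>I. h i p)"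
  using assms(1,3,4)
proof induction
  case (insert i I)
  have "nondegenerate_on (E \<inter> U) (\<lambda>p. h i p * (\<Prod>i\<in>I. h i p))"
    using insert by (intro nondegenerate_on_mult assms(2)) auto
  then show ?case using insert.hyps by simp
qed (simp add: nondegenerate_on_one)

text \<open>The points with \<open>h q \<noteq> 0\<close> are dense, so continuity extends the
  equality to all points. This is the standard way of turning an equation of quotients into an
  equation of holomorphic functions without exceptional points.\<close>

lemma nondegenerate_on_eqI:
  fixes f :: "('v::finite, 'e::finite) energy \<Rightarrow> complex"
  assumes "open U" "nondegenerate_on (E \<inter> U) h" "continuous_on (E \<inter> U) f" "continuous_on (E \<inter> U) g"
    and "\<And>q. q \<in> E \<inter> U \<Longrightarrow> h q \<noteq> 0 \<Longrightarrow> f q = g q" and q: "q \<in> E \<inter> U"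
  shows "f q = g q"
proof (rule ccontr)
  assume "f q \<noteq> g q"
  then have "f q - g q \<noteq> 0" by simp
  moreover have "continuous_on (E \<inter> U) (\<lambda>q. f q - g q)" using assms by (intro continuous_intros)
  ultimately obtain V where V: "open V" "q \<in> V" "V \<subseteq> U" "\<And>q'. q' \<in> E \<inter> V \<Longrightarrow> f q' - g q' \<noteq> 0"
    using nonzero_open[of E U "\<lambda>q. f q - g q" q] assms(1) q by blast
  then obtain q' where "q' \<in> E \<inter> U \<inter> V" "h q' \<noteq> 0" using assms(2) q unfolding nondegenerate_on_alt by blast
  then show False using V assms(5)[of q'] by auto
qed

section \<open>Meromorphic functions\<close>

definition frac_rep :: "('v::finite, 'e::finite) energy set \<Rightarrow> (('v, 'e) energy \<Rightarrow> complex) \<Rightarrow>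
    ('v, 'e) energy set \<Rightarrow> (('v, 'e) energy \<Rightarrow> complex) \<Rightarrow> (('v, 'e) energy \<Rightarrow> complex) \<Rightarrow> bool" where
  "frac_rep A f U g h \<longleftrightarrow> holomorphic_within (A \<inter> U) g \<and> holomorphic_within (A \<inter> U) h \<and>
     nondegenerate_on (A \<inter> U) h \<and> (\<forall>q\<in>A \<inter> U. h q \<noteq> 0 \<longrightarrow> f q = g q / h q)"

lemma meromorphic_within_frac_rep:
  "meromorphic_within A f \<longleftrightarrow> (\<forall>p\<in>A. \<exists>U g h. open U \<and> p \<in> U \<and> frac_rep A f U g h)"
  by (simp add: meromorphic_within_def frac_rep_def)

lemma frac_rep_subset:
  assumes "frac_rep A f U g h" "open B" "B \<subseteq> U"
  shows "frac_rep A f B g h"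
proof -
  have "A \<inter> B \<subseteq> A \<inter> U" using assms(3) by blast
  then show ?thesis
    using assms holomorphic_within_subset nondegenerate_on_subset[of A U h B] unfolding frac_rep_def by blast
qed

lemma meromorphic_within_mult:
  assumes "meromorphic_within A f" "meromorphic_within A f'"
  shows "meromorphic_within A (\<lambda>p. f p * f' p)"
  unfolding meromorphic_within_frac_rep
proof
  fix p assume p: "p \<in> A"
  obtain U g h where U: "open U" "p \<in> U" "frac_rep A f U g h"
    using assms(1) p unfolding meromorphic_within_frac_rep by blast
  obtain U' g' h' where U': "open U'" "p \<in> U'" "frac_rep A f' U' g' h'"
    using assms(2) p unfolding meromorphic_within_frac_rep by blast
  have *: "frac_rep A f (U \<inter> U') g h" "frac_rep A f' (U \<inter> U') g' h'"
    using U U' by (auto intro: frac_rep_subset)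
  then have "frac_rep A (\<lambda>p. f p * f' p) (U \<inter> U') (\<lambda>p. g p * g' p) (\<lambda>p. h p * h' p)"
    using U(1) U'(1) unfolding frac_rep_def
    by (intro conjI holomorphic_within_mult nondegenerate_on_mult open_Int) (auto dest: holomorphic_within_continuous)
  then show "\<exists>U g h. open U \<and> p \<in> U \<and> frac_rep A (\<lambda>p. f p * f' p) U g h"
    using U U' by (intro exI[of _ "U \<inter> U'"]) blast
qed

lemma meromorphic_within_holomorphic:
  assumes "holomorphic_within A f" shows "meromorphic_within A f"
  unfolding meromorphic_within_frac_rep frac_rep_def
  using assms holomorphic_within_const[of A 1]
  by (intro ballI exI[of _ UNIV] exI[of _ f] exI[of _ "\<lambda>_. 1"]) (simp add: nondegenerate_on_one)

lemma meromorphic_within_prod: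
  "(\<And>i. i \<in> I \<Longrightarrow> meromorphic_within A (f i)) \<Longrightarrow> meromorphic_within A (\<lambda>p. \<Prod>i\<in>I. f i p)"
  by (induction I rule: infinite_finite_induct)
    (auto intro: meromorphic_within_mult meromorphic_within_holomorphic holomorphic_within_const)

text \<open>The usable form of the statement that \<open>F\<close> coincides with a continuous
  function \<open>Q\<close>: it also holds at zeros of \<open>h\<close> and \<open>k\<close>, where
  the value of \<open>F\<close> itself carries no information.\<close>

lemma frac_rep_eq_continuous:
  assumes "frac_rep A F U g h" "open U" "open V" "V \<subseteq> U"
    and "continuous_on (A \<inter> V) Q" "continuous_on (A \<inter> V) k" "nondegenerate_on (A \<inter> V) k"
    and "\<And>q. q \<in> A \<inter> V \<Longrightarrow> k q \<noteq> 0 \<Longrightarrow> F q = Q q" and q: "q \<in> A \<inter> V"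
  shows "g q = h q * Q q"
proof -
  have r: "frac_rep A F V g h" using assms frac_rep_subset by blast
  then have c: "continuous_on (A \<inter> V) g" "continuous_on (A \<inter> V) h"
    unfolding frac_rep_def by (auto dest: holomorphic_within_continuous)
  show ?thesis
  proof (rule nondegenerate_on_eqI[OF assms(3) _ c(1) _ _ q])
    show "nondegenerate_on (A \<inter> V) (\<lambda>q. k q * h q)"
      using r assms by (intro nondegenerate_on_mult) (auto simp: frac_rep_def)
    show "continuous_on (A \<inter> V) (\<lambda>q. h q * Q q)" using c assms by (intro continuous_intros)
    fix q assume q: "q \<in> A \<inter> V" "k q * h q \<noteq> 0"
    then have "F q = g q / h q" using r unfolding frac_rep_def by simp
    moreover have "F q = Q q" using q assms(8) by simp
    ultimately show "g q = h q * Q q" using q by simp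
  qed
qed

text \<open>The condition of \<open>meromorphic_eq\<close> at a single point, isolated so that it
  can be propagated along a connected set.\<close>

definition eq_near :: "('v::finite, 'e::finite) energy set \<Rightarrow> (('v, 'e) energy \<Rightarrow> complex) \<Rightarrow>
    (('v, 'e) energy \<Rightarrow> complex) \<Rightarrow> ('v, 'e) energy \<Rightarrow> bool" where
  "eq_near A f f' p \<longleftrightarrow> (\<exists>U h. open U \<and> p \<in> U \<and>
     holomorphic_within (A \<inter> U) h \<and> nondegenerate_on (A \<inter> U) h \<and>
     (\<forall>q\<in>A \<inter> U. h q \<noteq> 0 \<longrightarrow> f q = f' q))"

lemma meromorphic_eq_near: "meromorphic_eq A f f' \<longleftrightarrow> (\<forall>p\<in>A. eq_near A f f' p)"
  by (simp add: meromorphic_eq_def eq_near_def)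

lemma frac_rep_eq_near:
  assumes "frac_rep E F U g h" "frac_rep E F' U g' h'" "open U" "p \<in> U"
    and eq: "\<And>q. q \<in> E \<inter> U \<Longrightarrow> g q * h' q - g' q * h q = 0"
  shows "eq_near E F F' p"
  unfolding eq_near_def
proof (intro exI[of _ U] exI[of _ "\<lambda>q. h q * h' q"] conjI ballI impI assms)
  show "holomorphic_within (E \<inter> U) (\<lambda>q. h q * h' q)" "nondegenerate_on (E \<inter> U) (\<lambda>q. h q * h' q)"
    using assms unfolding frac_rep_def
    by (auto intro!: holomorphic_within_mult nondegenerate_on_mult holomorphic_within_continuous)
  fix q assume q: "q \<in> E \<inter> U" "h q * h' q \<noteq> 0"
  then have "F q = g q / h q" "F' q = g' q / h' q" using assms(1,2) by (auto simp: frac_rep_def)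
  moreover have "g q * h' q = g' q * h q" using eq[OF q(1)] by simp
  ultimately show "F q = F' q" using q(2) by (simp add: frac_eq_eq)
qed

lemma meromorphic_within_two_reps:
  assumes "meromorphic_within E F" "meromorphic_within E F'" "p \<in> E"
  obtains r g h g' h' where "r > 0" "frac_rep E F (ball p r) g h" "frac_rep E F' (ball p r) g' h'"
proof -
  obtain U g h where U: "open U" "p \<in> U" "frac_rep E F U g h"
    using assms(1,3) unfolding meromorphic_within_frac_rep by blast
  obtain U' g' h' where U': "open U'" "p \<in> U'" "frac_rep E F' U' g' h'"
    using assms(2,3) unfolding meromorphic_within_frac_rep by blast
  have "open (U \<inter> U')" "p \<in> U \<inter> U'" using U U' by auto
  then obtain r where "r > 0" "ball p r \<subseteq> U \<inter> U'" using openE by blast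
  then show ?thesis using U U' frac_rep_subset[of E F U g h "ball p r"] frac_rep_subset[of E F' U' g' h' "ball p r"]
    by (intro that[of r g h g' h']) auto
qed

lemma frac_rep_cross_holomorphic:
  assumes "frac_rep E F U g h" "frac_rep E F' U g' h'"
  shows "holomorphic_within (E \<inter> U) (\<lambda>q. g q * h' q - g' q * h q)"
  using assms unfolding frac_rep_def by (auto intro!: holomorphic_within_mult holomorphic_within_diff)

text \<open>On a ball where both functions are fractions, equality near one point makes the cross
  difference \<open>g * h' - g' * h\<close> vanish on a small open set, hence on the whole ball, and
  this gives equality near every other point of the ball.\<close>

lemma eq_near_spreads:
  assumes E: "csubspace E" and "meromorphic_within E F" "meromorphic_within E F'" "p \<in> E"
  obtains r where "r > 0" "\<And>x y. x \<in> E \<inter> ball p r \<Longrightarrow> y \<in> E \<inter> ball p r \<Longrightarrow> eq_near E F F' x \<Longrightarrow> eq_near E F F' y"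
proof -
  obtain r g h g' h' where r: "r > 0" and reps: "frac_rep E F (ball p r) g h" "frac_rep E F' (ball p r) g' h'"
    by (rule meromorphic_within_two_reps[OF assms(2-4)]) blast
  let ?d = "\<lambda>q. g q * h' q - g' q * h q"
  have hol: "holomorphic_within (E \<inter> ball p r) ?d" by (rule frac_rep_cross_holomorphic[OF reps])
  have "eq_near E F F' y" if x: "x \<in> E \<inter> ball p r" and y: "y \<in> E \<inter> ball p r" and eq: "eq_near E F F' x" for x y
  proof -
    obtain V k where V: "open V" "x \<in> V" "holomorphic_within (E \<inter> V) k" "nondegenerate_on (E \<inter> V) k"
      "\<forall>q\<in>E \<inter> V. k q \<noteq> 0 \<longrightarrow> F q = F' q" using eq unfolding eq_near_def by blast
    let ?W = "V \<inter> ball p r"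
    have W: "open ?W" "?W \<subseteq> V" "?W \<subseteq> ball p r" using V by auto
    have k: "continuous_on (E \<inter> ?W) k" "nondegenerate_on (E \<inter> ?W) k"
      using V(3,4) W nondegenerate_on_subset holomorphic_within_continuous holomorphic_within_subset
      by (metis Int_mono order_refl)+
    have repsW: "frac_rep E F ?W g h" "frac_rep E F' ?W g' h'"
      using reps W frac_rep_subset by blast+
    then have cont: "continuous_on (E \<inter> ?W) h" "continuous_on (E \<inter> ?W) h'" "continuous_on (E \<inter> ?W) ?d"
      using frac_rep_cross_holomorphic[OF repsW] by (auto simp: frac_rep_def dest: holomorphic_within_continuous)
    \<comment> \<open>Where all three functions \<open>k\<close>, \<open>h\<close>,
      \<open>h'\<close> are nonzero the fractions may be compared; density removes the exceptional
      points.\<close>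
    have "?d q = 0" if "q \<in> E \<inter> ?W" for q
    proof (rule nondegenerate_on_eqI[OF W(1) _ cont(3) continuous_on_const _ that])
      show "nondegenerate_on (E \<inter> ?W) (\<lambda>q. k q * (h q * h' q))"
        using k cont repsW W by (intro nondegenerate_on_mult continuous_intros) (auto simp: frac_rep_def)
      fix q assume q: "q \<in> E \<inter> ?W" "k q * (h q * h' q) \<noteq> 0"
      then have "F q = g q / h q" "F' q = g' q / h' q" using repsW by (auto simp: frac_rep_def)
      moreover have "F q = F' q" using V q by auto
      ultimately show "?d q = 0" using q by (simp add: field_simps)
    qed
    then have "?d q = 0" if "q \<in> E \<inter> ball p r" for q
      using holomorphic_within_identity[OF E open_ball convex_ball hol x V(1,2) _ that] by blast
    then show ?thesis using frac_rep_eq_near[OF reps open_ball] y by blast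
  qed
  then show ?thesis using r that by blast
qed

lemma connected_spread:
  assumes "convex (A :: ('v::finite, 'e::finite) energy set)" "a \<in> A" "b \<in> A" "P a"
    and "\<And>p. p \<in> A \<Longrightarrow> \<exists>r>0. \<forall>x\<in>A \<inter> ball p r. \<forall>y\<in>A \<inter> ball p r. P x \<longrightarrow> P y"
  shows "P b"
proof (rule connected_induction_simple[where P = P, OF convex_connected[OF assms(1)] assms(2-4)])
  fix p assume p: "p \<in> A"
  then obtain r where "r > 0" "\<forall>x\<in>A \<inter> ball p r. \<forall>y\<in>A \<inter> ball p r. P x \<longrightarrow> P y" using assms(5) by blast
  then show "\<exists>T. openin (top_of_set A) T \<and> p \<in> T \<and> (\<forall>x\<in>T. \<forall>y\<in>T. P x \<longrightarrow> P y)"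
    using p by (intro exI[of _ "A \<inter> ball p r"]) (simp add: openin_open_Int)
qed

text \<open>Uniqueness of continuations: agreement on a set of uniqueness gives equality near
  \<open>p\<close>, and connectedness of the subspace carries it to all of \<open>E\<close>.\<close>

lemma meromorphic_eqI:
  assumes E: "csubspace E" and F: "meromorphic_within E F" "meromorphic_within E F'"
    and D: "determining E D p" and eq: "\<And>q. q \<in> D \<Longrightarrow> F q = F' q"
  shows "meromorphic_eq E F F'"
  unfolding meromorphic_eq_near
proof
  fix b assume b: "b \<in> E"
  have p: "p \<in> E" using D by (simp add: determining_def)
  show "eq_near E F F' b"
  proof (rule connected_spread[OF csubspace_convex[OF E] p b])
    obtain r g h g' h' where r: "r > 0" and reps: "frac_rep E F (ball p r) g h" "frac_rep E F' (ball p r) g' h'"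
      by (rule meromorphic_within_two_reps[OF F p]) blast
    let ?d = "\<lambda>q. g q * h' q - g' q * h q"
    let ?B = "ball p r"
    \<comment> \<open>The factor \<open>h q * h' q\<close> makes the function vanish at every point
      of \<open>D\<close>, including those where a denominator is zero and the fraction
      representations say nothing.\<close>
    have hol: "holomorphic_within (E \<inter> ?B) (\<lambda>q. (h q * h' q) * ?d q)"
      using frac_rep_cross_holomorphic[OF reps] reps
      by (intro holomorphic_within_mult) (auto simp: frac_rep_def)
    have "\<forall>q\<in>E \<inter> ?B \<inter> D. (h q * h' q) * ?d q = 0"
    proof
      fix q assume q: "q \<in> E \<inter> ?B \<inter> D"
      show "(h q * h' q) * ?d q = 0"
      proof (cases "h q * h' q = 0")
        case False
        then have "F q = g q / h q" "F' q = g' q / h' q" "F q = F' q"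
          using reps q eq[of q] unfolding frac_rep_def by simp_all
        then show ?thesis using False by (simp add: frac_eq_eq)
      qed simp
    qed
    then have z: "\<forall>q\<in>E \<inter> ?B. (h q * h' q) * ?d q = 0"
      using D hol r unfolding determining_def by (metis (no_types, lifting) centre_in_ball convex_ball open_ball)
    have "?d q = 0" if "q \<in> E \<inter> ?B" for q
    proof (rule nondegenerate_on_eqI[OF open_ball _ _ continuous_on_const _ that, where h = "\<lambda>q. h q * h' q"])
      show "nondegenerate_on (E \<inter> ?B) (\<lambda>q. h q * h' q)"
        using reps by (intro nondegenerate_on_mult) (auto simp: frac_rep_def dest: holomorphic_within_continuous)
      show "continuous_on (E \<inter> ?B) ?d"
        using frac_rep_cross_holomorphic[OF reps] by (rule holomorphic_within_continuous)
    qed (use z in auto)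
    then show "eq_near E F F' p" using frac_rep_eq_near[OF reps open_ball] r by simp
  next
    fix a assume "a \<in> E"
    then show "\<exists>r>0. \<forall>x\<in>E \<inter> ball a r. \<forall>y\<in>E \<inter> ball a r. eq_near E F F' x \<longrightarrow> eq_near E F F' y"
      using eq_near_spreads[OF E F] by metis
  qed
qed


section \<open>Division by a linear form\<close>

definition cis1 :: "real \<Rightarrow> complex" where
  "cis1 s = exp (2 * of_real pi * \<i> * of_real s)"

lemma norm_cis1 [simp]: "norm (cis1 s) = 1"
  by (simp add: cis1_def)

lemma continuous_on_cis1 [continuous_intros]: "continuous_on A f \<Longrightarrow> continuous_on A (\<lambda>x. cis1 (f x))"
  unfolding cis1_def by (intro continuous_intros)

text \<open>The difference quotient at 0 extends holomorphically over 0, so Cauchy's formula applies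
  to it. Along the circle u, the derivative of the path is 2 pi i u: its u cancels the denominator
  of the quotient and its 2 pi i the prefactor, which leaves a plain integral over [0, 1].\<close>

lemma Cauchy_difference_quotient:
  assumes hol: "\<phi> holomorphic_on ball 0 R" and r: "0 < r" "r < R" and t: "norm t < r"
  shows "((\<lambda>s. (\<phi> (of_real r * cis1 s) - \<phi> 0) / (of_real r * cis1 s - t)) has_integral
     (if t = 0 then deriv \<phi> 0 else (\<phi> t - \<phi> 0) / t)) {0..1}"
proof -
  define \<psi> where "\<psi> z = (if z = 0 then deriv \<phi> 0 else (\<phi> z - \<phi> 0) / (z - 0))" for z
  have psi: "\<psi> holomorphic_on ball 0 R"
    unfolding \<psi>_def by (rule pole_lemma_open[OF hol open_ball])
  have "((\<lambda>u. \<psi> u/(u-t)) has_contour_integral (2 * of_real pi * \<i> * \<psi> t)) (circlepath 0 r)"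
    by (rule Cauchy_integral_circlepath)
      (use t holomorphic_on_subset[OF psi, of "cball 0 r"] holomorphic_on_subset[OF psi, of "ball 0 r"] r in
        \<open>auto intro!: holomorphic_on_imp_continuous_on simp: subset_eq\<close>)
  then have "((\<lambda>s. (2 * of_real pi * \<i>) * ((\<phi> (of_real r * cis1 s) - \<phi> 0) / (of_real r * cis1 s - t)))
      has_integral (2 * of_real pi * \<i>) * \<psi> t) {0..1}"
    unfolding has_contour_integral_def
  proof (rule has_integral_eq[rotated])
    fix s :: real assume s: "s \<in> {0..1}"
    have "of_real r * cis1 s \<noteq> 0" using r by (simp add: cis1_def)
    moreover have "circlepath 0 r s = of_real r * cis1 s"
      by (simp add: circlepath cis1_def)
    moreover have "vector_derivative (circlepath 0 r) (at s within {0..1}) = 2 * of_real pi * \<i> * (of_real r * cis1 s)"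
      using s by (subst vector_derivative_circlepath01) (auto simp: cis1_def)
    moreover have "of_real r * cis1 s - t \<noteq> 0"
    proof
      assume "of_real r * cis1 s - t = 0"
      then have "norm (of_real r * cis1 s) = norm t" by simp
      then show False using r t by (simp add: norm_mult)
    qed
    ultimately show "\<psi> (circlepath 0 r s) / (circlepath 0 r s - t) * vector_derivative (circlepath 0 r) (at s within {0..1})
        = (2 * of_real pi * \<i>) * ((\<phi> (of_real r * cis1 s) - \<phi> 0) / (of_real r * cis1 s - t))"
      by (simp add: \<psi>_def)
  qed
  then have "((\<lambda>s. inverse (2 * of_real pi * \<i>) * ((2 * of_real pi * \<i>) * ((\<phi> (of_real r * cis1 s) - \<phi> 0) / (of_real r * cis1 s - t))))
      has_integral inverse (2 * of_real pi * \<i>) * ((2 * of_real pi * \<i>) * \<psi> t)) {0..1}"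
    by (rule has_integral_mult_right)
  moreover have "inverse c * (c * x) = x" if "c \<noteq> 0" for c x :: complex
    using that by (simp add: mult.assoc[symmetric])
  from this[of "2 * of_real pi * \<i>"]
  have "inverse (2 * of_real pi * \<i>) * (2 * of_real pi * \<i> * x) = x" for x
    by simp
  moreover have "\<psi> t = (if t = 0 then deriv \<phi> 0 else (\<phi> t - \<phi> 0) / t)" by (simp add: \<psi>_def)
  ultimately show ?thesis by (simp only:)
qed

text \<open>Leibniz' rule asks for a derivative that is continuous in \<open>q\<close> and
  \<open>s\<close> jointly, while only \<Phi> is known to be so. Cauchy integrals express the
  derivative through values of \<Phi> and transfer the continuity.\<close>

lemma holomorphic_within_integral:
  fixes \<Phi> :: "('v::finite, 'e::finite) energy \<Rightarrow> real \<Rightarrow> complex"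
  assumes V: "open V" and cont: "continuous_on (V \<times> {0..1}) (\<lambda>(q, s). \<Phi> q s)"
    and hol: "\<And>s. s \<in> {0..1} \<Longrightarrow> holomorphic_within V (\<lambda>q. \<Phi> q s)"
  shows "holomorphic_within V (\<lambda>q. integral {0..1} (\<Phi> q))"
  unfolding holomorphic_within_alt
proof
  fix q0 assume q0: "q0 \<in> V"
  then obtain r0 where r0: "r0 > 0" "ball q0 r0 \<subseteq> V" using V openE by blast
  \<comment> \<open>A disc of radius 2 r around a point of the ball of radius r stays within
    distance 3 r of the centre, hence inside \<open>V\<close>.\<close>
  define r where "r = r0 / 4"
  have r: "r > 0" "ball q0 (3 * r) \<subseteq> V" using r0 subset_ball[of "3 * r" r0 q0] by (auto simp: r_def)
  let ?B = "ball q0 r"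
  have B: "?B \<subseteq> V" using r subset_ball[of r "3 * r" q0] by auto
  define D where "D q s = (SOME D. ((\<lambda>q. \<Phi> q s) has_derivative D) (at q within V) \<and>
     (\<forall>c h. D (cscale c h) = c * D h))" for q s
  have "((\<lambda>q. \<Phi> q s) has_derivative D q s) (at q within V) \<and> (\<forall>c h. D q s (cscale c h) = c * D q s h)"
    if "q \<in> V" "s \<in> {0..1}" for q s
  proof -
    have "\<exists>D. ((\<lambda>q. \<Phi> q s) has_derivative D) (at q within V) \<and> (\<forall>c h. D (cscale c h) = c * D h)"
      using hol[OF that(2)] that(1) unfolding holomorphic_within_alt by (rule bspec)
    from someI_ex[OF this] show ?thesis unfolding D_def .
  qed
  then have D: "\<And>q s. q \<in> V \<Longrightarrow> s \<in> {0..1} \<Longrightarrow> ((\<lambda>q. \<Phi> q s) has_derivative D q s) (at q within V)"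
    "\<And>q s c h. q \<in> V \<Longrightarrow> s \<in> {0..1} \<Longrightarrow> D q s (cscale c h) = c * D q s h" by blast+
  have bl: "bounded_linear (D q s)" if "q \<in> V" "s \<in> {0..1}" for q s
    using D(1)[OF that] has_derivative_bounded_linear by blast
  have inV: "q + cscale w b \<in> V" if "q \<in> ?B" "b \<in> Basis" "norm w < 2 * r" for q b w
  proof -
    have "norm (cscale w b) = norm w" using that by (simp add: norm_cscale)
    then have "dist q0 (q + cscale w b) < 3 * r"
      using that norm_triangle_ineq[of "q - q0" "cscale w b"] by (simp add: dist_norm norm_minus_commute algebra_simps)
    then show ?thesis using r by auto
  qed
  \<comment> \<open>The case \<open>t = 0\<close> of \<open>Cauchy_difference_quotient\<close>, on
    the complex line through \<open>q\<close> in direction \<open>b\<close>.\<close>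
  have Dint: "D q s b = integral {0..1} (\<lambda>u. (\<Phi> (q + cscale (of_real r * cis1 u) b) s - \<Phi> q s) / (of_real r * cis1 u))"
    if "q \<in> ?B" "s \<in> {0..1}" "b \<in> Basis" for q s b
  proof -
    let ?\<phi> = "\<lambda>w. \<Phi> (q + cscale w b) s"
    have "?\<phi> holomorphic_on ball 0 (2 * r)"
      using inV[OF that(1,3)] by (intro holomorphic_within_line[OF hol[OF that(2)]]) auto
    from Cauchy_difference_quotient[OF this, of r 0] r(1)
    have "integral {0..1} (\<lambda>u. (\<Phi> (q + cscale (of_real r * cis1 u) b) s - \<Phi> q s) / (of_real r * cis1 u)) = deriv ?\<phi> 0"
      by (intro integral_unique) simp
    moreover have "(?\<phi> has_field_derivative D q s b) (at 0)"
    proof -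
      have qV: "q \<in> V" using that B by blast
      have "((\<lambda>t. q + cscale t b) has_derivative (\<lambda>h. cscale h b)) (at 0 within ball 0 (2 * r))"
        by (auto intro!: derivative_eq_intros bounded_linear_imp_has_derivative bounded_linear_cscale_left)
      moreover have "((\<lambda>q. \<Phi> q s) has_derivative D q s) (at (q + cscale 0 b) within (\<lambda>t. q + cscale t b) ` ball 0 (2 * r))"
      proof (rule has_derivative_subset)
        show "((\<lambda>q. \<Phi> q s) has_derivative D q s) (at (q + cscale 0 b) within V)"
          using D(1)[OF qV that(2)] by simp
      qed (use inV[OF that(1,3)] in \<open>simp add: image_subset_iff\<close>)
      ultimately have "(?\<phi> has_derivative (\<lambda>h. D q s (cscale h b))) (at 0 within ball 0 (2 * r))"
        by (rule has_derivative_in_compose)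
      then have "(?\<phi> has_derivative (\<lambda>h. D q s (cscale h b))) (at 0)"
        using r(1) at_within_open[of 0 "ball (0::complex) (2 * r)"] by simp
      then show ?thesis unfolding has_field_derivative_def D(2)[OF qV that(2)] by (simp add: mult.commute[of _ "D q s b"])
    qed
    ultimately show ?thesis using DERIV_imp_deriv by metis
  qed
  define fx where "fx q s = Blinfun (D q s)" for q s
  have fx: "blinfun_apply (fx q s) = D q s" if "q \<in> V" "s \<in> {0..1}" for q s
    unfolding fx_def using bl[OF that] by (simp add: bounded_linear_Blinfun_apply)
  have cfx: "continuous_on (?B \<times> {0..1}) (\<lambda>(q, s). fx q s)"
  proof (rule continuous_on_blinfun_componentwise)
    fix b :: "('v, 'e) energy" assume b: "b \<in> Basis"
    have 1: "continuous_on ((?B \<times> {0..1}) \<times> cbox 0 (1::real))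
       (\<lambda>(x, u). (\<Phi> (fst x + cscale (of_real r * cis1 u) b) (snd x) - \<Phi> (fst x) (snd x)) / (of_real r * cis1 u))"
    proof -
      have "continuous_on ((?B \<times> {0..1}) \<times> cbox 0 (1::real)) (\<lambda>z. (\<lambda>(q, s). \<Phi> q s) (fst (fst z) + cscale (of_real r * cis1 (snd z)) b, snd (fst z)))"
      proof (rule continuous_on_compose2[OF cont])
        show "(\<lambda>z. (fst (fst z) + cscale (of_real r * cis1 (snd z)) b, snd (fst z))) ` ((?B \<times> {0..1}) \<times> cbox 0 1) \<subseteq> V \<times> {0..1}"
          using inV[OF _ b] r(1) by (force simp: norm_mult)
      qed (intro continuous_intros)
      moreover have "continuous_on ((?B \<times> {0..1}) \<times> cbox 0 (1::real)) (\<lambda>z. (\<lambda>(q, s). \<Phi> q s) (fst (fst z), snd (fst z)))"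
        by (rule continuous_on_compose2[OF cont]) (use B in \<open>auto intro!: continuous_intros\<close>)
      ultimately have "continuous_on ((?B \<times> {0..1}) \<times> cbox 0 (1::real))
         (\<lambda>z. (\<Phi> (fst (fst z) + cscale (of_real r * cis1 (snd z)) b) (snd (fst z)) - \<Phi> (fst (fst z)) (snd (fst z))) / (of_real r * cis1 (snd z)))"
        using r(1) unfolding prod.case by (intro continuous_intros) (simp_all add: cis1_def)
      then show ?thesis by (simp add: case_prod_unfold)
    qed
    have "continuous_on (?B \<times> {0..1}) (\<lambda>x. integral (cbox 0 1)
       (\<lambda>u. (\<Phi> (fst x + cscale (of_real r * cis1 u) b) (snd x) - \<Phi> (fst x) (snd x)) / (of_real r * cis1 u)))"
      by (rule integral_continuous_on_param[OF 1])
    then show "continuous_on (?B \<times> {0..1}) (\<lambda>x. blinfun_apply (case x of (q, s) \<Rightarrow> fx q s) b)"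
    proof (rule continuous_on_eq)
      fix x assume x: "x \<in> ?B \<times> {0..1::real}"
      then have "fst x \<in> ?B" "snd x \<in> {0..1}" by (simp_all add: mem_Times_iff)
      then show "integral (cbox 0 1)
         (\<lambda>u. (\<Phi> (fst x + cscale (of_real r * cis1 u) b) (snd x) - \<Phi> (fst x) (snd x)) / (of_real r * cis1 u)) =
         blinfun_apply (case x of (q, s) \<Rightarrow> fx q s) b"
        using Dint[OF _ _ b, of "fst x" "snd x"] fx[of "fst x" "snd x"] B
        by (simp add: case_prod_unfold subset_eq)
    qed
  qed
  have cfx2: "continuous_on (?B \<times> cbox 0 1) (\<lambda>(q, s). fx q s)" using cfx by simp
  have "((\<lambda>q. integral (cbox 0 1) (\<Phi> q)) has_derivative blinfun_apply (integral (cbox 0 1) (fx q0))) (at q0 within ?B)"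
  proof (rule leibniz_rule[OF _ _ cfx2])
    fix q s assume "q \<in> ?B" "s \<in> cbox 0 (1::real)"
    then show "((\<lambda>q. \<Phi> q s) has_derivative blinfun_apply (fx q s)) (at q within ?B)"
      using fx[of q s] has_derivative_subset[OF D(1) B, of q s] subsetD[OF B, of q] by simp
  next
    fix q assume q: "q \<in> ?B"
    have "continuous_on {0..1} (\<lambda>s. (\<lambda>(q, s). \<Phi> q s) (q, s))"
      by (rule continuous_on_compose2[OF cont]) (use q B in \<open>auto intro!: continuous_intros\<close>)
    then show "\<Phi> q integrable_on cbox 0 1" by (simp add: integrable_continuous_interval)
  qed (use r in auto)
  then have der: "((\<lambda>q. integral {0..1} (\<Phi> q)) has_derivative blinfun_apply (integral {0..1} (fx q0))) (at q0 within V)"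
    using r(1) q0 V at_within_open[of q0 ?B] at_within_open[of q0 V] by simp
  have int: "fx q0 integrable_on {0..1}"
  proof -
    have "continuous_on {0..1} (\<lambda>s. (\<lambda>(q, s). fx q s) (q0, s))"
      by (rule continuous_on_compose2[OF cfx]) (use r in \<open>auto intro!: continuous_intros\<close>)
    then show ?thesis by (simp add: integrable_continuous_interval)
  qed
  have "blinfun_apply (integral {0..1} (fx q0)) (cscale c h) = c * blinfun_apply (integral {0..1} (fx q0)) h" for c h
  proof -
    have "integral {0..1} (\<lambda>s. fx q0 s (cscale c h)) = integral {0..1} (\<lambda>s. c * fx q0 s h)"
      using fx[OF q0] D(2)[OF q0] by (intro integral_cong) simp
    also have "\<dots> = c * integral {0..1} (\<lambda>s. fx q0 s h)" by simp
    finally show ?thesis by (simp add: blinfun_apply_integral[OF int])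
  qed
  then show "\<exists>D. ((\<lambda>q. integral {0..1} (\<Phi> q)) has_derivative D) (at q0 within V) \<and> (\<forall>c h. D (cscale c h) = c * D h)"
    using der by blast
qed

text \<open>The condition of \<open>is_restriction\<close> at one point of \<open>H\<close>, again
  isolated for propagation along the connected set \<open>H\<close>.\<close>

definition restr_at :: "('v::finite, 'e::finite) energy set \<Rightarrow> ('v, 'e) energy set \<Rightarrow>
    (('v, 'e) energy \<Rightarrow> complex) \<Rightarrow> (('v, 'e) energy \<Rightarrow> complex) \<Rightarrow> ('v, 'e) energy \<Rightarrow> bool" where
  "restr_at A H f R p \<longleftrightarrow> (\<exists>U k l. open U \<and> p \<in> U \<and>
     holomorphic_within (A \<inter> U) k \<and> holomorphic_within (A \<inter> U) l \<and> nondegenerate_on (H \<inter> U) l \<and>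
     (\<forall>q\<in>A \<inter> U - H. l q \<noteq> 0 \<longrightarrow> f q = k q / l q) \<and>
     (\<forall>q\<in>H \<inter> U. l q \<noteq> 0 \<longrightarrow> R q = k q / l q))"

lemma is_restriction_restr_at: "is_restriction A H f R \<longleftrightarrow> (\<forall>p\<in>H. restr_at A H f R p)"
  by (simp add: is_restriction_def restr_at_def)

text \<open>\<open>E\<close> is the direct sum of the kernel of \<open>X\<close> and the line
  spanned by \<open>e0\<close>. The projection \<open>P\<close> onto \<open>E\<close> extends
  functions from \<open>E\<close> to open subsets of the ambient space, in which \<open>E\<close>
  may have empty interior; parameter integrals are differentiated there.\<close>

locale split_hyperplane =
  fixes E :: "('v::finite, 'e::finite) energy set" and X :: "('v, 'e) energy \<Rightarrow> complex"
    and e0 :: "('v, 'e) energy" and P :: "('v, 'e) energy \<Rightarrow> ('v, 'e) energy"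
  assumes E: "csubspace E" and X: "cform X" and e0: "e0 \<in> E" "X e0 = 1"
    and P: "cmap P" "\<And>q. P q \<in> E" "\<And>q. q \<in> E \<Longrightarrow> P q = q"
begin

text \<open>The coordinates of the splitting are \<open>pr q\<close> in \<open>H\<close> and
  \<open>X q\<close> along \<open>e0\<close>. In them \<open>N B r\<close> is a product of a piece
  of \<open>H\<close> and a disc, and every fibre is a full disc, on which one-variable theory
  applies.\<close>

definition H where "H = {p \<in> E. X p = 0}"
definition pr where "pr q = q - cscale (X q) e0"
definition N where "N B r = {q. pr q \<in> B \<and> norm (X q) < r}"

lemma cmap_pr: "cmap pr"
proof -
  have "bounded_linear X" using X by (simp add: cform_def)
  then have "bounded_linear (\<lambda>q. cscale (X q) e0)"
    by (rule bounded_linear_compose[OF bounded_linear_cscale_left])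
  then have "bounded_linear pr"
    unfolding pr_def by (rule bounded_linear_sub[OF bounded_linear_ident])
  then show ?thesis unfolding cmap_def by (simp add: pr_def cform_linear[OF X])
qed

lemma csubspace_H: "csubspace H"
  using csubspaceD[OF E] unfolding csubspace_def H_def by (simp add: cform_linear[OF X])

lemma H_subset: "H \<subseteq> E" by (auto simp: H_def)

lemma pr_in_H: "q \<in> E \<Longrightarrow> pr q \<in> H"
  using csubspaceD[OF E] e0 by (simp add: H_def pr_def cform_linear[OF X])

lemma pr_H: "z \<in> H \<Longrightarrow> pr z = z"
  by (simp add: H_def pr_def)

lemma X_H: "z \<in> H \<Longrightarrow> X z = 0" by (simp add: H_def)

lemma pr_line: "z \<in> H \<Longrightarrow> pr (z + cscale w e0) = z" "z \<in> H \<Longrightarrow> X (z + cscale w e0) = w"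
  "z \<in> H \<Longrightarrow> z + cscale w e0 \<in> E"
proof -
  assume z: "z \<in> H"
  show 1: "X (z + cscale w e0) = w" using z by (simp add: cform_linear[OF X] X_H e0)
  show "pr (z + cscale w e0) = z" unfolding pr_def 1 by simp
  show "z + cscale w e0 \<in> E" using z H_subset csubspaceD[OF E] e0 by blast
qed

lemma open_N: "open B \<Longrightarrow> open (N B r)"
proof -
  assume "open B"
  then have "open (pr -` B)" using cmap_continuous[OF cmap_pr] open_vimage by blast
  moreover have "open {q. norm (X q) < r}"
    by (intro open_Collect_less continuous_intros cform_continuous[OF X])
  moreover have "N B r = pr -` B \<inter> {q. norm (X q) < r}" by (auto simp: N_def)
  ultimately show ?thesis by auto
qed

lemma convex_N:
  assumes "convex B" shows "convex (N B r)"
proof -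
  have 1: "linear pr" "linear X" using cmap_pr X by (auto simp: cmap_def cform_def bounded_linear.linear)
  have "convex (pr -` B)" using convex_linear_vimage[OF 1(1) assms] .
  moreover have "convex (X -` ball 0 r)" using convex_linear_vimage[OF 1(2) convex_ball] .
  moreover have "N B r = pr -` B \<inter> X -` ball 0 r" by (auto simp: N_def)
  ultimately show ?thesis by (simp add: convex_Int)
qed

lemma H_Int_N: "r > 0 \<Longrightarrow> H \<inter> N B r = H \<inter> B"
  by (rule set_eqI) (use pr_H X_H in \<open>auto simp: N_def simp del: split_paired_All\<close>)

lemma line_in_N: "z \<in> H \<Longrightarrow> z \<in> B \<Longrightarrow> norm w < r \<Longrightarrow> z + cscale w e0 \<in> E \<inter> N B r"
  using pr_line by (simp add: N_def)

lemma N_subset: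
  assumes "open U" "p \<in> U" "p \<in> H"
  obtains \<rho> r where "\<rho> > 0" "r > 0" "N (ball p \<rho>) r \<subseteq> U"
proof -
  obtain \<delta> where \<delta>: "\<delta> > 0" "ball p \<delta> \<subseteq> U" using assms openE by blast
  \<comment> \<open>Adding 1 keeps the divisor positive in the choice of \<open>r\<close>, half of
    whose budget pays for the displacement along \<open>e0\<close>.\<close>
  define K where "K = norm e0 + 1"
  define r where "r = \<delta> / (2 * K)"
  have n0: "K > 0" by (simp add: K_def add_nonneg_pos)
  have r: "r > 0" using \<delta> n0 by (simp add: r_def)
  have "N (ball p (\<delta>/2)) r \<subseteq> U"
  proof
    fix q assume q: "q \<in> N (ball p (\<delta>/2)) r"
    have "norm (X q) * norm e0 \<le> r * norm e0"
      using q by (intro mult_right_mono) (auto simp: N_def)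
    also have "\<dots> \<le> r * K" using r by (simp add: K_def)
    also have "\<dots> = \<delta> / 2" using n0 by (simp add: r_def)
    finally have "norm (cscale (X q) e0) \<le> \<delta> / 2" by (simp add: norm_cscale)
    moreover have "norm (p - pr q) < \<delta> / 2" using q by (simp add: N_def dist_norm)
    moreover have "p - q = (p - pr q) - cscale (X q) e0" by (simp add: pr_def)
    then have "norm (p - q) \<le> norm (p - pr q) + norm (cscale (X q) e0)"
      using norm_triangle_ineq4[of "p - pr q" "cscale (X q) e0"] by metis
    ultimately have "norm (p - q) < \<delta>" by linarith
    then show "q \<in> U" using \<delta> by (auto simp: dist_norm)
  qed
  then show ?thesis using that[of "\<delta>/2" r] \<delta> r by simp
qed

text \<open>Away from \<open>H\<close> the quotient by \<open>X\<close> is clearly holomorphic. Near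
  \<open>H\<close> it is given by a Cauchy integral over a circle in the fibre, whose integrand has
  no singularity at \<open>H\<close> and depends holomorphically on \<open>q\<close>.\<close>

lemma divide_by_X:
  assumes B: "open B" and r: "r > 0" and f: "holomorphic_within (E \<inter> N B r) f"
    and z: "\<And>z. z \<in> H \<inter> B \<Longrightarrow> f z = 0"
  obtains f1 where "holomorphic_within (E \<inter> N B r) f1" "\<And>q. q \<in> E \<inter> N B r \<Longrightarrow> f q = X q * f1 q"
proof -
  define \<rho> where "\<rho> = r / 2"
  have \<rho>: "0 < \<rho>" "\<rho> < r" using r by (auto simp: \<rho>_def)
  let ?w = "\<lambda>s. of_real \<rho> * cis1 s"
  \<comment> \<open>The integrand of \<open>Cauchy_difference_quotient\<close> on the fibre through
    \<open>q\<close>; the term at the centre of the fibre is absent because \<open>f\<close>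
    vanishes on \<open>H\<close>. Composition with \<open>P\<close> makes it a function on an open
    set.\<close>
  define \<Phi> where "\<Phi> q s = f (pr (P q) + cscale (?w s) e0) / (?w s - X (P q))" for q s
  define J where "J q = integral {0..1} (\<Phi> q)" for q
  define V where "V = P -` N B \<rho>"
  have V: "open V" unfolding V_def
    using open_vimage[OF open_N[OF B] cmap_continuous[OF P(1)]] .
  have inN: "pr (P q) + cscale (?w s) e0 \<in> E \<inter> N B r" if "q \<in> V" for q s
    using that line_in_N[OF pr_in_H[OF P(2)], of q B "?w s" r] \<rho> unfolding V_def N_def
    by (simp add: norm_mult)
  have nz: "?w s - X (P q) \<noteq> 0" if "q \<in> V" for q s
  proof
    assume "?w s - X (P q) = 0"
    then have "norm (?w s) = norm (X (P q))" by simp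
    then show False using that \<rho> by (simp add: V_def N_def norm_mult)
  qed
  have cmapprP: "cmap (\<lambda>q. pr (P q))"
    using bounded_linear_compose[of pr P] P(1) cmap_pr unfolding cmap_def
    by (simp add: cmap_linear(3)[OF P(1)] cmap_linear(3)[OF cmap_pr])
  have cformXP: "cform (\<lambda>q. X (P q))"
    using bounded_linear_compose[of X P] P(1) X cmap_linear(3)[OF P(1)] cform_linear(3)[OF X]
    unfolding cmap_def cform_def by simp
  have hol\<Phi>: "holomorphic_within V (\<lambda>q. \<Phi> q s)" for s
    unfolding \<Phi>_def
  proof (intro holomorphic_within_divide)
    show "holomorphic_within V (\<lambda>q. f (pr (P q) + cscale (?w s) e0))"
      using holomorphic_within_affine[OF f cmapprP, of V "cscale (?w s) e0"] inN
      by (simp add: add.commute[of "cscale (?w s) e0"])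
    show "holomorphic_within V (\<lambda>q. ?w s - X (P q))"
      by (intro holomorphic_within_diff holomorphic_within_const holomorphic_within_cform cformXP)
  qed (use nz in auto)
  have cont\<Phi>: "continuous_on (V \<times> {0..1}) (\<lambda>(q, s). \<Phi> q s)"
  proof -
    have "continuous_on (V \<times> {0..1}) (\<lambda>z. f (pr (P (fst z)) + cscale (?w (snd z)) e0))"
      by (rule continuous_on_compose2[OF holomorphic_within_continuous[OF f]])
        (use inN in \<open>auto intro!: continuous_intros continuous_on_compose2[OF cmap_continuous[OF cmapprP, of UNIV]]\<close>)
    moreover have "continuous_on (V \<times> {0..1}) (\<lambda>z. ?w (snd z) - X (P (fst z)))"
      by (auto intro!: continuous_intros continuous_on_compose2[OF cform_continuous[OF cformXP, of UNIV]])
    ultimately have "continuous_on (V \<times> {0..1}) (\<lambda>z. \<Phi> (fst z) (snd z))"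
      unfolding \<Phi>_def by (rule continuous_on_divide) (use nz in \<open>simp add: mem_Times_iff\<close>)
    then show ?thesis by (simp add: case_prod_unfold)
  qed
  have holJ: "holomorphic_within V J"
    unfolding J_def by (rule holomorphic_within_integral[OF V cont\<Phi> hol\<Phi>])
  have J: "J q = f q / X q" if q: "q \<in> E" "q \<in> N B \<rho>" "X q \<noteq> 0" for q
  proof -
    let ?\<phi> = "\<lambda>w. f (pr q + cscale w e0)"
    have prq: "pr q \<in> H \<inter> B" using q pr_in_H by (simp add: N_def)
    have "?\<phi> holomorphic_on ball 0 r"
      using line_in_N[of "pr q" B _ r] prq by (intro holomorphic_within_line[OF f]) auto
    from Cauchy_difference_quotient[OF this \<rho>, of "X q"]
    have "((\<lambda>s. (?\<phi> (?w s) - ?\<phi> 0) / (?w s - X q)) has_integral (?\<phi> (X q) - ?\<phi> 0) / X q) {0..1}"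
      using q by (simp add: N_def)
    moreover have "?\<phi> 0 = 0" using z prq by simp
    moreover have "?\<phi> (X q) = f q" by (simp add: pr_def)
    ultimately show ?thesis
      unfolding J_def \<Phi>_def using P(3)[OF q(1)] by (simp add: integral_unique)
  qed
  define f1 where "f1 q = (if X q = 0 then J q else f q / X q)" for q
  have f1J: "f1 q = J q" if "q \<in> E" "q \<in> N B \<rho>" for q
    using J[OF that] by (simp add: f1_def)
  show ?thesis
  proof
    show "holomorphic_within (E \<inter> N B r) f1"
    proof (rule holomorphic_within_local)
      fix p assume p: "p \<in> E \<inter> N B r"
      show "\<exists>U. open U \<and> p \<in> U \<and> holomorphic_within (E \<inter> N B r \<inter> U) f1"
      proof (cases "X p = 0")
        case True
        have "E \<inter> N B r \<inter> N B \<rho> \<subseteq> V" unfolding V_def using P(3) by (simp add: subset_iff del: split_paired_All)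
        then have "holomorphic_within (E \<inter> N B r \<inter> N B \<rho>) J" using holJ holomorphic_within_subset by blast
        then have "holomorphic_within (E \<inter> N B r \<inter> N B \<rho>) f1"
          using f1J holomorphic_within_cong[of "E \<inter> N B r \<inter> N B \<rho>" f1 J] by blast
        moreover have "p \<in> N B \<rho>" using p True \<rho> by (simp add: N_def)
        ultimately show ?thesis using open_N[OF B] by blast
      next
        case False
        let ?U = "- {q. X q = 0}"
        have "closed {q. X q = 0}"
          by (intro closed_Collect_eq cform_continuous[OF X] continuous_intros)
        then have "open ?U" by blast
        moreover have "holomorphic_within (E \<inter> N B r \<inter> ?U) (\<lambda>q. f q / X q)"
          by (intro holomorphic_within_divide holomorphic_within_subset[OF f] holomorphic_within_cform X) auto
        then have "holomorphic_within (E \<inter> N B r \<inter> ?U) f1"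
          using holomorphic_within_cong[of "E \<inter> N B r \<inter> ?U" f1 "\<lambda>q. f q / X q"] by (simp add: f1_def)
        ultimately show ?thesis using False by blast
      qed
    qed
    fix q assume q: "q \<in> E \<inter> N B r"
    show "f q = X q * f1 q"
    proof (cases "X q = 0")
      case True
      then have "pr q = q" by (simp add: pr_def)
      then have "q \<in> H \<inter> B" using q pr_in_H[of q] by (simp add: N_def)
      then show ?thesis using z True by simp
    qed (simp add: f1_def)
  qed
qed

text \<open>The vanishing order along the single fibre through \<open>z1\<close> bounds the number
  of divisions: each division by \<open>X\<close> lowers it by one, and at order 0 the value at
  \<open>z1\<close> is nonzero. The process may stop earlier, at another point of
  \<open>H\<close>.\<close>

lemma factor_out_X_aux:
  assumes B: "open B" and r: "r > 0" and z1: "z1 \<in> H \<inter> B"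
  shows "holomorphic_within (E \<inter> N B r) f \<Longrightarrow> isCont \<psi> 0 \<Longrightarrow> \<psi> 0 \<noteq> (0::complex) \<Longrightarrow>
    (\<forall>\<^sub>F w in at 0. f (z1 + cscale w e0) = w ^ n * \<psi> w) \<Longrightarrow>
    \<exists>m f'. holomorphic_within (E \<inter> N B r) f' \<and> (\<forall>q\<in>E \<inter> N B r. f q = X q ^ m * f' q) \<and> (\<exists>z\<in>H \<inter> B. f' z \<noteq> 0)"
proof (induction n arbitrary: f)
  case 0
  have "(\<lambda>w. f (z1 + cscale w e0)) holomorphic_on ball 0 r"
    using line_in_N[of z1 B _ r] z1 by (intro holomorphic_within_line[OF 0(1)]) auto
  then have "isCont (\<lambda>w. f (z1 + cscale w e0)) 0"
    using holomorphic_on_imp_continuous_on continuous_on_eq_continuous_at[OF open_ball] r centre_in_ball by blast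
  then have "((\<lambda>w. f (z1 + cscale w e0)) \<longlongrightarrow> f z1) (at 0)" by (simp add: isCont_def)
  moreover have "((\<lambda>w. f (z1 + cscale w e0)) \<longlongrightarrow> \<psi> 0) (at 0)"
    using 0(2,4) by (simp add: isCont_def) (simp add: tendsto_cong)
  ultimately have "f z1 = \<psi> 0" using tendsto_unique by (metis at_neq_bot)
  then have "f z1 \<noteq> 0" using 0 by simp
  then show ?case using 0(1) z1 by (intro exI[of _ 0] exI[of _ f] conjI bexI[of _ z1]) simp_all
next
  case (Suc n)
  show ?case
  proof (cases "\<exists>z\<in>H \<inter> B. f z \<noteq> 0")
    case True
    then show ?thesis using Suc.prems by (intro exI[of _ 0] exI[of _ f]) auto
  next
    case False
    then obtain f1 where f1: "holomorphic_within (E \<inter> N B r) f1" "\<And>q. q \<in> E \<inter> N B r \<Longrightarrow> f q = X q * f1 q"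
      using divide_by_X[OF B r Suc.prems(1)] by blast
    have "\<forall>\<^sub>F w in at (0::complex). norm w < r" "\<forall>\<^sub>F w in at 0. w \<noteq> (0::complex)"
      using r eventually_at_ball[OF r, of "0::complex" UNIV] by (auto simp: eventually_at_filter)
    then have "\<forall>\<^sub>F w in at 0. f1 (z1 + cscale w e0) = w ^ n * \<psi> w"
      using Suc.prems(4)
    proof eventually_elim
      case (elim w)
      have "f (z1 + cscale w e0) = w * f1 (z1 + cscale w e0)"
        using f1(2)[OF line_in_N[of z1 B w r]] z1 elim pr_line(2)[of z1 w] by simp
      then show ?case using elim by simp
    qed
    from Suc.IH[OF f1(1) Suc.prems(2,3) this]
    obtain m f' where "holomorphic_within (E \<inter> N B r) f'" "\<forall>q\<in>E \<inter> N B r. f1 q = X q ^ m * f' q" "\<exists>z\<in>H \<inter> B. f' z \<noteq> 0"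
      by blast
    then show ?thesis using f1(2) by (intro exI[of _ "Suc m"] exI[of _ f']) (simp add: mult.assoc)
  qed
qed

lemma factor_out_X:
  assumes B: "open B" and r: "r > 0" and f: "holomorphic_within (E \<inter> N B r) f"
    and q: "q \<in> E \<inter> N B r" "f q \<noteq> 0"
  obtains m f' where "holomorphic_within (E \<inter> N B r) f'" "\<And>q. q \<in> E \<inter> N B r \<Longrightarrow> f q = X q ^ m * f' q"
    "\<exists>z\<in>H \<inter> B. f' z \<noteq> 0"
proof -
  let ?z = "pr q" and ?\<phi> = "\<lambda>w. f (pr q + cscale w e0)"
  have z: "?z \<in> H \<inter> B" using q pr_in_H by (simp add: N_def)
  have hol: "?\<phi> holomorphic_on ball 0 r"
    using line_in_N[of ?z B _ r] z by (intro holomorphic_within_line[OF f]) auto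
  have nz: "?\<phi> (X q) \<noteq> 0" "X q \<in> ball 0 r" using q by (simp_all add: pr_def N_def)
  \<comment> \<open>A nonzero holomorphic function of one variable has a finite order at the centre
    of the fibre; \<open>q\<close> provides the nonzero value.\<close>
  obtain n \<psi> where "isCont \<psi> 0" "\<psi> 0 \<noteq> (0::complex)" "\<forall>\<^sub>F w in at 0. ?\<phi> w = w ^ n * \<psi> w"
  proof (cases "?\<phi> 0 = 0")
    case False
    have "isCont ?\<phi> 0"
      using holomorphic_on_imp_continuous_on[OF hol] continuous_on_eq_continuous_at[OF open_ball] r centre_in_ball by blast
    then show ?thesis using that[of ?\<phi> 0] False by simp
  next
    case True
    have "\<not> ?\<phi> constant_on ball 0 r"
    proof
      assume "?\<phi> constant_on ball 0 r"
      then have "?\<phi> (X q) = ?\<phi> 0" using nz r unfolding constant_on_def by (metis centre_in_ball)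
      then show False using nz True by simp
    qed
    then obtain g r' n where g: "0 < n" "0 < r'" "g holomorphic_on ball 0 r'"
       "\<And>w. w \<in> ball 0 r' \<Longrightarrow> ?\<phi> w = (w - 0) ^ n * g w" "\<And>w. w \<in> ball 0 r' \<Longrightarrow> g w \<noteq> 0"
      using holomorphic_factor_zero_nonconstant[OF hol open_ball connected_ball, of 0] True r
      by (metis centre_in_ball)
    have "isCont g 0"
      using holomorphic_on_imp_continuous_on[OF g(3)] continuous_on_eq_continuous_at[OF open_ball] g centre_in_ball by blast
    moreover have "\<forall>\<^sub>F w in at 0. ?\<phi> w = w ^ n * g w"
      using eventually_at_ball[OF g(2), of 0 UNIV] by eventually_elim (use g(4) in simp)
    ultimately show ?thesis using that[of g n] g(5)[of 0] g(2) by simp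
  qed
  from factor_out_X_aux[OF B r z f this] that show ?thesis by blast
qed

end

section \<open>Restrictions to the hyperplane: normal form, propagation, and a criterion by
  limits\<close>

context split_hyperplane
begin

lemma nondegenerate_X: assumes "open U" shows "nondegenerate_on (E \<inter> U) X"
  unfolding nondegenerate_on_alt
proof (intro ballI allI impI)
  fix q V assume q: "q \<in> E \<inter> U" "open V \<and> q \<in> V"
  show "\<exists>q'\<in>E \<inter> U \<inter> V. X q' \<noteq> 0"
  proof (cases "X q = 0")
    case True
    then have "q \<in> H" using q by (simp add: H_def)
    have "continuous_on UNIV (\<lambda>t. q + cscale t e0)" by (intro continuous_intros)
    then have "open ((\<lambda>t. q + cscale t e0) -` (U \<inter> V))" using assms q open_vimage by blast
    moreover have "0 \<in> (\<lambda>t. q + cscale t e0) -` (U \<inter> V)" using q by simp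
    ultimately obtain \<delta> where d: "\<delta> > 0" "ball 0 \<delta> \<subseteq> (\<lambda>t. q + cscale t e0) -` (U \<inter> V)" by (meson openE)
    have "of_real (\<delta>/2) \<in> ball (0::complex) \<delta>" using d by simp
    then have "q + cscale (of_real (\<delta>/2)) e0 \<in> U \<inter> V" using d by blast
    then show ?thesis using pr_line(2,3)[OF \<open>q \<in> H\<close>, of "of_real (\<delta>/2)"] d
      by (intro bexI[of _ "q + cscale (of_real (\<delta>/2)) e0"]) auto
  qed (use q in blast)
qed

text \<open>A normal form on a tube around a point of \<open>H\<close>: \<open>F\<close> is
  \<open>X ^ n * g\<close> over \<open>X ^ m * h\<close> with \<open>h\<close> not identically zero
  on \<open>H\<close>, and \<open>R\<close> is \<open>s / t\<close>. The last clause says that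
  \<open>n\<close> is the exact order of the numerator unless the fraction has no pole along
  \<open>H\<close> anyway; it turns a bound on \<open>F\<close> into
  \<open>m \<le> n\<close>.\<close>

definition local_data where
  "local_data F R B r g h n m s t \<longleftrightarrow> open B \<and> convex B \<and> r > 0 \<and>
     holomorphic_within (E \<inter> N B r) g \<and> holomorphic_within (E \<inter> N B r) h \<and> (\<exists>z\<in>H \<inter> B. h z \<noteq> 0) \<and>
     frac_rep E F (N B r) (\<lambda>q. X q ^ n * g q) (\<lambda>q. X q ^ m * h q) \<and> frac_rep H R (N B r) s t \<and>
     (m \<le> n \<or> (\<exists>z\<in>H \<inter> B. g z \<noteq> 0))"

lemma local_data_exists:
  assumes F: "meromorphic_within E F" and R: "meromorphic_within H R" and a: "a \<in> H" and W: "open W" "a \<in> W"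
  obtains \<rho> r g h n m s t where "\<rho> > 0" "local_data F R (ball a \<rho>) r g h n m s t" "N (ball a \<rho>) r \<subseteq> W"
proof -
  obtain U g h where U: "open U" "a \<in> U" "frac_rep E F U g h"
    using F a H_subset unfolding meromorphic_within_frac_rep by blast
  obtain U' s t where U': "open U'" "a \<in> U'" "frac_rep H R U' s t"
    using R a unfolding meromorphic_within_frac_rep by blast
  have "open (U \<inter> U' \<inter> W)" "a \<in> U \<inter> U' \<inter> W" using U U' W by auto
  then obtain \<rho> r where r: "\<rho> > 0" "r > 0" "N (ball a \<rho>) r \<subseteq> U \<inter> U' \<inter> W"
    by (rule N_subset[OF _ _ a])
  let ?B = "ball a \<rho>"
  have N: "open (N ?B r)" "convex (N ?B r)" using open_N convex_N by auto
  have reps: "frac_rep E F (N ?B r) g h" "frac_rep H R (N ?B r) s t"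
    using U U' r N by (auto intro: frac_rep_subset)
  have hol: "holomorphic_within (E \<inter> N ?B r) g" "holomorphic_within (E \<inter> N ?B r) h"
    using reps by (auto simp: frac_rep_def)
  have "a \<in> E \<inter> N ?B r" using line_in_N[OF a, of ?B 0 r] r by simp
  moreover have "nondegenerate_on (E \<inter> N ?B r) h" using reps by (simp add: frac_rep_def)
  ultimately obtain q where q: "q \<in> E \<inter> N ?B r" "h q \<noteq> 0"
    unfolding nondegenerate_on_alt by (metis IntD1 UNIV_I open_UNIV)
  obtain m h' where h': "holomorphic_within (E \<inter> N ?B r) h'" "\<And>q. q \<in> E \<inter> N ?B r \<Longrightarrow> h q = X q ^ m * h' q"
    "\<exists>z\<in>H \<inter> ?B. h' z \<noteq> 0"
    by (rule factor_out_X[OF open_ball r(2) hol(2) q]) (rule that)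
  have "\<exists>n g'. holomorphic_within (E \<inter> N ?B r) g' \<and> (\<forall>q\<in>E \<inter> N ?B r. g q = X q ^ n * g' q) \<and>
     (m \<le> n \<or> (\<exists>z\<in>H \<inter> ?B. g' z \<noteq> 0))"
  proof (cases "\<exists>q\<in>E \<inter> N ?B r. g q \<noteq> 0")
    case True
    then obtain q where q: "q \<in> E \<inter> N ?B r" "g q \<noteq> 0" by blast
    obtain n g' where "holomorphic_within (E \<inter> N ?B r) g'" "\<And>q. q \<in> E \<inter> N ?B r \<Longrightarrow> g q = X q ^ n * g' q"
      "\<exists>z\<in>H \<inter> ?B. g' z \<noteq> 0"
      by (rule factor_out_X[OF open_ball r(2) hol(1) q]) (rule that)
    then show ?thesis by (intro exI[of _ n] exI[of _ g'] conjI disjI2 ballI)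
  next
    case False
    \<comment> \<open>A numerator that is identically zero has no finite order; taking
      \<open>n = m\<close> puts it into the first alternative.\<close>
    then show ?thesis by (intro exI[of _ m] exI[of _ "\<lambda>_. 0"]) (simp add: holomorphic_within_const)
  qed
  then obtain n g' where g': "holomorphic_within (E \<inter> N ?B r) g'" "\<And>q. q \<in> E \<inter> N ?B r \<Longrightarrow> g q = X q ^ n * g' q"
     "m \<le> n \<or> (\<exists>z\<in>H \<inter> ?B. g' z \<noteq> 0)" by blast
  have "frac_rep E F (N ?B r) (\<lambda>q. X q ^ n * g' q) (\<lambda>q. X q ^ m * h' q)"
  proof -
    have "nondegenerate_on (E \<inter> N ?B r) (\<lambda>q. X q ^ m * h' q)"
      using reps(1) h'(2) unfolding frac_rep_def nondegenerate_on_alt by (metis IntD1)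
    then show ?thesis using reps(1) g'(1,2) h'(1,2) unfolding frac_rep_def
      by (auto intro!: holomorphic_within_mult holomorphic_within_power holomorphic_within_cform[OF X] simp del: split_paired_All)
  qed
  then have "local_data F R ?B r g' h' n m s t"
    unfolding local_data_def using g' h' r reps by simp
  then show ?thesis using that r by blast
qed

text \<open>With \<open>m \<le> n\<close> the fraction restricts to \<open>H\<close>, and equality
  with \<open>R\<close> there is an equation of holomorphic functions on \<open>H\<close>. Knowing
  it on any open piece of the tube's base gives it on the whole base by the identity
  theorem.\<close>

lemma local_data_restr_at:
  assumes L: "local_data F R B r g h n m s t" and mn: "m \<le> n"
    and V: "open V" "x \<in> V" "x \<in> H \<inter> B"
    and eq: "\<And>q. q \<in> H \<inter> B \<inter> V \<Longrightarrow> X q ^ (n - m) * g q * t q = s q * h q"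
    and y: "y \<in> H \<inter> B"
  shows "restr_at E H F R y"
proof -
  have l: "open B" "convex B" "r > 0" and hol: "holomorphic_within (E \<inter> N B r) g" "holomorphic_within (E \<inter> N B r) h"
    and hnz: "\<exists>z\<in>H \<inter> B. h z \<noteq> 0"
    and rep: "frac_rep E F (N B r) (\<lambda>q. X q ^ n * g q) (\<lambda>q. X q ^ m * h q)" and repR: "frac_rep H R (N B r) s t"
    using L unfolding local_data_def by auto
  have N: "open (N B r)" "convex (N B r)" "H \<inter> N B r = H \<inter> B" using open_N convex_N l H_Int_N by auto
  have sub: "H \<inter> N B r \<subseteq> E \<inter> N B r" using H_subset by blast
  let ?k1 = "\<lambda>q. X q ^ (n - m) * g q"
  have k1: "holomorphic_within (E \<inter> N B r) ?k1"
    by (intro holomorphic_within_mult holomorphic_within_power holomorphic_within_cform[OF X] hol)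
  have holH: "holomorphic_within (H \<inter> N B r) g" "holomorphic_within (H \<inter> N B r) h" "holomorphic_within (H \<inter> N B r) ?k1"
    "holomorphic_within (H \<inter> N B r) s" "holomorphic_within (H \<inter> N B r) t"
    using holomorphic_within_subset[OF _ sub] hol k1 repR by (auto simp: frac_rep_def)
  have eqH: "?k1 q * t q - s q * h q = 0" if "q \<in> H \<inter> N B r" for q
  proof (rule holomorphic_within_identity[OF csubspace_H N(1,2) _ _ V(1,2) _ that])
    show "holomorphic_within (H \<inter> N B r) (\<lambda>q. ?k1 q * t q - s q * h q)"
      by (intro holomorphic_within_diff holomorphic_within_mult[of _ ?k1] holomorphic_within_mult[of _ s] holH)
    show "x \<in> H \<inter> N B r" using V N by simp
    show "?k1 q * t q - s q * h q = 0" if "q \<in> H \<inter> N B r \<inter> V" for q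
      using eq[of q] that N by auto
  qed
  have holtpr: "holomorphic_within (E \<inter> N B r) (\<lambda>q. f (pr q))" if "holomorphic_within (H \<inter> N B r) f" for f
  proof (rule holomorphic_within_cmap[OF that cmap_pr])
    fix q assume q: "q \<in> E \<inter> N B r"
    then have "pr q \<in> B" by (simp add: N_def)
    then show "pr q \<in> H \<inter> N B r" using pr_in_H[of q] q N(3) by blast
  qed
  show ?thesis
    unfolding restr_at_def
  \<comment> \<open>Both sides of the cancelled fraction are multiplied by \<open>t\<close>,
    extended constantly along \<open>e0\<close> through \<open>pr\<close>. A nonzero denominator
    then guarantees \<open>t q \<noteq> 0\<close>, so that \<open>R q = s q / t q\<close> is
    available.\<close>
  proof (rule exI[of _ "N B r"], rule exI[of _ "\<lambda>q. ?k1 q * t (pr q)"],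
      rule exI[of _ "\<lambda>q. h q * t (pr q)"], intro conjI ballI impI)
    show "y \<in> N B r" using y N by blast
    show "holomorphic_within (E \<inter> N B r) (\<lambda>q. ?k1 q * t (pr q))" "holomorphic_within (E \<inter> N B r) (\<lambda>q. h q * t (pr q))"
      using holtpr[OF holH(5)] holomorphic_within_mult[OF k1] holomorphic_within_mult[OF hol(2)] by blast+
    have "nondegenerate_on (H \<inter> N B r) h"
      using hnz N by (metis csubspace_H holH(2) nondegenerate_on_convex)
    then have "nondegenerate_on (H \<inter> N B r) (\<lambda>q. h q * t q)"
      using repR holomorphic_within_continuous[OF holH(2)] N(1) unfolding frac_rep_def by (intro nondegenerate_on_mult) auto
    then show "nondegenerate_on (H \<inter> N B r) (\<lambda>q. h q * t (pr q))"
      unfolding nondegenerate_on_alt by (metis IntD1 pr_H)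
    fix q assume q: "q \<in> E \<inter> N B r - H" "h q * t (pr q) \<noteq> 0"
    then have nz: "X q \<noteq> 0" "h q \<noteq> 0" by (auto simp: H_def)
    then have "F q = X q ^ n * g q / (X q ^ m * h q)" using rep q unfolding frac_rep_def by simp
    also have "\<dots> = ?k1 q / h q" using nz mn by (simp add: power_diff)
    finally show "F q = ?k1 q * t (pr q) / (h q * t (pr q))" using q by simp
  next
    show "open (N B r)" by fact
    fix q assume q: "q \<in> H \<inter> N B r" "h q * t (pr q) \<noteq> 0"
    then have pq: "pr q = q" using pr_H by blast
    have "R q = s q / t q" using q repR pq unfolding frac_rep_def by simp
    moreover have "?k1 q * t q = s q * h q" using eqH[OF q(1)] by simp
    ultimately show "R q = ?k1 q * t (pr q) / (h q * t (pr q))"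
      using q pq by (simp add: frac_eq_eq)
  qed
qed

text \<open>The restriction property at \<open>x\<close> excludes a pole along \<open>H\<close> and
  yields the equation of \<open>local_data_restr_at\<close> near \<open>x\<close>; that lemma then
  gives the property at every \<open>y\<close> in the same tube.\<close>

lemma restr_at_spreads:
  assumes F: "meromorphic_within E F" and R: "meromorphic_within H R" and a: "a \<in> H"
  shows "\<exists>\<rho>>0. \<forall>x\<in>H \<inter> ball a \<rho>. \<forall>y\<in>H \<inter> ball a \<rho>. restr_at E H F R x \<longrightarrow> restr_at E H F R y"
proof -
  obtain \<rho> r g h n m s t where \<rho>: "\<rho> > 0" and L: "local_data F R (ball a \<rho>) r g h n m s t"
    using local_data_exists[OF F R a open_UNIV UNIV_I] by metis
  let ?B = "ball a \<rho>" let ?N = "N (ball a \<rho>) r"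
  have l: "r > 0" and hol: "holomorphic_within (E \<inter> ?N) g" "holomorphic_within (E \<inter> ?N) h"
    and hnz: "\<exists>z\<in>H \<inter> ?B. h z \<noteq> 0" and gnz: "m \<le> n \<or> (\<exists>z\<in>H \<inter> ?B. g z \<noteq> 0)"
    and rep: "frac_rep E F ?N (\<lambda>q. X q ^ n * g q) (\<lambda>q. X q ^ m * h q)" and repR: "frac_rep H R ?N s t"
    using L unfolding local_data_def by auto
  have N: "open ?N" "convex ?N" "H \<inter> ?N = H \<inter> ?B" using open_N convex_N l H_Int_N by auto
  have holX: "holomorphic_within A (\<lambda>q. X q ^ j)" for A j
    by (intro holomorphic_within_power holomorphic_within_cform[OF X])
  have "restr_at E H F R y" if x: "x \<in> H \<inter> ?B" and y: "y \<in> H \<inter> ?B" and res: "restr_at E H F R x" for x y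
  proof -
    obtain U k l where U: "open U" "x \<in> U" "holomorphic_within (E \<inter> U) k" "holomorphic_within (E \<inter> U) l"
      "nondegenerate_on (H \<inter> U) l" "\<forall>q\<in>E \<inter> U - H. l q \<noteq> 0 \<longrightarrow> F q = k q / l q"
      "\<forall>q\<in>H \<inter> U. l q \<noteq> 0 \<longrightarrow> R q = k q / l q"
      using res unfolding restr_at_def by blast
    have "open ?N \<and> x \<in> ?N" using N x by blast
    \<comment> \<open>From \<open>x\<close> to a nearby point of \<open>H\<close> where
      \<open>l\<close> is nonzero, around which the given fraction \<open>k / l\<close> has no
      exceptional points.\<close>
    then obtain x' where x': "x' \<in> H \<inter> U" "x' \<in> ?N" "l x' \<noteq> 0"
      using U(2,5) x unfolding nondegenerate_on_alt by (metis IntD1 IntD2 IntI)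
    obtain V0 where V0: "open V0" "x' \<in> V0" "V0 \<subseteq> U" "\<And>q'. q' \<in> E \<inter> V0 \<Longrightarrow> l q' \<noteq> 0"
      using nonzero_open[OF holomorphic_within_continuous[OF U(4)] U(1), of x'] x' H_subset by blast
    define V where "V = V0 \<inter> ?N"
    have V: "open V" "x' \<in> V" "V \<subseteq> U" "V \<subseteq> ?N" using V0 N x' by (auto simp: V_def)
    have lV: "l q \<noteq> 0" if "q \<in> E \<inter> V" for q using V0(4) that by (simp add: V_def)
    have holV: "holomorphic_within (E \<inter> V) g" "holomorphic_within (E \<inter> V) h" "holomorphic_within (E \<inter> V) k" "holomorphic_within (E \<inter> V) l"
      using hol U(3,4) V holomorphic_within_subset by (metis Int_mono order_refl)+
    have cont: "continuous_on (E \<inter> V) g" "continuous_on (E \<inter> V) h" "continuous_on (E \<inter> V) k" "continuous_on (E \<inter> V) l"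
       "continuous_on (E \<inter> V) (\<lambda>q. X q ^ j)" for j
      using holV holX by (auto intro: holomorphic_within_continuous)
    have main: "X q ^ n * g q * l q = k q * (X q ^ m * h q)" if "q \<in> E \<inter> V" for q
    proof (rule nondegenerate_on_eqI[OF V(1) _ _ _ _ that])
      \<comment> \<open>The additional factor \<open>X q\<close> excludes the points of
        \<open>H\<close>, where the values of \<open>F\<close> are unconstrained.\<close>
      show "nondegenerate_on (E \<inter> V) (\<lambda>q. X q * (X q ^ m * h q))"
        using rep nondegenerate_on_subset[OF _ V(1,4)] unfolding frac_rep_def
        by (intro nondegenerate_on_mult[OF V(1) cform_continuous[OF X] nondegenerate_X[OF V(1)]]) blast
      show "continuous_on (E \<inter> V) (\<lambda>q. X q ^ n * g q * l q)" "continuous_on (E \<inter> V) (\<lambda>q. k q * (X q ^ m * h q))"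
        using cont by (intro continuous_on_mult; simp)+
      fix q assume q: "q \<in> E \<inter> V" "X q * (X q ^ m * h q) \<noteq> 0"
      then have "q \<in> E \<inter> U - H" "q \<in> E \<inter> ?N" using V by (auto simp: H_def)
      then have "F q = k q / l q" "F q = X q ^ n * g q / (X q ^ m * h q)"
        using U(6) lV[OF q(1)] rep q by (auto simp: frac_rep_def)
      then show "X q ^ n * g q * l q = k q * (X q ^ m * h q)"
        using lV[OF q(1)] q by (simp add: frac_eq_eq)
    qed
    have cancel: "f q = f' q" if "\<And>q. q \<in> E \<inter> V \<Longrightarrow> X q ^ j * f q = X q ^ j * f' q"
        "continuous_on (E \<inter> V) f" "continuous_on (E \<inter> V) f'" "q \<in> E \<inter> V" for f f' :: "('v, 'e) energy \<Rightarrow> complex" and j q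
      by (rule nondegenerate_on_eqI[OF V(1) nondegenerate_X[OF V(1)] that(2,3) _ that(4)]) (use that(1) in force)
    \<comment> \<open>Otherwise, after cancelling \<open>X ^ n\<close>, setting \<open>X = 0\<close>
      forces \<open>g\<close> to vanish on an open piece of \<open>H\<close> and hence on all of it,
      against the normal form.\<close>
    have mn: "m \<le> n"
    proof (rule ccontr)
      assume "\<not> m \<le> n"
      then have nm: "m = n + (m - n)" "m - n \<noteq> 0" by auto
      have z: "g q * l q = k q * (X q ^ (m - n) * h q)" if "q \<in> E \<inter> V" for q
      proof (rule cancel[OF _ _ _ that])
        fix q assume "q \<in> E \<inter> V"
        then show "X q ^ n * (g q * l q) = X q ^ n * (k q * (X q ^ (m - n) * h q))"
          using main[of q] nm by (metis (no_types, opaque_lifting) mult.assoc mult.left_commute power_add)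
      qed (use cont in \<open>intro continuous_on_mult; simp\<close>)+
      have "g q = 0" if "q \<in> H \<inter> ?N \<inter> V" for q
        using z[of q] lV[of q] that X_H[of q] nm H_subset by (auto simp: power_0_left)
      then have "g q = 0" if "q \<in> H \<inter> ?N" for q
        using holomorphic_within_identity[OF csubspace_H N(1,2) _ _ V(1,2) _ that, of g] x'
          holomorphic_within_subset[OF hol(1), of "H \<inter> ?N"] H_subset by blast
      then show False using gnz \<open>\<not> m \<le> n\<close> N by blast
    qed
    have k1: "X q ^ (n - m) * g q * l q = k q * h q" if "q \<in> E \<inter> V" for q
    proof (rule cancel[OF _ _ _ that])
      fix q assume "q \<in> E \<inter> V"
      then show "X q ^ m * (X q ^ (n - m) * g q * l q) = X q ^ m * (k q * h q)"
        using main[of q] mn by (metis (no_types, opaque_lifting) mult.assoc mult.left_commute power_add le_add_diff_inverse)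
    qed (use cont in \<open>intro continuous_on_mult; simp\<close>)+
    have sub: "H \<inter> V \<subseteq> E \<inter> V" using H_subset by blast
    have repV: "frac_rep H R V s t" by (rule frac_rep_subset[OF repR V(1,4)])
    have st: "s q = t q * (k q / l q)" if "q \<in> H \<inter> V" for q
    proof (rule frac_rep_eq_continuous[where k = "\<lambda>_. 1", OF repV V(1,1) order_refl _ _ _ _ that])
      show "continuous_on (H \<inter> V) (\<lambda>q. k q / l q)"
        using cont lV sub continuous_on_subset[OF _ sub] by (intro continuous_on_divide) blast+
      show "R q = k q / l q" if "q \<in> H \<inter> V" for q using U(7) V(3) lV sub that by blast
    qed (auto intro: nondegenerate_on_one)
    show ?thesis
    proof (rule local_data_restr_at[OF L mn V(1,2) _ _ y])
      fix q assume q: "q \<in> H \<inter> ?B \<inter> V"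
      then have "X q ^ (n - m) * g q * l q = k q * h q" "l q \<noteq> 0" "s q * l q = t q * k q"
        using k1[of q] lV[of q] st[of q] sub by auto
      then have "X q ^ (n - m) * g q * t q * l q = s q * h q * l q"
        by (metis mult.assoc mult.commute)
      then show "X q ^ (n - m) * g q * t q = s q * h q" using \<open>l q \<noteq> 0\<close> by simp
    qed (use x' N in blast)
  qed
  then show ?thesis using \<rho> by blast
qed

text \<open>A criterion by limits along real rays that leave \<open>H\<close> in direction
  \<open>e0\<close>. As values of \<open>F\<close> and \<open>R\<close> cannot be trusted pointwise,
  the known values \<open>Q\<close> on \<open>D\<close> and \<open>R0\<close> on \<open>H\<close>
  enter only through the numerators and denominators of arbitrary fractions representing
  \<open>F\<close> and \<open>R\<close>.\<close>

lemma is_restrictionI: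
  assumes F: "meromorphic_within E F" and R: "meromorphic_within H R" and a: "a \<in> H" and W: "open W" "a \<in> W"
    and ev: "\<And>z. z \<in> H \<inter> W \<Longrightarrow> \<forall>\<^sub>F t in at_right 0. z + cscale (of_real t) e0 \<in> D"
    and Q: "\<And>U g h q. open U \<Longrightarrow> frac_rep E F U g h \<Longrightarrow> q \<in> E \<inter> U \<inter> D \<Longrightarrow> g q = h q * Q q"
    and lim: "\<And>z. z \<in> H \<inter> W \<Longrightarrow> ((\<lambda>t. Q (z + cscale (of_real t) e0)) \<longlongrightarrow> R0 z) (at_right 0)"
    and RR0: "\<And>U s t z. open U \<Longrightarrow> U \<subseteq> W \<Longrightarrow> frac_rep H R U s t \<Longrightarrow> z \<in> H \<inter> U \<Longrightarrow> s z = t z * R0 z"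
  shows "is_restriction E H F R"
proof -
  obtain \<rho> r g h n m s t where \<rho>: "\<rho> > 0" and L: "local_data F R (ball a \<rho>) r g h n m s t" and NW: "N (ball a \<rho>) r \<subseteq> W"
    using local_data_exists[OF F R a W] by metis
  let ?B = "ball a \<rho>" let ?N = "N (ball a \<rho>) r"
  have l: "r > 0" and hol: "holomorphic_within (E \<inter> ?N) g" "holomorphic_within (E \<inter> ?N) h"
    and hnz: "\<exists>z\<in>H \<inter> ?B. h z \<noteq> 0" and gnz: "m \<le> n \<or> (\<exists>z\<in>H \<inter> ?B. g z \<noteq> 0)"
    and rep: "frac_rep E F ?N (\<lambda>q. X q ^ n * g q) (\<lambda>q. X q ^ m * h q)" and repR: "frac_rep H R ?N s t"
    using L unfolding local_data_def by auto
  have N: "open ?N" "convex ?N" "H \<inter> ?N = H \<inter> ?B" using open_N convex_N l H_Int_N by auto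
  let ?q = "\<lambda>z t. z + cscale (of_real t) e0"
  \<comment> \<open>On the ray \<open>X\<close> equals \<open>t\<close>, so the fraction
    representation turns into an equation between powers of the real parameter.\<close>
  have ev': "\<forall>\<^sub>F t in at_right 0. t > 0 \<and> ?q z t \<in> E \<inter> ?N \<and>
      of_real t ^ n * g (?q z t) = of_real t ^ m * h (?q z t) * Q (?q z t)" if z: "z \<in> H \<inter> ?B" for z
  proof -
    have "z \<in> H \<inter> W" using z N NW by blast
    have "\<forall>\<^sub>F t in at_right (0::real). t < r" "\<forall>\<^sub>F t in at_right (0::real). t > 0"
      using l by (auto simp: eventually_at_right_field)
    then show ?thesis
      using ev[OF \<open>z \<in> H \<inter> W\<close>]
    proof eventually_elim
      case (elim t)
      have "?q z t \<in> E \<inter> ?N" using line_in_N[of z ?B "of_real t" r] z elim by simp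
      moreover have "X (?q z t) = of_real t" using pr_line(2) z by blast
      ultimately show ?case using Q[OF N(1) rep, of "?q z t"] elim by simp
    qed
  qed
  have lims: "((\<lambda>t. f (?q z t)) \<longlongrightarrow> f z) (at_right 0)" if "holomorphic_within (E \<inter> ?N) f" "z \<in> H \<inter> ?B" for f z
  proof -
    have "((\<lambda>t. ?q z t) \<longlongrightarrow> z) (at_right 0)"
      using continuous_on_cscale[of UNIV "\<lambda>t. of_real t" "\<lambda>_. e0"]
      by (auto intro!: tendsto_eq_intros bounded_bilinear.tendsto[OF bounded_bilinear_cscale])
    moreover have "\<forall>\<^sub>F t in at_right 0. ?q z t \<in> E \<inter> ?N" using ev'[OF that(2)] by eventually_elim simp
    moreover have "z \<in> E \<inter> ?N" using that N H_subset by blast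
    ultimately show ?thesis
      using continuous_on_tendsto_compose[OF holomorphic_within_continuous[OF that(1)]] by blast
  qed
  \<comment> \<open>A positive power of \<open>t\<close> on the side of the convergent
    \<open>Q\<close> would make \<open>g\<close> tend to 0 on every ray and thus vanish on
    \<open>H\<close>.\<close>
  have mn: "m \<le> n"
  proof (rule ccontr)
    assume mn: "\<not> m \<le> n"
    then obtain z where z: "z \<in> H \<inter> ?B" "g z \<noteq> 0" using gnz by blast
    have "z \<in> H \<inter> W" using z N NW by blast
    have "((\<lambda>t. of_real t ^ (m - n) * h (?q z t) * Q (?q z t)) \<longlongrightarrow> of_real 0 ^ (m - n) * h z * R0 z) (at_right 0)"
      by (intro tendsto_intros lims[OF hol(2) z(1)] lim \<open>z \<in> H \<inter> W\<close>)
    then have "((\<lambda>t. of_real t ^ (m - n) * h (?q z t) * Q (?q z t)) \<longlongrightarrow> 0) (at_right 0)" using mn by (simp add: power_0_left)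
    moreover have "\<forall>\<^sub>F t in at_right 0. of_real t ^ (m - n) * h (?q z t) * Q (?q z t) = g (?q z t)"
      using ev'[OF z(1)]
    proof eventually_elim
      case (elim t)
      have "of_real t ^ n * (of_real t ^ (m - n) * h (?q z t) * Q (?q z t)) = of_real t ^ m * h (?q z t) * Q (?q z t)"
        using mn by (metis (no_types, opaque_lifting) mult.assoc power_add le_add_diff_inverse nat_le_linear)
      also have "\<dots> = of_real t ^ n * g (?q z t)" using elim by simp
      finally have "of_real t ^ n * (of_real t ^ (m - n) * h (?q z t) * Q (?q z t)) = of_real t ^ n * g (?q z t)" .
      moreover have "of_real t ^ n \<noteq> (0::complex)" using elim by simp
      ultimately show ?case by (metis mult_left_cancel)
    qed
    ultimately have "((\<lambda>t. g (?q z t)) \<longlongrightarrow> 0) (at_right 0)" by (simp add: tendsto_cong)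
    then have "g z = 0" using lims[OF hol(1) z(1)] tendsto_unique[OF trivial_limit_at_right_real] by blast
    then show False using z by simp
  qed
  have eq: "X z ^ (n - m) * g z * t z = s z * h z" if z: "z \<in> H \<inter> ?B" for z
  proof -
    have zW: "z \<in> H \<inter> W" using z N NW by blast
    have lim1: "((\<lambda>t. X (?q z t) ^ (n - m) * g (?q z t)) \<longlongrightarrow> X z ^ (n - m) * g z) (at_right 0)"
      by (intro lims[OF _ z] holomorphic_within_mult holomorphic_within_power holomorphic_within_cform[OF X] hol)
    have "\<forall>\<^sub>F t in at_right 0. h (?q z t) * Q (?q z t) = X (?q z t) ^ (n - m) * g (?q z t)"
      using ev'[OF z]
    proof eventually_elim
      case (elim t)
      have [simp]: "X (?q z t) = of_real t" using pr_line(2) z by blast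
      have "of_real t ^ m * (X (?q z t) ^ (n - m) * g (?q z t)) = of_real t ^ n * g (?q z t)"
        using mn by (simp add: mult.assoc[symmetric] power_add[symmetric])
      then show ?case using elim by (simp add: mult.assoc)
    qed
    moreover have "((\<lambda>t. h (?q z t) * Q (?q z t)) \<longlongrightarrow> h z * R0 z) (at_right 0)"
      by (intro tendsto_intros lims[OF hol(2) z] lim zW)
    ultimately have "((\<lambda>t. X (?q z t) ^ (n - m) * g (?q z t)) \<longlongrightarrow> h z * R0 z) (at_right 0)"
      by (rule Lim_transform_eventually[rotated])
    with lim1 have "X z ^ (n - m) * g z = h z * R0 z"
      by (rule tendsto_unique[OF trivial_limit_at_right_real])
    moreover have "s z = t z * R0 z" using RR0[OF N(1) NW repR, of z] z N by blast
    ultimately show ?thesis by (simp add: mult_ac)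
  qed
  have "restr_at E H F R a"
    by (rule local_data_restr_at[OF L mn open_UNIV UNIV_I, of a]) (use eq a \<rho> in auto)
  then have "restr_at E H F R b" if "b \<in> H" for b
    by (rule connected_spread[of H a b "restr_at E H F R", OF csubspace_convex[OF csubspace_H] a that])
      (rule restr_at_spreads[OF F R])
  then show ?thesis unfolding is_restriction_restr_at by blast
qed

end

section \<open>Lebesgue measure on finite products\<close>

abbreviation lebP :: "'i set \<Rightarrow> ('i \<Rightarrow> real) measure" where
  "lebP W \<equiv> Pi\<^sub>M W (\<lambda>_. lborel)"

interpretation lbP: product_sigma_finite "\<lambda>_::'i. lborel :: real measure"
  by standard

text \<open>A product measure is determined by its values on boxes, and the preimage of a box under
  a coordinatewise map is again a box.\<close>

lemma distr_lebP_coordinatewise: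
  fixes W :: "'i set"
  assumes W: "finite W" and \<phi>: "\<And>i. \<phi> i \<in> borel_measurable borel" "\<And>i. distr lborel borel (\<phi> i) = lborel"
  shows "distr (lebP W) (lebP W) (\<lambda>\<tau>. \<lambda>i\<in>W. \<phi> i (\<tau> i)) = lebP W"
proof (rule lbP.PiM_eqI[OF W])
  fix A :: "'i \<Rightarrow> real set" assume A: "\<And>i. i \<in> W \<Longrightarrow> A i \<in> sets lborel"
  have meas: "(\<lambda>\<tau>. \<lambda>i\<in>W. \<phi> i (\<tau> i)) \<in> measurable (lebP W) (lebP W)"
    using \<phi>(1) by (intro measurable_restrict) simp
  have "emeasure (distr (lebP W) (lebP W) (\<lambda>\<tau>. \<lambda>i\<in>W. \<phi> i (\<tau> i))) (Pi\<^sub>E W A)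
      = emeasure (lebP W) ((\<lambda>\<tau>. \<lambda>i\<in>W. \<phi> i (\<tau> i)) -` Pi\<^sub>E W A \<inter> space (lebP W))"
    using A W by (intro emeasure_distr meas sets_PiM_I_finite) auto
  also have "(\<lambda>\<tau>. \<lambda>i\<in>W. \<phi> i (\<tau> i)) -` Pi\<^sub>E W A \<inter> space (lebP W) = Pi\<^sub>E W (\<lambda>i. \<phi> i -` A i)"
    by (auto simp: space_PiM PiE_def Pi_def)
  also have "emeasure (lebP W) \<dots> = (\<Prod>i\<in>W. emeasure lborel (\<phi> i -` A i))"
    using A measurable_sets[OF \<phi>(1)] by (intro lbP.emeasure_PiM W) force
  also have "\<dots> = (\<Prod>i\<in>W. emeasure lborel (A i))"
  proof (rule prod.cong)
    fix i assume "i \<in> W"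
    then show "emeasure lborel (\<phi> i -` A i) = emeasure lborel (A i)"
      using emeasure_distr[of "\<phi> i" lborel borel "A i"] A[of i] \<phi> by simp
  qed simp
  finally show "emeasure (distr (lebP W) (lebP W) (\<lambda>\<tau>. \<lambda>i\<in>W. \<phi> i (\<tau> i))) (Pi\<^sub>E W A) = (\<Prod>i\<in>W. emeasure lborel (A i))" .
qed simp

lemma distr_lebP_translate:
  assumes W: "finite W"
  shows "distr (lebP W) (lebP W) (\<lambda>\<tau>. \<lambda>i\<in>W. \<tau> i + a i) = lebP W"
proof (rule distr_lebP_coordinatewise[OF W, of "\<lambda>i x. x + a i"])
  fix i
  have "(+) (a i) = (\<lambda>x. x + a i)" by auto
  then show "distr lborel borel (\<lambda>x. x + a i) = lborel" using lborel_distr_plus[of "a i"] by simp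
qed simp

lemma distr_lebP_uminus:
  assumes W: "finite W"
  shows "distr (lebP W) (lebP W) (\<lambda>\<tau>. \<lambda>i\<in>W. - \<tau> i) = lebP W"
  using distr_lebP_coordinatewise[OF W, of "\<lambda>i x. - x"] lborel_distr_uminus by simp

lemma measurable_lebP_translate [measurable]: "(\<lambda>\<tau>. \<lambda>i\<in>W. \<tau> i + a i) \<in> measurable (lebP W) (lebP W)"
  by (intro measurable_restrict) simp

lemma measurable_lebP_uminus [measurable]: "(\<lambda>\<tau>. \<lambda>i\<in>W. - \<tau> i) \<in> measurable (lebP W) (lebP W)"
  by (intro measurable_restrict) simp

lemma integral_lebP_translate:
  fixes f :: "('i \<Rightarrow> real) \<Rightarrow> 'a :: {banach, second_countable_topology}"
  assumes "finite W" "f \<in> borel_measurable (lebP W)"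
  shows "(\<integral>\<tau>. f (\<lambda>i\<in>W. \<tau> i + a i) \<partial>lebP W) = integral\<^sup>L (lebP W) f"
  by (subst integral_distr[OF measurable_lebP_translate assms(2), symmetric])
    (simp only: distr_lebP_translate[OF assms(1)])

lemma integral_lebP_uminus:
  fixes f :: "('i \<Rightarrow> real) \<Rightarrow> 'a :: {banach, second_countable_topology}"
  assumes "finite W" "f \<in> borel_measurable (lebP W)"
  shows "(\<integral>\<tau>. f (\<lambda>i\<in>W. - \<tau> i) \<partial>lebP W) = integral\<^sup>L (lebP W) f"
  by (subst integral_distr[OF measurable_lebP_uminus assms(2), symmetric])
    (simp only: distr_lebP_uminus[OF assms(1)])

section \<open>Exponential decay and the size of ln (2 cosh x)\<close>

lemma integral_exp_half_line:
  assumes "(\<epsilon>::real) > 0"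
  shows "integrable lborel (\<lambda>x. indicator {0..} x * exp (- \<epsilon> * x))"
    "(\<integral>x. indicator {0..} x * exp (- \<epsilon> * x) \<partial>lborel) = 1 / \<epsilon>"
proof -
  have i: "((\<lambda>x. exp (- \<epsilon> * x)) has_integral exp (- \<epsilon> * 0) / \<epsilon>) {0..}"
    by (rule has_integral_exp_minus_to_infinity[OF assms])
  then have "(\<lambda>x. exp (- \<epsilon> * x)) absolutely_integrable_on {0..}"
    by (intro nonnegative_absolutely_integrable_1) (auto simp: integrable_on_def)
  then have s: "set_integrable lborel {0..} (\<lambda>x. exp (- \<epsilon> * x))"
    unfolding set_integrable_def by (subst integrable_completion[symmetric]) auto
  then show "integrable lborel (\<lambda>x. indicator {0..} x * exp (- \<epsilon> * x))"
    by (simp add: set_integrable_def)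
  show "(\<integral>x. indicator {0..} x * exp (- \<epsilon> * x) \<partial>lborel) = 1 / \<epsilon>"
    using set_borel_integral_eq_integral(2)[OF s] integral_unique[OF i]
    by (simp add: set_lebesgue_integral_def)
qed

lemma integrable_exp_abs:
  assumes "(\<epsilon>::real) > 0"
  shows "integrable lborel (\<lambda>x. exp (- \<epsilon> * \<bar>x\<bar>))"
proof -
  note 1 = integral_exp_half_line(1)[OF assms]
  have 2: "integrable lborel (\<lambda>x. indicator {0..} (- x) * exp (\<epsilon> * x))"
    using lborel_integrable_real_affine[OF 1, of "-1" 0] by simp
  show ?thesis
    by (rule Bochner_Integration.integrable_bound[OF Bochner_Integration.integrable_add[OF 1 2]])
      (auto simp: indicator_def)
qed

lemma integrable_exp_sum_abs:
  assumes "finite W" "(\<epsilon>::real) > 0"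
  shows "integrable (lebP W) (\<lambda>\<tau>. exp (- \<epsilon> * (\<Sum>i\<in>W. \<bar>\<tau> i\<bar>)))"
proof -
  have "integrable (lebP W) (\<lambda>\<tau>. \<Prod>i\<in>W. exp (- \<epsilon> * \<bar>\<tau> i\<bar>))"
    using integrable_exp_abs[OF assms(2)] by (intro lbP.product_integrable_prod assms(1))
  then show ?thesis using assms(1) by (simp add: exp_sum[symmetric] sum_distrib_left)
qed

text \<open>From exp |x| \<le> 2 cosh x \<le> 2 exp |x|. The error is bounded by ln 2, so
  convergence of the integrals is a question about piecewise linear functions.\<close>

lemma ln_two_cosh_bounds:
  fixes x :: real
  shows "\<bar>x\<bar> \<le> ln (2 * cosh x)" "ln (2 * cosh x) \<le> \<bar>x\<bar> + ln 2"
proof -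
  have c: "2 * cosh x = exp x + exp (- x)" by (simp add: cosh_def)
  have "exp \<bar>x\<bar> \<le> 2 * cosh x" unfolding c by (auto simp: abs_if)
  then show "\<bar>x\<bar> \<le> ln (2 * cosh x)" by (simp add: ln_ge_iff)
  have "2 * cosh x \<le> exp \<bar>x\<bar> * 2" unfolding c by (auto simp: abs_if)
  then have "ln (2 * cosh x) \<le> ln (exp \<bar>x\<bar> * 2)" by (subst ln_le_cancel_iff) auto
  then show "ln (2 * cosh x) \<le> \<bar>x\<bar> + ln 2" by (simp add: ln_mult)
qed


section \<open>Exponential integrals over weighted differences\<close>

locale diff_integral =
  fixes W :: "'v::finite set" and src tgt :: "'j::finite \<Rightarrow> 'v option"
begin

text \<open>\<open>None\<close> is a ground vertex held at \<open>0\<close>: a factor \<open>2 * cosh (\<tau> v)\<close> is an edge from \<open>v\<close> to it.\<close>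

definition pot :: "('v \<Rightarrow> real) \<Rightarrow> 'v option \<Rightarrow> real" where
  "pot \<tau> o' = (case o' of None \<Rightarrow> 0 | Some v \<Rightarrow> if v \<in> W then \<tau> v else 0)"

definition gap :: "'j \<Rightarrow> ('v \<Rightarrow> real) \<Rightarrow> real" where
  "gap j \<tau> = pot \<tau> (src j) - pot \<tau> (tgt j)"

definition expo :: "('v, 'j) energy \<Rightarrow> ('v \<Rightarrow> real) \<Rightarrow> complex" where
  "expo p \<tau> = (\<Sum>i\<in>W. fst p $ i * of_real (\<tau> i)) - (\<Sum>j\<in>UNIV. snd p $ j * of_real (ln (2 * cosh (gap j \<tau>))))"

text \<open>The piecewise linear function that is the limit of
  \<open>- expo p (k \<tau>) / k\<close> for k to infinity: the decay rate of the integrand along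
  the ray through \<tau>.\<close>

definition rate :: "('v, 'j) energy \<Rightarrow> ('v \<Rightarrow> real) \<Rightarrow> complex" where
  "rate p \<tau> = (\<Sum>j\<in>UNIV. snd p $ j * of_real \<bar>gap j \<tau>\<bar>) - (\<Sum>i\<in>W. fst p $ i * of_real (\<tau> i))"

definition total :: "('v \<Rightarrow> real) \<Rightarrow> real" where "total \<tau> = (\<Sum>i\<in>W. \<bar>\<tau> i\<bar>)"

definition dvec :: "real \<Rightarrow> 'v set \<Rightarrow> 'v \<Rightarrow> real" where "dvec c T = (\<lambda>i. if i \<in> T then c else 0)"

definition dirs :: "('v \<Rightarrow> real) set" where "dirs = {dvec c T | c T. c \<in> {1, -1} \<and> T \<subseteq> W \<and> T \<noteq> {}}"

text \<open>The region of absolute convergence, as \<open>integrable_iff_Dom\<close> shows.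
  Positivity of the decay rate has to be tested only on signed indicator functions, which are
  finitely many; so the region is cut out by finitely many half spaces and is open and
  convex.\<close>

definition Dom :: "('v, 'j) energy set" where "Dom = {p. \<forall>d\<in>dirs. 0 < Re (rate p d)}"

definition ival :: "('v, 'j) energy \<Rightarrow> complex" where "ival p = (\<integral>\<tau>. exp (expo p \<tau>) \<partial>lebP W)"

lemma finite_dirs: "finite dirs"
proof -
  have "dirs \<subseteq> (\<lambda>(c, T). dvec c T) ` ({1, -1} \<times> Pow W)" by (auto simp: dirs_def)
  then show ?thesis by (rule finite_subset) simp
qed

lemma pot_linear: "pot (\<lambda>i. a * \<tau> i + b * \<sigma> i) x = a * pot \<tau> x + b * pot \<sigma> x"
  by (simp add: pot_def split: option.split)

lemma gap_linear: "gap j (\<lambda>i. a * \<tau> i + b * \<sigma> i) = a * gap j \<tau> + b * gap j \<sigma>"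
  by (simp add: gap_def pot_linear algebra_simps)

lemma gap_add: "gap j (\<lambda>i. \<tau> i + r * \<sigma> i) = gap j \<tau> + r * gap j \<sigma>"
  using gap_linear[of j 1 \<tau> r \<sigma>] by simp

lemma gap_minus: "gap j (\<lambda>i. - \<tau> i) = - gap j \<tau>"
  using gap_linear[of j "-1" \<tau> 0 \<tau>] by simp

lemma gap_cong: "(\<And>i. i \<in> W \<Longrightarrow> \<tau> i = \<sigma> i) \<Longrightarrow> gap j \<tau> = gap j \<sigma>"
  by (simp add: gap_def pot_def split: option.split)

lemma abs_pot_le: "\<bar>pot \<tau> x\<bar> \<le> total \<tau>"
  unfolding pot_def total_def
  by (auto split: option.split intro: sum_nonneg member_le_sum)

lemma abs_gap_le: "\<bar>gap j \<tau>\<bar> \<le> 2 * total \<tau>"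
  using abs_pot_le[of \<tau> "src j"] abs_pot_le[of \<tau> "tgt j"] by (simp add: gap_def)

lemma total_nonneg: "0 \<le> total \<tau>" by (simp add: total_def sum_nonneg)

lemma expo_linear: "expo (p + q) \<tau> = expo p \<tau> + expo q \<tau>" "expo (cscale c p) \<tau> = c * expo p \<tau>"
  by (simp_all add: expo_def algebra_simps sum.distrib sum_distrib_left)

lemma cform_rate: "cform (\<lambda>p. rate p d)"
proof -
  have "cform (\<lambda>p. (\<Sum>j\<in>UNIV. of_real \<bar>gap j d\<bar> * snd p $ j) + (-1) * (\<Sum>i\<in>W. of_real (d i) * fst p $ i))"
    by (intro cform_add cform_sum cform_cmult cform_snd cform_fst)
  then show ?thesis by (simp add: rate_def mult.commute)
qed

lemma open_Dom_gen: "open {p. \<forall>d\<in>dirs. b d < Re (rate p d)}"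
proof -
  have "{p. \<forall>d\<in>dirs. b d < Re (rate p d)} = (\<Inter>d\<in>dirs. {p. b d < Re (rate p d)})" by auto
  also have "open \<dots>"
    using finite_dirs by (intro open_INT ballI open_Collect_less continuous_intros cform_continuous[OF cform_rate])
  finally show ?thesis .
qed

lemma convex_Dom_gen: "convex {p. \<forall>d\<in>dirs. b d < Re (rate p d)}"
proof (rule convexI, clarify)
  fix p1 p2 q1 q2 u v d
  assume *: "\<forall>d\<in>dirs. b d < Re (rate (p1, p2) d)" "\<forall>d\<in>dirs. b d < Re (rate (q1, q2) d)" "0 \<le> u" "0 \<le> v" "u + v = (1::real)"
    "d \<in> dirs"
  have "b d = u * b d + v * b d" using * by (metis distrib_right mult_1)
  also have "\<dots> < u * Re (rate (p1, p2) d) + v * Re (rate (q1, q2) d)"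
  proof (cases "u = 0")
    case True then show ?thesis using * by simp
  next
    case False
    then have "u * b d < u * Re (rate (p1, p2) d)" using * by simp
    moreover have "v * b d \<le> v * Re (rate (q1, q2) d)" using * by (intro mult_left_mono) auto
    ultimately show ?thesis by linarith
  qed
  also have "\<dots> = Re (rate (u *\<^sub>R (p1, p2) + v *\<^sub>R (q1, q2)) d)"
    by (simp only: scaleR_eq_cscale cform_linear[OF cform_rate]) simp
  finally show "b d < Re (rate (u *\<^sub>R (p1, p2) + v *\<^sub>R (q1, q2)) d)" .
qed

lemma open_Dom: "open Dom" and convex_Dom: "convex Dom"
  using open_Dom_gen[of "\<lambda>_. 0"] convex_Dom_gen[of "\<lambda>_. 0"] by (simp_all add: Dom_def)

text \<open>The first bound serves convergence inside \<open>Dom\<close>, the second one divergence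
  outside.\<close>

lemma Re_expo_bounds:
  "Re (expo p \<tau>) \<le> - Re (rate p \<tau>) + (\<Sum>j\<in>UNIV. \<bar>Re (snd p $ j)\<bar> * ln 2)"
  "- Re (rate p \<tau>) - (\<Sum>j\<in>UNIV. \<bar>Re (snd p $ j)\<bar> * ln 2) \<le> Re (expo p \<tau>)"
proof -
  have e: "Re (expo p \<tau>) + Re (rate p \<tau>) =
      (\<Sum>j\<in>UNIV. Re (snd p $ j) * (\<bar>gap j \<tau>\<bar> - ln (2 * cosh (gap j \<tau>))))"
    by (simp add: expo_def rate_def algebra_simps sum_subtractf)
  have "\<bar>\<Sum>j\<in>UNIV. Re (snd p $ j) * (\<bar>gap j \<tau>\<bar> - ln (2 * cosh (gap j \<tau>)))\<bar> \<le>
      (\<Sum>j\<in>UNIV. \<bar>Re (snd p $ j) * (\<bar>gap j \<tau>\<bar> - ln (2 * cosh (gap j \<tau>)))\<bar>)"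
    by (rule sum_abs)
  also have "\<dots> \<le> (\<Sum>j\<in>UNIV. \<bar>Re (snd p $ j)\<bar> * ln 2)"
  proof (rule sum_mono)
    fix j
    have "\<bar>\<bar>gap j \<tau>\<bar> - ln (2 * cosh (gap j \<tau>))\<bar> \<le> ln 2"
      using ln_two_cosh_bounds[of "gap j \<tau>"] by simp
    then show "\<bar>Re (snd p $ j) * (\<bar>gap j \<tau>\<bar> - ln (2 * cosh (gap j \<tau>)))\<bar> \<le> \<bar>Re (snd p $ j)\<bar> * ln 2"
      unfolding abs_mult by (intro mult_left_mono) auto
  qed
  finally have "\<bar>Re (expo p \<tau>) + Re (rate p \<tau>)\<bar> \<le> (\<Sum>j\<in>UNIV. \<bar>Re (snd p $ j)\<bar> * ln 2)" using e by simp
  then show "Re (expo p \<tau>) \<le> - Re (rate p \<tau>) + (\<Sum>j\<in>UNIV. \<bar>Re (snd p $ j)\<bar> * ln 2)"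
    "- Re (rate p \<tau>) - (\<Sum>j\<in>UNIV. \<bar>Re (snd p $ j)\<bar> * ln 2) \<le> Re (expo p \<tau>)" by linarith+
qed

lemma borel_measurable_pot [measurable]: "(\<lambda>\<tau>. pot \<tau> x) \<in> borel_measurable (lebP W)"
proof (cases x)
  case (Some v)
  have "(\<lambda>\<tau>. \<tau> v) \<in> borel_measurable (lebP W)" if "v \<in> W"
    using measurable_component_singleton[OF that, of "\<lambda>_. lborel"] by simp
  then show ?thesis unfolding pot_def Some by (cases "v \<in> W") simp_all
qed (simp add: pot_def)

lemma borel_measurable_gap [measurable]: "gap j \<in> borel_measurable (lebP W)"
  unfolding gap_def by measurable

lemma borel_measurable_expo [measurable]: "expo p \<in> borel_measurable (lebP W)"
proof -
  have [measurable]: "(\<lambda>x. ln (2 * cosh x)) \<in> borel_measurable (borel :: real measure)"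
    by (intro borel_measurable_continuous_onI continuous_intros) auto
  have [measurable]: "(\<lambda>\<tau>. \<tau> i) \<in> borel_measurable (lebP W)" if "i \<in> W" for i
    using measurable_component_singleton[OF that, of "\<lambda>_. lborel"] by simp
  have "(\<lambda>\<tau>. of_real (ln (2 * cosh (gap j \<tau>))) :: complex) \<in> borel_measurable (lebP W)" for j
    by measurable
  then show ?thesis unfolding expo_def by measurable
qed

text \<open>The rate is additive on functions with nested level sets, so a decomposition of \<open>\<tau>\<close> into
  level sets bounds it below by its values on (signed) indicator functions.\<close>

lemma rate_level_set:
  assumes m: "i0 \<in> W" "0 < \<tau> i0" "\<And>i. i \<in> W \<Longrightarrow> \<tau> i \<le> \<tau> i0"
  obtains \<tau>' h T where "T \<subseteq> W" "T \<noteq> {}" "0 \<le> h" "card (\<tau>' ` W - {0}) < card (\<tau> ` W - {0})"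
    "\<And>p. rate p \<tau> = rate p \<tau>' + of_real h * rate p (dvec 1 T)"
    "total \<tau> = total \<tau>' + h * total (dvec 1 T)"
proof -
  define M where "M = \<tau> i0"
  \<comment> \<open>The candidates for the level to which the top level set is lowered. Including 0
    stops the descent at the ground level, where negative values begin and the ground vertex
    sits.\<close>
  define V where "V = insert 0 {x \<in> \<tau> ` W. x < M}"
  define M' where "M' = Max V"
  have fV: "finite V" "V \<noteq> {}" by (auto simp: V_def)
  have M': "0 \<le> M'" "M' < M" "M' \<in> V"
    using fV m Max_in[OF fV] Max_ge[OF fV(1), of 0] unfolding M'_def V_def M_def by auto
  define T where "T = {i \<in> W. \<tau> i = M}"
  define \<tau>' where "\<tau>' i = (if i \<in> T then M' else \<tau> i)" for i
  have T: "T \<subseteq> W" "T \<noteq> {}" using m by (auto simp: T_def M_def)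
  have le: "\<tau> i = M \<or> \<tau> i \<le> M'" if "i \<in> W" for i
  proof (cases "\<tau> i = M")
    case False
    then have "\<tau> i \<in> V" using m(3)[OF that] that by (auto simp: V_def M_def)
    then show ?thesis using Max_ge[OF fV(1)] by (simp add: M'_def)
  qed simp
  have ptau: "(pot \<tau> x = M \<and> pot \<tau>' x = M' \<and> pot (dvec 1 T) x = 1) \<or>
      (pot \<tau> x \<le> M' \<and> pot \<tau>' x = pot \<tau> x \<and> pot (dvec 1 T) x = 0)" for x
    using le M' unfolding pot_def \<tau>'_def dvec_def T_def by (auto split: option.split)
  have g: "\<bar>gap j \<tau>\<bar> = \<bar>gap j \<tau>'\<bar> + (M - M') * \<bar>gap j (dvec 1 T)\<bar>" for j
    using ptau[of "src j"] ptau[of "tgt j"] M' unfolding gap_def by auto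
  have tau: "\<tau> i = \<tau>' i + (M - M') * dvec 1 T i" for i
    unfolding \<tau>'_def dvec_def T_def by auto
  show ?thesis
  proof (rule that[OF T, of "M - M'" \<tau>'])
    show "0 \<le> M - M'" using M' by simp
    show "rate p \<tau> = rate p \<tau>' + of_real (M - M') * rate p (dvec 1 T)" for p
    proof -
      have "rate p \<tau> = (\<Sum>j\<in>UNIV. snd p $ j * of_real (\<bar>gap j \<tau>'\<bar> + (M - M') * \<bar>gap j (dvec 1 T)\<bar>)) -
          (\<Sum>i\<in>W. fst p $ i * of_real (\<tau>' i + (M - M') * dvec 1 T i))"
        unfolding rate_def g[symmetric] tau[symmetric] ..
      then show ?thesis
        unfolding rate_def by (simp add: algebra_simps sum.distrib sum_distrib_left sum_subtractf)
    qed
    have "\<bar>\<tau> i\<bar> = \<bar>\<tau>' i\<bar> + (M - M') * \<bar>dvec 1 T i\<bar>" for i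
      unfolding \<tau>'_def dvec_def T_def using M' by auto
    then show "total \<tau> = total \<tau>' + (M - M') * total (dvec 1 T)"
      unfolding total_def by (simp add: sum.distrib sum_distrib_left)
    have "\<tau>' ` W - {0} \<subset> \<tau> ` W - {0}"
    proof -
      have "\<tau>' ` W - {0} \<subseteq> \<tau> ` W - {0}" using M' unfolding \<tau>'_def V_def by auto
      moreover have "M \<in> \<tau> ` W - {0}" using m unfolding M_def by auto
      moreover have "M \<notin> \<tau>' ` W" using le M' unfolding \<tau>'_def T_def by force
      ultimately show ?thesis by blast
    qed
    then show "card (\<tau>' ` W - {0}) < card (\<tau> ` W - {0})" by (intro psubset_card_mono) auto
  qed
qed

text \<open>The energies seen after the reflection of \<tau>. They reduce functions with only
  nonpositive values to functions with a positive value, for which a top level set can be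
  lowered.\<close>

definition flip :: "('v, 'j) energy \<Rightarrow> ('v, 'j) energy" where "flip p = (- fst p, snd p)"

lemma rate_flip: "rate (flip p) (\<lambda>i. - \<tau> i) = rate p \<tau>"
  by (simp add: rate_def flip_def gap_minus)

text \<open>Both \<open>rate\<close> and \<open>total\<close> are additive when the top level set is
  lowered, so the inequality for indicator functions adds up. Each lowering removes one nonzero
  value, and the induction is on their number.\<close>

lemma rate_lower_bound_aux:
  assumes "\<And>d. d \<in> dirs \<Longrightarrow> \<epsilon> * total d \<le> Re (rate p d)"
  shows "\<epsilon> * total \<tau> \<le> Re (rate p \<tau>)"
  using assms
proof (induction "card (\<tau> ` W - {0})" arbitrary: p \<tau> rule: less_induct)
  case less
  \<comment> \<open>Stated for arbitrary energies and functions with no more nonzero values than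
    \<tau>, so that it also covers the reflected pair.\<close>
  have pos: "\<epsilon> * total \<sigma> \<le> Re (rate q \<sigma>)"
    if q: "\<And>d. d \<in> dirs \<Longrightarrow> \<epsilon> * total d \<le> Re (rate q d)" and s: "i \<in> W" "0 < \<sigma> i"
      and c: "card (\<sigma> ` W - {0}) \<le> card (\<tau> ` W - {0})" for q \<sigma> i
  proof -
    have "Max (\<sigma> ` W) \<in> \<sigma> ` W" using s by (intro Max_in) auto
    then obtain i0 where i0: "i0 \<in> W" "\<sigma> i0 = Max (\<sigma> ` W)" by (metis imageE)
    then have m: "\<And>i. i \<in> W \<Longrightarrow> \<sigma> i \<le> \<sigma> i0" by simp
    moreover have "0 < \<sigma> i0" using m[OF s(1)] s by simp
    ultimately obtain \<sigma>' h T where h: "T \<subseteq> W" "T \<noteq> {}" "0 \<le> h" "card (\<sigma>' ` W - {0}) < card (\<sigma> ` W - {0})"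
      "rate q \<sigma> = rate q \<sigma>' + of_real h * rate q (dvec 1 T)" "total \<sigma> = total \<sigma>' + h * total (dvec 1 T)"
      using rate_level_set[OF i0(1)] by metis
    have "dvec 1 T \<in> dirs" using h unfolding dirs_def by blast
    then have "h * (\<epsilon> * total (dvec 1 T)) \<le> h * Re (rate q (dvec 1 T))" using q h by (intro mult_left_mono) auto
    moreover have "\<epsilon> * total \<sigma>' \<le> Re (rate q \<sigma>')" using less.hyps[of \<sigma>' q] h c q by simp
    ultimately show ?thesis using h by (simp add: algebra_simps)
  qed
  show ?case
  proof (cases "\<exists>i\<in>W. 0 < \<tau> i")
    case True
    then show ?thesis using pos[OF less.prems] by blast
  next
    case False
    show ?thesis
    proof (cases "\<exists>i\<in>W. \<tau> i < 0")
      case True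
      then obtain i where i: "i \<in> W" "\<tau> i < 0" by blast
      let ?\<sigma> = "\<lambda>i. - \<tau> i"
      have c: "card (?\<sigma> ` W - {0}) \<le> card (\<tau> ` W - {0})"
      proof -
        have "?\<sigma> ` W - {0} = uminus ` (\<tau> ` W - {0})" by auto
        then show ?thesis by (metis card_image_le finite finite_Diff finite_imageI)
      qed
      have f: "\<epsilon> * total d \<le> Re (rate (flip p) d)" if dd: "d \<in> dirs" for d
      proof -
        have "(\<lambda>i. - d i) \<in> dirs"
        proof -
          obtain c T where "d = dvec c T" "c \<in> {1, -1}" "T \<subseteq> W" "T \<noteq> {}" using dd unfolding dirs_def by blast
          moreover from this have "(\<lambda>i. - d i) = dvec (- c) T" "- c \<in> {1, -1}" by (auto simp: dvec_def)
          ultimately show ?thesis unfolding dirs_def by blast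
        qed
        then show ?thesis using less.prems[of "\<lambda>i. - d i"] rate_flip[of p "\<lambda>i. - d i"] by (simp add: total_def)
      qed
      have "\<epsilon> * total ?\<sigma> \<le> Re (rate (flip p) ?\<sigma>)"
        by (rule pos[OF f i(1) _ c]) (use i in simp_all)
      then show ?thesis unfolding rate_flip by (simp add: total_def)
    next
      case False
      with \<open>\<not> (\<exists>i\<in>W. 0 < \<tau> i)\<close> have z: "\<tau> i = 0" if "i \<in> W" for i using that by force
      then have "gap j \<tau> = 0" for j by (simp add: gap_def pot_def split: option.split)
      then show ?thesis using z by (simp add: total_def rate_def)
    qed
  qed
qed

lemma rate_lower_bound:
  assumes "p \<in> Dom"
  obtains \<epsilon> where "\<epsilon> > 0" "\<And>\<tau>. \<epsilon> * total \<tau> \<le> Re (rate p \<tau>)"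
proof -
  \<comment> \<open>The element 1 keeps the minimum meaningful when there are no directions, and
    \<open>1 + total d\<close> is a positive divisor in all cases.\<close>
  define S where "S = insert 1 ((\<lambda>d. Re (rate p d) / (1 + total d)) ` dirs)"
  define \<epsilon> where "\<epsilon> = Min S"
  have fS: "finite S" "S \<noteq> {}" using finite_dirs by (auto simp: S_def)
  have pt: "1 + total d > 0" for d using total_nonneg[of d] by linarith
  have "\<epsilon> > 0" unfolding \<epsilon>_def using fS assms pt by (subst Min_gr_iff) (auto simp: S_def Dom_def)
  have "\<epsilon> * total d \<le> Re (rate p d)" if "d \<in> dirs" for d
  proof -
    have "\<epsilon> \<le> Re (rate p d) / (1 + total d)" unfolding \<epsilon>_def using fS that by (intro Min_le) (auto simp: S_def)
    then have "\<epsilon> * (1 + total d) \<le> Re (rate p d)" using pt[of d] by (simp add: pos_le_divide_eq)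
    then show ?thesis using \<open>\<epsilon> > 0\<close> by (simp add: algebra_simps)
  qed
  then show ?thesis using that \<open>\<epsilon> > 0\<close> rate_lower_bound_aux by blast
qed

lemma norm_exp_expo_le:
  assumes "\<And>\<tau>. \<epsilon> * total \<tau> \<le> Re (rate p \<tau>)"
  shows "norm (exp (expo p \<tau>)) \<le> exp (\<Sum>j\<in>UNIV. \<bar>Re (snd p $ j)\<bar> * ln 2) * exp (- \<epsilon> * total \<tau>)"
  using Re_expo_bounds(1)[of p \<tau>] assms[of \<tau>] by (simp flip: exp_add)

lemma integrable_exp_total: "\<epsilon> > 0 \<Longrightarrow> integrable (lebP W) (\<lambda>\<tau>. exp (- \<epsilon> * total \<tau>))"
  unfolding total_def by (rule integrable_exp_sum_abs) auto

lemma integrable_rate: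
  assumes "\<epsilon> > 0" "\<And>\<tau>. \<epsilon> * total \<tau> \<le> Re (rate p \<tau>)"
  shows "integrable (lebP W) (\<lambda>\<tau>. exp (expo p \<tau>))"
proof (rule Bochner_Integration.integrable_bound)
  show "integrable (lebP W) (\<lambda>\<tau>. exp (\<Sum>j\<in>UNIV. \<bar>Re (snd p $ j)\<bar> * ln 2) * exp (- \<epsilon> * total \<tau>))"
    using integrable_exp_total[OF assms(1)] by simp
  show "AE \<tau> in lebP W. norm (exp (expo p \<tau>)) \<le> norm (exp (\<Sum>j\<in>UNIV. \<bar>Re (snd p $ j)\<bar> * ln 2) * exp (- \<epsilon> * total \<tau>))"
    using norm_exp_expo_le[OF assms(2)] by (intro AE_I2) (simp add: abs_mult)
qed measurable

lemma integrable_Dom: "p \<in> Dom \<Longrightarrow> integrable (lebP W) (\<lambda>\<tau>. exp (expo p \<tau>))"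
  using rate_lower_bound[of p] integrable_rate by blast

end

section \<open>Differentiation in the energies, and the effect of translating the variables\<close>

context diff_integral
begin

lemma norm_expo_le: "norm (expo h \<tau>) \<le> norm h * ((1 + 2 * real CARD('j)) * (1 + total \<tau>))"
proof -
  have comp: "norm (fst h $ i) \<le> norm h" "norm (snd h $ j) \<le> norm h" for i j
    using Finite_Cartesian_Product.norm_nth_le[of "fst h" i] Finite_Cartesian_Product.norm_nth_le[of "snd h" j]
      norm_fst_le[of "fst h" "snd h"] norm_snd_le[of "snd h" "fst h"] by simp_all
  have "norm (expo h \<tau>) \<le> norm (\<Sum>i\<in>W. fst h $ i * of_real (\<tau> i)) + norm (\<Sum>j\<in>UNIV. snd h $ j * of_real (ln (2 * cosh (gap j \<tau>))))"
    unfolding expo_def by (rule norm_triangle_ineq4)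
  also have "norm (\<Sum>i\<in>W. fst h $ i * of_real (\<tau> i)) \<le> (\<Sum>i\<in>W. norm h * \<bar>\<tau> i\<bar>)"
    using comp by (intro sum_norm_le) (simp add: norm_mult mult_right_mono)
  also have "\<dots> = norm h * total \<tau>" by (simp add: total_def sum_distrib_left)
  also have "norm (\<Sum>j\<in>UNIV. snd h $ j * of_real (ln (2 * cosh (gap j \<tau>)))) \<le> (\<Sum>j\<in>(UNIV :: 'j set). norm h * (2 * (1 + total \<tau>)))"
  proof (rule sum_norm_le)
    fix j
    have "ln (2::real) \<le> 1" using ln_2_less_1 by simp
    moreover have b: "0 \<le> ln (2 * cosh (gap j \<tau>))"
      using order_trans[OF abs_ge_zero ln_two_cosh_bounds(1)] .
    ultimately have "\<bar>ln (2 * cosh (gap j \<tau>))\<bar> \<le> 2 * (1 + total \<tau>)"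
      using ln_two_cosh_bounds(2)[of "gap j \<tau>"] abs_gap_le[of j \<tau>] unfolding abs_of_nonneg[OF b] by argo
    then show "norm (snd h $ j * of_real (ln (2 * cosh (gap j \<tau>)))) \<le> norm h * (2 * (1 + total \<tau>))"
      unfolding norm_mult using comp by (intro mult_mono) auto
  qed
  also have "\<dots> = norm h * (2 * real CARD('j) * (1 + total \<tau>))" by simp
  finally have "norm (expo h \<tau>) \<le> norm h * total \<tau> + norm h * (2 * real CARD('j) * (1 + total \<tau>))" by simp
  also have "\<dots> \<le> norm h * ((1 + 2 * real CARD('j)) * (1 + total \<tau>))"
    by (simp add: algebra_simps)
  finally show ?thesis .
qed

lemma exp_quadratic_bound:
  fixes x \<epsilon> :: real
  assumes "\<epsilon> > 0" "x \<ge> 0"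
  shows "x\<^sup>2 \<le> 2 / \<epsilon>\<^sup>2 * exp (\<epsilon> * x)"
proof -
  have "1 + \<epsilon> * x + (\<epsilon> * x)\<^sup>2 / 2 \<le> exp (\<epsilon> * x)"
    using assms by (intro exp_lower_Taylor_quadratic) auto
  then have "(\<epsilon> * x)\<^sup>2 / 2 \<le> exp (\<epsilon> * x)" using assms mult_nonneg_nonneg[of \<epsilon> x] by linarith
  then show ?thesis using assms by (simp add: field_simps power_mult_distrib)
qed

text \<open>The remainder of the exponential series is at most |u|^2 exp |Re u| with u =
  \<open>expo h \<tau>\<close>, which grows linearly in \<open>total \<tau>\<close>. For small
  \<open>h\<close> the exponential factor costs a quarter of the decay \<epsilon>, the square
  another quarter, and decay at rate \<epsilon>/2 remains integrable.\<close>

lemma ival_has_derivative: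
  assumes p: "p \<in> Dom"
  shows "(ival has_derivative (\<lambda>h. \<integral>\<tau>. exp (expo p \<tau>) * expo h \<tau> \<partial>lebP W)) (at p)"
proof -
  obtain \<epsilon> where e: "\<epsilon> > 0" "\<And>\<tau>. \<epsilon> * total \<tau> \<le> Re (rate p \<tau>)" by (rule rate_lower_bound[OF p]) (rule that)
  define C where "C = exp (\<Sum>j\<in>UNIV. \<bar>Re (snd p $ j)\<bar> * ln 2)"
  define K where "K = 1 + 2 * real CARD('j)"
  have K: "K > 0" by (simp add: K_def add_pos_nonneg)
  have C: "C > 0" by (simp add: C_def)
  have fb: "norm (exp (expo p \<tau>)) \<le> C * exp (- \<epsilon> * total \<tau>)" for \<tau>
    unfolding C_def by (rule norm_exp_expo_le[OF e(2)])
  have eb: "norm (expo h \<tau>) \<le> norm h * K * (1 + total \<tau>)" for h \<tau>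
    using norm_expo_le[of h \<tau>] by (simp add: K_def mult.assoc)
  \<comment> \<open>Collects the constant of \<open>exp_quadratic_bound\<close> at \<epsilon>/4, the
    constant of the integrand, and exp (\<epsilon>/2) from two factors exp (\<epsilon>/4 * (1 +
    total)).\<close>
  define Q where "Q = 2 / (\<epsilon>/4)\<^sup>2 * C * exp (\<epsilon>/2)"
  have Q: "Q > 0" using e C by (simp add: Q_def)
  let ?b = "\<lambda>\<tau>. Q * exp (- (\<epsilon>/2) * total \<tau>)"
  have bint: "integrable (lebP W) ?b" using integrable_exp_total[of "\<epsilon>/2"] e by simp
  have quad: "C * exp (- \<epsilon> * total \<tau>) * ((1 + total \<tau>)\<^sup>2 * exp (\<epsilon>/4 * (1 + total \<tau>))) \<le> ?b \<tau>" for \<tau>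
  proof -
    have "(1 + total \<tau>)\<^sup>2 \<le> 2 / (\<epsilon>/4)\<^sup>2 * exp (\<epsilon>/4 * (1 + total \<tau>))"
      using e total_nonneg by (intro exp_quadratic_bound) auto
    then have "C * exp (- \<epsilon> * total \<tau>) * ((1 + total \<tau>)\<^sup>2 * exp (\<epsilon>/4 * (1 + total \<tau>))) \<le>
        C * exp (- \<epsilon> * total \<tau>) * (2 / (\<epsilon>/4)\<^sup>2 * exp (\<epsilon>/4 * (1 + total \<tau>)) * exp (\<epsilon>/4 * (1 + total \<tau>)))"
      using C by (intro mult_left_mono mult_right_mono) auto
    also have "\<dots> = 2 / (\<epsilon>/4)\<^sup>2 * C * (exp (- \<epsilon> * total \<tau>) * exp (\<epsilon>/4 * (1 + total \<tau>)) * exp (\<epsilon>/4 * (1 + total \<tau>)))"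
      by (simp add: mult_ac)
    also have "exp (- \<epsilon> * total \<tau>) * exp (\<epsilon>/4 * (1 + total \<tau>)) * exp (\<epsilon>/4 * (1 + total \<tau>)) = exp (\<epsilon>/2) * exp (- (\<epsilon>/2) * total \<tau>)"
      by (simp add: exp_add[symmetric] algebra_simps)
    finally show ?thesis by (simp add: Q_def mult_ac)
  qed
  have lin_int: "integrable (lebP W) (\<lambda>\<tau>. exp (expo p \<tau>) * expo h \<tau>)" for h
  proof (rule Bochner_Integration.integrable_bound)
    show "integrable (lebP W) (\<lambda>\<tau>. norm h * K * ?b \<tau>)" using bint by simp
    show "AE \<tau> in lebP W. norm (exp (expo p \<tau>) * expo h \<tau>) \<le> norm (norm h * K * ?b \<tau>)"
    proof (rule AE_I2)
      fix \<tau>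
      have "1 + total \<tau> \<le> (1 + total \<tau>)\<^sup>2 * exp (\<epsilon>/4 * (1 + total \<tau>))"
      proof -
        have "1 + total \<tau> \<le> (1 + total \<tau>)\<^sup>2" using total_nonneg[of \<tau>] by (simp add: power2_eq_square algebra_simps)
        moreover have "1 \<le> exp (\<epsilon>/4 * (1 + total \<tau>))" using e total_nonneg[of \<tau>] by simp
        ultimately show ?thesis using total_nonneg[of \<tau>]
          by (metis (no_types, opaque_lifting) mult_left_mono mult.right_neutral order_trans zero_le_power2)
      qed
      then have "C * exp (- \<epsilon> * total \<tau>) * (1 + total \<tau>) \<le> ?b \<tau>"
        using quad[of \<tau>] C by (meson exp_ge_zero less_imp_le mult_left_mono mult_nonneg_nonneg order_trans)
      moreover have "norm (exp (expo p \<tau>) * expo h \<tau>) \<le> (C * exp (- \<epsilon> * total \<tau>)) * (norm h * K * (1 + total \<tau>))"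
        unfolding norm_mult using fb eb C by (intro mult_mono) auto
      moreover have "\<dots> = norm h * K * (C * exp (- \<epsilon> * total \<tau>) * (1 + total \<tau>))" by (simp add: mult_ac)
      moreover have "norm h * K * (C * exp (- \<epsilon> * total \<tau>) * (1 + total \<tau>)) \<le> norm h * K * ?b \<tau>"
        if "C * exp (- \<epsilon> * total \<tau>) * (1 + total \<tau>) \<le> ?b \<tau>"
        using K by (intro mult_left_mono that) auto
      moreover have "norm (norm h * K * ?b \<tau>) = norm h * K * ?b \<tau>" using K Q by (simp add: abs_mult)
      ultimately show "norm (exp (expo p \<tau>) * expo h \<tau>) \<le> norm (norm h * K * ?b \<tau>)" by linarith
    qed
  qed measurable
  let ?D = "\<lambda>h. \<integral>\<tau>. exp (expo p \<tau>) * expo h \<tau> \<partial>lebP W"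
  define B where "B = (\<integral>\<tau>. ?b \<tau> \<partial>lebP W)"
  have B: "B \<ge> 0" unfolding B_def using Q by (intro integral_nonneg_AE) auto
  have Dadd: "?D (h + h') = ?D h + ?D h'" for h h'
    using lin_int by (simp add: expo_linear distrib_left)
  have Dsc: "?D (cscale c h) = c * ?D h" for c h
  proof -
    have "(\<lambda>\<tau>. exp (expo p \<tau>) * expo (cscale c h) \<tau>) = (\<lambda>\<tau>. c * (exp (expo p \<tau>) * expo h \<tau>))"
      by (simp add: expo_linear mult_ac)
    then show ?thesis by simp
  qed
  have lin: "linear ?D"
    using Dadd Dsc by (intro linearI) (simp_all add: scaleR_eq_cscale scaleR_conv_of_real)
  obtain \<delta> where \<delta>: "\<delta> > 0" "ball p \<delta> \<subseteq> Dom" using open_Dom p openE by blast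
  \<comment> \<open>The first bound keeps \<open>p + h\<close> in \<open>Dom\<close>, the second
    makes \<open>expo h\<close> grow at most at rate \<epsilon>/4.\<close>
  define r where "r = min \<delta> (\<epsilon> / (4 * K))"
  have r: "r > 0" using \<delta> e K by (simp add: r_def)
  have rem: "norm (ival (p + h) - ival p - ?D h) \<le> K\<^sup>2 * B * (norm h)\<^sup>2" if h: "norm h < r" for h
  proof -
    have hp: "p + h \<in> Dom" using \<delta> h by (auto simp: r_def dist_norm)
    have hK: "norm h * K \<le> \<epsilon>/4"
    proof -
      have "norm h \<le> \<epsilon> / (4 * K)" using h by (simp add: r_def)
      then have "norm h * K \<le> \<epsilon> / (4 * K) * K" using K by (intro mult_right_mono) auto
      then show ?thesis using K by simp
    qed
    let ?g = "\<lambda>\<tau>. exp (expo (p + h) \<tau>) - exp (expo p \<tau>) - exp (expo p \<tau>) * expo h \<tau>"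
    have "ival (p + h) - ival p - ?D h = (\<integral>\<tau>. ?g \<tau> \<partial>lebP W)"
      unfolding ival_def using integrable_Dom[OF p] integrable_Dom[OF hp] lin_int by simp
    also have "norm \<dots> \<le> (\<integral>\<tau>. norm (?g \<tau>) \<partial>lebP W)" by (rule integral_norm_bound)
    also have "\<dots> \<le> (\<integral>\<tau>. K\<^sup>2 * (norm h)\<^sup>2 * ?b \<tau> \<partial>lebP W)"
    proof (rule integral_mono)
      show "integrable (lebP W) (\<lambda>\<tau>. norm (?g \<tau>))"
        using integrable_Dom[OF p] integrable_Dom[OF hp] lin_int by (intro integrable_norm Bochner_Integration.integrable_diff)
      show "integrable (lebP W) (\<lambda>\<tau>. K\<^sup>2 * (norm h)\<^sup>2 * ?b \<tau>)" using bint by simp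
      fix \<tau>
      let ?u = "expo h \<tau>"
      have u: "norm ?u \<le> norm h * K * (1 + total \<tau>)" by (rule eb)
      have u2: "norm ?u \<le> \<epsilon>/4 * (1 + total \<tau>)"
        using u mult_right_mono[OF hK, of "1 + total \<tau>"] total_nonneg[of \<tau>] by linarith
      have "norm (exp ?u - (\<Sum>k\<le>1. ?u ^ k / fact k)) \<le> exp \<bar>Re ?u\<bar> * norm ?u ^ Suc 1 / fact 1"
        by (rule Taylor_exp)
      then have "norm (exp ?u - 1 - ?u) \<le> exp \<bar>Re ?u\<bar> * (norm ?u)\<^sup>2"
        by (simp add: power2_eq_square diff_diff_eq)
      also have "\<dots> \<le> exp (\<epsilon>/4 * (1 + total \<tau>)) * (norm h * K * (1 + total \<tau>))\<^sup>2"
        using u u2 abs_Re_le_cmod[of ?u] by (intro mult_mono power_mono) auto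
      finally have 1: "norm (exp ?u - 1 - ?u) \<le> exp (\<epsilon>/4 * (1 + total \<tau>)) * (norm h * K * (1 + total \<tau>))\<^sup>2" .
      have "?g \<tau> = exp (expo p \<tau>) * (exp ?u - 1 - ?u)"
        by (simp add: expo_linear exp_add algebra_simps)
      then have "norm (?g \<tau>) = norm (exp (expo p \<tau>)) * norm (exp ?u - 1 - ?u)" by (simp add: norm_mult)
      also have "\<dots> \<le> (C * exp (- \<epsilon> * total \<tau>)) * (exp (\<epsilon>/4 * (1 + total \<tau>)) * (norm h * K * (1 + total \<tau>))\<^sup>2)"
        using fb 1 C by (intro mult_mono) auto
      also have "\<dots> = K\<^sup>2 * (norm h)\<^sup>2 * (C * exp (- \<epsilon> * total \<tau>) * ((1 + total \<tau>)\<^sup>2 * exp (\<epsilon>/4 * (1 + total \<tau>))))"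
        by (simp add: power_mult_distrib mult_ac)
      also have "\<dots> \<le> K\<^sup>2 * (norm h)\<^sup>2 * ?b \<tau>" using quad by (intro mult_left_mono) auto
      finally show "norm (?g \<tau>) \<le> K\<^sup>2 * (norm h)\<^sup>2 * ?b \<tau>" .
    qed
    also have "\<dots> = K\<^sup>2 * (norm h)\<^sup>2 * B" unfolding B_def by simp
    finally show ?thesis by (simp add: mult_ac)
  qed
  show ?thesis
  proof (rule has_derivativeI_sandwich[of r])
    show "r > 0" by fact
    show "bounded_linear ?D" using lin by (simp add: linear_conv_bounded_linear)
    fix y assume y: "y \<in> UNIV" "y \<noteq> p" "dist y p < r"
    have "norm (ival y - ival p - ?D (y - p)) \<le> K\<^sup>2 * B * (norm (y - p))\<^sup>2"
      using rem[of "y - p"] y by (simp add: dist_norm)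
    then show "norm (ival y - ival p - ?D (y - p)) / norm (y - p) \<le> K\<^sup>2 * B * norm (y - p)"
      using y by (simp add: pos_divide_le_eq power2_eq_square mult.assoc)
  next
    show "((\<lambda>y. K\<^sup>2 * B * norm (y - p)) \<longlongrightarrow> 0) (at p)"
      by (auto intro!: tendsto_eq_intros)
  qed
qed

lemma holomorphic_ival: "holomorphic_within Dom ival"
  unfolding holomorphic_within_alt
proof
  fix p assume p: "p \<in> Dom"
  have "(\<integral>\<tau>. exp (expo p \<tau>) * expo (cscale c h) \<tau> \<partial>lebP W) = c * (\<integral>\<tau>. exp (expo p \<tau>) * expo h \<tau> \<partial>lebP W)" for c h
  proof -
    have "(\<lambda>\<tau>. exp (expo p \<tau>) * expo (cscale c h) \<tau>) = (\<lambda>\<tau>. c * (exp (expo p \<tau>) * expo h \<tau>))"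
      by (simp add: expo_linear mult_ac)
    then show ?thesis by simp
  qed
  then show "\<exists>D. (ival has_derivative D) (at p within Dom) \<and> (\<forall>c h. D (cscale c h) = c * D h)"
    using has_derivative_at_withinI[OF ival_has_derivative[OF p]] by (intro exI conjI) auto
qed

text \<open>Multiplying the integrand by \<open>exp (- c * gap j) / (2 * cosh (gap j))\<close>, where \<open>c = gap j d\<close>.\<close>

definition shift :: "'j \<Rightarrow> ('v \<Rightarrow> real) \<Rightarrow> ('v, 'j) energy" where
  "shift j d = ((\<chi> i. of_real (- gap j d * gap j (\<lambda>k. if k = i then 1 else 0))), axis j 1)"

lemma gap_as_sum: "gap j \<tau> = (\<Sum>i\<in>W. gap j (\<lambda>k. if k = i then 1 else 0) * \<tau> i)"
proof -
  have p: "pot \<tau> x = (\<Sum>i\<in>W. pot (\<lambda>k. if k = i then 1 else 0) x * \<tau> i)" for x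
  proof (cases x)
    case (Some v)
    have "(\<Sum>i\<in>W. pot (\<lambda>k. if k = i then 1 else 0) x * \<tau> i) = (\<Sum>i\<in>W. if i = v then \<tau> i else 0)"
      unfolding pot_def Some by (intro sum.cong) auto
    then show ?thesis by (simp add: pot_def Some)
  qed (simp add: pot_def)
  show ?thesis
    unfolding gap_def p[of "src j"] p[of "tgt j"] by (simp add: sum_subtractf left_diff_distrib)
qed

lemma snd_shift: "snd (shift j d) $ k = (if k = j then 1 else 0)"
  by (simp add: shift_def axis_def)

lemma sum_fst_shift: "(\<Sum>i\<in>W. fst (shift j d) $ i * of_real (\<tau> i)) = of_real (- gap j d * gap j \<tau>)"
proof -
  have "(\<Sum>i\<in>W. fst (shift j d) $ i * of_real (\<tau> i)) =
      of_real (\<Sum>i\<in>W. - gap j d * gap j (\<lambda>k. if k = i then 1 else 0) * \<tau> i)"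
    by (simp add: shift_def)
  also have "(\<Sum>i\<in>W. - gap j d * gap j (\<lambda>k. if k = i then 1 else 0) * \<tau> i) = - gap j d * gap j \<tau>"
    unfolding gap_as_sum[of j \<tau>] by (simp add: sum_distrib_left mult.assoc)
  finally show ?thesis .
qed

lemma expo_shift: "expo (shift j d) \<tau> = of_real (- gap j d * gap j \<tau> - ln (2 * cosh (gap j \<tau>)))"
proof -
  have "(\<Sum>k\<in>UNIV. snd (shift j d) $ k * of_real (ln (2 * cosh (gap k \<tau>)))) = of_real (ln (2 * cosh (gap j \<tau>)))"
    unfolding snd_shift by (simp add: if_distrib[of "\<lambda>x. x * _"] cong: if_cong)
  then show ?thesis unfolding expo_def sum_fst_shift by simp
qed

lemma rate_shift: "rate (p + shift j d) \<tau> = rate p \<tau> + of_real (\<bar>gap j \<tau>\<bar> + gap j d * gap j \<tau>)"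
proof -
  have "(\<Sum>k\<in>UNIV. snd (shift j d) $ k * of_real \<bar>gap k \<tau>\<bar>) = of_real \<bar>gap j \<tau>\<bar>"
    unfolding snd_shift by (simp add: if_distrib[of "\<lambda>x. x * _"] cong: if_cong)
  then have "rate (shift j d) \<tau> = of_real (\<bar>gap j \<tau>\<bar> + gap j d * gap j \<tau>)"
    unfolding rate_def sum_fst_shift by simp
  then show ?thesis using cform_linear(1)[OF cform_rate] by metis
qed

lemma gap_dirs: "d \<in> dirs \<Longrightarrow> gap j d \<in> {-1, 0, 1}"
proof -
  assume "d \<in> dirs"
  then obtain c T where d: "d = dvec c T" "c = 1 \<or> c = -1" "T \<subseteq> W" unfolding dirs_def by blast
  have "pot d x \<in> {0, c}" for x
    using d by (auto simp: pot_def dvec_def split: option.split)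
  from this[of "src j"] this[of "tgt j"] show ?thesis
    unfolding gap_def using d(2) by auto
qed

lemma rate_shift_mono:
  assumes "d \<in> dirs"
  shows "Re (rate p \<tau>) \<le> Re (rate (p + shift j d) \<tau>)"
proof -
  have "\<bar>gap j \<tau>\<bar> + gap j d * gap j \<tau> \<ge> 0" using gap_dirs[OF assms, of j] by auto
  then show ?thesis by (simp add: rate_shift)
qed

text \<open>Together with \<open>rate_shift_mono\<close> this drives the continuation: shifting an
  edge on which \<open>d\<close> is not constant gains 2 in direction \<open>d\<close> and loses
  nothing in any other direction.\<close>

lemma rate_shift_gain:
  assumes "d \<in> dirs" "gap j d \<noteq> 0"
  shows "Re (rate (p + shift j d) d) = Re (rate p d) + 2"
proof -
  have "\<bar>gap j d\<bar> + gap j d * gap j d = 2" using gap_dirs[OF assms(1), of j] assms(2) by auto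
  then show ?thesis by (simp add: rate_shift)
qed

lemma Dom_shift: "d \<in> dirs \<Longrightarrow> p \<in> Dom \<Longrightarrow> p + shift j d \<in> Dom"
  unfolding Dom_def using rate_shift_mono[of d p _ j] by (auto intro: less_le_trans)

text \<open>The derivative of ln (2 cosh) is tanh, and for c in {-1, 0, 1} one has c tanh x = |c| -
  2 |c| exp (- c x) / (2 cosh x). The constant parts combine with the linear terms to
  \<open>- rate p d\<close>, and the remaining factors are exactly those produced by
  \<open>shift\<close>.\<close>

lemma expo_has_vector_derivative:
  assumes d: "d \<in> dirs"
  shows "((\<lambda>s. exp (expo p (\<lambda>i. \<tau> i + s * d i))) has_vector_derivative
    (- rate p d * exp (expo p (\<lambda>i. \<tau> i + s * d i)) +
     (\<Sum>j\<in>UNIV. 2 * snd p $ j * of_real \<bar>gap j d\<bar> * exp (expo (p + shift j d) (\<lambda>i. \<tau> i + s * d i))))) (at s)"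
proof -
  let ?t = "\<lambda>s i. \<tau> i + s * d i"
  have ga: "gap j (?t s) = gap j \<tau> + s * gap j d" for j s by (rule gap_add)
  have der: "((\<lambda>s. ln (2 * cosh (gap j (?t s)))) has_real_derivative gap j d * tanh (gap j (?t s))) (at s)" for j s
    unfolding ga by (auto intro!: derivative_eq_intros simp: tanh_def)
  have de: "((\<lambda>s. expo p (?t s)) has_vector_derivative
     ((\<Sum>i\<in>W. fst p $ i * of_real (d i)) - (\<Sum>j\<in>UNIV. snd p $ j * of_real (gap j d * tanh (gap j (?t s)))))) (at s)"
  proof -
    have "((\<lambda>s. of_real (ln (2 * cosh (gap j (?t s)))) :: complex) has_vector_derivative
        of_real (gap j d * tanh (gap j (?t s)))) (at s)" for j
      using der by (intro has_vector_derivative_of_real) (simp add: has_real_derivative_iff_has_vector_derivative)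
    moreover have "((\<lambda>s. of_real (\<tau> i + s * d i) :: complex) has_vector_derivative of_real (d i)) (at s)" for i
      by (intro has_vector_derivative_of_real)
        (auto intro!: derivative_eq_intros simp: has_real_derivative_iff_has_vector_derivative[symmetric])
    ultimately show ?thesis
      unfolding expo_def
      by (intro has_vector_derivative_diff has_vector_derivative_sum has_vector_derivative_mult_right)
  qed
  have "((\<lambda>s. exp (expo p (?t s))) has_vector_derivative
     ((\<Sum>i\<in>W. fst p $ i * of_real (d i)) - (\<Sum>j\<in>UNIV. snd p $ j * of_real (gap j d * tanh (gap j (?t s)))))
       * exp (expo p (?t s))) (at s)"
    using field_vector_diff_chain_at[OF de DERIV_exp] by (simp add: o_def)
  moreover have t: "of_real (gap j d * tanh (gap j (?t s))) = of_real \<bar>gap j d\<bar> -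
      2 * of_real \<bar>gap j d\<bar> * exp (expo (shift j d) (?t s))" for j
  proof -
    let ?x = "gap j (?t s)"
    have "exp (expo (shift j d) (?t s)) = of_real (exp (- gap j d * ?x) / (2 * cosh ?x))"
      unfolding expo_shift exp_of_real by (simp add: exp_diff)
    moreover have "gap j d * tanh ?x = \<bar>gap j d\<bar> - 2 * \<bar>gap j d\<bar> * (exp (- gap j d * ?x) / (2 * cosh ?x))"
    proof -
      have c: "2 * cosh ?x = exp ?x + exp (- ?x)" "2 * sinh ?x = exp ?x - exp (- ?x)"
        by (simp_all add: cosh_def sinh_def)
      have n: "exp ?x + exp (- ?x) > 0" by (simp add: add_pos_pos)
      have "tanh ?x = (2 * sinh ?x) / (2 * cosh ?x)" by (simp add: tanh_def)
      then have "tanh ?x = (exp ?x - exp (- ?x)) / (exp ?x + exp (- ?x))" unfolding c .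
      then show ?thesis unfolding c using gap_dirs[OF d, of j] n
        by (auto simp: field_simps)
    qed
    ultimately show ?thesis by simp
  qed
  moreover have "((\<Sum>i\<in>W. fst p $ i * of_real (d i)) - (\<Sum>j\<in>UNIV. snd p $ j * of_real (gap j d * tanh (gap j (?t s)))))
       * exp (expo p (?t s)) = - rate p d * exp (expo p (?t s)) +
     (\<Sum>j\<in>UNIV. 2 * snd p $ j * of_real \<bar>gap j d\<bar> * exp (expo (p + shift j d) (?t s)))"
    unfolding t rate_def expo_linear(1) exp_add
    by (simp add: algebra_simps sum_distrib_left sum_distrib_right sum.distrib sum_subtractf)
  ultimately show ?thesis by simp
qed

lemma total_shift: "d \<in> dirs \<Longrightarrow> \<bar>s\<bar> \<le> 1 \<Longrightarrow> total \<tau> - real (card W) \<le> total (\<lambda>i. \<tau> i + s * d i)"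
proof -
  assume "d \<in> dirs" "\<bar>s\<bar> \<le> 1"
  then have "\<bar>s * d i\<bar> \<le> 1" for i
    unfolding abs_mult by (intro mult_le_one) (auto simp: dirs_def dvec_def split: if_splits)
  moreover have "\<bar>\<tau> i\<bar> \<le> \<bar>\<tau> i + s * d i\<bar> + \<bar>s * d i\<bar>" for i
    using abs_triangle_ineq4[of "\<tau> i + s * d i" "s * d i"] by simp
  ultimately have "\<bar>\<tau> i\<bar> - 1 \<le> \<bar>\<tau> i + s * d i\<bar>" for i
    by (metis add_le_cancel_left diff_le_eq order_trans)
  then have "(\<Sum>i\<in>W. \<bar>\<tau> i\<bar> - 1) \<le> (\<Sum>i\<in>W. \<bar>\<tau> i + s * d i\<bar>)" by (intro sum_mono)
  then show ?thesis by (simp add: total_def sum_subtractf)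
qed

lemma expo_cong: "(\<And>i. i \<in> W \<Longrightarrow> \<tau> i = \<sigma> i) \<Longrightarrow> expo p \<tau> = expo p \<sigma>"
  using gap_cong[of \<tau> \<sigma>] by (simp add: expo_def)

lemma ival_translate: "(\<integral>\<tau>. exp (expo p (\<lambda>i. \<tau> i + a i)) \<partial>lebP W) = ival p"
proof -
  have "(\<integral>\<tau>. exp (expo p (\<lambda>i\<in>W. \<tau> i + a i)) \<partial>lebP W) = ival p"
    unfolding ival_def by (rule integral_lebP_translate) auto
  moreover have "expo p (\<lambda>i\<in>W. \<tau> i + a i) = expo p (\<lambda>i. \<tau> i + a i)" for \<tau>
    by (rule expo_cong) simp
  ultimately show ?thesis by simp
qed

end

section \<open>The recursion between shifted energies and the exact region of convergence\<close>

context diff_integral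
begin

lemma measurable_exp_expo_translate [measurable]:
  "(\<lambda>\<tau>. exp (expo p (\<lambda>i. \<tau> i + a i))) \<in> borel_measurable (lebP W)"
proof -
  have "(\<lambda>\<tau>. exp (expo p (\<lambda>i\<in>W. \<tau> i + a i))) \<in> borel_measurable (lebP W)"
    by (rule measurable_compose[OF measurable_lebP_translate]) measurable
  moreover have "expo p (\<lambda>i\<in>W. \<tau> i + a i) = expo p (\<lambda>i. \<tau> i + a i)" for \<tau>
    by (rule expo_cong) simp
  ultimately show ?thesis by simp
qed

text \<open>By translation invariance the integral of the integrand translated by
  \<open>s * d\<close> is independent of \<open>s\<close>. Hence the integral of its derivative at 0
  vanishes, and the preceding formula for the derivative gives the recursion.\<close>

lemma rate_identity:
  assumes p: "p \<in> Dom" and d: "d \<in> dirs"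
  shows "rate p d * ival p = (\<Sum>j\<in>UNIV. 2 * snd p $ j * of_real \<bar>gap j d\<bar> * ival (p + shift j d))"
proof -
  let ?f = "\<lambda>\<tau> s. exp (expo p (\<lambda>i. \<tau> i + s * d i))"
  define G where "G \<tau> s = - rate p d * ?f \<tau> s +
     (\<Sum>j\<in>UNIV. 2 * snd p $ j * of_real \<bar>gap j d\<bar> * exp (expo (p + shift j d) (\<lambda>i. \<tau> i + s * d i)))" for \<tau> s
  obtain \<epsilon> where e: "\<epsilon> > 0" "\<And>\<tau>. \<epsilon> * total \<tau> \<le> Re (rate p \<tau>)" by (rule rate_lower_bound[OF p]) (rule that)
  have es: "\<epsilon> * total \<tau> \<le> Re (rate (p + shift j d) \<tau>)" for j \<tau>
    using order_trans[OF e(2) rate_shift_mono[OF d]] .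
  define C where "C q = exp (\<Sum>j\<in>UNIV. \<bar>Re (snd q $ j)\<bar> * ln 2) * exp (\<epsilon> * real (card W))" for q :: "('v, 'j) energy"
  have eb: "norm (exp (expo q (\<lambda>i. \<tau> i + s * d i))) \<le> C q * exp (- \<epsilon> * total \<tau>)"
    if "\<And>\<tau>. \<epsilon> * total \<tau> \<le> Re (rate q \<tau>)" "\<bar>s\<bar> \<le> 1" for q \<tau> s
  proof -
    have "norm (exp (expo q (\<lambda>i. \<tau> i + s * d i))) \<le> exp (\<Sum>j\<in>UNIV. \<bar>Re (snd q $ j)\<bar> * ln 2) * exp (- \<epsilon> * total (\<lambda>i. \<tau> i + s * d i))"
      by (rule norm_exp_expo_le[OF that(1)])
    also have "\<dots> \<le> exp (\<Sum>j\<in>UNIV. \<bar>Re (snd q $ j)\<bar> * ln 2) * (exp (\<epsilon> * real (card W)) * exp (- \<epsilon> * total \<tau>))"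
    proof (rule mult_left_mono)
      have "\<epsilon> * (total \<tau> - real (card W)) \<le> \<epsilon> * total (\<lambda>i. \<tau> i + s * d i)"
        using total_shift[OF d that(2)] e by (intro mult_left_mono) auto
      then show "exp (- \<epsilon> * total (\<lambda>i. \<tau> i + s * d i)) \<le> exp (\<epsilon> * real (card W)) * exp (- \<epsilon> * total \<tau>)"
        by (simp add: exp_add[symmetric] algebra_simps)
    qed simp
    finally show ?thesis by (simp add: C_def mult.assoc)
  qed
  define B where "B = norm (rate p d) * C p + (\<Sum>j\<in>UNIV. norm (2 * snd p $ j * of_real \<bar>gap j d\<bar>) * C (p + shift j d))"
  have GB: "norm (G \<tau> s) \<le> B * exp (- \<epsilon> * total \<tau>)" if "\<bar>s\<bar> \<le> 1" for \<tau> s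
  proof -
    have "norm (G \<tau> s) \<le> norm (- rate p d * ?f \<tau> s) +
        norm (\<Sum>j\<in>UNIV. 2 * snd p $ j * of_real \<bar>gap j d\<bar> * exp (expo (p + shift j d) (\<lambda>i. \<tau> i + s * d i)))"
      unfolding G_def by (rule norm_triangle_ineq)
    also have "\<dots> \<le> norm (rate p d) * (C p * exp (- \<epsilon> * total \<tau>)) +
       (\<Sum>j\<in>UNIV. norm (2 * snd p $ j * of_real \<bar>gap j d\<bar>) * (C (p + shift j d) * exp (- \<epsilon> * total \<tau>)))"
    proof (rule add_mono)
      show "norm (- rate p d * ?f \<tau> s) \<le> norm (rate p d) * (C p * exp (- \<epsilon> * total \<tau>))"
        using eb[OF e(2) that] by (simp add: norm_mult mult_left_mono)
      show "norm (\<Sum>j\<in>UNIV. 2 * snd p $ j * of_real \<bar>gap j d\<bar> * exp (expo (p + shift j d) (\<lambda>i. \<tau> i + s * d i))) \<le>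
         (\<Sum>j\<in>UNIV. norm (2 * snd p $ j * of_real \<bar>gap j d\<bar>) * (C (p + shift j d) * exp (- \<epsilon> * total \<tau>)))"
        using eb[OF es that] by (intro sum_norm_le) (subst norm_mult, intro mult_left_mono, auto)
    qed
    also have "\<dots> = B * exp (- \<epsilon> * total \<tau>)"
      by (simp add: B_def sum_distrib_left sum_distrib_right algebra_simps)
    finally show ?thesis .
  qed
  have der: "(?f \<tau> has_vector_derivative G \<tau> s) (at s)" for \<tau> s
    unfolding G_def by (rule expo_has_vector_derivative[OF d])
  \<comment> \<open>Step sizes in (0, 1], the range in which the translated integrand has a common
    exponential bound.\<close>
  let ?s = "\<lambda>n. 1 / real (Suc n)"
  let ?q = "\<lambda>n \<tau>. (?f \<tau> (?s n) - ?f \<tau> 0) / of_real (?s n)"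
  have lim: "(\<lambda>n. ?q n \<tau>) \<longlonglongrightarrow> G \<tau> 0" for \<tau>
  proof -
    have "((\<lambda>h. norm (?f \<tau> (0 + h) - ?f \<tau> 0 - h *\<^sub>R G \<tau> 0) / norm h) \<longlongrightarrow> 0) (at 0)"
      using der[of \<tau> 0] unfolding has_vector_derivative_def has_derivative_at by blast
    moreover have "filterlim ?s (at 0) sequentially"
      unfolding filterlim_at using LIMSEQ_inverse_real_of_nat by (auto simp: inverse_eq_divide)
    ultimately have "(\<lambda>n. norm (?f \<tau> (0 + ?s n) - ?f \<tau> 0 - ?s n *\<^sub>R G \<tau> 0) / norm (?s n)) \<longlonglongrightarrow> 0"
      by (rule filterlim_compose)
    moreover have "norm (?f \<tau> (0 + ?s n) - ?f \<tau> 0 - ?s n *\<^sub>R G \<tau> 0) / norm (?s n) = norm (?q n \<tau> - G \<tau> 0)" for n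
    proof -
      have "(x - y) / of_real s - z = (x - y - s *\<^sub>R z) / of_real s" if "s \<noteq> 0" for x y z :: complex and s
        using that by (simp add: scaleR_conv_of_real diff_divide_distrib)
      from this[of "?s n" "?f \<tau> (0 + ?s n)" "?f \<tau> 0" "G \<tau> 0"]
      have "?q n \<tau> - G \<tau> 0 = (?f \<tau> (0 + ?s n) - ?f \<tau> 0 - ?s n *\<^sub>R G \<tau> 0) / of_real (?s n)"
        by (simp only: add_0) simp
      then show ?thesis by (simp only: norm_divide norm_of_real real_norm_def)
    qed
    ultimately have "(\<lambda>n. norm (?q n \<tau> - G \<tau> 0)) \<longlonglongrightarrow> 0" by simp
    then show ?thesis using LIM_zero_cancel tendsto_norm_zero_iff by blast
  qed
  \<comment> \<open>The mean value inequality turns the bound on the derivative for parameters in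
    [0, 1] into a dominating function for all difference quotients.\<close>
  have qB: "norm (?q n \<tau>) \<le> B * exp (- \<epsilon> * total \<tau>)" for n \<tau>
  proof -
    have aux: "norm (x / of_real s) \<le> c" if "norm x \<le> c * norm (s - 0)" "s > 0" for x :: complex and c s :: real
      using that by (simp add: norm_divide pos_divide_le_eq)
    have bnd: "norm (?f \<tau> (?s n) - ?f \<tau> 0) \<le> B * exp (- \<epsilon> * total \<tau>) * norm (?s n - 0)"
    proof (rule differentiable_bound[of "{0..1}" "?f \<tau>" "\<lambda>s h. h *\<^sub>R G \<tau> s"])
      show "(?f \<tau> has_derivative (\<lambda>h. h *\<^sub>R G \<tau> s)) (at s within {0..1})" for s
        using der[of \<tau> s] unfolding has_vector_derivative_def by (rule has_derivative_at_withinI)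
      show "onorm (\<lambda>h. h *\<^sub>R G \<tau> s) \<le> B * exp (- \<epsilon> * total \<tau>)" if "s \<in> {0..1}" for s
        using GB[of s \<tau>] that by (intro onorm_le) (simp add: mult.commute mult_left_mono)
    qed (auto simp: field_simps)
    show ?thesis by (rule aux[OF bnd]) simp
  qed
  have qm: "?q n \<in> borel_measurable (lebP W)" for n by measurable
  have Gm: "(\<lambda>\<tau>. G \<tau> 0) \<in> borel_measurable (lebP W)" unfolding G_def by measurable
  have limG: "(\<lambda>n. \<integral>\<tau>. ?q n \<tau> \<partial>lebP W) \<longlonglongrightarrow> (\<integral>\<tau>. G \<tau> 0 \<partial>lebP W)"
  proof (rule integral_dominated_convergence[OF Gm qm])
    show "integrable (lebP W) (\<lambda>\<tau>. B * exp (- \<epsilon> * total \<tau>))" using integrable_exp_total[OF e(1)] by simp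
  qed (use lim qB in auto)
  have z: "(\<integral>\<tau>. ?q n \<tau> \<partial>lebP W) = 0" for n
  proof -
    have i0: "integrable (lebP W) (\<lambda>\<tau>. ?f \<tau> s)" if "\<bar>s\<bar> \<le> 1" for s
    proof (rule Bochner_Integration.integrable_bound)
      show "integrable (lebP W) (\<lambda>\<tau>. C p * exp (- \<epsilon> * total \<tau>))" using integrable_exp_total[OF e(1)] by simp
      show "AE \<tau> in lebP W. norm (?f \<tau> s) \<le> norm (C p * exp (- \<epsilon> * total \<tau>))"
        using eb[OF e(2) that] by (intro AE_I2) (simp add: C_def abs_mult)
    qed measurable
    have "(\<integral>\<tau>. ?q n \<tau> \<partial>lebP W) = ((\<integral>\<tau>. ?f \<tau> (?s n) \<partial>lebP W) - (\<integral>\<tau>. ?f \<tau> 0 \<partial>lebP W)) / of_real (?s n)"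
      using i0[of "?s n"] i0[of 0] by (subst integral_divide_zero) (subst Bochner_Integration.integral_diff, auto simp: field_simps)
    then show ?thesis unfolding ival_translate by simp
  qed
  have "(\<integral>\<tau>. G \<tau> 0 \<partial>lebP W) = 0" using LIMSEQ_unique[OF limG[unfolded z] tendsto_const] .
  moreover have "(\<integral>\<tau>. G \<tau> 0 \<partial>lebP W) = - rate p d * ival p +
      (\<Sum>j\<in>UNIV. 2 * snd p $ j * of_real \<bar>gap j d\<bar> * ival (p + shift j d))"
    unfolding G_def ival_def using integrable_Dom[OF p] integrable_Dom[OF Dom_shift[OF d p]]
    by simp
  ultimately show ?thesis by simp
qed

text \<open>If the integrand does not decay in some direction \<open>d\<close>, the cubes
  \<open>Q + n d\<close> all carry mass bounded below. They escape to infinity, so dominated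
  convergence makes these masses tend to 0, a contradiction.\<close>

lemma Dom_if_integrable:
  assumes int: "integrable (lebP W) (\<lambda>\<tau>. exp (expo p \<tau>))"
  shows "p \<in> Dom"
proof (rule ccontr)
  assume "p \<notin> Dom"
  then obtain d where d: "d \<in> dirs" "Re (rate p d) \<le> 0" unfolding Dom_def by force
  then obtain c T where cT: "d = dvec c T" "c = 1 \<or> c = -1" "T \<subseteq> W" "T \<noteq> {}" unfolding dirs_def by blast
  then obtain i0 where "i0 \<in> T" by blast
  with cT have i0: "i0 \<in> W" "\<bar>d i0\<bar> = 1" by (auto simp: dvec_def)
  have d1: "\<bar>d i\<bar> \<le> 1" for i using cT by (auto simp: dvec_def)
  define Q where "Q = (\<Pi>\<^sub>E i\<in>W. {-1..1::real})"
  have Qm [measurable]: "Q \<in> sets (lebP W)" unfolding Q_def by (intro sets_PiM_I_finite) auto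
  have Qe: "emeasure (lebP W) Q = ennreal (2 ^ card W)"
    unfolding Q_def by (subst lbP.emeasure_PiM) (auto simp: ennreal_power[symmetric])
  let ?h = "\<lambda>\<tau>. norm (exp (expo p \<tau>))"
  let ?tr = "\<lambda>a \<tau>. \<lambda>i\<in>W. \<tau> i + a * d i"
  \<comment> \<open>The integrand restricted to the cube translated by \<open>n * d\<close>.\<close>
  let ?u = "\<lambda>n \<tau>. indicator Q (?tr (- real n) \<tau>) * ?h \<tau>"
  have um: "?u n \<in> borel_measurable (lebP W)" for n
  proof -
    have "(\<lambda>\<tau>. indicator Q (?tr (- real n) \<tau>) :: real) \<in> borel_measurable (lebP W)"
      by (rule measurable_compose[OF measurable_lebP_translate]) measurable
    then show ?thesis by measurable
  qed
  have "(\<lambda>n. \<integral>\<tau>. ?u n \<tau> \<partial>lebP W) \<longlonglongrightarrow> (\<integral>\<tau>. 0 \<partial>lebP W)"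
  proof (rule integral_dominated_convergence[OF _ um])
    show "integrable (lebP W) ?h" using int by (rule integrable_norm)
    show "AE \<tau> in lebP W. (\<lambda>n. ?u n \<tau>) \<longlonglongrightarrow> 0"
    proof (rule AE_I2)
      fix \<tau>
      \<comment> \<open>The coordinate \<open>i0\<close> of the moving cube has speed 1, so a fixed
        \<tau> is left behind after finitely many steps.\<close>
      obtain m :: nat where m: "\<bar>\<tau> i0\<bar> + 1 < real m" using reals_Archimedean2 by blast
      have "?u n \<tau> = 0" if "m \<le> n" for n
      proof -
        have "\<bar>real n * d i0\<bar> = real n" using i0 by (simp add: abs_mult)
        then have "1 < \<bar>\<tau> i0 + - real n * d i0\<bar>"
          using m that abs_triangle_ineq2[of "real n * d i0" "\<tau> i0"] by (simp add: abs_minus_commute)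
        moreover have "\<tau> i0 + - real n * d i0 \<in> {-1..1}" if "?tr (- real n) \<tau> \<in> Q"
          using that i0(1) unfolding Q_def PiE_iff by (metis (no_types, lifting) restrict_apply')
        ultimately have "?tr (- real n) \<tau> \<notin> Q" by fastforce
        then show ?thesis by simp
      qed
      then show "(\<lambda>n. ?u n \<tau>) \<longlonglongrightarrow> 0"
        by (intro tendsto_eventually) (auto simp: eventually_sequentially)
    qed
    show "AE \<tau> in lebP W. norm (?u n \<tau>) \<le> ?h \<tau>" for n
      by (intro AE_I2) (simp add: indicator_def)
  qed simp
  then have to0: "(\<lambda>n. \<integral>\<tau>. ?u n \<tau> \<partial>lebP W) \<longlonglongrightarrow> 0" by simp
  define K where "K = (\<Sum>j\<in>UNIV. \<bar>Re (snd p $ j)\<bar> * (2 * real (card W))) + (\<Sum>i\<in>W. \<bar>Re (fst p $ i)\<bar>)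
     + (\<Sum>j\<in>UNIV. \<bar>Re (snd p $ j)\<bar> * ln 2)"
  \<comment> \<open>On the translated cube the rate differs from \<open>n * rate p d\<close> by a
    quantity bounded independently of \<open>n\<close>, and the latter term has nonpositive real
    part.\<close>
  have low: "exp (- K) \<le> ?h (\<lambda>i. \<tau> i + real n * d i)" if "\<tau> \<in> Q" for \<tau> n
  proof -
    have t1: "\<bar>\<tau> i\<bar> \<le> 1" if "i \<in> W" for i using \<open>\<tau> \<in> Q\<close> that by (auto simp: Q_def abs_le_iff PiE_iff)
    then have tt: "total \<tau> \<le> real (card W)" unfolding total_def using sum_mono[of W "\<lambda>i. \<bar>\<tau> i\<bar>" "\<lambda>_. 1"] by simp
    have "Re (rate p (\<lambda>i. \<tau> i + real n * d i)) - real n * Re (rate p d) =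
       (\<Sum>j\<in>UNIV. Re (snd p $ j) * (\<bar>gap j \<tau> + real n * gap j d\<bar> - real n * \<bar>gap j d\<bar>)) - (\<Sum>i\<in>W. Re (fst p $ i) * \<tau> i)"
      unfolding rate_def gap_add
      by (simp add: algebra_simps sum.distrib sum_subtractf sum_distrib_left)
    also have "\<dots> \<le> (\<Sum>j\<in>UNIV. \<bar>Re (snd p $ j)\<bar> * (2 * real (card W))) + (\<Sum>i\<in>W. \<bar>Re (fst p $ i)\<bar>)"
    proof -
      have "(\<Sum>j\<in>UNIV. Re (snd p $ j) * (\<bar>gap j \<tau> + real n * gap j d\<bar> - real n * \<bar>gap j d\<bar>)) \<le>
          (\<Sum>j\<in>UNIV. \<bar>Re (snd p $ j)\<bar> * (2 * real (card W)))"
      proof (rule sum_mono)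
        fix j
        have "\<bar>\<bar>gap j \<tau> + real n * gap j d\<bar> - real n * \<bar>gap j d\<bar>\<bar> \<le> \<bar>gap j \<tau>\<bar>"
          using abs_triangle_ineq3[of "gap j \<tau> + real n * gap j d" "real n * gap j d"] by (simp add: abs_mult)
        then have "\<bar>\<bar>gap j \<tau> + real n * gap j d\<bar> - real n * \<bar>gap j d\<bar>\<bar> \<le> 2 * real (card W)"
          using abs_gap_le[of j \<tau>] tt by linarith
        then have "\<bar>Re (snd p $ j) * (\<bar>gap j \<tau> + real n * gap j d\<bar> - real n * \<bar>gap j d\<bar>)\<bar> \<le> \<bar>Re (snd p $ j)\<bar> * (2 * real (card W))"
          unfolding abs_mult by (intro mult_left_mono) auto
        then show "Re (snd p $ j) * (\<bar>gap j \<tau> + real n * gap j d\<bar> - real n * \<bar>gap j d\<bar>) \<le> \<bar>Re (snd p $ j)\<bar> * (2 * real (card W))"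
          by (rule order_trans[OF abs_ge_self])
      qed
      moreover have "(\<Sum>i\<in>W. - (Re (fst p $ i) * \<tau> i)) \<le> (\<Sum>i\<in>W. \<bar>Re (fst p $ i)\<bar>)"
      proof (rule sum_mono)
        fix i assume "i \<in> W"
        then have "\<bar>Re (fst p $ i)\<bar> * \<bar>\<tau> i\<bar> \<le> \<bar>Re (fst p $ i)\<bar> * 1" by (intro mult_left_mono t1) auto
        then show "- (Re (fst p $ i) * \<tau> i) \<le> \<bar>Re (fst p $ i)\<bar>"
          using abs_ge_minus_self[of "Re (fst p $ i) * \<tau> i"] by (simp add: abs_mult)
      qed
      ultimately show ?thesis by (simp add: sum_negf)
    qed
    finally have "Re (rate p (\<lambda>i. \<tau> i + real n * d i)) \<le> real n * Re (rate p d) + ((\<Sum>j\<in>UNIV. \<bar>Re (snd p $ j)\<bar> * (2 * real (card W))) + (\<Sum>i\<in>W. \<bar>Re (fst p $ i)\<bar>))" by linarith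
    moreover have "real n * Re (rate p d) \<le> 0" using d by (simp add: mult_nonneg_nonpos)
    ultimately have "- K \<le> Re (expo p (\<lambda>i. \<tau> i + real n * d i))"
      using Re_expo_bounds(2)[of p "\<lambda>i. \<tau> i + real n * d i"] unfolding K_def by linarith
    then show ?thesis by simp
  qed
  have "exp (- K) * 2 ^ card W \<le> (\<integral>\<tau>. ?u n \<tau> \<partial>lebP W)" for n
  proof -
    have ui: "integrable (lebP W) (?u n)"
      by (rule Bochner_Integration.integrable_bound[OF integrable_norm[OF int] um]) (simp add: indicator_def)
    have eq: "(\<integral>\<tau>. ?u n (\<lambda>i\<in>W. \<tau> i + real n * d i) \<partial>lebP W) = (\<integral>\<tau>. ?u n \<tau> \<partial>lebP W)"
      by (rule integral_lebP_translate[OF _ um]) simp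
    have ui': "integrable (lebP W) (\<lambda>\<tau>. ?u n (\<lambda>i\<in>W. \<tau> i + real n * d i))"
      by (rule integrable_distr[OF measurable_lebP_translate]) (subst distr_lebP_translate, simp, rule ui)
    have "exp (- K) * 2 ^ card W = (\<integral>\<tau>. exp (- K) * indicator Q \<tau> \<partial>lebP W)"
      using Qe by (simp add: measure_def)
    also have "\<dots> \<le> (\<integral>\<tau>. ?u n (\<lambda>i\<in>W. \<tau> i + real n * d i) \<partial>lebP W)"
    proof (rule integral_mono[OF _ ui'])
      show "integrable (lebP W) (\<lambda>\<tau>. exp (- K) * indicator Q \<tau>)"
        using Qe by (intro integrable_mult_right integrable_real_indicator) auto
      fix \<tau> assume t: "\<tau> \<in> space (lebP W)"
      have "?tr (- real n) (\<lambda>i\<in>W. \<tau> i + real n * d i) = \<tau>"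
        using t by (auto simp: space_PiM PiE_def extensional_def fun_eq_iff)
      moreover have "expo p (\<lambda>i\<in>W. \<tau> i + real n * d i) = expo p (\<lambda>i. \<tau> i + real n * d i)"
        by (rule expo_cong) simp
      ultimately show "exp (- K) * indicator Q \<tau> \<le> ?u n (\<lambda>i\<in>W. \<tau> i + real n * d i)"
        using low[of \<tau> n] by (simp add: indicator_def)
    qed
    finally show ?thesis unfolding eq .
  qed
  then have "exp (- K) * 2 ^ card W \<le> 0"
    using LIMSEQ_le_const[OF to0] by blast
  moreover have "0 < exp (- K) * 2 ^ card W" by simp
  ultimately show False by linarith
qed

lemma integrable_iff_Dom: "integrable (lebP W) (\<lambda>\<tau>. exp (expo p \<tau>)) \<longleftrightarrow> p \<in> Dom"
  using integrable_Dom Dom_if_integrable by blast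


subsection \<open>Meromorphic continuation\<close>

text \<open>The bound for direction \<open>d\<close> is relaxed \<open>n d\<close> times by 2, and
  the induction is on the total number of relaxations. To relax direction \<open>d0\<close>, solve
  \<open>rate_identity\<close> for the integral: the shifted energies on the other side satisfy the
  stronger bounds of the induction hypothesis.\<close>

lemma continuation_step:
  "\<lbrakk>(\<Sum>d\<in>dirs. n d) = m\<rbrakk> \<Longrightarrow> \<exists>g h. holomorphic_within UNIV h \<and> (\<forall>p\<in>Dom. h p \<noteq> 0) \<and>
     holomorphic_within {p. \<forall>d\<in>dirs. - 2 * real (n d) < Re (rate p d)} g \<and> (\<forall>p\<in>Dom. g p = h p * ival p)"
proof (induction m arbitrary: n)
  case 0
  then have n0: "n d = 0" if "d \<in> dirs" for d using finite_dirs that by simp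
  have "{p. \<forall>d\<in>dirs. - 2 * real (n d) < Re (rate p d)} = Dom" using n0 by (auto simp: Dom_def)
  then show ?case using holomorphic_ival holomorphic_within_const[of UNIV 1] by (intro exI[of _ ival] exI[of _ "\<lambda>_. 1"]) simp
next
  case (Suc m)
  then have "(\<Sum>d\<in>dirs. n d) \<noteq> 0" by simp
  then obtain d0 where d0: "d0 \<in> dirs" "n d0 \<noteq> 0" by (meson sum.neutral)
  define n' where "n' = n(d0 := n d0 - 1)"
  have "(\<Sum>d\<in>dirs. n' d) = m"
    using Suc.prems d0 finite_dirs by (simp add: n'_def sum.remove[of dirs d0])
  from Suc.IH[OF this] obtain g h where gh: "holomorphic_within UNIV h" "\<And>p. p \<in> Dom \<Longrightarrow> h p \<noteq> 0"
    "holomorphic_within {p. \<forall>d\<in>dirs. - 2 * real (n' d) < Re (rate p d)} g" "\<And>p. p \<in> Dom \<Longrightarrow> g p = h p * ival p" by blast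
  \<comment> \<open>Only these edges gain 2 under the shift; all other terms of
    \<open>rate_identity\<close> have coefficient 0.\<close>
  define J where "J = {j. gap j d0 \<noteq> 0}"
  have fJ: "finite J" by simp
  let ?S = "{p. \<forall>d\<in>dirs. - 2 * real (n d) < Re (rate p d)}"
  let ?h = "\<lambda>p. rate p d0 * (\<Prod>j\<in>J. h (p + shift j d0))"
  \<comment> \<open>The sum of fractions brought to the common denominator \<open>?h\<close>; the
    factor omitted from the product is the denominator of the summand itself.\<close>
  let ?g = "\<lambda>p. \<Sum>j\<in>J. 2 * snd p $ j * of_real \<bar>gap j d0\<bar> * (g (p + shift j d0) * (\<Prod>i\<in>J - {j}. h (p + shift i d0)))"
  have cid: "cmap (\<lambda>p. p)" by (simp add: cmap_def)
  have hs: "holomorphic_within A (\<lambda>p. h (p + shift j d0))" for A j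
    using holomorphic_within_affine[OF gh(1) cid, of A "shift j d0"] by (simp add: add.commute)
  have gs: "holomorphic_within ?S (\<lambda>p. g (p + shift j d0))" if "j \<in> J" for j
  proof -
    have "p + shift j d0 \<in> {p. \<forall>d\<in>dirs. - 2 * real (n' d) < Re (rate p d)}" if "p \<in> ?S" for p
    proof (rule CollectI, rule ballI)
      fix d assume dd: "d \<in> dirs"
      have *: "- 2 * real (n d) < Re (rate p d)" using that dd by blast
      show "- 2 * real (n' d) < Re (rate (p + shift j d0) d)"
      proof (cases "d = d0")
        case True
        then show ?thesis using rate_shift_gain[OF d0(1), of j p] \<open>j \<in> J\<close> * d0(2) by (simp add: J_def n'_def of_nat_diff)
      next
        case False
        then show ?thesis using rate_shift_mono[OF d0(1), of p d j] * by (simp add: n'_def)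
      qed
    qed
    then show ?thesis
      using holomorphic_within_affine[OF gh(3) cid, of ?S "shift j d0"] by (simp add: add.commute)
  qed
  show ?case
  proof (rule exI[of _ ?g], rule exI[of _ ?h], intro conjI ballI)
    show "holomorphic_within UNIV ?h"
      by (intro holomorphic_within_mult holomorphic_within_cform[OF cform_rate] holomorphic_within_prod hs)
    show "holomorphic_within ?S ?g"
      by (intro holomorphic_within_sum holomorphic_within_mult holomorphic_within_const holomorphic_within_cform[OF cform_snd] gs hs holomorphic_within_prod)
    fix p assume p: "p \<in> Dom"
    have ps: "p + shift j d0 \<in> Dom" for j by (rule Dom_shift[OF d0(1) p])
    have "rate p d0 \<noteq> 0" using p d0 unfolding Dom_def by force
    then show "?h p \<noteq> 0" using gh(2)[OF ps] by simp
    have "?g p = (\<Sum>j\<in>J. 2 * snd p $ j * of_real \<bar>gap j d0\<bar> * (ival (p + shift j d0) * (\<Prod>i\<in>J. h (p + shift i d0))))"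
    proof (rule sum.cong)
      fix j assume "j \<in> J"
      then have "(\<Prod>i\<in>J. h (p + shift i d0)) = h (p + shift j d0) * (\<Prod>i\<in>J - {j}. h (p + shift i d0))"
        by (rule prod.remove[OF fJ])
      then show "2 * snd p $ j * of_real \<bar>gap j d0\<bar> * (g (p + shift j d0) * (\<Prod>i\<in>J - {j}. h (p + shift i d0))) =
        2 * snd p $ j * of_real \<bar>gap j d0\<bar> * (ival (p + shift j d0) * (\<Prod>i\<in>J. h (p + shift i d0)))"
        using gh(4)[OF ps, of j] by (simp add: mult_ac)
    qed simp
    also have "\<dots> = (\<Sum>j\<in>J. 2 * snd p $ j * of_real \<bar>gap j d0\<bar> * ival (p + shift j d0)) * (\<Prod>i\<in>J. h (p + shift i d0))"
      by (simp add: sum_distrib_right mult.assoc)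
    also have "(\<Sum>j\<in>J. 2 * snd p $ j * of_real \<bar>gap j d0\<bar> * ival (p + shift j d0)) = rate p d0 * ival p"
      unfolding rate_identity[OF p d0(1)] by (rule sum.mono_neutral_left) (auto simp: J_def)
    finally show "?g p = ?h p * ival p" by (simp add: mult_ac)
  qed
qed

text \<open>A fraction that continues the integral from \<open>Dom\<close> to a larger region.
  Convexity of the region makes any two such fractions comparable on their common domain, which is
  again convex and contains \<open>Dom\<close>.\<close>

definition adm where
  "adm \<Omega> g h \<longleftrightarrow> open \<Omega> \<and> convex \<Omega> \<and> Dom \<subseteq> \<Omega> \<and> holomorphic_within \<Omega> g \<and> holomorphic_within UNIV h \<and>
     (\<forall>p\<in>Dom. h p \<noteq> 0 \<and> g p = h p * ival p)"

lemma adm_exists: "\<exists>\<Omega> g h. adm \<Omega> g h \<and> p \<in> \<Omega>"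
proof -
  \<comment> \<open>Large enough for the relaxed bounds to include the given point
    \<open>p\<close>.\<close>
  define n where "n d = nat \<lceil>\<bar>Re (rate p d)\<bar>\<rceil> + 1" for d
  let ?\<Omega> = "{p. \<forall>d\<in>dirs. - 2 * real (n d) < Re (rate p d)}"
  obtain g h where gh: "holomorphic_within UNIV h" "\<forall>p\<in>Dom. h p \<noteq> 0" "holomorphic_within ?\<Omega> g" "\<forall>p\<in>Dom. g p = h p * ival p"
    using continuation_step[of n, OF refl] by blast
  have "- 2 * real (n d) < Re (rate p d)" for d
  proof -
    have "\<bar>Re (rate p d)\<bar> < real (n d)" unfolding n_def by linarith
    then show ?thesis by linarith
  qed
  then have "p \<in> ?\<Omega>" by blast
  moreover have "Dom \<subseteq> ?\<Omega>"
  proof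
    fix q assume q: "q \<in> Dom"
    have "- 2 * real (n d) < Re (rate q d)" if "d \<in> dirs" for d
      using q that unfolding Dom_def by (auto intro: le_less_trans[of _ 0])
    then show "q \<in> ?\<Omega>" by blast
  qed
  ultimately have "adm ?\<Omega> g h \<and> p \<in> ?\<Omega>"
    unfolding adm_def using gh by (intro conjI open_Dom_gen convex_Dom_gen ballI) auto
  then show ?thesis by blast
qed

lemma adm_unique:
  assumes "Dom \<noteq> {}" "adm \<Omega> g h" "adm \<Omega>' g' h'" "q \<in> \<Omega>" "q \<in> \<Omega>'"
  shows "g q * h' q = g' q * h q"
proof -
  obtain p where p: "p \<in> Dom" using assms(1) by blast
  have a: "open \<Omega>" "convex \<Omega>" "Dom \<subseteq> \<Omega>" "holomorphic_within \<Omega> g" "holomorphic_within UNIV h"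
      "\<And>p. p \<in> Dom \<Longrightarrow> g p = h p * ival p"
    "open \<Omega>'" "convex \<Omega>'" "Dom \<subseteq> \<Omega>'" "holomorphic_within \<Omega>' g'" "holomorphic_within UNIV h'"
      "\<And>p. p \<in> Dom \<Longrightarrow> g' p = h' p * ival p"
    using assms unfolding adm_def by auto
  have "holomorphic_within (UNIV \<inter> (\<Omega> \<inter> \<Omega>')) (\<lambda>q. g q * h' q - g' q * h q)"
    by (intro holomorphic_within_diff holomorphic_within_mult)
      (rule holomorphic_within_subset[OF a(4)] holomorphic_within_subset[OF a(11)]
        holomorphic_within_subset[OF a(10)] holomorphic_within_subset[OF a(5)]; blast)+
  then have "g q * h' q - g' q * h q = 0"
    by (rule holomorphic_within_identity[OF csubspace_UNIV open_Int[OF a(1,7)] convex_Int[OF a(2,8)] _ _ open_Dom p])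
      (use p a(3,9) assms(4,5) in \<open>auto simp: a(6,12) simp del: split_paired_All\<close>)
  then show ?thesis by simp
qed

text \<open>Glues all admissible fractions into one function. By \<open>adm_unique\<close> the value
  does not depend on the fraction; where every denominator vanishes it is arbitrary.\<close>

definition cval :: "('v, 'j) energy \<Rightarrow> complex" where
  "cval q = (THE v. \<exists>\<Omega> g h. adm \<Omega> g h \<and> q \<in> \<Omega> \<and> h q \<noteq> 0 \<and> v = g q / h q)"

lemma cval_eq:
  assumes "Dom \<noteq> {}" "adm \<Omega> g h" "q \<in> \<Omega>" "h q \<noteq> 0"
  shows "cval q = g q / h q"
  unfolding cval_def
proof (rule the_equality)
  show "\<exists>\<Omega>' g' h'. adm \<Omega>' g' h' \<and> q \<in> \<Omega>' \<and> h' q \<noteq> 0 \<and> g q / h q = g' q / h' q" using assms by blast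
  fix v assume "\<exists>\<Omega> g h. adm \<Omega> g h \<and> q \<in> \<Omega> \<and> h q \<noteq> 0 \<and> v = g q / h q"
  then obtain \<Omega>' g' h' where *: "adm \<Omega>' g' h'" "q \<in> \<Omega>'" "h' q \<noteq> 0" "v = g' q / h' q" by blast
  then show "v = g q / h q" using adm_unique[OF assms(1,2) *(1) assms(3) *(2)] assms(4) by (simp add: frac_eq_eq)
qed

lemma cval_Dom: assumes "q \<in> Dom" shows "cval q = ival q"
proof -
  have "adm Dom ival (\<lambda>_. 1)"
    unfolding adm_def using open_Dom convex_Dom holomorphic_ival holomorphic_within_const by simp
  then show ?thesis using cval_eq[of Dom ival "\<lambda>_. 1" q] assms by auto
qed

text \<open>After composition with \<iota> a denominator could vanish identically on the subspace. A
  single point of the subspace that is mapped into \<open>Dom\<close> excludes this, since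
  denominators have no zeros there. The lemma is applied both to the energy space and to the
  hyperplane.\<close>

lemma frac_rep_pullback:
  assumes \<iota>: "cmap \<iota>" and E: "csubspace E" and p: "p \<in> E" "\<iota> p \<in> Dom" and a: "adm \<Omega> g h"
  shows "frac_rep E (\<lambda>q. cval (\<iota> q)) (\<iota> -` \<Omega>) (\<lambda>q. g (\<iota> q)) (\<lambda>q. h (\<iota> q))"
    "open (\<iota> -` \<Omega>)" "nondegenerate_on (E \<inter> \<iota> -` \<Omega>) (\<lambda>q. h (\<iota> q))"
    "holomorphic_within (\<iota> -` \<Omega>) (\<lambda>q. g (\<iota> q))" "holomorphic_within A (\<lambda>q. h (\<iota> q))"
proof -
  have a': "open \<Omega>" "convex \<Omega>" "Dom \<subseteq> \<Omega>" "holomorphic_within \<Omega> g" "holomorphic_within UNIV h" "h (\<iota> p) \<noteq> 0"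
    using a p unfolding adm_def by auto
  show o: "open (\<iota> -` \<Omega>)" by (rule open_vimage[OF a'(1) cmap_continuous[OF \<iota>]])
  have c: "convex (\<iota> -` \<Omega>)"
    using \<iota> a'(2) by (intro convex_linear_vimage) (auto simp: cmap_def bounded_linear.linear)
  show hg: "holomorphic_within (\<iota> -` \<Omega>) (\<lambda>q. g (\<iota> q))"
    by (rule holomorphic_within_cmap[OF a'(4) \<iota>]) simp
  show hh: "holomorphic_within A (\<lambda>q. h (\<iota> q))" for A
    by (rule holomorphic_within_cmap[OF a'(5) \<iota>]) simp
  show n: "nondegenerate_on (E \<inter> \<iota> -` \<Omega>) (\<lambda>q. h (\<iota> q))"
    by (rule nondegenerate_on_convex[OF E o c hh, of p]) (use p a' in auto)
  have "Dom \<noteq> {}" using p by blast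
  then have "cval (\<iota> q) = g (\<iota> q) / h (\<iota> q)" if "q \<in> E \<inter> \<iota> -` \<Omega>" "h (\<iota> q) \<noteq> 0" for q
    using cval_eq[OF _ a] that by simp
  moreover have "holomorphic_within (E \<inter> \<iota> -` \<Omega>) (\<lambda>q. g (\<iota> q))"
    by (rule holomorphic_within_subset[OF hg]) simp
  ultimately show "frac_rep E (\<lambda>q. cval (\<iota> q)) (\<iota> -` \<Omega>) (\<lambda>q. g (\<iota> q)) (\<lambda>q. h (\<iota> q))"
    unfolding frac_rep_def using hh n by blast
qed

lemma meromorphic_pullback:
  assumes "cmap \<iota>" "csubspace E" "p \<in> E" "\<iota> p \<in> Dom"
  shows "meromorphic_within E (\<lambda>q. cval (\<iota> q))"
  unfolding meromorphic_within_frac_rep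
proof
  fix q assume "q \<in> E"
  obtain \<Omega> g h where "adm \<Omega> g h" "\<iota> q \<in> \<Omega>" using adm_exists by blast
  then show "\<exists>U g h. open U \<and> q \<in> U \<and> frac_rep E (\<lambda>q. cval (\<iota> q)) U g h"
    using frac_rep_pullback[OF assms] by (meson vimageI2)
qed

text \<open>The same numerator and denominator represent the function on \<open>E\<close> and on
  \<open>H\<close>, because the point mapped into \<open>Dom\<close> lies in both.\<close>

lemma is_restriction_pullback:
  assumes \<iota>: "cmap \<iota>" and E: "csubspace E" "csubspace H" "H \<subseteq> E" and p: "p \<in> H" "\<iota> p \<in> Dom"
  shows "is_restriction E H (\<lambda>q. cval (\<iota> q)) (\<lambda>q. cval (\<iota> q))"
  unfolding is_restriction_def
proof
  fix q assume "q \<in> H"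
  obtain \<Omega> g h where a: "adm \<Omega> g h" and q: "\<iota> q \<in> \<Omega>" using adm_exists by blast
  have pE: "p \<in> E" using p E by blast
  note r = frac_rep_pullback[OF \<iota> E(1) pE p(2) a] and rH = frac_rep_pullback[OF \<iota> E(2) p a]
  show "\<exists>U k l. open U \<and> q \<in> U \<and> holomorphic_within (E \<inter> U) k \<and> holomorphic_within (E \<inter> U) l \<and> nondegenerate_on (H \<inter> U) l \<and>
     (\<forall>q\<in>E \<inter> U - H. l q \<noteq> 0 \<longrightarrow> cval (\<iota> q) = k q / l q) \<and> (\<forall>q\<in>H \<inter> U. l q \<noteq> 0 \<longrightarrow> cval (\<iota> q) = k q / l q)"
  proof (rule exI[of _ "\<iota> -` \<Omega>"], rule exI[of _ "\<lambda>q. g (\<iota> q)"], rule exI[of _ "\<lambda>q. h (\<iota> q)"], intro conjI ballI impI)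
    show "open (\<iota> -` \<Omega>)" "q \<in> \<iota> -` \<Omega>" "nondegenerate_on (H \<inter> \<iota> -` \<Omega>) (\<lambda>q. h (\<iota> q))"
      using r q rH by auto
    show "holomorphic_within (E \<inter> \<iota> -` \<Omega>) (\<lambda>q. g (\<iota> q))" "holomorphic_within (E \<inter> \<iota> -` \<Omega>) (\<lambda>q. h (\<iota> q))"
      using r(1) unfolding frac_rep_def by auto
    show "cval (\<iota> q) = g (\<iota> q) / h (\<iota> q)" if "q \<in> E \<inter> \<iota> -` \<Omega> - H" "h (\<iota> q) \<noteq> 0" for q
      using r(1) that unfolding frac_rep_def by blast
    show "cval (\<iota> q) = g (\<iota> q) / h (\<iota> q)" if "q \<in> H \<inter> \<iota> -` \<Omega>" "h (\<iota> q) \<noteq> 0" for q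
      using rH(1) that unfolding frac_rep_def by blast
  qed
qed

end

section \<open>Components of a graph\<close>

lemma connected_union:
  assumes "Digraph_Component.connected H1" "Digraph_Component.connected H2" "compatible H1 H2"
    and "w \<in> verts H1" "w \<in> verts H2"
  shows "Digraph_Component.connected (union H1 H2)"
proof -
  let ?U = "union H1 H2"
  let ?R = "\<lambda>G. rtrancl_on (verts G) ((arcs_ends G)\<^sup>s)"
  have sub: "arcs_ends H1 \<subseteq> arcs_ends ?U" "arcs_ends H2 \<subseteq> arcs_ends ?U"
    using assms(3) by (auto simp: arcs_ends_conv compatible_def)
  have sc: "(arcs_ends H)\<^sup>s \<subseteq> (arcs_ends ?U)\<^sup>s" if "arcs_ends H \<subseteq> arcs_ends ?U" for H
    using that by (auto simp: symcl_def)
  have mono: "?R H \<subseteq> ?R ?U" if "arcs_ends H \<subseteq> arcs_ends ?U" "verts H \<subseteq> verts ?U" for H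
  proof (rule subrelI)
    fix u v assume "(u, v) \<in> ?R H"
    then show "(u, v) \<in> ?R ?U" by (rule rtrancl_on_mono[OF sc[OF that(1)] that(2)])
  qed
  have m: "?R H1 \<subseteq> ?R ?U" "?R H2 \<subseteq> ?R ?U"
    using mono[OF sub(1)] mono[OF sub(2)] by simp_all
  have r1: "(u, w) \<in> ?R H1 \<and> (w, u) \<in> ?R H1" if "u \<in> verts H1" for u
    using assms(1,4) that unfolding connected_conv by blast
  have r2: "(u, w) \<in> ?R H2 \<and> (w, u) \<in> ?R H2" if "u \<in> verts H2" for u
    using assms(2,5) that unfolding connected_conv by blast
  have to: "(u, w) \<in> ?R ?U" "(w, u) \<in> ?R ?U" if "u \<in> verts ?U" for u
  proof -
    have "u \<in> verts H1 \<or> u \<in> verts H2" using that by simp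
    then show "(u, w) \<in> ?R ?U" "(w, u) \<in> ?R ?U" using r1 r2 m by blast+
  qed
  show ?thesis
    unfolding connected_conv
  proof (intro conjI ballI)
    show "verts ?U \<noteq> {}" using assms(4) by auto
    fix u v assume "u \<in> verts ?U" "v \<in> verts ?U"
    then show "(u, v) \<in> ?R ?U" using to by (meson rtrancl_on_trans)
  qed
qed

lemma connected_pair:
  assumes "e \<in> arcs B" "V = {tail B e, head B e}"
  shows "Digraph_Component.connected (B \<restriction> V)"
  unfolding connected_conv
proof (intro conjI ballI)
  fix u v assume "u \<in> verts (B \<restriction> V)" "v \<in> verts (B \<restriction> V)"
  then have uv: "u \<in> V" "v \<in> V" by auto
  have "e \<in> arcs (B \<restriction> V)" using assms by auto
  then have "(tail B e, head B e) \<in> arcs_ends (B \<restriction> V)" by (force simp: arcs_ends_conv)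
  then have *: "(tail B e, head B e) \<in> (arcs_ends (B \<restriction> V))\<^sup>s" "(head B e, tail B e) \<in> (arcs_ends (B \<restriction> V))\<^sup>s"
    by (auto simp: symcl_def)
  show "(u, v) \<in> rtrancl_on (verts (B \<restriction> V)) ((arcs_ends (B \<restriction> V))\<^sup>s)"
  proof (cases "u = v")
    case False
    then have "(u, v) \<in> (arcs_ends (B \<restriction> V))\<^sup>s" using uv assms(2) * by auto
    then show ?thesis
      using rtrancl_on_into_rtrancl_on[OF rtrancl_on_refl] uv by (metis induce_subgraph_verts)
  qed (use uv in simp)
qed (use assms in auto)

lemma connected_singleton: "Digraph_Component.connected (B \<restriction> {w})"
  by (auto simp: connected_conv)

locale component_graph = fin_digraph B for B :: "('v, 'e) pre_digraph"
begin

lemma component_props: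
  assumes "K \<in> graph_components B"
  shows "subgraph K B" "Digraph_Component.connected K" "verts K \<subseteq> verts B" "arcs K \<subseteq> arcs B" "wf_digraph K"
    "tail K = tail B" "head K = head B" "verts K \<noteq> {}" "finite (verts K)" "finite (arcs K)"
proof -
  have k: "max_subgraph Digraph_Component.connected K" using assms by (simp add: graph_components_def)
  show s: "subgraph K B" and c: "Digraph_Component.connected K"
    using subgraphI_max_subgraph[OF k] max_subgraph_prop[OF k] by auto
  then show "verts K \<subseteq> verts B" "arcs K \<subseteq> arcs B" "wf_digraph K"
    "tail K = tail B" "head K = head B" "verts K \<noteq> {}"
    by (auto simp: subgraph_def compatible_def connected_conv)
  then show "finite (verts K)" "finite (arcs K)" using finite_verts finite_arcs finite_subset by blast+
qed

text \<open>The union with \<open>K\<close> is connected through the common vertex \<open>w\<close>,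
  so maximality of \<open>K\<close> leaves no room for anything new.\<close>

lemma component_absorbs:
  assumes K: "K \<in> graph_components B" and H: "subgraph H B" "Digraph_Component.connected H"
    and w: "w \<in> verts K" "w \<in> verts H"
  shows "verts H \<subseteq> verts K" "arcs H \<subseteq> arcs K"
proof -
  note k = component_props[OF K]
  have comp: "compatible K H" using k(6,7) H(1) by (auto simp: subgraph_def compatible_def)
  let ?U = "union K H"
  have "subgraph ?U B"
    using k(1) H(1) by (intro subgraph_union) (auto simp: subgraph_def compatible_def)
  moreover have "Digraph_Component.connected ?U" using connected_union[OF k(2) H(2) comp w] .
  moreover have "subgraph K ?U"
    using subgraphs_of_union(1)[OF k(5) _ comp] H(1) by (auto simp: subgraph_def)
  ultimately have "?U = K"
    using K unfolding graph_components_def max_subgraph_def by blast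
  then have "verts K = verts K \<union> verts H" "arcs K = arcs K \<union> arcs H" by (metis verts_union, metis arcs_union)
  then show "verts H \<subseteq> verts K" "arcs H \<subseteq> arcs K" by blast+
qed

lemma subgraph_eqI:
  assumes "subgraph H H'" "verts H = verts H'" "arcs H = arcs H'"
  shows "H = H'"
  using assms by (intro pre_digraph.equality) (auto simp: subgraph_def compatible_def)

lemma component_disjoint:
  assumes "K \<in> graph_components B" "K' \<in> graph_components B" "w \<in> verts K" "w \<in> verts K'"
  shows "K = K'"
proof -
  note k = component_props[OF assms(1)] and k' = component_props[OF assms(2)]
  have "verts K = verts K'" "arcs K = arcs K'"
    using component_absorbs[OF assms(1) k'(1,2) assms(3,4)] component_absorbs[OF assms(2) k(1,2) assms(4,3)] by auto
  then show ?thesis using k k' by (intro pre_digraph.equality) auto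
qed

lemma component_exists:
  assumes w: "w \<in> verts B"
  shows "\<exists>K\<in>graph_components B. w \<in> verts K"
proof -
  let ?P = "\<lambda>H. subgraph H B \<and> Digraph_Component.connected H \<and> w \<in> verts H"
  let ?m = "\<lambda>H. card (verts H) + card (arcs H)"
  have "?P (B \<restriction> {w})"
    using w connected_singleton induced_induce[of "{w}"] by (auto dest: induced_imp_subgraph)
  moreover have bound: "?m H < Suc (card (verts B) + card (arcs B))" if "?P H" for H
  proof -
    have "card (verts H) \<le> card (verts B)" "card (arcs H) \<le> card (arcs B)"
      using that by (auto simp: subgraph_def intro!: card_mono)
    then show ?thesis by simp
  qed
  \<comment> \<open>A subgraph with the largest number of vertices and arcs together is maximal for
    inclusion, since a proper extension on the same vertices has more arcs.\<close>
  ultimately obtain K where K: "?P K" "\<And>H. ?P H \<Longrightarrow> ?m H \<le> ?m K"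
    using ex_has_greatest_nat[of ?P "B \<restriction> {w}" ?m "Suc (card (verts B) + card (arcs B))"] by blast
  have "max_subgraph Digraph_Component.connected K"
    unfolding max_subgraph_def
  proof (intro conjI allI impI notI)
    fix H assume H: "H \<noteq> K \<and> subgraph K H" "subgraph H B \<and> Digraph_Component.connected H"
    then have sub: "verts K \<subseteq> verts H" "arcs K \<subseteq> arcs H" "verts H \<subseteq> verts B" "arcs H \<subseteq> arcs B" by (auto simp: subgraph_def)
    then have fin: "finite (verts H)" "finite (arcs H)" using finite_verts finite_arcs finite_subset by blast+
    have "?P H" using H K sub by blast
    then have "?m H \<le> ?m K" using K by blast
    moreover have "card (verts K) \<le> card (verts H)" "card (arcs K) \<le> card (arcs H)"
      using sub fin by (auto intro: card_mono)
    ultimately have "card (verts K) = card (verts H)" "card (arcs K) = card (arcs H)" by linarith+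
    then have "verts K = verts H" "arcs K = arcs H" using card_subset_eq sub fin by metis+
    then show False using H subgraph_eqI by blast
  qed (use K in auto)
  then show ?thesis using K by (auto simp: graph_components_def)
qed

lemma component_arc:
  assumes K: "K \<in> graph_components B" and e: "e \<in> arcs B" "tail B e \<in> verts K \<or> head B e \<in> verts K"
  shows "e \<in> arcs K"
proof -
  let ?V = "{tail B e, head B e}"
  let ?H = "B \<restriction> ?V"
  have "subgraph ?H B" using e(1) wellformed by (intro induced_imp_subgraph induced_induce) auto
  moreover have "Digraph_Component.connected ?H" using connected_pair[OF e(1) refl] .
  moreover have "e \<in> arcs ?H" using e(1) by simp
  ultimately show ?thesis using component_absorbs(2)[OF K, of ?H] e(2) by auto
qed

lemma component_arcs_eq:
  assumes K: "K \<in> graph_components B"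
  shows "arcs K = {e \<in> arcs B. tail B e \<in> verts K}" "arcs K = {e \<in> arcs B. head B e \<in> verts K}"
proof -
  note k = component_props[OF K]
  have "tail B e \<in> verts K" "head B e \<in> verts K" if "e \<in> arcs K" for e
    using wf_digraph.wellformed[OF k(5) that] k(6,7) by auto
  then show "arcs K = {e \<in> arcs B. tail B e \<in> verts K}" "arcs K = {e \<in> arcs B. head B e \<in> verts K}"
    using component_arc[OF K] k(4) by blast+
qed

lemma Union_component_verts: "(\<Union>K\<in>graph_components B. verts K) = verts B"
  using component_props(3) component_exists by blast

lemma finite_graph_components: "finite (graph_components B)"
proof -
  have "inj_on verts (graph_components B)"
  proof (rule inj_onI)
    fix K K' assume *: "K \<in> graph_components B" "K' \<in> graph_components B" "verts K = verts K'"
    obtain w where "w \<in> verts K" using component_props(8)[OF *(1)] by blast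
    then show "K = K'" using component_disjoint[OF *(1,2)] * by auto
  qed
  moreover have "verts ` graph_components B \<subseteq> Pow (verts B)" using component_props(3) by blast
  then have "finite (verts ` graph_components B)"
    by (rule finite_subset) (simp add: finite_verts)
  ultimately show ?thesis by (rule finite_imageD[rotated])
qed

lemma sum_components:
  "(\<Sum>v\<in>verts B. f v) = (\<Sum>K\<in>graph_components B. \<Sum>v\<in>verts K. f v)"
  "(\<Sum>e\<in>arcs B. g e) = (\<Sum>K\<in>graph_components B. \<Sum>e\<in>arcs K. g e)"
proof -
  have "(\<Sum>v\<in>\<Union>(verts ` graph_components B). f v) = (\<Sum>K\<in>graph_components B. \<Sum>v\<in>verts K. f v)"
    using finite_graph_components component_props(9) component_disjoint
    by (intro sum.UNION_disjoint) blast+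
  then show "(\<Sum>v\<in>verts B. f v) = (\<Sum>K\<in>graph_components B. \<Sum>v\<in>verts K. f v)"
    using Union_component_verts by simp
  have "arcs B = \<Union>(arcs ` graph_components B)"
    using component_exists component_arc component_props(4) tail_in_verts by blast
  moreover have "arcs K \<inter> arcs K' = {}" if "K \<in> graph_components B" "K' \<in> graph_components B" "K \<noteq> K'" for K K'
    using component_arcs_eq(1)[OF that(1)] component_arcs_eq(1)[OF that(2)] component_disjoint[OF that(1,2)] that(3) by blast
  then have "(\<Sum>e\<in>\<Union>(arcs ` graph_components B). g e) = (\<Sum>K\<in>graph_components B. \<Sum>e\<in>arcs K. g e)"
    using finite_graph_components component_props(10) by (intro sum.UNION_disjoint) blast+
  ultimately show "(\<Sum>e\<in>arcs B. g e) = (\<Sum>K\<in>graph_components B. \<Sum>e\<in>arcs K. g e)" by simp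
qed

end

text \<open>A discrete Poincare inequality: along a walk from \<open>a\<close> to \<open>v\<close>
  each step changes \<sigma> by at most the total variation, so the number of steps is an admissible
  constant.\<close>

lemma connected_variation_bound:
  assumes conn: "Digraph_Component.connected H" and fin: "finite (verts H)" "finite (arcs H)" and a: "a \<in> verts H"
  obtains c where "0 \<le> c" "\<And>\<sigma> v. v \<in> verts H \<Longrightarrow>
    \<bar>\<sigma> v - \<sigma> a\<bar> \<le> c * (\<Sum>e\<in>arcs H. \<bar>\<sigma> (tail H e) - (\<sigma> (head H e) :: real)\<bar>)"
proof -
  let ?s = "\<lambda>\<sigma>. \<Sum>e\<in>arcs H. \<bar>\<sigma> (tail H e) - (\<sigma> (head H e) :: real)\<bar>"
  have s0: "0 \<le> ?s \<sigma>" for \<sigma> by (intro sum_nonneg) auto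
  have "\<exists>n::nat. \<forall>\<sigma>. \<bar>\<sigma> v - \<sigma> a\<bar> \<le> real n * ?s \<sigma>" if "v \<in> verts H" for v
  proof -
    have "(a, v) \<in> rtrancl_on (verts H) ((arcs_ends H)\<^sup>s)" using conn a that unfolding connected_conv by blast
    then show ?thesis
    proof (induction rule: rtrancl_on_induct)
      case base
      then show ?case by (intro exI[of _ 0]) simp
    next
      case (step y z)
      then obtain n where n: "\<bar>\<sigma> y - \<sigma> a\<bar> \<le> real n * ?s \<sigma>" for \<sigma> by blast
      obtain e where e: "e \<in> arcs H" "(y, z) = (tail H e, head H e) \<or> (z, y) = (tail H e, head H e)"
        using step(2) by (auto simp: symcl_def arcs_ends_conv)
      have "\<bar>\<sigma> z - \<sigma> a\<bar> \<le> real (Suc n) * ?s \<sigma>" for \<sigma>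
      proof -
        have "\<bar>\<sigma> (tail H e) - \<sigma> (head H e)\<bar> \<le> ?s \<sigma>"
          using fin(2) e(1) by (intro member_le_sum) auto
        moreover have "\<bar>\<sigma> (tail H e) - \<sigma> (head H e)\<bar> = \<bar>\<sigma> z - \<sigma> y\<bar>" using e(2) by auto
        ultimately have "\<bar>\<sigma> z - \<sigma> a\<bar> \<le> real n * ?s \<sigma> + ?s \<sigma>" using n[of \<sigma>] by linarith
        then show ?thesis by (simp add: algebra_simps)
      qed
      then show ?case by blast
    qed
  qed
  then obtain n where n: "\<And>v \<sigma>. v \<in> verts H \<Longrightarrow> \<bar>\<sigma> v - \<sigma> a\<bar> \<le> real (n v :: nat) * ?s \<sigma>" by metis
  \<comment> \<open>The sum dominates the constant of every single vertex.\<close>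
  define c where "c = (\<Sum>v\<in>verts H. real (n v))"
  show ?thesis
  proof (rule that[of c])
    show "0 \<le> c" unfolding c_def by (intro sum_nonneg) auto
    fix \<sigma> v assume v: "v \<in> verts H"
    have "real (n v) \<le> c" unfolding c_def using v fin(1) by (intro member_le_sum) auto
    then have "real (n v) * ?s \<sigma> \<le> c * ?s \<sigma>" using s0 by (intro mult_right_mono)
    then show "\<bar>\<sigma> v - \<sigma> a\<bar> \<le> c * ?s \<sigma>" using n[OF v, of \<sigma>] by linarith
  qed
qed

section \<open>Fubini for blocks and shears\<close>

text \<open>The last two hypotheses say that \<open>f\<close> and \<open>g\<close> read only the
  coordinates of their own block, so on merged points the product separates and Fubini's theorem
  applies.\<close>

lemma lebP_two_blocks:
  fixes f g :: "('i \<Rightarrow> real) \<Rightarrow> complex"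
  assumes AB: "A \<inter> B = {}" "finite A" "finite B"
    and f: "integrable (lebP A) f" and g: "integrable (lebP B) g"
    and df: "\<And>\<tau>. f (restrict \<tau> A) = f \<tau>" and dg: "\<And>\<tau>. g (restrict \<tau> B) = g \<tau>"
  shows "integrable (lebP (A \<union> B)) (\<lambda>\<tau>. f \<tau> * g \<tau>)"
    "(\<integral>\<tau>. f \<tau> * g \<tau> \<partial>lebP (A \<union> B)) = (\<integral>\<tau>. f \<tau> \<partial>lebP A) * (\<integral>\<tau>. g \<tau> \<partial>lebP B)"
proof -
  interpret A: sigma_finite_measure "lebP A" by (rule lbP.sigma_finite[OF AB(2)])
  interpret B: sigma_finite_measure "lebP B" by (rule lbP.sigma_finite[OF AB(3)])
  interpret P: pair_sigma_finite "lebP A" "lebP B" ..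
  have [measurable]: "f \<in> borel_measurable (lebP A)" "g \<in> borel_measurable (lebP B)"
    using f g by auto
  have mf: "f (merge A B (x, y)) = f x" "g (merge A B (x, y)) = g y"
    if "x \<in> space (lebP A)" "y \<in> space (lebP B)" for x y
  proof -
    have "restrict (merge A B (x, y)) A = x" "restrict (merge A B (x, y)) B = y"
      using that AB(1) by (auto simp: space_PiM merge_def PiE_def extensional_def fun_eq_iff)
    then show "f (merge A B (x, y)) = f x" "g (merge A B (x, y)) = g y" by (metis df, metis dg)
  qed
  have fm: "f \<in> borel_measurable (lebP (A \<union> B))" "g \<in> borel_measurable (lebP (A \<union> B))"
  proof -
    have "(\<lambda>\<tau>. f (restrict \<tau> A)) \<in> borel_measurable (lebP (A \<union> B))"
      by (rule measurable_compose[OF measurable_restrict_subset]) auto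
    then show "f \<in> borel_measurable (lebP (A \<union> B))" using df by simp
    have "(\<lambda>\<tau>. g (restrict \<tau> B)) \<in> borel_measurable (lebP (A \<union> B))"
      by (rule measurable_compose[OF measurable_restrict_subset]) auto
    then show "g \<in> borel_measurable (lebP (A \<union> B))" using dg by simp
  qed
  have int_pair: "integrable (lebP A \<Otimes>\<^sub>M lebP B) (\<lambda>(x, y). f x * g y)"
  proof (rule P.Fubini_integrable)
    show "integrable (lebP A) (\<lambda>x. \<integral>y. norm (case (x, y) of (x, y) \<Rightarrow> f x * g y) \<partial>lebP B)"
      using f by (simp add: norm_mult)
    show "AE x in lebP A. integrable (lebP B) (\<lambda>y. case (x, y) of (x, y) \<Rightarrow> f x * g y)"
      using g by simp
  qed measurable
  have "integrable (lebP A \<Otimes>\<^sub>M lebP B) (\<lambda>z. f (merge A B z) * g (merge A B z))"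
    using int_pair
    by (rule Bochner_Integration.integrable_cong[THEN iffD1, rotated 2]) (auto simp: space_pair_measure mf)
  then have "integrable (distr (lebP A \<Otimes>\<^sub>M lebP B) (lebP (A \<union> B)) (merge A B)) (\<lambda>\<tau>. f \<tau> * g \<tau>)"
    using fm by (subst integrable_distr_eq) auto
  then show int: "integrable (lebP (A \<union> B)) (\<lambda>\<tau>. f \<tau> * g \<tau>)"
    by (simp only: lbP.distr_merge[OF AB])
  have "(\<integral>\<tau>. f \<tau> * g \<tau> \<partial>lebP (A \<union> B)) = (\<integral>x. (\<integral>y. f (merge A B (x, y)) * g (merge A B (x, y)) \<partial>lebP B) \<partial>lebP A)"
    by (rule lbP.product_integral_fold[OF AB int])
  also have "\<dots> = (\<integral>x. (\<integral>y. f x * g y \<partial>lebP B) \<partial>lebP A)"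
    by (intro Bochner_Integration.integral_cong refl) (simp add: mf)
  also have "\<dots> = (\<integral>\<tau>. f \<tau> \<partial>lebP A) * (\<integral>\<tau>. g \<tau> \<partial>lebP B)" by simp
  finally show "(\<integral>\<tau>. f \<tau> * g \<tau> \<partial>lebP (A \<union> B)) = (\<integral>\<tau>. f \<tau> \<partial>lebP A) * (\<integral>\<tau>. g \<tau> \<partial>lebP B)" .
qed

lemma lebP_blocks:
  fixes f :: "'k \<Rightarrow> ('i \<Rightarrow> real) \<Rightarrow> complex"
  assumes "finite I" "\<And>k. k \<in> I \<Longrightarrow> finite (A k)" "\<And>k. k \<in> I \<Longrightarrow> integrable (lebP (A k)) (f k)"
    and "\<And>k \<tau>. k \<in> I \<Longrightarrow> f k (restrict \<tau> (A k)) = f k \<tau>"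
    and "\<And>k l. k \<in> I \<Longrightarrow> l \<in> I \<Longrightarrow> k \<noteq> l \<Longrightarrow> A k \<inter> A l = {}"
  shows "integrable (lebP (\<Union>k\<in>I. A k)) (\<lambda>\<tau>. \<Prod>k\<in>I. f k \<tau>) \<and>
    (\<integral>\<tau>. (\<Prod>k\<in>I. f k \<tau>) \<partial>lebP (\<Union>k\<in>I. A k)) = (\<Prod>k\<in>I. \<integral>\<tau>. f k \<tau> \<partial>lebP (A k))"
  using assms
proof (induction I)
  case empty
  have "finite_measure (lebP ({} :: 'i set))" by (rule finite_measureI) (simp add: PiM_empty)
  then show ?case by (simp add: PiM_empty lebesgue_integral_count_space_finite integrable_count_space)
next
  case (insert k I)
  let ?B = "\<Union>k\<in>I. A k"
  have IH: "integrable (lebP ?B) (\<lambda>\<tau>. \<Prod>k\<in>I. f k \<tau>)"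
    "(\<integral>\<tau>. (\<Prod>k\<in>I. f k \<tau>) \<partial>lebP ?B) = (\<Prod>k\<in>I. \<integral>\<tau>. f k \<tau> \<partial>lebP (A k))"
    using insert by auto
  have disj: "A k \<inter> ?B = {}" using insert.prems(4)[of k] insert.hyps by blast
  have dep: "(\<Prod>k\<in>I. f k (restrict \<tau> ?B)) = (\<Prod>k\<in>I. f k \<tau>)" for \<tau>
  proof (rule prod.cong)
    fix l assume l: "l \<in> I"
    have "restrict (restrict \<tau> ?B) (A l) = restrict \<tau> (A l)" using l by (auto simp: fun_eq_iff)
    then show "f l (restrict \<tau> ?B) = f l \<tau>" using insert.prems(3)[of l] l by (metis insertCI)
  qed simp
  have k: "finite (A k)" "finite ?B" "integrable (lebP (A k)) (f k)"
    using insert by auto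
  have k4: "f k (restrict \<tau> (A k)) = f k \<tau>" for \<tau> by (rule insert.prems(3)) simp
  from lebP_two_blocks[OF disj k(1,2,3) IH(1) k4 dep] show ?case
    using insert.hyps IH(2) by simp
qed

text \<open>Coordinates adapted to a common translation of the vertices in \<open>S\<close>: the position of \<open>a\<close>
  and the positions relative to \<open>a\<close>.\<close>

definition shear :: "'i set \<Rightarrow> 'i set \<Rightarrow> 'i \<Rightarrow> real \<times> ('i \<Rightarrow> real) \<Rightarrow> 'i \<Rightarrow> real" where
  "shear V S a = (\<lambda>(s, \<rho>). \<lambda>v\<in>V. if v = a then s else if v \<in> S then \<rho> v + s else \<rho> v)"

lemma measurable_shear [measurable]:
  "shear V S a \<in> measurable (lborel \<Otimes>\<^sub>M lebP (V - {a})) (lebP V)"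
proof -
  have "(\<lambda>z. \<lambda>v\<in>V. if v = a then fst z else if v \<in> S then snd z v + fst z else snd z v)
      \<in> measurable (lborel \<Otimes>\<^sub>M lebP (V - {a})) (lebP V)"
  proof (rule measurable_restrict)
    fix v assume v: "v \<in> V"
    have m1: "(\<lambda>z. fst z) \<in> borel_measurable (lborel \<Otimes>\<^sub>M lebP (V - {a}))"
      using measurable_fst[of "lborel :: real measure" "lebP (V - {a})"] by simp
    have "(\<lambda>z. if v = a then fst z else if v \<in> S then snd z v + fst z else snd z v)
       \<in> borel_measurable (lborel \<Otimes>\<^sub>M lebP (V - {a}))"
    proof (cases "v = a")
      case False
      have "(\<lambda>z. snd z v) \<in> measurable (lborel \<Otimes>\<^sub>M lebP (V - {a})) lborel"
        using v False by (intro measurable_compose[OF measurable_snd measurable_component_singleton]) auto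
      then have m2: "(\<lambda>z. snd z v) \<in> borel_measurable (lborel \<Otimes>\<^sub>M lebP (V - {a}))" by simp
      show ?thesis using False m1 m2 borel_measurable_add[OF m2 m1] by (cases "v \<in> S") simp_all
    qed (use m1 in simp)
    then show "(\<lambda>z. if v = a then fst z else if v \<in> S then snd z v + fst z else snd z v)
       \<in> measurable (lborel \<Otimes>\<^sub>M lebP (V - {a})) lborel" by simp
  qed
  then show ?thesis by (simp add: shear_def case_prod_unfold)
qed

text \<open>For a fixed position of \<open>a\<close> the map is a translation of the other
  coordinates, which preserves Lebesgue measure.\<close>

lemma distr_shear:
  assumes V: "finite V" "a \<in> V"
  shows "distr (lborel \<Otimes>\<^sub>M lebP (V - {a})) (lebP V) (shear V S a) = lebP V"
proof (rule measure_eqI)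
  interpret Q: sigma_finite_measure "lebP (V - {a})" by (rule lbP.sigma_finite) (use V in auto)
  have Va: "insert a (V - {a}) = V" using V by auto
  fix A assume "A \<in> sets (distr (lborel \<Otimes>\<^sub>M lebP (V - {a})) (lebP V) (shear V S a))"
  then have A [measurable]: "A \<in> sets (lebP V)" by simp
  have cm: "(\<lambda>\<rho>. shear V S a (s, \<rho>)) \<in> measurable (lebP (V - {a})) (lebP V)"
    "(\<lambda>\<rho>. shear V {} a (s, \<rho>)) \<in> measurable (lebP (V - {a})) (lebP V)" for s
    by (rule measurable_compose[OF _ measurable_shear], simp)+
  have "emeasure (distr (lborel \<Otimes>\<^sub>M lebP (V - {a})) (lebP V) (shear V S a)) A =
      (\<integral>\<^sup>+z. indicator A (shear V S a z) \<partial>(lborel \<Otimes>\<^sub>M lebP (V - {a})))"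
    by (subst nn_integral_indicator[symmetric], simp, subst nn_integral_distr) auto
  also have "\<dots> = (\<integral>\<^sup>+s. \<integral>\<^sup>+\<rho>. indicator A (shear V S a (s, \<rho>)) \<partial>lebP (V - {a}) \<partial>lborel)"
    by (rule Q.nn_integral_fst[symmetric]) measurable
  \<comment> \<open>Translation invariance for fixed \<open>s\<close> removes the displacement of
    \<open>S\<close>; a shear with empty \<open>S\<close> merely inserts the coordinate
    \<open>a\<close>.\<close>
  also have "\<dots> = (\<integral>\<^sup>+s. \<integral>\<^sup>+\<rho>. indicator A (shear V {} a (s, \<rho>)) \<partial>lebP (V - {a}) \<partial>lborel)"
  proof (rule nn_integral_cong)
    fix s :: real
    let ?t = "\<lambda>i. if i \<in> S then s else 0"
    have m: "(\<lambda>\<rho>. indicator A (shear V {} a (s, \<rho>)) :: ennreal) \<in> borel_measurable (lebP (V - {a}))"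
      by (rule measurable_compose[OF cm(2)[of s] borel_measurable_indicator[OF A]])
    have eq: "shear V {} a (s, \<lambda>i\<in>V - {a}. \<rho> i + ?t i) = shear V S a (s, \<rho>)" for \<rho>
      by (auto simp: shear_def fun_eq_iff)
    have "(\<integral>\<^sup>+\<rho>. indicator A (shear V {} a (s, \<rho>)) \<partial>lebP (V - {a})) =
       (\<integral>\<^sup>+\<rho>. indicator A (shear V {} a (s, \<rho>)) \<partial>distr (lebP (V - {a})) (lebP (V - {a})) (\<lambda>\<rho>. \<lambda>i\<in>V - {a}. \<rho> i + ?t i))"
      using V by (subst distr_lebP_translate) auto
    also have "\<dots> = (\<integral>\<^sup>+\<rho>. indicator A (shear V {} a (s, \<lambda>i\<in>V - {a}. \<rho> i + ?t i)) \<partial>lebP (V - {a}))"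
      by (rule nn_integral_distr[OF measurable_lebP_translate]) (simp add: m)
    finally show "(\<integral>\<^sup>+\<rho>. indicator A (shear V S a (s, \<rho>)) \<partial>lebP (V - {a})) =
        (\<integral>\<^sup>+\<rho>. indicator A (shear V {} a (s, \<rho>)) \<partial>lebP (V - {a}))"
      unfolding eq by simp
  qed
  also have "\<dots> = (\<integral>\<^sup>+s. \<integral>\<^sup>+\<rho>. indicator A (\<rho>(a := s)) \<partial>lebP (V - {a}) \<partial>lborel)"
  proof (intro nn_integral_cong)
    fix s \<rho> assume "\<rho> \<in> space (lebP (V - {a}))"
    then have "shear V {} a (s, \<rho>) = \<rho>(a := s)"
      using V by (auto simp: shear_def fun_eq_iff space_PiM PiE_def extensional_def)
    then show "indicator A (shear V {} a (s, \<rho>)) = (indicator A (\<rho>(a := s)) :: ennreal)" by simp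
  qed
  also have "\<dots> = (\<integral>\<^sup>+\<tau>. indicator A \<tau> \<partial>lebP V)"
    using lbP.product_nn_integral_insert_rev[of "V - {a}" a "indicator A"] V unfolding Va by simp
  also have "\<dots> = emeasure (lebP V) A" by simp
  finally show "emeasure (distr (lborel \<Otimes>\<^sub>M lebP (V - {a})) (lebP V) (shear V S a)) A = emeasure (lebP V) A" .
qed simp

lemma integral_shear:
  fixes f :: "('i \<Rightarrow> real) \<Rightarrow> complex"
  assumes V: "finite V" "a \<in> V" and [measurable]: "f \<in> borel_measurable (lebP V)"
  shows "integrable (lborel \<Otimes>\<^sub>M lebP (V - {a})) (\<lambda>z. f (shear V S a z)) \<longleftrightarrow> integrable (lebP V) f"
    "integral\<^sup>L (lborel \<Otimes>\<^sub>M lebP (V - {a})) (\<lambda>z. f (shear V S a z)) = integral\<^sup>L (lebP V) f"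
proof -
  show "integrable (lborel \<Otimes>\<^sub>M lebP (V - {a})) (\<lambda>z. f (shear V S a z)) \<longleftrightarrow> integrable (lebP V) f"
    using integrable_distr_eq[OF measurable_shear[of V S a], of f] unfolding distr_shear[OF V] by simp
  show "integral\<^sup>L (lborel \<Otimes>\<^sub>M lebP (V - {a})) (\<lambda>z. f (shear V S a z)) = integral\<^sup>L (lebP V) f"
    using integral_distr[OF measurable_shear[of V S a], of f] unfolding distr_shear[OF V] by simp
qed

lemma integral_shear_iterated:
  fixes f :: "('i \<Rightarrow> real) \<Rightarrow> complex"
  assumes V: "finite V" "a \<in> V" and f: "integrable (lebP V) f"
  shows "(\<integral>s. (\<integral>\<rho>. f (shear V S a (s, \<rho>)) \<partial>lebP (V - {a})) \<partial>lborel) = integral\<^sup>L (lebP V) f"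
    "(\<integral>\<rho>. (\<integral>s. f (shear V S a (s, \<rho>)) \<partial>lborel) \<partial>lebP (V - {a})) = integral\<^sup>L (lebP V) f"
proof -
  interpret Q: sigma_finite_measure "lebP (V - {a})" by (rule lbP.sigma_finite) (use V in auto)
  interpret P: pair_sigma_finite "lborel :: real measure" "lebP (V - {a})" ..
  have fm: "f \<in> borel_measurable (lebP V)" using f by auto
  have int: "integrable (lborel \<Otimes>\<^sub>M lebP (V - {a})) (\<lambda>z. f (shear V S a z))"
    using integral_shear(1)[OF V fm] f by simp
  show "(\<integral>s. (\<integral>\<rho>. f (shear V S a (s, \<rho>)) \<partial>lebP (V - {a})) \<partial>lborel) = integral\<^sup>L (lebP V) f"
    using P.integral_fst'[OF int] integral_shear(2)[OF V fm] by simp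
  show "(\<integral>\<rho>. (\<integral>s. f (shear V S a (s, \<rho>)) \<partial>lborel) \<partial>lebP (V - {a})) = integral\<^sup>L (lebP V) f"
    using P.integral_snd[of "\<lambda>s \<rho>. f (shear V S a (s, \<rho>))"] int integral_shear(2)[OF V fm]
    by (simp add: case_prod_unfold)
qed


section \<open>An Abelian limit\<close>

lemma integral_exp_abs:
  assumes "(\<alpha>::real) > 0"
  shows "(\<integral>x. exp (- \<alpha> * \<bar>x\<bar>) \<partial>lborel) = 2 / \<alpha>"
proof -
  note h = integral_exp_half_line[OF assms]
  have 2: "integrable lborel (\<lambda>x. indicator {0..} (- x) * exp (\<alpha> * x))"
    using lborel_integrable_real_affine[OF h(1), of "-1" 0] by simp
  have "(\<integral>x. indicator {0..} (- x) * exp (\<alpha> * x) \<partial>lborel) = 1 / \<alpha>"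
    using lborel_integral_real_affine[of "-1" "\<lambda>x. indicator {0..} x * exp (- \<alpha> * x)" 0] h(2) by simp
  moreover have "(\<integral>x. exp (- \<alpha> * \<bar>x\<bar>) \<partial>lborel) =
      (\<integral>x. indicator {0..} x * exp (- \<alpha> * x) + indicator {0..} (- x) * exp (\<alpha> * x) \<partial>lborel)"
  proof (rule integral_cong_AE)
    show "AE x in lborel. exp (- \<alpha> * \<bar>x\<bar>) = indicator {0..} x * exp (- \<alpha> * x) + indicator {0..} (- x) * exp (\<alpha> * x)"
      using AE_lborel_singleton[of 0] by eventually_elim (auto simp: indicator_def)
  qed measurable
  ultimately show ?thesis using h 2 by simp
qed

lemma scaled_ln_two_cosh_tendsto:
  fixes r :: real
  shows "((\<lambda>k. ln (2 * cosh (k * r)) / k) \<longlongrightarrow> \<bar>r\<bar>) at_top"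
proof (rule tendsto_sandwich)
  have pos: "\<forall>\<^sub>F k in at_top. k > (0::real)" by (rule eventually_gt_at_top)
  show "\<forall>\<^sub>F k in at_top. \<bar>r\<bar> \<le> ln (2 * cosh (k * r)) / k"
    using pos by eventually_elim (use ln_two_cosh_bounds(1) in \<open>simp add: pos_le_divide_eq abs_mult mult.commute\<close>, metis abs_mult abs_of_pos ln_two_cosh_bounds(1) mult.commute)
  show "\<forall>\<^sub>F k in at_top. ln (2 * cosh (k * r)) / k \<le> \<bar>r\<bar> + ln 2 / k"
    using pos
  proof eventually_elim
    case (elim k)
    have "ln (2 * cosh (k * r)) \<le> k * \<bar>r\<bar> + ln 2"
      using ln_two_cosh_bounds(2)[of "k * r"] elim by (simp add: abs_mult)
    then have "ln (2 * cosh (k * r)) / k \<le> (k * \<bar>r\<bar> + ln 2) / k" using elim by (intro divide_right_mono) auto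
    then show ?case using elim by (simp add: add_divide_distrib)
  qed
  show "((\<lambda>k. \<bar>r\<bar>) \<longlongrightarrow> \<bar>r\<bar>) at_top" by simp
  have "((\<lambda>k. ln 2 / k :: real) \<longlongrightarrow> 0) at_top"
    by (rule tendsto_divide_0[OF tendsto_const]) (simp add: filterlim_at_top_imp_at_infinity filterlim_ident)
  then show "((\<lambda>k. \<bar>r\<bar> + ln 2 / k) \<longlongrightarrow> \<bar>r\<bar>) at_top"
    using tendsto_add[OF tendsto_const] by fastforce
qed

text \<open>Substitute s = k r with k = 1 / t. Then t ln (2 cosh s) tends to |r| and \<Psi> s to
  \<open>L\<close> at both ends, with dominating function \<open>B * exp (- \<alpha> * |r|)\<close>;
  the integral of exp (- \<alpha> |r|) over the line is 2 / \<alpha>.\<close>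

lemma abelian_limit:
  fixes \<Psi> :: "real \<Rightarrow> complex"
  assumes \<alpha>: "\<alpha> > 0" and [measurable]: "\<Psi> \<in> borel_measurable borel" and B: "\<And>s. norm (\<Psi> s) \<le> B"
    and even: "\<And>s. \<Psi> (- s) = \<Psi> s" and lim: "(\<Psi> \<longlongrightarrow> L) at_top"
  shows "((\<lambda>t. of_real t * (\<integral>s. of_real (exp (- (\<alpha> * t * ln (2 * cosh s)))) * \<Psi> s \<partial>lborel)) \<longlongrightarrow> of_real (2 / \<alpha>) * L) (at_right 0)"
proof -
  have [measurable]: "(\<lambda>x. ln (2 * cosh x)) \<in> borel_measurable (borel :: real measure)"
    by (intro borel_measurable_continuous_onI continuous_intros) auto
  let ?f = "\<lambda>k r. of_real (exp (- (\<alpha> * (ln (2 * cosh (k * r)) / k)))) * \<Psi> (k * r)"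
  have "((\<lambda>k. \<integral>r. ?f k r \<partial>lborel) \<longlongrightarrow> (\<integral>r. of_real (exp (- (\<alpha> * \<bar>r\<bar>))) * L \<partial>lborel)) at_top"
  proof (rule integral_dominated_convergence_at_top[where w = "\<lambda>r. B * exp (- \<alpha> * \<bar>r\<bar>)"])
    show "integrable lborel (\<lambda>r. B * exp (- \<alpha> * \<bar>r\<bar>))" using integrable_exp_abs[OF \<alpha>] by simp
    show "AE r in lborel. ((\<lambda>k. ?f k r) \<longlongrightarrow> of_real (exp (- (\<alpha> * \<bar>r\<bar>))) * L) at_top"
      using AE_lborel_singleton[of 0]
    proof eventually_elim
      case (elim r)
      have "filterlim (\<lambda>k. k * \<bar>r\<bar>) at_top at_top"
        using elim by (intro filterlim_at_top_mult_tendsto_pos[OF tendsto_const]) (auto simp: filterlim_ident)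
      then have "((\<lambda>k. \<Psi> (k * \<bar>r\<bar>)) \<longlongrightarrow> L) at_top" by (rule filterlim_compose[OF lim])
      moreover have "\<Psi> (k * \<bar>r\<bar>) = \<Psi> (k * r)" for k using even[of "k * r"] by (auto simp: abs_if)
      ultimately have "((\<lambda>k. \<Psi> (k * r)) \<longlongrightarrow> L) at_top" by simp
      then show ?case by (intro tendsto_intros scaled_ln_two_cosh_tendsto)
    qed
    show "\<forall>\<^sub>F k in at_top. AE r in lborel. norm (?f k r) \<le> B * exp (- \<alpha> * \<bar>r\<bar>)"
      using eventually_gt_at_top[of 0]
    proof eventually_elim
      case (elim k)
      show ?case
      proof (rule AE_I2)
        fix r
        have "\<bar>k * r\<bar> \<le> ln (2 * cosh (k * r))" by (rule ln_two_cosh_bounds)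
        then have "\<bar>r\<bar> \<le> ln (2 * cosh (k * r)) / k" using elim by (simp add: pos_le_divide_eq abs_mult mult.commute)
        then have "exp (- (\<alpha> * (ln (2 * cosh (k * r)) / k))) \<le> exp (- \<alpha> * \<bar>r\<bar>)"
          using mult_left_mono[of "\<bar>r\<bar>" "ln (2 * cosh (k * r)) / k" \<alpha>] \<alpha> by simp
        then have "exp (- (\<alpha> * (ln (2 * cosh (k * r)) / k))) * norm (\<Psi> (k * r)) \<le> exp (- \<alpha> * \<bar>r\<bar>) * B"
          by (intro mult_mono B) auto
        then show "norm (?f k r) \<le> B * exp (- \<alpha> * \<bar>r\<bar>)" by (simp add: norm_mult mult.commute)
      qed
    qed
  qed measurable
  moreover have "(\<integral>r. of_real (exp (- (\<alpha> * \<bar>r\<bar>))) * L \<partial>lborel) = of_real (2 / \<alpha>) * L"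
    using integral_exp_abs[OF \<alpha>] integrable_exp_abs[OF \<alpha>]
    by (subst integral_mult_left_zero) simp
  moreover have "\<forall>\<^sub>F k in at_top. (\<integral>r. ?f k r \<partial>lborel) =
      of_real (inverse k) * (\<integral>s. of_real (exp (- (\<alpha> * inverse k * ln (2 * cosh s)))) * \<Psi> s \<partial>lborel)"
    using eventually_gt_at_top[of 0]
  proof eventually_elim
    case (elim k)
    then show ?case
      using lborel_integral_real_affine[of k "\<lambda>s. of_real (exp (- (\<alpha> * inverse k * ln (2 * cosh s)))) * \<Psi> s" 0]
      by (simp add: scaleR_conv_of_real field_simps)
  qed
  ultimately have "((\<lambda>k. of_real (inverse k) * (\<integral>s. of_real (exp (- (\<alpha> * inverse k * ln (2 * cosh s)))) * \<Psi> s \<partial>lborel)) \<longlongrightarrow> of_real (2 / \<alpha>) * L) at_top"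
    using Lim_transform_eventually by fastforce
  then show ?thesis unfolding filterlim_at_right_to_top .
qed

section \<open>The graph integrals as exponential integrals\<close>

text \<open>The factors of the integrand are indexed by vertices and arcs together: an index
  \<open>Inl v\<close> is an edge from \<open>v\<close> to the ground vertex, an index
  \<open>Inr e\<close> the arc itself.\<close>

definition gsrc :: "('v, 'e) pre_digraph \<Rightarrow> 'v + 'e \<Rightarrow> 'v option" where
  "gsrc G j = (case j of Inl v \<Rightarrow> Some v | Inr e \<Rightarrow> Some (tail G e))"

definition gtgt :: "('v, 'e) pre_digraph \<Rightarrow> 'v + 'e \<Rightarrow> 'v option" where
  "gtgt G j = (case j of Inl v \<Rightarrow> None | Inr e \<Rightarrow> Some (head G e))"

text \<open>Translates energies into those of \<open>diff_integral\<close>: \<open>c\<close>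
  supplies the linear terms of the exponent, \<open>Vs\<close> and \<open>Es\<close> select the cosh
  factors. Weight 0 switches a factor off, so all integrals share one index type.\<close>

definition weights :: "real \<Rightarrow> 'v set \<Rightarrow> 'e set \<Rightarrow> ('v \<Rightarrow> ('v, 'e) energy \<Rightarrow> complex) \<Rightarrow>
    ('v::finite, 'e::finite) energy \<Rightarrow> ('v, 'v + 'e) energy" where
  "weights \<alpha> Vs Es c p = ((\<chi> v. of_real \<alpha> * c v p),
     (\<chi> j. case j of Inl v \<Rightarrow> if v \<in> Vs then of_real \<alpha> * fst p $ v else 0
                   | Inr e \<Rightarrow> if e \<in> Es then of_real \<alpha> * snd p $ e else 0))"

lemma cmap_weights: "(\<And>v. cform (c v)) \<Longrightarrow> cmap (weights \<alpha> Vs Es c)"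
proof (rule cmapI)
  assume c: "\<And>v. cform (c v)"
  show "cform (\<lambda>p. fst (weights \<alpha> Vs Es c p) $ v)" for v
    unfolding weights_def by (simp add: cform_cmult c)
  show "cform (\<lambda>p. snd (weights \<alpha> Vs Es c p) $ j)" for j
  proof (cases j)
    case (Inl v)
    then show ?thesis unfolding weights_def by (cases "v \<in> Vs") (simp_all add: cform_cmult cform_fst cform_zero)
  next
    case (Inr e)
    then show ?thesis unfolding weights_def by (cases "e \<in> Es") (simp_all add: cform_cmult cform_snd cform_zero)
  qed
qed

lemma sum_UNIV_Plus:
  fixes f :: "'v::finite + 'e::finite \<Rightarrow> 'a::comm_monoid_add"
  shows "(\<Sum>j\<in>UNIV. f j) = (\<Sum>v\<in>UNIV. f (Inl v)) + (\<Sum>e\<in>UNIV. f (Inr e))"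
  using sum.Plus[of "UNIV :: 'v set" "UNIV :: 'e set" f] by (simp add: UNIV_Plus_UNIV)

abbreviation lcosh :: "real \<Rightarrow> real" where "lcosh t \<equiv> ln (2 * cosh t)"

lemma lcosh_minus: "lcosh (- t) = lcosh t" by simp

lemma expo_weights:
  "diff_integral.expo W (gsrc G) (gtgt G) (weights \<alpha> Vs Es c p) \<tau> =
    of_real \<alpha> * ((\<Sum>i\<in>W. c i p * of_real (\<tau> i))
     - (\<Sum>v\<in>Vs. fst p $ v * of_real (lcosh (diff_integral.pot W \<tau> (Some v))))
     - (\<Sum>e\<in>Es. snd p $ e * of_real (lcosh (diff_integral.pot W \<tau> (Some (tail G e)) - diff_integral.pot W \<tau> (Some (head G e))))))"
proof -
  have ifs: "(if b then x else 0) * z = (if b then x * z else (0::complex))" for b x z by simp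
  show ?thesis
    unfolding diff_integral.expo_def sum_UNIV_Plus diff_integral.gap_def
    by (simp add: weights_def gsrc_def gtgt_def diff_integral.pot_def[of _ _ None] ifs
        sum.If_cases sum_distrib_left mult.assoc right_diff_distrib flip: sum.inter_restrict)
qed

lemma rate_weights:
  "diff_integral.rate W (gsrc G) (gtgt G) (weights \<alpha> Vs Es c p) \<tau> =
    of_real \<alpha> * ((\<Sum>v\<in>Vs. fst p $ v * of_real \<bar>diff_integral.pot W \<tau> (Some v)\<bar>)
     + (\<Sum>e\<in>Es. snd p $ e * of_real \<bar>diff_integral.pot W \<tau> (Some (tail G e)) - diff_integral.pot W \<tau> (Some (head G e))\<bar>)
     - (\<Sum>i\<in>W. c i p * of_real (\<tau> i)))"
proof -
  have ifs: "(if b then x else 0) * z = (if b then x * z else (0::complex))" for b x z by simp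
  show ?thesis
    unfolding diff_integral.rate_def sum_UNIV_Plus diff_integral.gap_def
    by (simp add: weights_def gsrc_def gtgt_def diff_integral.pot_def[of _ _ None] ifs
        sum.If_cases sum_distrib_left mult.assoc right_diff_distrib distrib_left flip: sum.inter_restrict)
qed

text \<open>The base is a positive real number, so the principal logarithm is the real one.\<close>

lemma two_cosh_powr: "two_cosh t powr z = exp (z * of_real (lcosh t))"
proof -
  have "2 * cosh t > 0" by simp
  then have "Ln (two_cosh t) = of_real (lcosh t)" "two_cosh t \<noteq> 0"
    unfolding two_cosh_def using Ln_of_real by (blast, simp)
  then show ?thesis by (simp add: powr_def)
qed

lemma edge_factor_exp:
  "edge_factor K \<alpha> p \<tau> = exp (- (of_real \<alpha> * (\<Sum>e\<in>arcs K. snd p $ e * of_real (lcosh (\<tau> (tail K e) - \<tau> (head K e))))))"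
  unfolding edge_factor_def two_cosh_powr
  by (subst exp_sum[symmetric]) (simp_all add: sum_distrib_left sum_negf[symmetric] mult.assoc)

lemma zono_integrand_exp:
  "zono_integrand K \<alpha> p \<tau> = exp (of_real \<alpha> * (- (\<Sum>v\<in>verts K. fst p $ v * of_real (lcosh (\<tau> v)))
     - (\<Sum>e\<in>arcs K. snd p $ e * of_real (lcosh (\<tau> (tail K e) - \<tau> (head K e))))))"
proof -
  have "(\<Prod>v\<in>verts K. two_cosh (\<tau> v) powr (- (of_real \<alpha> * fst p $ v))) =
      exp (- (of_real \<alpha> * (\<Sum>v\<in>verts K. fst p $ v * of_real (lcosh (\<tau> v)))))"
    unfolding two_cosh_powr
    by (subst exp_sum[symmetric]) (simp_all add: sum_distrib_left sum_negf[symmetric] mult.assoc)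
  then show ?thesis
    unfolding zono_integrand_def edge_factor_exp by (simp add: exp_add[symmetric] algebra_simps)
qed

lemma cform_eta: "cform (\<lambda>p. eta G S p v)"
  unfolding eta_def by (intro cform_sum cform_snd)

lemma cform_Xform: "cform (Xform G S)"
proof -
  have "cform (\<lambda>p. (\<Sum>v\<in>S. fst p $ v) + (\<Sum>e\<in>boundary G S. snd p $ e))"
    by (intro cform_add cform_sum cform_fst cform_snd)
  then show ?thesis unfolding Xform_def[abs_def] .
qed

lemma csubspace_energy_space: "csubspace (energy_space G)"
  unfolding csubspace_def energy_space_def by (auto simp: cscale_def zero_prod_def)

locale zono_setup =
  fixes G :: "('v::finite, 'e::finite) pre_digraph" and \<alpha> :: real and S :: "'v set"
  assumes fin: "fin_digraph G" and \<alpha>: "0 < \<alpha>" and S: "S \<subseteq> verts G"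
    and connS: "Digraph_Component.connected (G \<restriction> S)"
begin

abbreviation "src \<equiv> gsrc G"
abbreviation "tgt \<equiv> gtgt G"
abbreviation "out \<equiv> verts G - S"
abbreviation "comps \<equiv> graph_components (G \<restriction> out)"
abbreviation "bd \<equiv> boundary G S"

sublocale fin_digraph G by (rule fin)

sublocale B: component_graph "G \<restriction> out"
proof -
  show "component_graph (G \<restriction> out)"
    by (intro component_graph.intro fin_digraph.intro fin_digraph_axioms.intro wellformed_induce_subgraph)
      (simp_all add: finite_arcs)
qed

text \<open>The weights of the full integral, the internal block and the shifted blocks.
  \<open>iw\<close> does not mention the reference vertex: integrating over \<open>S - {a}\<close>
  pins \<open>a\<close> at 0, because \<open>pot\<close> sends every vertex outside the integration
  set to 0. The same weights over all of \<open>S\<close> give the integrand with no vertex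
  pinned.\<close>

definition zw where "zw = weights \<alpha> (verts G) (arcs G) (\<lambda>_ _. 0)"
definition iw where "iw = weights \<alpha> {} (arcs (G \<restriction> S)) (\<lambda>v p. - (fst p $ v + eta G S p v))"
definition sw where "sw K = weights \<alpha> (verts K) (arcs K) (\<lambda>v p. eta G S p v)"

lemma cmap_zw: "cmap zw" and cmap_iw: "cmap iw" and cmap_sw: "cmap (sw K)"
proof -
  show "cmap zw" unfolding zw_def by (rule cmap_weights[OF cform_zero])
  have "cform (\<lambda>p. - (fst p $ v + eta G S p v))" for v
    using cform_cmult[OF cform_add[OF cform_fst[of v] cform_eta[of G S v]], of "-1"] by simp
  then show "cmap iw" unfolding iw_def by (rule cmap_weights)
  show "cmap (sw K)" unfolding sw_def by (rule cmap_weights[OF cform_eta])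
qed

abbreviation "zDom \<equiv> diff_integral.Dom (verts G) src tgt"
abbreviation "iDom a \<equiv> diff_integral.Dom (S - {a}) src tgt"
abbreviation "sDom K \<equiv> diff_integral.Dom (verts K) src tgt"
abbreviation "zval \<equiv> diff_integral.ival (verts G) src tgt"
abbreviation "ival a \<equiv> diff_integral.ival (S - {a}) src tgt"
abbreviation "sval K \<equiv> diff_integral.ival (verts K) src tgt"
abbreviation "zexpo \<equiv> diff_integral.expo (verts G) src tgt"
abbreviation "iexpo a \<equiv> diff_integral.expo (S - {a}) src tgt"
abbreviation "sexpo K \<equiv> diff_integral.expo (verts K) src tgt"

lemma compD:
  assumes "K \<in> comps"
  shows "verts K \<subseteq> out" "arcs K \<subseteq> arcs G" "tail K = tail G" "head K = head G"
    "e \<in> arcs K \<Longrightarrow> tail G e \<in> verts K" "e \<in> arcs K \<Longrightarrow> head G e \<in> verts K"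
  using B.component_props(3,4,6,7)[OF assms] B.component_arcs_eq[OF assms] by auto

lemma zono_integrand_expo: "zono_integrand G \<alpha> p \<tau> = exp (zexpo (zw p) \<tau>)"
proof -
  have "diff_integral.pot (verts G) \<tau> (Some v) = \<tau> v" if "v \<in> verts G" for v
    using that by (simp add: diff_integral.pot_def)
  then show ?thesis unfolding zono_integrand_exp zw_def expo_weights by simp
qed

lemma shifted_integrand_expo:
  assumes K: "K \<in> comps"
  shows "shifted_integrand G \<alpha> S K p \<tau> = exp (sexpo K (sw K p) \<tau>)"
proof -
  have p: "diff_integral.pot (verts K) \<tau> (Some v) = \<tau> v" if "v \<in> verts K" for v
    using that by (simp add: diff_integral.pot_def)
  show ?thesis
    unfolding shifted_integrand_def zono_integrand_exp sw_def expo_weights exp_add[symmetric]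
    using compD[OF K] p by (simp add: algebra_simps)
qed

lemma internal_integrand_expo:
  assumes a: "a \<in> S"
  shows "internal_integrand G \<alpha> S a p \<tau> = exp (iexpo a (iw p) \<tau>)"
proof -
  have p: "diff_integral.pot (S - {a}) \<tau> (Some v) = (\<tau>(a := 0)) v" if "v \<in> S" for v
    using that by (simp add: diff_integral.pot_def)
  have "(\<Sum>v\<in>S. (fst p $ v + eta G S p v) * of_real ((\<tau>(a := 0)) v)) =
      (\<Sum>v\<in>S - {a}. (fst p $ v + eta G S p v) * of_real (\<tau> v))"
    using a by (subst sum.remove[of S a]) auto
  then show ?thesis
    unfolding internal_integrand_def Let_def edge_factor_exp iw_def expo_weights exp_add[symmetric]
    using p by (simp add: algebra_simps sum_negf sum_subtractf sum.distrib)
qed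

lemma shifted_integrand_fun: "K \<in> comps \<Longrightarrow> shifted_integrand G \<alpha> S K p = (\<lambda>\<tau>. exp (sexpo K (sw K p) \<tau>))"
  by (rule ext) (rule shifted_integrand_expo)

lemma internal_integrand_fun: "a \<in> S \<Longrightarrow> internal_integrand G \<alpha> S a p = (\<lambda>\<tau>. exp (iexpo a (iw p) \<tau>))"
  by (rule ext) (rule internal_integrand_expo)

lemma zono_integral_zval: "zono_integral G \<alpha> p = of_real \<alpha> ^ card (verts G) * zval (zw p)"
  unfolding zono_integral_def zono_integrand_expo diff_integral.ival_def ..

lemma shifted_integral_sval: "K \<in> comps \<Longrightarrow> shifted_integral G \<alpha> S K p = of_real \<alpha> ^ card (verts K) * sval K (sw K p)"
  unfolding shifted_integral_def diff_integral.ival_def shifted_integrand_fun by simp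

lemma internal_integral_ival: "a \<in> S \<Longrightarrow> internal_integral G \<alpha> S a p = of_real \<alpha> ^ (card S - 1) * ival a (iw p)"
  unfolding internal_integral_def diff_integral.ival_def internal_integrand_fun by simp

lemma integrable_shifted: "K \<in> comps \<Longrightarrow> integrable (lebP (verts K)) (shifted_integrand G \<alpha> S K p) \<longleftrightarrow> sw K p \<in> sDom K"
  unfolding diff_integral.integrable_iff_Dom[symmetric] shifted_integrand_fun by simp

lemma integrable_internal: "a \<in> S \<Longrightarrow> integrable (lebP (S - {a})) (internal_integrand G \<alpha> S a p) \<longleftrightarrow> iw p \<in> iDom a"
  unfolding diff_integral.integrable_iff_Dom[symmetric] internal_integrand_fun by simp


subsection \<open>The boundary edges\<close>

text \<open>The endpoints of a boundary arc inside and outside \<open>S\<close>, whichever way the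
  arc happens to be oriented.\<close>

definition inner :: "'e \<Rightarrow> 'v" where "inner e = (if tail G e \<in> S then tail G e else head G e)"
definition outer :: "'e \<Rightarrow> 'v" where "outer e = (if tail G e \<in> S then head G e else tail G e)"

lemma inner_outer: "e \<in> bd \<Longrightarrow> inner e \<in> S" "e \<in> bd \<Longrightarrow> outer e \<in> out"
  by (auto simp: boundary_def inner_def outer_def)

lemma abs_inner_outer: "\<bar>u (tail G e) - u (head G e)\<bar> = \<bar>u (inner e) - (u (outer e) :: real)\<bar>"
  by (simp add: inner_def outer_def abs_minus_commute)

lemma lcosh_inner_outer: "lcosh (u (tail G e) - u (head G e)) = lcosh (u (inner e) - u (outer e))"
  using lcosh_minus[of "u (tail G e) - u (head G e)"] by (simp add: inner_def outer_def)

lemma sum_eta_inner: "(\<Sum>v\<in>S. eta G S p v * f v) = (\<Sum>e\<in>bd. snd p $ e * f (inner e))"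
proof -
  have "eta G S p v * f v = (\<Sum>e\<in>{e \<in> bd. inner e = v}. snd p $ e * f (inner e))" if "v \<in> S" for v
  proof -
    have "{e. e \<in> bd \<and> (tail G e = v \<or> head G e = v)} = {e \<in> bd. inner e = v}"
      using that by (auto simp: boundary_def inner_def)
    then show ?thesis unfolding eta_def by (simp add: sum_distrib_right)
  qed
  then have "(\<Sum>v\<in>S. eta G S p v * f v) = (\<Sum>v\<in>S. \<Sum>e\<in>{e \<in> bd. inner e = v}. snd p $ e * f (inner e))" by simp
  also have "\<dots> = (\<Sum>e\<in>bd. snd p $ e * f (inner e))"
    by (rule sum.group) (use inner_outer in auto)
  finally show ?thesis .
qed

lemma sum_eta_outer: "(\<Sum>v\<in>out. eta G S p v * f v) = (\<Sum>e\<in>bd. snd p $ e * f (outer e))"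
proof -
  have "eta G S p v * f v = (\<Sum>e\<in>{e \<in> bd. outer e = v}. snd p $ e * f (outer e))" if "v \<in> out" for v
  proof -
    have "{e. e \<in> bd \<and> (tail G e = v \<or> head G e = v)} = {e \<in> bd. outer e = v}"
      using that by (auto simp: boundary_def outer_def)
    then show ?thesis unfolding eta_def by (simp add: sum_distrib_right)
  qed
  then have "(\<Sum>v\<in>out. eta G S p v * f v) = (\<Sum>v\<in>out. \<Sum>e\<in>{e \<in> bd. outer e = v}. snd p $ e * f (outer e))" by simp
  also have "\<dots> = (\<Sum>e\<in>bd. snd p $ e * f (outer e))"
    by (rule sum.group) (use inner_outer in auto)
  finally show ?thesis .
qed

lemma Xform_eta: "Xform G S p = (\<Sum>v\<in>S. fst p $ v + eta G S p v)"
  using sum_eta_inner[of p "\<lambda>_. 1"] by (simp add: Xform_def sum.distrib)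

lemma sum_arcs_split:
  fixes f :: "'e \<Rightarrow> 'a::comm_monoid_add"
  shows "(\<Sum>e\<in>arcs G. f e) = (\<Sum>e\<in>arcs (G \<restriction> S). f e) + ((\<Sum>e\<in>arcs (G \<restriction> out). f e) + (\<Sum>e\<in>bd. f e))"
proof -
  have "arcs G = arcs (G \<restriction> S) \<union> (arcs (G \<restriction> out) \<union> bd)"
    using wellformed by (auto simp: boundary_def)
  moreover have "arcs (G \<restriction> S) \<inter> (arcs (G \<restriction> out) \<union> bd) = {}"
    by (auto simp: boundary_def)
  moreover have disj: "arcs (G \<restriction> out) \<inter> bd = {}"
    by (auto simp: boundary_def)
  ultimately have "(\<Sum>e\<in>arcs G. f e) = (\<Sum>e\<in>arcs (G \<restriction> S). f e) + (\<Sum>e\<in>arcs (G \<restriction> out) \<union> bd. f e)"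
    using sum.union_disjoint[of "arcs (G \<restriction> S)" "arcs (G \<restriction> out) \<union> bd" f] finite by metis
  also have "(\<Sum>e\<in>arcs (G \<restriction> out) \<union> bd. f e) = (\<Sum>e\<in>arcs (G \<restriction> out). f e) + (\<Sum>e\<in>bd. f e)"
    by (rule sum.union_disjoint) (fact finite finite disj)+
  finally show ?thesis .
qed

lemma sum_verts_split:
  fixes f :: "'v \<Rightarrow> 'a::comm_monoid_add"
  shows "(\<Sum>v\<in>verts G. f v) = (\<Sum>v\<in>S. f v) + (\<Sum>v\<in>out. f v)"
  using sum.subset_diff[OF S, of f] by (simp add: add.commute)


subsection \<open>A region where all integrals converge\<close>

text \<open>Sufficient conditions for convergence. Off \<open>S\<close> the energy x must exceed the
  exponential shift eta; inside \<open>S\<close> every edge must outweigh all linear weights, where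
  \<open>c\<close> will be the constant that bounds differences of positions by edge
  variations.\<close>

definition region :: "real \<Rightarrow> ('v, 'e) energy set" where
  "region c = {p. (\<forall>e\<in>arcs G. 0 < Re (snd p $ e)) \<and> (\<forall>w\<in>out. 0 < Re (fst p $ w - eta G S p w)) \<and>
     (\<forall>e\<in>arcs (G \<restriction> S). c * (\<Sum>v\<in>S. \<bar>Re (fst p $ v + eta G S p v)\<bar>) < Re (snd p $ e))}"

text \<open>All edge energies are 1, so eta counts boundary edges. On \<open>S\<close> the choice x
  = - eta makes the linear weights zero, hence X_S = 0 and membership in \<open>region c\<close> for
  every \<open>c\<close>; off \<open>S\<close> there is a margin of 1.\<close>

definition base :: "('v, 'e) energy" where
  "base = ((\<chi> v. if v \<in> S then - of_nat (card {e \<in> bd. tail G e = v \<or> head G e = v})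
            else if v \<in> verts G then of_nat (card {e \<in> bd. tail G e = v \<or> head G e = v}) + 1 else 0),
          (\<chi> e. if e \<in> arcs G then 1 else 0))"

lemma eta_base: "eta G S base v = of_nat (card {e \<in> bd. tail G e = v \<or> head G e = v})"
proof -
  have "eta G S base v = (\<Sum>e | e \<in> bd \<and> (tail G e = v \<or> head G e = v). 1)"
    unfolding eta_def base_def by (intro sum.cong) (auto simp: boundary_def)
  then show ?thesis by simp
qed

lemma base_in: "base \<in> region c" "base \<in> hyperplane G S"
proof -
  have f: "fst base $ v = - eta G S base v" if "v \<in> S" for v
    unfolding eta_base using that by (simp add: base_def)
  have o: "fst base $ v = eta G S base v + 1" if "v \<in> out" for v
    unfolding eta_base using that by (simp add: base_def)
  have s: "snd base $ e = 1" if "e \<in> arcs G" for e using that by (simp add: base_def)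
  show "base \<in> region c" unfolding region_def using f o s by simp
  have "base \<in> energy_space G" using S by (auto simp: energy_space_def base_def)
  moreover have "Xform G S base = 0" unfolding Xform_eta using f by simp
  ultimately show "base \<in> hyperplane G S" by (simp add: hyperplane_def)
qed

lemma open_region: "open (region c)"
proof -
  have c: "continuous_on UNIV (\<lambda>p. Re (snd p $ e))" "continuous_on UNIV (\<lambda>p. Re (fst p $ w - eta G S p w))"
    "continuous_on UNIV (\<lambda>p. Re (fst p $ v + eta G S p v))" for e w v
    using cform_continuous[OF cform_snd] cform_continuous[OF cform_fst] cform_continuous[OF cform_eta]
    by (auto intro!: continuous_intros)
  have "region c = (\<Inter>e\<in>arcs G. {p. 0 < Re (snd p $ e)}) \<inter> (\<Inter>w\<in>out. {p. 0 < Re (fst p $ w - eta G S p w)}) \<inter>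
     (\<Inter>e\<in>arcs (G \<restriction> S). {p. c * (\<Sum>v\<in>S. \<bar>Re (fst p $ v + eta G S p v)\<bar>) < Re (snd p $ e)})"
    unfolding region_def by blast
  also have "open \<dots>"
    by (intro open_Int open_INT finite ballI open_Collect_less continuous_intros c)
  finally show ?thesis .
qed

lemma finite_positive_lower_bound:
  assumes "finite A" "\<And>x. x \<in> A \<Longrightarrow> 0 < f x"
  obtains m :: real where "m > 0" "\<And>x. x \<in> A \<Longrightarrow> m \<le> f x"
proof -
  have fin: "finite (insert 1 (f ` A))" using assms(1) by simp
  show ?thesis
  proof (rule that[of "Min (insert 1 (f ` A))"])
    show "0 < Min (insert 1 (f ` A))" using fin assms(2) by (subst Min_gr_iff) auto
    show "Min (insert 1 (f ` A)) \<le> f x" if "x \<in> A" for x using fin that by (intro Min_le) auto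
  qed
qed

text \<open>Part of each edge energy, \<open>c * M\<close>, pays for all linear weights through the
  variation bound. The remaining margin \<open>m\<close> still controls the total variation and
  thereby all positions relative to \<open>a\<close>.\<close>

lemma internal_estimate:
  assumes c: "0 \<le> c" "\<And>\<sigma> v. v \<in> S \<Longrightarrow> \<bar>\<sigma> v - \<sigma> a\<bar> \<le> c * (\<Sum>e\<in>arcs (G \<restriction> S). \<bar>\<sigma> (tail G e) - (\<sigma> (head G e) :: real)\<bar>)"
    and p: "p \<in> region c"
  obtains \<epsilon> where "\<epsilon> > 0" "\<And>\<sigma>. \<epsilon> * (\<Sum>v\<in>S. \<bar>\<sigma> v - \<sigma> a\<bar>) \<le>
     (\<Sum>e\<in>arcs (G \<restriction> S). Re (snd p $ e) * \<bar>\<sigma> (tail G e) - \<sigma> (head G e)\<bar>) - (\<Sum>v\<in>S. \<bar>Re (fst p $ v + eta G S p v)\<bar> * \<bar>\<sigma> v - \<sigma> a\<bar>)"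
proof -
  define M where "M = (\<Sum>v\<in>S. \<bar>Re (fst p $ v + eta G S p v)\<bar>)"
  obtain m where m: "m > 0" "\<And>e. e \<in> arcs (G \<restriction> S) \<Longrightarrow> m \<le> Re (snd p $ e) - c * M"
    using finite_positive_lower_bound[of "arcs (G \<restriction> S)" "\<lambda>e. Re (snd p $ e) - c * M"] p
    unfolding region_def M_def by auto
  \<comment> \<open>The sum over \<open>S\<close> is at most \<open>card S * c\<close> times the
    variation; adding 1 keeps the divisor positive.\<close>
  define k where "k = real (card S) * c + 1"
  have k: "k > 0" using c(1) by (simp add: k_def add_nonneg_pos)
  show ?thesis
  proof (rule that[of "m / k"])
    show "m / k > 0" using m k by simp
    fix \<sigma> :: "'v \<Rightarrow> real"
    define t where "t = (\<Sum>e\<in>arcs (G \<restriction> S). \<bar>\<sigma> (tail G e) - \<sigma> (head G e)\<bar>)"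
    have t: "0 \<le> t" unfolding t_def by (intro sum_nonneg) auto
    have ct: "\<bar>\<sigma> v - \<sigma> a\<bar> \<le> c * t" if "v \<in> S" for v using c(2)[OF that] by (simp add: t_def)
    have "(\<Sum>v\<in>S. \<bar>\<sigma> v - \<sigma> a\<bar>) \<le> (\<Sum>v\<in>S. c * t)" by (intro sum_mono ct)
    also have "\<dots> \<le> k * t" using t by (simp add: k_def algebra_simps)
    finally have "m / k * (\<Sum>v\<in>S. \<bar>\<sigma> v - \<sigma> a\<bar>) \<le> m / k * (k * t)" using m k by (intro mult_left_mono) auto
    also have "\<dots> = m * t" using k by simp
    also have "\<dots> \<le> (\<Sum>e\<in>arcs (G \<restriction> S). (Re (snd p $ e) - c * M) * \<bar>\<sigma> (tail G e) - \<sigma> (head G e)\<bar>)"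
      unfolding t_def sum_distrib_left by (intro sum_mono mult_right_mono m) auto
    also have "\<dots> = (\<Sum>e\<in>arcs (G \<restriction> S). Re (snd p $ e) * \<bar>\<sigma> (tail G e) - \<sigma> (head G e)\<bar>) - M * (c * t)"
      unfolding t_def by (simp add: left_diff_distrib sum_subtractf sum_distrib_left mult_ac)
    also have "\<dots> \<le> (\<Sum>e\<in>arcs (G \<restriction> S). Re (snd p $ e) * \<bar>\<sigma> (tail G e) - \<sigma> (head G e)\<bar>) -
       (\<Sum>v\<in>S. \<bar>Re (fst p $ v + eta G S p v)\<bar> * \<bar>\<sigma> v - \<sigma> a\<bar>)"
    proof -
      have "(\<Sum>v\<in>S. \<bar>Re (fst p $ v + eta G S p v)\<bar> * \<bar>\<sigma> v - \<sigma> a\<bar>) \<le> M * (c * t)"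
        unfolding M_def sum_distrib_right by (intro sum_mono mult_left_mono ct) auto
      then show ?thesis by linarith
    qed
    finally show "m / k * (\<Sum>v\<in>S. \<bar>\<sigma> v - \<sigma> a\<bar>) \<le>
     (\<Sum>e\<in>arcs (G \<restriction> S). Re (snd p $ e) * \<bar>\<sigma> (tail G e) - \<sigma> (head G e)\<bar>) - (\<Sum>v\<in>S. \<bar>Re (fst p $ v + eta G S p v)\<bar> * \<bar>\<sigma> v - \<sigma> a\<bar>)" .
  qed
qed

lemma Re_eta_nonneg: "p \<in> region c \<Longrightarrow> 0 \<le> Re (eta G S p v)"
  unfolding eta_def Re_sum
  by (intro sum_nonneg) (auto simp: region_def boundary_def intro: less_imp_le)

text \<open>The decay rate of the full integrand on X_S = 0. Boundary edges transfer their energies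
  to the vertices, with sign + on \<open>S\<close> and - off \<open>S\<close>. The left side
  contains only positions relative to \<open>a\<close>: on the hyperplane there is no decay under
  the common translation of \<open>S\<close>, which is the source of the pole.\<close>

lemma zono_estimate:
  assumes c: "0 \<le> c" "\<And>\<sigma> v. v \<in> S \<Longrightarrow> \<bar>\<sigma> v - \<sigma> a\<bar> \<le> c * (\<Sum>e\<in>arcs (G \<restriction> S). \<bar>\<sigma> (tail G e) - (\<sigma> (head G e) :: real)\<bar>)"
    and p: "p \<in> region c" and X: "Xform G S p = 0"
  obtains \<epsilon> where "\<epsilon> > 0" "\<And>u. \<epsilon> * ((\<Sum>v\<in>S. \<bar>u v - u a\<bar>) + (\<Sum>w\<in>out. \<bar>u w\<bar>)) \<le>
     (\<Sum>v\<in>verts G. Re (fst p $ v) * \<bar>u v\<bar>) + (\<Sum>e\<in>arcs G. Re (snd p $ e) * \<bar>u (tail G e) - u (head G e)\<bar>)"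
proof -
  obtain \<epsilon>1 where e1: "\<epsilon>1 > 0" "\<And>\<sigma>. \<epsilon>1 * (\<Sum>v\<in>S. \<bar>\<sigma> v - \<sigma> a\<bar>) \<le>
     (\<Sum>e\<in>arcs (G \<restriction> S). Re (snd p $ e) * \<bar>\<sigma> (tail G e) - \<sigma> (head G e)\<bar>) - (\<Sum>v\<in>S. \<bar>Re (fst p $ v + eta G S p v)\<bar> * \<bar>\<sigma> v - \<sigma> a\<bar>)"
    by (rule internal_estimate[OF c(1) _ p], erule c(2)) (rule that)
  obtain m where m: "m > 0" "\<And>w. w \<in> out \<Longrightarrow> m \<le> Re (fst p $ w - eta G S p w)"
    by (rule finite_positive_lower_bound[of out "\<lambda>w. Re (fst p $ w - eta G S p w)"])
      (use p in \<open>auto simp: region_def\<close>)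
  show ?thesis
  proof (rule that[of "min \<epsilon>1 m"])
    show "min \<epsilon>1 m > 0" using e1 m by simp
    fix u :: "'v \<Rightarrow> real"
    let ?y = "\<lambda>e. Re (snd p $ e)" and ?d = "\<lambda>e. \<bar>u (tail G e) - u (head G e)\<bar>"
    let ?x = "\<lambda>v. Re (fst p $ v)" and ?h = "\<lambda>v. Re (eta G S p v)"
    have y: "0 \<le> ?y e" if "e \<in> arcs G" for e using p that by (auto simp: region_def intro: less_imp_le)
    have in': "(\<Sum>v\<in>S. ?h v * \<bar>u v\<bar>) = (\<Sum>e\<in>bd. ?y e * \<bar>u (inner e)\<bar>)"
      using arg_cong[OF sum_eta_inner[of p "\<lambda>v. of_real \<bar>u v\<bar>"], of Re] by simp
    have out': "(\<Sum>v\<in>out. ?h v * \<bar>u v\<bar>) = (\<Sum>e\<in>bd. ?y e * \<bar>u (outer e)\<bar>)"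
      using arg_cong[OF sum_eta_outer[of p "\<lambda>v. of_real \<bar>u v\<bar>"], of Re] by simp
    \<comment> \<open>The reverse triangle inequality |u - w| \<ge> |u| - |w| for the inner end u
      and the outer end w of each boundary edge.\<close>
    have bd: "(\<Sum>v\<in>S. ?h v * \<bar>u v\<bar>) - (\<Sum>v\<in>out. ?h v * \<bar>u v\<bar>) \<le> (\<Sum>e\<in>bd. ?y e * ?d e)"
      unfolding in' out' sum_subtractf[symmetric] right_diff_distrib[symmetric] abs_inner_outer
    proof (intro sum_mono mult_left_mono)
      show "0 \<le> ?y e" if "e \<in> bd" for e using y that by (auto simp: boundary_def)
    qed (rule abs_triangle_ineq2)
    have outs: "0 \<le> (\<Sum>e\<in>arcs (G \<restriction> out). ?y e * ?d e)"
      using y by (intro sum_nonneg mult_nonneg_nonneg) auto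
    \<comment> \<open>X_S = 0 allows \<open>\<bar>u a\<bar>\<close> to be subtracted from each
      \<open>\<bar>u v\<bar>\<close>, which leaves differences within \<open>S\<close>.\<close>
    have sumX: "(\<Sum>v\<in>S. (?x v + ?h v) * \<bar>u a\<bar>) = 0"
      using arg_cong[OF X[unfolded Xform_eta], of Re] by (simp add: sum_distrib_right[symmetric])
    have "(\<Sum>v\<in>S. - (\<bar>?x v + ?h v\<bar> * \<bar>u v - u a\<bar>)) \<le> (\<Sum>v\<in>S. (?x v + ?h v) * (\<bar>u v\<bar> - \<bar>u a\<bar>))"
    proof (rule sum_mono)
      fix v
      have "\<bar>(?x v + ?h v) * (\<bar>u v\<bar> - \<bar>u a\<bar>)\<bar> \<le> \<bar>?x v + ?h v\<bar> * \<bar>u v - u a\<bar>"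
        unfolding abs_mult by (intro mult_left_mono abs_triangle_ineq3) auto
      then show "- (\<bar>?x v + ?h v\<bar> * \<bar>u v - u a\<bar>) \<le> (?x v + ?h v) * (\<bar>u v\<bar> - \<bar>u a\<bar>)" by linarith
    qed
    then have s: "- (\<Sum>v\<in>S. \<bar>?x v + ?h v\<bar> * \<bar>u v - u a\<bar>) \<le> (\<Sum>v\<in>S. ?x v * \<bar>u v\<bar>) + (\<Sum>v\<in>S. ?h v * \<bar>u v\<bar>)"
      using sumX by (simp add: sum_negf right_diff_distrib sum_subtractf distrib_right sum.distrib)
    have o: "m * (\<Sum>w\<in>out. \<bar>u w\<bar>) \<le> (\<Sum>w\<in>out. ?x w * \<bar>u w\<bar>) - (\<Sum>w\<in>out. ?h w * \<bar>u w\<bar>)"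
      unfolding sum_distrib_left sum_subtractf[symmetric] left_diff_distrib[symmetric]
      using m(2) by (intro sum_mono mult_right_mono) auto
    have "min \<epsilon>1 m * ((\<Sum>v\<in>S. \<bar>u v - u a\<bar>) + (\<Sum>w\<in>out. \<bar>u w\<bar>)) \<le>
        \<epsilon>1 * (\<Sum>v\<in>S. \<bar>u v - u a\<bar>) + m * (\<Sum>w\<in>out. \<bar>u w\<bar>)"
      unfolding distrib_left by (intro add_mono mult_right_mono sum_nonneg) auto
    also have "\<dots> \<le> (\<Sum>v\<in>verts G. ?x v * \<bar>u v\<bar>) + (\<Sum>e\<in>arcs G. ?y e * ?d e)"
      unfolding sum_arcs_split sum_verts_split using e1(2)[of u] bd outs s o by simp
    finally show "min \<epsilon>1 m * ((\<Sum>v\<in>S. \<bar>u v - u a\<bar>) + (\<Sum>w\<in>out. \<bar>u w\<bar>)) \<le>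
     (\<Sum>v\<in>verts G. ?x v * \<bar>u v\<bar>) + (\<Sum>e\<in>arcs G. ?y e * ?d e)" .
  qed
qed

end

text \<open>Because ln (2 cosh x) - x = ln (1 + exp (- 2 x)).\<close>

lemma lcosh_shift_limit: "((\<lambda>s. lcosh (s + c) - s) \<longlongrightarrow> c) at_top"
proof -
  have e: "lcosh x - x = ln (1 + exp (- 2 * x))" for x :: real
  proof -
    have n: "1 + exp (- 2 * x) > 0" by (simp add: add_pos_pos)
    have "2 * cosh x = exp x * (1 + exp (- 2 * x))"
      by (simp add: cosh_def distrib_left exp_add[symmetric])
    then have "lcosh x = ln (exp x * (1 + exp (- 2 * x)))" by simp
    also have "\<dots> = x + ln (1 + exp (- 2 * x))" using n by (subst ln_mult) auto
    finally show ?thesis by simp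
  qed
  have "filterlim (\<lambda>s::real. 2 * (c + s)) at_top at_top"
    by (intro filterlim_tendsto_pos_mult_at_top[OF tendsto_const] filterlim_tendsto_add_at_top[OF tendsto_const] filterlim_ident) auto
  then have "filterlim (\<lambda>s::real. 2 * (s + c)) at_top at_top" by (simp only: add.commute)
  then have "((\<lambda>s. exp (- (2 * (s + c)))) \<longlongrightarrow> 0) at_top"
    by (intro filterlim_compose[OF exp_at_bot]) (simp add: filterlim_uminus_at_bot add.commute)
  then have "((\<lambda>s. ln (1 + exp (- 2 * (s + c)))) \<longlongrightarrow> ln (1 + 0)) at_top"
    by (intro tendsto_ln tendsto_intros) auto
  then have "((\<lambda>s. lcosh (s + c) - (s + c) + c) \<longlongrightarrow> 0 + c) at_top"
    unfolding e by (intro tendsto_intros) auto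
  then show ?thesis by (simp add: algebra_simps)
qed

context zono_setup
begin


subsection \<open>The limit at the hyperplane\<close>

text \<open>A fixed choice of the constant in the variation bound, so that
  \<open>region (cvar a)\<close> depends only on the reference vertex.\<close>

definition cvar :: "'v \<Rightarrow> real" where
  "cvar a = (SOME c. 0 \<le> c \<and> (\<forall>\<sigma> v. v \<in> S \<longrightarrow>
     \<bar>\<sigma> v - \<sigma> a\<bar> \<le> c * (\<Sum>e\<in>arcs (G \<restriction> S). \<bar>\<sigma> (tail G e) - (\<sigma> (head G e) :: real)\<bar>)))"

lemma cvar:
  assumes "a \<in> S"
  shows "0 \<le> cvar a"
    "v \<in> S \<Longrightarrow> \<bar>\<sigma> v - \<sigma> a\<bar> \<le> cvar a * (\<Sum>e\<in>arcs (G \<restriction> S). \<bar>\<sigma> (tail G e) - (\<sigma> (head G e) :: real)\<bar>)"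
proof -
  let ?P = "\<lambda>c. 0 \<le> c \<and> (\<forall>\<sigma> v. v \<in> S \<longrightarrow>
     \<bar>\<sigma> v - \<sigma> a\<bar> \<le> c * (\<Sum>e\<in>arcs (G \<restriction> S). \<bar>\<sigma> (tail G e) - (\<sigma> (head G e) :: real)\<bar>))"
  obtain c where "0 \<le> c" and "\<And>\<sigma> v. v \<in> verts (G \<restriction> S) \<Longrightarrow>
      \<bar>\<sigma> v - \<sigma> a\<bar> \<le> c * (\<Sum>e\<in>arcs (G \<restriction> S). \<bar>\<sigma> (tail (G \<restriction> S) e) - (\<sigma> (head (G \<restriction> S) e) :: real)\<bar>)"
    by (rule connected_variation_bound[OF connS, of a]) (use assms in auto)
  then have "?P c" by simp
  from someI[of ?P, OF this] have "?P (cvar a)" unfolding cvar_def .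
  then show "0 \<le> cvar a"
    "v \<in> S \<Longrightarrow> \<bar>\<sigma> v - \<sigma> a\<bar> \<le> cvar a * (\<Sum>e\<in>arcs (G \<restriction> S). \<bar>\<sigma> (tail G e) - (\<sigma> (head G e) :: real)\<bar>)"
    by blast+
qed

lemma pot_eq: "diff_integral.pot W \<tau> (Some v) = (if v \<in> W then \<tau> v else 0)"
  by (simp add: diff_integral.pot_def)

lemma DomI:
  assumes "\<epsilon> > 0" "\<And>\<tau>. \<epsilon> * diff_integral.total W \<tau> \<le> Re (diff_integral.rate W src tgt p \<tau>)"
  shows "p \<in> diff_integral.Dom W src tgt"
  by (rule diff_integral.Dom_if_integrable[OF diff_integral.integrable_rate[OF assms]])

lemma iw_Dom:
  assumes a: "a \<in> S" and p: "p \<in> region (cvar a)"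
  shows "iw p \<in> iDom a"
proof -
  obtain \<epsilon> where e: "\<epsilon> > 0" "\<And>\<sigma>. \<epsilon> * (\<Sum>v\<in>S. \<bar>\<sigma> v - \<sigma> a\<bar>) \<le>
     (\<Sum>e\<in>arcs (G \<restriction> S). Re (snd p $ e) * \<bar>\<sigma> (tail G e) - \<sigma> (head G e)\<bar>) - (\<Sum>v\<in>S. \<bar>Re (fst p $ v + eta G S p v)\<bar> * \<bar>\<sigma> v - \<sigma> a\<bar>)"
    by (rule internal_estimate[OF cvar(1)[OF a] _ p], erule cvar(2)[OF a]) (rule that)
  show ?thesis
  proof (rule DomI)
    show "\<alpha> * \<epsilon> > 0" using e \<alpha> by simp
    fix \<tau> :: "'v \<Rightarrow> real"
    define \<sigma> where "\<sigma> v = (if v \<in> S - {a} then \<tau> v else 0)" for v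
    have sa: "\<sigma> a = 0" by (simp add: \<sigma>_def)
    have tot: "diff_integral.total (S - {a}) \<tau> = (\<Sum>v\<in>S. \<bar>\<sigma> v - \<sigma> a\<bar>)"
      unfolding diff_integral.total_def sa using a by (subst sum.remove[of S a]) (auto simp: \<sigma>_def)
    have lin: "(\<Sum>i\<in>S - {a}. - Re (fst p $ i + eta G S p i) * \<tau> i) \<le> (\<Sum>v\<in>S. \<bar>Re (fst p $ v + eta G S p v)\<bar> * \<bar>\<sigma> v - \<sigma> a\<bar>)"
    proof -
      have "(\<Sum>i\<in>S - {a}. - Re (fst p $ i + eta G S p i) * \<tau> i) \<le> (\<Sum>v\<in>S - {a}. \<bar>Re (fst p $ v + eta G S p v)\<bar> * \<bar>\<sigma> v - \<sigma> a\<bar>)"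
      proof (rule sum_mono)
        fix i assume "i \<in> S - {a}"
        then have st: "\<sigma> i - \<sigma> a = \<tau> i" by (simp add: \<sigma>_def)
        show "- Re (fst p $ i + eta G S p i) * \<tau> i \<le> \<bar>Re (fst p $ i + eta G S p i)\<bar> * \<bar>\<sigma> i - \<sigma> a\<bar>"
          using abs_ge_minus_self[of "Re (fst p $ i + eta G S p i) * \<tau> i"]
          unfolding st abs_mult mult_minus_left .
      qed
      also have "\<dots> \<le> (\<Sum>v\<in>S. \<bar>Re (fst p $ v + eta G S p v)\<bar> * \<bar>\<sigma> v - \<sigma> a\<bar>)"
        by (rule sum_mono2) auto
      finally show ?thesis .
    qed
    have "Re (diff_integral.rate (S - {a}) src tgt (iw p) \<tau>) = \<alpha> * ((\<Sum>e\<in>arcs (G \<restriction> S). Re (snd p $ e) * \<bar>\<sigma> (tail G e) - \<sigma> (head G e)\<bar>)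
       - (\<Sum>i\<in>S - {a}. - Re (fst p $ i + eta G S p i) * \<tau> i))"
      unfolding iw_def rate_weights pot_eq \<sigma>_def by (simp add: sum_negf Re_divide_of_real)
    also have "\<dots> \<ge> \<alpha> * (\<epsilon> * (\<Sum>v\<in>S. \<bar>\<sigma> v - \<sigma> a\<bar>))"
      using \<alpha> e(2)[of \<sigma>] lin by (intro mult_left_mono) linarith+
    finally show "\<alpha> * \<epsilon> * diff_integral.total (S - {a}) \<tau> \<le> Re (diff_integral.rate (S - {a}) src tgt (iw p) \<tau>)"
      unfolding tot by (simp add: mult.assoc)
  qed
qed

text \<open>Since Re eta is nonnegative, the shift eta \<tau> is at most eta |\<tau>|, and the
  margin of x over eta off \<open>S\<close> gives the decay.\<close>

lemma sw_Dom:
  assumes K: "K \<in> comps" and p: "p \<in> region c"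
  shows "sw K p \<in> sDom K"
proof -
  have fin: "finite (verts K)" using finite by blast
  obtain m where m: "m > 0" "\<And>w. w \<in> verts K \<Longrightarrow> m \<le> Re (fst p $ w - eta G S p w)"
    by (rule finite_positive_lower_bound[of "verts K" "\<lambda>w. Re (fst p $ w - eta G S p w)"])
      (use p compD(1)[OF K] in \<open>auto simp: region_def\<close>)
  show ?thesis
  proof (rule DomI)
    show "\<alpha> * m > 0" using m \<alpha> by simp
    fix \<tau> :: "'v \<Rightarrow> real"
    have "0 \<le> (\<Sum>e\<in>arcs K. Re (snd p $ e) * \<bar>diff_integral.pot (verts K) \<tau> (Some (tail G e)) - diff_integral.pot (verts K) \<tau> (Some (head G e))\<bar>)"
      using p compD(2)[OF K] by (intro sum_nonneg mult_nonneg_nonneg) (auto simp: region_def intro: less_imp_le)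
    moreover have "(\<Sum>v\<in>verts K. m * \<bar>\<tau> v\<bar>) \<le> (\<Sum>v\<in>verts K. Re (fst p $ v) * \<bar>\<tau> v\<bar> - Re (eta G S p v) * \<tau> v)"
    proof (rule sum_mono)
      fix v assume v: "v \<in> verts K"
      have "m * \<bar>\<tau> v\<bar> \<le> Re (fst p $ v - eta G S p v) * \<bar>\<tau> v\<bar>" using m(2)[OF v] by (intro mult_right_mono) auto
      moreover have "Re (eta G S p v) * \<tau> v \<le> Re (eta G S p v) * \<bar>\<tau> v\<bar>"
        using Re_eta_nonneg[OF p] by (intro mult_left_mono) auto
      ultimately show "m * \<bar>\<tau> v\<bar> \<le> Re (fst p $ v) * \<bar>\<tau> v\<bar> - Re (eta G S p v) * \<tau> v"
        by (simp add: left_diff_distrib)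
    qed
    moreover have "Re (diff_integral.rate (verts K) src tgt (sw K p) \<tau>) = \<alpha> * ((\<Sum>v\<in>verts K. Re (fst p $ v) * \<bar>\<tau> v\<bar> - Re (eta G S p v) * \<tau> v)
       + (\<Sum>e\<in>arcs K. Re (snd p $ e) * \<bar>diff_integral.pot (verts K) \<tau> (Some (tail G e)) - diff_integral.pot (verts K) \<tau> (Some (head G e))\<bar>))"
      unfolding sw_def rate_weights pot_eq by (simp add: sum_subtractf)
    ultimately have le: "(\<Sum>v\<in>verts K. m * \<bar>\<tau> v\<bar>) \<le> (\<Sum>v\<in>verts K. Re (fst p $ v) * \<bar>\<tau> v\<bar> - Re (eta G S p v) * \<tau> v)
       + (\<Sum>e\<in>arcs K. Re (snd p $ e) * \<bar>diff_integral.pot (verts K) \<tau> (Some (tail G e)) - diff_integral.pot (verts K) \<tau> (Some (head G e))\<bar>)"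
      and eq: "Re (diff_integral.rate (verts K) src tgt (sw K p) \<tau>) = \<alpha> * ((\<Sum>v\<in>verts K. Re (fst p $ v) * \<bar>\<tau> v\<bar> - Re (eta G S p v) * \<tau> v)
       + (\<Sum>e\<in>arcs K. Re (snd p $ e) * \<bar>diff_integral.pot (verts K) \<tau> (Some (tail G e)) - diff_integral.pot (verts K) \<tau> (Some (head G e))\<bar>))"
      by linarith+
    show "\<alpha> * m * diff_integral.total (verts K) \<tau> \<le> Re (diff_integral.rate (verts K) src tgt (sw K p) \<tau>)"
      using mult_left_mono[OF le, of \<alpha>] \<alpha> unfolding eq diff_integral.total_def
      by (simp only: sum_distrib_left mult.assoc)
  qed
qed

definition unit :: "'v \<Rightarrow> ('v, 'e) energy" where "unit a = (axis a 1, 0)"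

lemma unit_simps: "fst (unit a) $ v = (if v = a then 1 else 0)" "snd (unit a) $ e = 0"
  by (simp_all add: unit_def axis_def)

lemma zrate: "Re (diff_integral.rate (verts G) src tgt (zw p) \<tau>) =
   \<alpha> * ((\<Sum>v\<in>verts G. Re (fst p $ v) * \<bar>\<tau> v\<bar>) + (\<Sum>e\<in>arcs G. Re (snd p $ e) * \<bar>\<tau> (tail G e) - \<tau> (head G e)\<bar>))"
  unfolding zw_def rate_weights pot_eq by simp

text \<open>Raising x_a by \<open>t\<close> adds t |u a| to the rate, which supplies the decay under
  common translations of \<open>S\<close> that is absent on the hyperplane.\<close>

lemma zw_Dom:
  assumes a: "a \<in> S" and p: "p \<in> region (cvar a)" "Xform G S p = 0" and t: "t > 0"
  shows "zw (p + cscale (of_real t) (unit a)) \<in> zDom"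
proof -
  obtain \<epsilon> where e: "\<epsilon> > 0" "\<And>u. \<epsilon> * ((\<Sum>v\<in>S. \<bar>u v - u a\<bar>) + (\<Sum>w\<in>out. \<bar>u w\<bar>)) \<le>
     (\<Sum>v\<in>verts G. Re (fst p $ v) * \<bar>u v\<bar>) + (\<Sum>e\<in>arcs G. Re (snd p $ e) * \<bar>u (tail G e) - u (head G e)\<bar>)"
    by (rule zono_estimate[OF cvar(1)[OF a] _ p], erule cvar(2)[OF a]) (rule that)
  have cS: "real (card S) > 0" using a finite by (simp add: card_gt_0_iff) auto
  \<comment> \<open>From |u v| \<le> |u v - u a| + |u a|, summed over \<open>S\<close>: the last
    term appears \<open>card S\<close> times and must be paid for by \<open>t\<close>.\<close>
  define m where "m = min \<epsilon> (t / card S)"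
  have m: "m > 0" "m \<le> \<epsilon>" "m * card S \<le> t" using e t cS by (auto simp: m_def min_def field_simps)
  show ?thesis
  proof (rule DomI)
    show "\<alpha> * m > 0" using m \<alpha> by simp
    fix u :: "'v \<Rightarrow> real"
    let ?q = "p + cscale (of_real t) (unit a)"
    have x: "(\<Sum>v\<in>verts G. Re (fst ?q $ v) * \<bar>u v\<bar>) = (\<Sum>v\<in>verts G. Re (fst p $ v) * \<bar>u v\<bar>) + t * \<bar>u a\<bar>"
    proof -
      have "(\<Sum>v\<in>verts G. Re (fst ?q $ v) * \<bar>u v\<bar>) = (\<Sum>v\<in>verts G. Re (fst p $ v) * \<bar>u v\<bar> + (if v = a then t * \<bar>u v\<bar> else 0))"
        by (intro sum.cong) (auto simp: unit_simps distrib_right)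
      then show ?thesis using a S by (simp add: sum.distrib subset_eq)
    qed
    have "(\<Sum>v\<in>S. \<bar>u v\<bar>) \<le> (\<Sum>v\<in>S. \<bar>u v - u a\<bar> + \<bar>u a\<bar>)" by (intro sum_mono) auto
    then have "(\<Sum>v\<in>S. \<bar>u v\<bar>) \<le> (\<Sum>v\<in>S. \<bar>u v - u a\<bar>) + card S * \<bar>u a\<bar>" by (simp add: sum.distrib)
    from mult_left_mono[OF this, of m]
    have "m * (\<Sum>v\<in>S. \<bar>u v\<bar>) \<le> m * (\<Sum>v\<in>S. \<bar>u v - u a\<bar>) + m * card S * \<bar>u a\<bar>"
      using m(1) by (simp add: distrib_left mult.assoc)
    also have "\<dots> \<le> \<epsilon> * (\<Sum>v\<in>S. \<bar>u v - u a\<bar>) + t * \<bar>u a\<bar>"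
      using m by (intro add_mono mult_right_mono sum_nonneg) auto
    finally have "m * (\<Sum>v\<in>verts G. \<bar>u v\<bar>) \<le> \<epsilon> * (\<Sum>v\<in>S. \<bar>u v - u a\<bar>) + t * \<bar>u a\<bar> + \<epsilon> * (\<Sum>w\<in>out. \<bar>u w\<bar>)"
      using mult_right_mono[OF m(2), of "\<Sum>w\<in>out. \<bar>u w\<bar>"] unfolding sum_verts_split distrib_left
      by (simp add: sum_nonneg)
    also have "\<dots> \<le> (\<Sum>v\<in>verts G. Re (fst ?q $ v) * \<bar>u v\<bar>) + (\<Sum>e\<in>arcs G. Re (snd p $ e) * \<bar>u (tail G e) - u (head G e)\<bar>)"
      unfolding x using e(2)[of u] by (simp add: distrib_left)
    finally have "\<alpha> * (m * (\<Sum>v\<in>verts G. \<bar>u v\<bar>)) \<le> \<alpha> * ((\<Sum>v\<in>verts G. Re (fst ?q $ v) * \<bar>u v\<bar>) + (\<Sum>e\<in>arcs G. Re (snd p $ e) * \<bar>u (tail G e) - u (head G e)\<bar>))"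
      using \<alpha> by (intro mult_left_mono) auto
    then show "\<alpha> * m * diff_integral.total (verts G) u \<le> Re (diff_integral.rate (verts G) src tgt (zw ?q) u)"
      unfolding zrate diff_integral.total_def by (simp add: mult.assoc unit_simps)
  qed
qed

lemma zexpo_formula: "zexpo (zw p) \<tau> = of_real \<alpha> * (- (\<Sum>v\<in>verts G. fst p $ v * of_real (lcosh (\<tau> v)))
     - (\<Sum>e\<in>arcs G. snd p $ e * of_real (lcosh (\<tau> (tail G e) - \<tau> (head G e)))))"
  unfolding zw_def expo_weights pot_eq by simp

abbreviation "T a \<equiv> shear (verts G) S a"

lemma T_simps:
  assumes "a \<in> S"
  shows "v \<in> S \<Longrightarrow> T a (s, \<rho>) v = s + (if v = a then 0 else \<rho> v)" "w \<in> out \<Longrightarrow> T a (s, \<rho>) w = \<rho> w"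
  using assms S by (auto simp: shear_def)

definition \<Psi> where "\<Psi> a p s = (\<integral>\<rho>. exp (zexpo (zw p) (T a (s, \<rho>))) \<partial>lebP (verts G - {a}))"

text \<open>The bound is independent of \<open>s\<close>; it shows that \<Psi> is bounded and
  dominates the integrand in the limit for s to infinity.\<close>

lemma norm_integrand_shear:
  assumes a: "a \<in> S" and p: "p \<in> region (cvar a)" "Xform G S p = 0"
  obtains C \<epsilon> where "\<epsilon> > 0" "\<And>s \<rho>. norm (exp (zexpo (zw p) (T a (s, \<rho>)))) \<le> C * exp (- \<epsilon> * (\<Sum>v\<in>verts G - {a}. \<bar>\<rho> v\<bar>))"
proof -
  obtain \<epsilon> where e: "\<epsilon> > 0" "\<And>u. \<epsilon> * ((\<Sum>v\<in>S. \<bar>u v - u a\<bar>) + (\<Sum>w\<in>out. \<bar>u w\<bar>)) \<le>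
     (\<Sum>v\<in>verts G. Re (fst p $ v) * \<bar>u v\<bar>) + (\<Sum>e\<in>arcs G. Re (snd p $ e) * \<bar>u (tail G e) - u (head G e)\<bar>)"
    by (rule zono_estimate[OF cvar(1)[OF a] _ p], erule cvar(2)[OF a]) (rule that)
  let ?C = "\<Sum>j\<in>UNIV. \<bar>Re (snd (zw p) $ j)\<bar> * ln 2"
  show ?thesis
  proof (rule that[of "\<alpha> * \<epsilon>" "exp ?C"])
    show "\<alpha> * \<epsilon> > 0" using e \<alpha> by simp
    fix s \<rho>
    let ?u = "T a (s, \<rho>)"
    have "(\<Sum>v\<in>S. \<bar>?u v - ?u a\<bar>) = (\<Sum>v\<in>S - {a}. \<bar>\<rho> v\<bar>)"
      using a by (subst sum.remove[of S a]) (auto simp: T_simps[OF a] intro!: sum.cong)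
    moreover have "(\<Sum>w\<in>out. \<bar>?u w\<bar>) = (\<Sum>w\<in>out. \<bar>\<rho> w\<bar>)" by (simp add: T_simps[OF a])
    moreover have "(\<Sum>v\<in>verts G - {a}. \<bar>\<rho> v\<bar>) = (\<Sum>v\<in>S - {a}. \<bar>\<rho> v\<bar>) + (\<Sum>w\<in>out. \<bar>\<rho> w\<bar>)"
    proof -
      have "verts G - {a} = (S - {a}) \<union> out" using a S by auto
      then show ?thesis using sum.union_disjoint[of "S - {a}" out "\<lambda>v. \<bar>\<rho> v\<bar>"] finite by (simp add: Int_Diff disjoint_iff)
    qed
    ultimately have "\<epsilon> * (\<Sum>v\<in>verts G - {a}. \<bar>\<rho> v\<bar>) \<le>
        (\<Sum>v\<in>verts G. Re (fst p $ v) * \<bar>?u v\<bar>) + (\<Sum>e\<in>arcs G. Re (snd p $ e) * \<bar>?u (tail G e) - ?u (head G e)\<bar>)"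
      using e(2)[of ?u] by simp
    then have "\<alpha> * (\<epsilon> * (\<Sum>v\<in>verts G - {a}. \<bar>\<rho> v\<bar>)) \<le> Re (diff_integral.rate (verts G) src tgt (zw p) ?u)"
      unfolding zrate using \<alpha> by (intro mult_left_mono) auto
    then have "Re (zexpo (zw p) ?u) \<le> ?C - \<alpha> * \<epsilon> * (\<Sum>v\<in>verts G - {a}. \<bar>\<rho> v\<bar>)"
      using diff_integral.Re_expo_bounds(1)[of "verts G" src tgt "zw p" ?u] by (simp add: mult.assoc)
    then show "norm (exp (zexpo (zw p) ?u)) \<le> exp ?C * exp (- (\<alpha> * \<epsilon>) * (\<Sum>v\<in>verts G - {a}. \<bar>\<rho> v\<bar>))"
      by (simp add: exp_add[symmetric])
  qed
qed

lemma measurable_integrand_shear: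
  assumes a: "a \<in> S"
  shows "(\<lambda>z. exp (zexpo (zw p) (T a z))) \<in> borel_measurable (lborel \<Otimes>\<^sub>M lebP (verts G - {a}))"
    "(\<lambda>\<rho>. exp (zexpo (zw p) (T a (s, \<rho>)))) \<in> borel_measurable (lebP (verts G - {a}))"
proof -
  have e: "(\<lambda>\<tau>. exp (zexpo (zw p) \<tau>)) \<in> borel_measurable (lebP (verts G))"
    using diff_integral.borel_measurable_expo[of "verts G" src tgt "zw p"] by measurable
  show 1: "(\<lambda>z. exp (zexpo (zw p) (T a z))) \<in> borel_measurable (lborel \<Otimes>\<^sub>M lebP (verts G - {a}))"
    by (rule measurable_compose[OF measurable_shear e])
  have "(\<lambda>\<rho>. (s, \<rho>)) \<in> measurable (lebP (verts G - {a})) (lborel \<Otimes>\<^sub>M lebP (verts G - {a}))" by measurable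
  from measurable_compose[OF this 1]
  show "(\<lambda>\<rho>. exp (zexpo (zw p) (T a (s, \<rho>)))) \<in> borel_measurable (lebP (verts G - {a}))" .
qed

text \<open>Raising x_a by \<open>t\<close> multiplies the integrand by (2 cosh \<tau> a) to the
  power - \<alpha> t, and in shear coordinates \<tau> a is \<open>s\<close>.\<close>

lemma zval_as_Psi:
  assumes a: "a \<in> S" and p: "p \<in> region (cvar a)" "Xform G S p = 0" and t: "t > 0"
  shows "zval (zw (p + cscale (of_real t) (unit a))) = (\<integral>s. of_real (exp (- (\<alpha> * t * lcosh s))) * \<Psi> a p s \<partial>lborel)"
proof -
  let ?q = "p + cscale (of_real t) (unit a)"
  have aV: "a \<in> verts G" using a S by auto
  have ex: "zexpo (zw ?q) \<tau> = zexpo (zw p) \<tau> + of_real (- (\<alpha> * t * lcosh (\<tau> a)))" for \<tau>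
  proof -
    have "zexpo (zw (unit a)) \<tau> = of_real (- (\<alpha> * lcosh (\<tau> a)))"
      unfolding zexpo_formula unit_simps using aV
      by (simp add: if_distrib[of "\<lambda>x. x * _"] cong: if_cong)
    then show ?thesis
      unfolding cmap_linear[OF cmap_zw] diff_integral.expo_linear by simp
  qed
  have "integrable (lebP (verts G)) (\<lambda>\<tau>. exp (zexpo (zw ?q) \<tau>))"
    by (rule diff_integral.integrable_Dom[OF zw_Dom[OF a p t]])
  from integral_shear_iterated(1)[OF _ aV this, of S]
  have "zval (zw ?q) = (\<integral>s. (\<integral>\<rho>. exp (zexpo (zw ?q) (T a (s, \<rho>))) \<partial>lebP (verts G - {a})) \<partial>lborel)"
    unfolding diff_integral.ival_def by simp
  also have "\<dots> = (\<integral>s. of_real (exp (- (\<alpha> * t * lcosh s))) * \<Psi> a p s \<partial>lborel)"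
  proof (rule Bochner_Integration.integral_cong[OF refl])
    fix s
    have "T a (s, \<rho>) a = s" for \<rho> using T_simps(1)[OF a a] by simp
    then have "exp (zexpo (zw ?q) (T a (s, \<rho>))) = of_real (exp (- (\<alpha> * t * lcosh s))) * exp (zexpo (zw p) (T a (s, \<rho>)))" for \<rho>
      unfolding ex exp_add by (simp add: exp_of_real[symmetric])
    then show "(\<integral>\<rho>. exp (zexpo (zw ?q) (T a (s, \<rho>))) \<partial>lebP (verts G - {a})) = of_real (exp (- (\<alpha> * t * lcosh s))) * \<Psi> a p s"
      unfolding \<Psi>_def by simp
  qed
  finally show ?thesis .
qed

text \<open>Reflecting all relative positions together with \<open>s\<close> reflects every vertex,
  and ln (2 cosh) is even. Thus the limit at one end of the line determines the limit at the
  other.\<close>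

lemma Psi_even:
  assumes a: "a \<in> S"
  shows "\<Psi> a p (- s) = \<Psi> a p s"
proof -
  have "\<Psi> a p (- s) = (\<integral>\<rho>. exp (zexpo (zw p) (T a (- s, \<lambda>i\<in>verts G - {a}. - \<rho> i))) \<partial>lebP (verts G - {a}))"
    unfolding \<Psi>_def using integral_lebP_uminus[OF _ measurable_integrand_shear(2)[OF a, of p "- s"]] by simp
  also have "\<dots> = \<Psi> a p s"
    unfolding \<Psi>_def
  proof (rule Bochner_Integration.integral_cong[OF refl])
    fix \<rho>
    have T: "T a (- s, \<lambda>i\<in>verts G - {a}. - \<rho> i) v = - T a (s, \<rho>) v" if "v \<in> verts G" for v
      using that by (auto simp: shear_def)
    have "zexpo (zw p) (T a (- s, \<lambda>i\<in>verts G - {a}. - \<rho> i)) = zexpo (zw p) (\<lambda>v. - T a (s, \<rho>) v)"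
      by (rule diff_integral.expo_cong) (rule T)
    also have "\<dots> = zexpo (zw p) (T a (s, \<rho>))"
    proof -
      have "lcosh (- x - - y) = lcosh (x - y)" for x y using lcosh_minus[of "x - y"] by (simp only: minus_diff_minus)
      then show ?thesis unfolding zexpo_formula lcosh_minus by (simp only:)
    qed
    finally show "exp (zexpo (zw p) (T a (- s, \<lambda>i\<in>verts G - {a}. - \<rho> i))) = exp (zexpo (zw p) (T a (s, \<rho>)))" by simp
  qed
  finally show ?thesis .
qed

text \<open>Vertices of \<open>S\<close> and boundary edges contribute s + constant up to a
  vanishing error; their terms linear in \<open>s\<close> add up to a multiple of X_S and cancel.
  The constants give - (x + eta) \<sigma> on \<open>S\<close>, the linear term of the internal
  block, and + eta \<sigma> off \<open>S\<close>, the shift of the component blocks.\<close>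

lemma zexpo_shear_limit:
  assumes a: "a \<in> S" and X: "Xform G S p = 0"
  shows "((\<lambda>s. zexpo (zw p) (T a (s, \<rho>))) \<longlongrightarrow> iexpo a (iw p) \<rho> + (\<Sum>K\<in>comps. sexpo K (sw K p) \<rho>)) at_top"
proof -
  let ?x = "\<lambda>v. fst p $ v" and ?y = "\<lambda>e. snd p $ e" and ?h = "\<lambda>v. eta G S p v"
  define \<sigma> where "\<sigma> v = (if v = a then 0 else \<rho> v)" for v
  have T: "T a (s, \<rho>) v = s + \<sigma> v" if "v \<in> S" for v s using T_simps(1)[OF a that] by (simp add: \<sigma>_def)
  have To: "T a (s, \<rho>) w = \<sigma> w" if "w \<in> out" for w s using T_simps(2)[OF a that] a that by (auto simp: \<sigma>_def)
  let ?Rest = "(\<Sum>w\<in>out. ?x w * of_real (lcosh (\<sigma> w))) +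
     ((\<Sum>e\<in>arcs (G \<restriction> S). ?y e * of_real (lcosh (\<sigma> (tail G e) - \<sigma> (head G e)))) +
      (\<Sum>e\<in>arcs (G \<restriction> out). ?y e * of_real (lcosh (\<sigma> (tail G e) - \<sigma> (head G e)))))"
  \<comment> \<open>The divergent \<open>s\<close> is subtracted from each term; the total
    subtracted is \<open>s\<close> times X_S, that is 0.\<close>
  let ?A = "\<lambda>s. (\<Sum>v\<in>S. ?x v * of_real (lcosh (s + \<sigma> v) - s)) + (\<Sum>e\<in>bd. ?y e * of_real (lcosh (s + (\<sigma> (inner e) - \<sigma> (outer e))) - s))"
  have z: "zexpo (zw p) (T a (s, \<rho>)) = of_real \<alpha> * (- (?A s + ?Rest))" for s
  proof -
    have "(\<Sum>v\<in>S. ?x v * of_real (lcosh (s + \<sigma> v))) + (\<Sum>e\<in>bd. ?y e * of_real (lcosh (s + (\<sigma> (inner e) - \<sigma> (outer e))))) =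
        ?A s + of_real s * Xform G S p"
      unfolding Xform_def by (simp add: of_real_diff right_diff_distrib sum_subtractf sum_distrib_left distrib_left mult.commute[of "of_real s"])
    then have A: "?A s = (\<Sum>v\<in>S. ?x v * of_real (lcosh (s + \<sigma> v))) + (\<Sum>e\<in>bd. ?y e * of_real (lcosh (s + (\<sigma> (inner e) - \<sigma> (outer e)))))"
      using X by simp
    have "(\<Sum>e\<in>bd. ?y e * of_real (lcosh (T a (s, \<rho>) (tail G e) - T a (s, \<rho>) (head G e)))) =
        (\<Sum>e\<in>bd. ?y e * of_real (lcosh (s + (\<sigma> (inner e) - \<sigma> (outer e)))))"
    proof (rule sum.cong)
      fix e assume e: "e \<in> bd"
      have "T a (s, \<rho>) (inner e) - T a (s, \<rho>) (outer e) = s + (\<sigma> (inner e) - \<sigma> (outer e))"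
        unfolding T[OF inner_outer(1)[OF e]] To[OF inner_outer(2)[OF e]] by simp
      then show "?y e * of_real (lcosh (T a (s, \<rho>) (tail G e) - T a (s, \<rho>) (head G e))) =
          ?y e * of_real (lcosh (s + (\<sigma> (inner e) - \<sigma> (outer e))))"
        unfolding lcosh_inner_outer by (simp only:)
    qed simp
    moreover have "(\<Sum>e\<in>arcs (G \<restriction> S). ?y e * of_real (lcosh (T a (s, \<rho>) (tail G e) - T a (s, \<rho>) (head G e)))) =
        (\<Sum>e\<in>arcs (G \<restriction> S). ?y e * of_real (lcosh (\<sigma> (tail G e) - \<sigma> (head G e))))"
      by (rule sum.cong) (auto simp: T)
    moreover have "(\<Sum>e\<in>arcs (G \<restriction> out). ?y e * of_real (lcosh (T a (s, \<rho>) (tail G e) - T a (s, \<rho>) (head G e)))) =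
        (\<Sum>e\<in>arcs (G \<restriction> out). ?y e * of_real (lcosh (\<sigma> (tail G e) - \<sigma> (head G e))))"
      by (rule sum.cong) (auto simp: To)
    moreover have "(\<Sum>v\<in>S. ?x v * of_real (lcosh (T a (s, \<rho>) v))) = (\<Sum>v\<in>S. ?x v * of_real (lcosh (s + \<sigma> v)))"
      "(\<Sum>v\<in>out. ?x v * of_real (lcosh (T a (s, \<rho>) v))) = (\<Sum>v\<in>out. ?x v * of_real (lcosh (\<sigma> v)))"
      by (auto intro!: sum.cong simp: T To)
    ultimately show ?thesis
      unfolding zexpo_formula sum_arcs_split sum_verts_split A by simp
  qed
  have "(?A \<longlongrightarrow> (\<Sum>v\<in>S. ?x v * of_real (\<sigma> v)) + (\<Sum>e\<in>bd. ?y e * of_real (\<sigma> (inner e) - \<sigma> (outer e)))) at_top"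
    by (intro tendsto_intros lcosh_shift_limit)
  then have lim: "(?A \<longlongrightarrow> (\<Sum>v\<in>S. ?x v * of_real (\<sigma> v)) + ((\<Sum>v\<in>S. ?h v * of_real (\<sigma> v)) - (\<Sum>w\<in>out. ?h w * of_real (\<sigma> w)))) at_top"
    unfolding sum_eta_inner sum_eta_outer by (simp add: right_diff_distrib sum_subtractf)
  have "((\<lambda>s. of_real \<alpha> * (- (?A s + ?Rest))) \<longlongrightarrow>
      of_real \<alpha> * (- ((\<Sum>v\<in>S. ?x v * of_real (\<sigma> v)) + ((\<Sum>v\<in>S. ?h v * of_real (\<sigma> v)) - (\<Sum>w\<in>out. ?h w * of_real (\<sigma> w))) + ?Rest))) at_top"
    by (rule tendsto_mult[OF tendsto_const tendsto_minus[OF tendsto_add[OF lim tendsto_const]]])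
  also have "of_real \<alpha> * (- ((\<Sum>v\<in>S. ?x v * of_real (\<sigma> v)) + ((\<Sum>v\<in>S. ?h v * of_real (\<sigma> v)) - (\<Sum>w\<in>out. ?h w * of_real (\<sigma> w))) + ?Rest)) =
      iexpo a (iw p) \<rho> + (\<Sum>K\<in>comps. sexpo K (sw K p) \<rho>)"
  proof -
    have i: "iexpo a (iw p) \<rho> = of_real \<alpha> * (- (\<Sum>v\<in>S. (?x v + ?h v) * of_real (\<sigma> v))
        - (\<Sum>e\<in>arcs (G \<restriction> S). ?y e * of_real (lcosh (\<sigma> (tail G e) - \<sigma> (head G e)))))"
    proof -
      have "(\<Sum>v\<in>S. (?x v + ?h v) * of_real (\<sigma> v)) = (\<Sum>v\<in>S - {a}. (?x v + ?h v) * of_real (\<rho> v))"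
        using a by (subst sum.remove[of S a]) (auto simp: \<sigma>_def intro!: sum.cong)
      moreover have "(\<Sum>e\<in>arcs (G \<restriction> S). ?y e * of_real (lcosh ((if tail G e \<in> S - {a} then \<rho> (tail G e) else 0) - (if head G e \<in> S - {a} then \<rho> (head G e) else 0)))) =
          (\<Sum>e\<in>arcs (G \<restriction> S). ?y e * of_real (lcosh (\<sigma> (tail G e) - \<sigma> (head G e))))"
        by (rule sum.cong) (auto simp: \<sigma>_def)
      moreover have "(\<Sum>i\<in>S - {a}. - (?x i + ?h i) * of_real (\<rho> i)) = - (\<Sum>v\<in>S - {a}. (?x v + ?h v) * of_real (\<rho> v))"
        by (simp only: sum_negf mult_minus_left)
      ultimately show ?thesis unfolding iw_def expo_weights pot_eq by simp
    qed
    have k: "sexpo K (sw K p) \<rho> = of_real \<alpha> * ((\<Sum>w\<in>verts K. ?h w * of_real (\<sigma> w))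
       - (\<Sum>w\<in>verts K. ?x w * of_real (lcosh (\<sigma> w))) - (\<Sum>e\<in>arcs K. ?y e * of_real (lcosh (\<sigma> (tail G e) - \<sigma> (head G e)))))"
      if K: "K \<in> comps" for K
    proof -
      have r: "\<rho> w = \<sigma> w" if "w \<in> verts K" for w using that compD(1)[OF K] a by (auto simp: \<sigma>_def)
      have "(\<Sum>e\<in>arcs K. ?y e * of_real (lcosh ((if tail G e \<in> verts K then \<rho> (tail G e) else 0) - (if head G e \<in> verts K then \<rho> (head G e) else 0)))) =
          (\<Sum>e\<in>arcs K. ?y e * of_real (lcosh (\<sigma> (tail G e) - \<sigma> (head G e))))"
        using compD(5,6)[OF K] by (intro sum.cong) (simp_all add: r)
      then show ?thesis unfolding sw_def expo_weights pot_eq using r by simp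
    qed
    have "(\<Sum>K\<in>comps. sexpo K (sw K p) \<rho>) = of_real \<alpha> * ((\<Sum>w\<in>out. ?h w * of_real (\<sigma> w))
       - (\<Sum>w\<in>out. ?x w * of_real (lcosh (\<sigma> w))) - (\<Sum>e\<in>arcs (G \<restriction> out). ?y e * of_real (lcosh (\<sigma> (tail G e) - \<sigma> (head G e)))))"
      using B.sum_components(1)[of "\<lambda>w. ?h w * of_real (\<sigma> w)"] B.sum_components(1)[of "\<lambda>w. ?x w * of_real (lcosh (\<sigma> w))"]
        B.sum_components(2)[of "\<lambda>e. ?y e * of_real (lcosh (\<sigma> (tail G e) - \<sigma> (head G e)))"]
      by (simp add: k sum_distrib_left[symmetric] sum_subtractf del: induce_subgraph_arcs)
    then show ?thesis unfolding i by (simp add: algebra_simps sum.distrib del: induce_subgraph_arcs)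
  qed
  finally show ?thesis unfolding z .
qed

definition limit_integrand where
  "limit_integrand a p \<rho> = exp (iexpo a (iw p) \<rho>) * (\<Prod>K\<in>comps. exp (sexpo K (sw K p) \<rho>))"

lemma limit_integrand_integral:
  assumes a: "a \<in> S" and p: "p \<in> region (cvar a)"
  shows "limit_integrand a p \<in> borel_measurable (lebP (verts G - {a}))"
    "(\<integral>\<rho>. limit_integrand a p \<rho> \<partial>lebP (verts G - {a})) = ival a (iw p) * (\<Prod>K\<in>comps. sval K (sw K p))"
proof -
  have U: "(\<Union>K\<in>comps. verts K) = out" using B.Union_component_verts by simp
  have rest: "exp (diff_integral.expo W src tgt q (restrict \<tau> W)) = exp (diff_integral.expo W src tgt q \<tau>)" for W q \<tau>
    by (rule arg_cong[of _ _ exp], rule diff_integral.expo_cong) simp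
  have "integrable (lebP (\<Union>K\<in>comps. verts K)) (\<lambda>\<tau>. \<Prod>K\<in>comps. exp (sexpo K (sw K p) \<tau>)) \<and>
    (\<integral>\<tau>. (\<Prod>K\<in>comps. exp (sexpo K (sw K p) \<tau>)) \<partial>lebP (\<Union>K\<in>comps. verts K)) = (\<Prod>K\<in>comps. \<integral>\<tau>. exp (sexpo K (sw K p) \<tau>) \<partial>lebP (verts K))"
  proof (rule lebP_blocks[OF B.finite_graph_components])
    show "integrable (lebP (verts K)) (\<lambda>\<tau>. exp (sexpo K (sw K p) \<tau>))" if "K \<in> comps" for K
      by (rule diff_integral.integrable_Dom[OF sw_Dom[OF that p]])
    show "verts K \<inter> verts L = {}" if "K \<in> comps" "L \<in> comps" "K \<noteq> L" for K L
      using B.component_disjoint that by blast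
  qed (auto simp: rest)
  note blocks = this[unfolded U]
  have V: "verts G - {a} = (S - {a}) \<union> out" "(S - {a}) \<inter> out = {}" using a S by auto
  have dep: "(\<Prod>K\<in>comps. exp (sexpo K (sw K p) (restrict \<tau> out))) = (\<Prod>K\<in>comps. exp (sexpo K (sw K p) \<tau>))" for \<tau>
  proof (rule prod.cong)
    fix K assume "K \<in> comps"
    then have "sexpo K (sw K p) (restrict \<tau> out) = sexpo K (sw K p) \<tau>"
      using compD(1) by (intro diff_integral.expo_cong) auto
    then show "exp (sexpo K (sw K p) (restrict \<tau> out)) = exp (sexpo K (sw K p) \<tau>)" by simp
  qed simp
  define f g where "f = (\<lambda>\<rho>. exp (iexpo a (iw p) \<rho>))" and "g = (\<lambda>\<rho>. \<Prod>K\<in>comps. exp (sexpo K (sw K p) \<rho>))"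
  have f: "integrable (lebP (S - {a})) f" "f (restrict \<tau> (S - {a})) = f \<tau>" for \<tau>
    unfolding f_def by (rule diff_integral.integrable_Dom[OF iw_Dom[OF a p]], rule rest)
  have g: "integrable (lebP out) g" "g (restrict \<tau> out) = g \<tau>" for \<tau>
    unfolding g_def by (rule conjunct1[OF blocks], rule dep)
  have fin: "finite (S - {a})" "finite out" by (fact finite)+
  have two: "integrable (lebP ((S - {a}) \<union> out)) (\<lambda>\<tau>. f \<tau> * g \<tau>)" "(\<integral>\<tau>. f \<tau> * g \<tau> \<partial>lebP ((S - {a}) \<union> out)) = (\<integral>\<tau>. f \<tau> \<partial>lebP (S - {a})) * (\<integral>\<tau>. g \<tau> \<partial>lebP out)"
    using lebP_two_blocks[where f = f and g = g, OF V(2) fin f(1) g(1)] f(2) g(2) by blast+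
  have li: "limit_integrand a p = (\<lambda>\<rho>. f \<rho> * g \<rho>)"
    by (rule ext) (simp add: limit_integrand_def f_def g_def)
  have two1: "integrable (lebP (verts G - {a})) (\<lambda>\<rho>. f \<rho> * g \<rho>)"
    by (subst V(1)) (rule two(1))
  have two2: "(\<integral>\<rho>. f \<rho> * g \<rho> \<partial>lebP (verts G - {a})) = (\<integral>\<rho>. f \<rho> \<partial>lebP (S - {a})) * (\<integral>\<rho>. g \<rho> \<partial>lebP out)"
    by (subst V(1)) (rule two(2))
  have two': "integrable (lebP (verts G - {a})) (limit_integrand a p)"
    by (subst li) (rule two1)
  have "limit_integrand a p \<in> borel_measurable (lebP (verts G - {a}))"
    by (rule borel_measurable_integrable[OF two'])
  then show "limit_integrand a p \<in> borel_measurable (lebP (verts G - {a}))" .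
  have "(\<integral>\<rho>. limit_integrand a p \<rho> \<partial>lebP (verts G - {a})) = (\<integral>\<rho>. f \<rho> \<partial>lebP (S - {a})) * (\<integral>\<rho>. g \<rho> \<partial>lebP out)"
    by (subst li) (rule two2)
  also have "\<dots> = ival a (iw p) * (\<Prod>K\<in>comps. sval K (sw K p))"
    unfolding f_def g_def conjunct2[OF blocks] diff_integral.ival_def by (rule refl)
  finally show "(\<integral>\<rho>. limit_integrand a p \<rho> \<partial>lebP (verts G - {a})) = ival a (iw p) * (\<Prod>K\<in>comps. sval K (sw K p))" .
qed

lemma Psi_limit:
  assumes a: "a \<in> S" and p: "p \<in> region (cvar a)" "Xform G S p = 0"
  shows "(\<Psi> a p \<longlongrightarrow> ival a (iw p) * (\<Prod>K\<in>comps. sval K (sw K p))) at_top"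
    "\<exists>B. \<forall>s. norm (\<Psi> a p s) \<le> B" "\<Psi> a p \<in> borel_measurable borel"
proof -
  let ?M = "lebP (verts G - {a})"
  obtain C \<epsilon> where b: "\<epsilon> > 0" "\<And>s \<rho>. norm (exp (zexpo (zw p) (T a (s, \<rho>)))) \<le> C * exp (- \<epsilon> * (\<Sum>v\<in>verts G - {a}. \<bar>\<rho> v\<bar>))"
    by (rule norm_integrand_shear[OF a p]) (rule that)
  have ib: "integrable ?M (\<lambda>\<rho>. C * exp (- \<epsilon> * (\<Sum>v\<in>verts G - {a}. \<bar>\<rho> v\<bar>)))"
    using integrable_exp_sum_abs[of "verts G - {a}" \<epsilon>] b(1) by simp
  have "((\<lambda>s. \<integral>\<rho>. exp (zexpo (zw p) (T a (s, \<rho>))) \<partial>?M) \<longlongrightarrow> (\<integral>\<rho>. limit_integrand a p \<rho> \<partial>?M)) at_top"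
  proof (rule integral_dominated_convergence_at_top[OF limit_integrand_integral(1)[OF a p(1)] measurable_integrand_shear(2)[OF a] ib])
    show "AE \<rho> in ?M. ((\<lambda>s. exp (zexpo (zw p) (T a (s, \<rho>)))) \<longlongrightarrow> limit_integrand a p \<rho>) at_top"
    proof (rule AE_I2)
      fix \<rho>
      have "limit_integrand a p \<rho> = exp (iexpo a (iw p) \<rho> + (\<Sum>K\<in>comps. sexpo K (sw K p) \<rho>))"
        unfolding limit_integrand_def exp_add using B.finite_graph_components by (simp add: exp_sum)
      then show "((\<lambda>s. exp (zexpo (zw p) (T a (s, \<rho>)))) \<longlongrightarrow> limit_integrand a p \<rho>) at_top"
        using tendsto_exp[OF zexpo_shear_limit[OF a p(2)]] by simp
    qed
  qed (use b(2) in simp)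
  then show "(\<Psi> a p \<longlongrightarrow> ival a (iw p) * (\<Prod>K\<in>comps. sval K (sw K p))) at_top"
    unfolding limit_integrand_integral(2)[OF a p(1)] \<Psi>_def[abs_def] .
  have "norm (\<Psi> a p s) \<le> (\<integral>\<rho>. C * exp (- \<epsilon> * (\<Sum>v\<in>verts G - {a}. \<bar>\<rho> v\<bar>)) \<partial>?M)" for s
  proof -
    have n: "norm (exp (zexpo (zw p) (T a (s, \<rho>)))) \<le> norm (C * exp (- \<epsilon> * (\<Sum>v\<in>verts G - {a}. \<bar>\<rho> v\<bar>)))" for \<rho>
      using b(2)[of s \<rho>] unfolding real_norm_def by linarith
    have "integrable ?M (\<lambda>\<rho>. exp (zexpo (zw p) (T a (s, \<rho>))))"
      by (rule Bochner_Integration.integrable_bound[OF ib measurable_integrand_shear(2)[OF a]]) (rule AE_I2, rule n)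
    then show ?thesis
      unfolding \<Psi>_def using b(2)
      by (intro order_trans[OF integral_norm_bound integral_mono[OF integrable_norm ib]])
  qed
  then show "\<exists>B. \<forall>s. norm (\<Psi> a p s) \<le> B" by blast
  interpret Q: sigma_finite_measure ?M by (rule lbP.sigma_finite) simp
  have "(\<lambda>s. \<integral>\<rho>. exp (zexpo (zw p) (T a (s, \<rho>))) \<partial>?M) \<in> borel_measurable lborel"
    by (rule Q.borel_measurable_lebesgue_integral) (use measurable_integrand_shear(1)[OF a, of p] in \<open>simp add: case_prod_unfold\<close>)
  then show "\<Psi> a p \<in> borel_measurable borel" unfolding \<Psi>_def[abs_def] by simp
qed

lemma Xform_unit: "a \<in> S \<Longrightarrow> Xform G S (unit a) = 1"
  unfolding Xform_def unit_simps using finite by simp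

text \<open>On the ray X_S equals \<open>t\<close>, so the Abelian limit applies directly; what
  remains is to match the powers of \<alpha>.\<close>

lemma zono_residue_limit:
  assumes a: "a \<in> S" and p: "p \<in> region (cvar a)" "Xform G S p = 0"
  shows "((\<lambda>t. Xform G S (p + cscale (of_real t) (unit a)) * zono_integral G \<alpha> (p + cscale (of_real t) (unit a))) \<longlongrightarrow>
     2 * internal_integral G \<alpha> S a p * (\<Prod>K\<in>comps. shifted_integral G \<alpha> S K p)) (at_right 0)"
proof -
  let ?L = "ival a (iw p) * (\<Prod>K\<in>comps. sval K (sw K p))"
  obtain B where B: "\<And>s. norm (\<Psi> a p s) \<le> B" using Psi_limit(2)[OF a p] by blast
  have lim: "((\<lambda>t. of_real t * (\<integral>s. of_real (exp (- (\<alpha> * t * lcosh s))) * \<Psi> a p s \<partial>lborel)) \<longlongrightarrow> of_real (2 / \<alpha>) * ?L) (at_right 0)"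
    by (rule abelian_limit[OF \<alpha> Psi_limit(3)[OF a p] B Psi_even[OF a] Psi_limit(1)[OF a p]])
  have "((\<lambda>t. of_real \<alpha> ^ card (verts G) * (of_real t * (\<integral>s. of_real (exp (- (\<alpha> * t * lcosh s))) * \<Psi> a p s \<partial>lborel))) \<longlongrightarrow>
      of_real \<alpha> ^ card (verts G) * (of_real (2 / \<alpha>) * ?L)) (at_right 0)"
    by (intro tendsto_mult lim tendsto_const)
  moreover have "\<forall>\<^sub>F t in at_right 0. of_real \<alpha> ^ card (verts G) * (of_real t * (\<integral>s. of_real (exp (- (\<alpha> * t * lcosh s))) * \<Psi> a p s \<partial>lborel)) =
      Xform G S (p + cscale (of_real t) (unit a)) * zono_integral G \<alpha> (p + cscale (of_real t) (unit a))"
  proof -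
    have "\<forall>\<^sub>F t in at_right (0::real). t > 0" by (rule eventually_at_right_less)
    then show ?thesis
    proof eventually_elim
      case (elim t)
      have "Xform G S (p + cscale (of_real t) (unit a)) = of_real t"
        unfolding cform_linear(1,3)[OF cform_Xform] Xform_unit[OF a] p(2) by simp
      then show ?case
        unfolding zono_integral_zval zval_as_Psi[OF a p elim] by (simp add: mult_ac)
    qed
  qed
  ultimately have "((\<lambda>t. Xform G S (p + cscale (of_real t) (unit a)) * zono_integral G \<alpha> (p + cscale (of_real t) (unit a))) \<longlongrightarrow>
     of_real \<alpha> ^ card (verts G) * (of_real (2 / \<alpha>) * ?L)) (at_right 0)"
    by (rule Lim_transform_eventually)
  also have "of_real \<alpha> ^ card (verts G) * (of_real (2 / \<alpha>) * ?L) =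
      2 * internal_integral G \<alpha> S a p * (\<Prod>K\<in>comps. shifted_integral G \<alpha> S K p)"
  proof -
    \<comment> \<open>The block prefactors account for all vertices but one; the remaining power of
      \<alpha> cancels the denominator of 2 / \<alpha>.\<close>
    have cV: "card (verts G) = Suc (card S - 1 + (\<Sum>K\<in>comps. card (verts K)))"
    proof -
      have "card (verts G) = card S + card out"
        using S finite by (metis card_Diff_subset card_mono le_add_diff_inverse)
      moreover have "card out = (\<Sum>K\<in>comps. card (verts K))"
        using B.sum_components(1)[of "\<lambda>_. 1::nat"] by simp
      moreover have "card S > 0" using a finite by (simp add: card_gt_0_iff) auto
      ultimately show ?thesis by simp
    qed
    have "(\<Prod>K\<in>comps. shifted_integral G \<alpha> S K p) = of_real \<alpha> ^ (\<Sum>K\<in>comps. card (verts K)) * (\<Prod>K\<in>comps. sval K (sw K p))"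
      by (simp add: shifted_integral_sval prod.distrib power_sum)
    then show ?thesis
      unfolding internal_integral_ival[OF a] cV using \<alpha> by (simp add: power_add)
  qed
  finally show ?thesis .
qed

end

section \<open>Operations on restrictions, and the positive energies as a set of uniqueness\<close>

lemma meromorphic_within_cmult: "meromorphic_within A f \<Longrightarrow> meromorphic_within A (\<lambda>p. c * f p)"
  by (rule meromorphic_within_mult[OF meromorphic_within_holomorphic[OF holomorphic_within_const]])

lemma is_restrictionE:
  assumes "is_restriction A H f R" "p \<in> H"
  obtains U k l where "open U" "p \<in> U" "holomorphic_within (A \<inter> U) k" "holomorphic_within (A \<inter> U) l"
    "nondegenerate_on (H \<inter> U) l" "\<And>q. q \<in> A \<inter> U - H \<Longrightarrow> l q \<noteq> 0 \<Longrightarrow> f q = k q / l q"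
    "\<And>q. q \<in> H \<inter> U \<Longrightarrow> l q \<noteq> 0 \<Longrightarrow> R q = k q / l q"
proof -
  from bspec[OF assms(1)[unfolded is_restriction_def] assms(2)] obtain U k l where
    U: "open U \<and> p \<in> U \<and> holomorphic_within (A \<inter> U) k \<and> holomorphic_within (A \<inter> U) l \<and> nondegenerate_on (H \<inter> U) l \<and>
     (\<forall>q\<in>A \<inter> U - H. l q \<noteq> 0 \<longrightarrow> f q = k q / l q) \<and> (\<forall>q\<in>H \<inter> U. l q \<noteq> 0 \<longrightarrow> R q = k q / l q)"
    by (elim exE)
  show ?thesis by (rule that[of U k l]) (use U in blast)+
qed

lemma meromorphic_within_restriction:
  assumes R: "is_restriction A H f R" and H: "H \<subseteq> A"
  shows "meromorphic_within H R"
  unfolding meromorphic_within_def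
proof
  fix p assume "p \<in> H"
  from is_restrictionE[OF R this] obtain U k l where U: "open U" "p \<in> U" "holomorphic_within (A \<inter> U) k" "holomorphic_within (A \<inter> U) l"
    "nondegenerate_on (H \<inter> U) l" "\<And>q. q \<in> H \<inter> U \<Longrightarrow> l q \<noteq> 0 \<Longrightarrow> R q = k q / l q"
    by metis
  have sub: "H \<inter> U \<subseteq> A \<inter> U" using H by blast
  show "\<exists>U g h. open U \<and> p \<in> U \<and> holomorphic_within (H \<inter> U) g \<and> holomorphic_within (H \<inter> U) h \<and>
     nondegenerate_on (H \<inter> U) h \<and> (\<forall>q\<in>H \<inter> U. h q \<noteq> 0 \<longrightarrow> R q = g q / h q)"
    by (rule exI[of _ U], rule exI[of _ k], rule exI[of _ l])
      (intro conjI ballI impI U holomorphic_within_subset[OF U(3) sub] holomorphic_within_subset[OF U(4) sub])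
qed

lemma is_restriction_cmult:
  assumes R: "is_restriction A H f R"
  shows "is_restriction A H (\<lambda>p. c * f p) (\<lambda>p. c * R p)"
  unfolding is_restriction_def
proof
  fix p assume p: "p \<in> H"
  show "\<exists>U k l. open U \<and> p \<in> U \<and> holomorphic_within (A \<inter> U) k \<and> holomorphic_within (A \<inter> U) l \<and>
     nondegenerate_on (H \<inter> U) l \<and> (\<forall>q\<in>A \<inter> U - H. l q \<noteq> 0 \<longrightarrow> c * f q = k q / l q) \<and>
     (\<forall>q\<in>H \<inter> U. l q \<noteq> 0 \<longrightarrow> c * R q = k q / l q)"
  proof (rule is_restrictionE[OF R p])
    fix U k l
    assume U: "open U" "p \<in> U" "holomorphic_within (A \<inter> U) k" "holomorphic_within (A \<inter> U) l" "nondegenerate_on (H \<inter> U) l"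
      and f: "\<And>q. q \<in> A \<inter> U - H \<Longrightarrow> l q \<noteq> 0 \<Longrightarrow> f q = k q / l q" "\<And>q. q \<in> H \<inter> U \<Longrightarrow> l q \<noteq> 0 \<Longrightarrow> R q = k q / l q"
    have "holomorphic_within (A \<inter> U) (\<lambda>p. c * k p)" by (intro holomorphic_within_mult holomorphic_within_const U)
    moreover have "c * f q = c * k q / l q" if "q \<in> A \<inter> U - H" "l q \<noteq> 0" for q using f(1)[OF that] by simp
    moreover have "c * R q = c * k q / l q" if "q \<in> H \<inter> U" "l q \<noteq> 0" for q using f(2)[OF that] by simp
    ultimately show ?thesis
      using U by (intro exI[of _ U], rule_tac exI[of _ "\<lambda>p. c * k p"], rule_tac exI[of _ l]) blast
  qed
qed

definition ones :: "('v::finite, 'e::finite) pre_digraph \<Rightarrow> ('v, 'e) energy" where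
  "ones G = ((\<chi> v. if v \<in> verts G then 1 else 0), (\<chi> e. if e \<in> arcs G then 1 else 0))"

lemma ones_positive: "ones G \<in> positive_energies G" "ones G \<in> energy_space G"
  by (auto simp: ones_def positive_energies_def energy_space_def)

text \<open>Write w = u + i b with real vectors u and b. If u is positive, \<open>f\<close> vanishes
  at u + t b for all small real t, and these parameters accumulate at 0; one-variable uniqueness
  then gives f = 0 at t = i, that is at w. Such w fill an open set.\<close>

lemma determining_positive_energies:
  fixes G :: "('v::finite, 'e::finite) pre_digraph"
  shows "determining (energy_space G) (positive_energies G) (ones G)" (is "determining ?E ?D ?o")
  unfolding determining_def
proof (intro conjI allI impI ballI)
  show oE: "?o \<in> ?E" by (rule ones_positive)
  fix U f q
  assume A: "open U \<and> convex U \<and> ?o \<in> U \<and> holomorphic_within (?E \<inter> U) f \<and> (\<forall>q\<in>?E \<inter> U \<inter> ?D. f q = 0)"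
    and q: "q \<in> ?E \<inter> U"
  define re :: "('v, 'e) energy \<Rightarrow> ('v, 'e) energy"
    where "re q = ((\<chi> v. of_real (Re (fst q $ v))), (\<chi> e. of_real (Re (snd q $ e))))" for q
  \<comment> \<open>Energies with positive real parts: an open set, whose real points in
    \<open>E\<close> are the positive energies.\<close>
  define P where "P = {q :: ('v, 'e) energy. (\<forall>v\<in>verts G. 0 < Re (fst q $ v)) \<and> (\<forall>e\<in>arcs G. 0 < Re (snd q $ e))}"
  have cre: "continuous_on UNIV re"
    unfolding re_def[abs_def]
    by (intro continuous_intros cform_continuous[OF cform_fst] cform_continuous[OF cform_snd])
  have oP: "open P"
  proof -
    have "P = (\<Inter>v\<in>verts G. {q. 0 < Re (fst q $ v)}) \<inter> (\<Inter>e\<in>arcs G. {q. 0 < Re (snd q $ e)})"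
      unfolding P_def by blast
    also have "open \<dots>"
      by (intro open_Int open_INT finite ballI open_Collect_less continuous_intros
          cform_continuous[OF cform_fst] cform_continuous[OF cform_snd])
    finally show ?thesis .
  qed
  have ro: "re ?o = ?o" by (intro energy_eqI) (simp_all add: re_def ones_def)
  have oUP: "open (U \<inter> P)" using A oP by blast
  have B: "open (re -` (U \<inter> P))" by (rule open_vimage[OF oUP cre])
  have oB: "?o \<in> re -` (U \<inter> P)" using A ro by (simp add: P_def ones_def)
  have z: "f w = 0" if w: "w \<in> ?E \<inter> U \<inter> re -` (U \<inter> P)" for w
  proof -
    \<comment> \<open>The real part of - i w, which is the imaginary part of w.\<close>
    define b where "b = re (cscale (- \<i>) w)"
    have w_eq: "re w + cscale \<i> b = w" by (intro energy_eqI) (simp_all add: re_def b_def complex_eq_iff)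
    have E: "re w \<in> ?E" "b \<in> ?E" using w by (auto simp: energy_space_def re_def b_def cscale_def)
    have cont: "continuous_on UNIV (\<lambda>t::real. re w + cscale (of_real t) b)" by (intro continuous_intros)
    have "open ((\<lambda>t::real. re w + cscale (of_real t) b) -` (U \<inter> P))" by (rule open_vimage[OF oUP cont])
    moreover have "0 \<in> (\<lambda>t::real. re w + cscale (of_real t) b) -` (U \<inter> P)" using w by simp
    ultimately obtain d where d: "d > 0" "ball 0 d \<subseteq> (\<lambda>t::real. re w + cscale (of_real t) b) -` (U \<inter> P)"
      by (rule openE)
    have lim: "0 islimpt {t. re w + cscale t b \<in> U \<and> f (re w + cscale t b) = 0}"
      unfolding islimpt_approachable
    proof (intro allI impI)
      fix e :: real assume e: "e > 0"
      define t where "t = min d e / 2"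
      have t: "t > 0" "t < d" "t < e" using d e by (auto simp: t_def min_def)
      let ?x = "re w + cscale (of_real t) b"
      have "t \<in> ball 0 d" using t by simp
      then have x: "?x \<in> U \<inter> P" using d(2) by blast
      have xE: "?x \<in> ?E" using csubspaceD[OF csubspace_energy_space] E by blast
      have xD: "?x \<in> ?D"
        using x xE unfolding positive_energies_def P_def by (auto simp: re_def b_def case_prod_unfold)
      have "f ?x = 0" using A x xE xD by blast
      then show "\<exists>x'\<in>{t. re w + cscale t b \<in> U \<and> f (re w + cscale t b) = 0}. x' \<noteq> 0 \<and> dist x' 0 < e"
        using x t by (intro bexI[of _ "of_real t"]) auto
    qed
    have "f (re w + cscale \<i> b) = 0"
      by (rule holomorphic_within_zero_line[OF csubspace_energy_space _ _ _ _ E(2) lim])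
        (use A w E w_eq in auto)
    then show ?thesis unfolding w_eq .
  qed
  show "f q = 0"
    by (rule holomorphic_within_identity[OF csubspace_energy_space _ _ _ _ B oB z q]) (use A oE in auto)
qed

context zono_setup
begin

abbreviation "E \<equiv> energy_space G"
abbreviation "Hp \<equiv> hyperplane G S"

definition proj :: "('v, 'e) energy \<Rightarrow> ('v, 'e) energy" where
  "proj q = ((\<chi> v. if v \<in> verts G then fst q $ v else 0), (\<chi> e. if e \<in> arcs G then snd q $ e else 0))"

lemma split_hyperplane_unit: assumes a: "a \<in> S" shows "split_hyperplane E (Xform G S) (unit a) proj"
proof
  show "csubspace E" by (rule csubspace_energy_space)
  show "cform (Xform G S)" by (rule cform_Xform)
  show "unit a \<in> E" using a S by (auto simp: energy_space_def unit_def axis_def)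
  show "Xform G S (unit a) = 1" by (rule Xform_unit[OF a])
  show "cmap proj"
  proof (rule cmapI)
    show "cform (\<lambda>p. fst (proj p) $ v)" for v
      unfolding proj_def by (cases "v \<in> verts G") (simp_all add: cform_fst cform_zero)
    show "cform (\<lambda>p. snd (proj p) $ e)" for e
      unfolding proj_def by (cases "e \<in> arcs G") (simp_all add: cform_snd cform_zero)
  qed
  show "proj q \<in> E" for q by (simp add: proj_def energy_space_def)
  show "proj q = q" if "q \<in> E" for q
    using that by (intro energy_eqI) (auto simp: proj_def energy_space_def case_prod_unfold)
qed

lemma csubspace_Hp: "csubspace Hp"
  using csubspaceD[OF csubspace_energy_space[of G]] unfolding csubspace_def hyperplane_def
  by (simp add: cform_linear[OF cform_Xform])

lemma Hp_subset: "Hp \<subseteq> E" by (auto simp: hyperplane_def)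

lemma Hp_X: "z \<in> Hp \<Longrightarrow> Xform G S z = 0" by (simp add: hyperplane_def)

lemma positive_zDom:
  assumes p: "p \<in> positive_energies G"
  shows "zw p \<in> zDom"
proof -
  have pos: "\<And>v. v \<in> verts G \<Longrightarrow> 0 < Re (fst p $ v)" "\<And>e. e \<in> arcs G \<Longrightarrow> 0 < Re (snd p $ e)"
    using p by (auto simp: positive_energies_def)
  obtain m where m: "m > 0" "\<And>v. v \<in> verts G \<Longrightarrow> m \<le> Re (fst p $ v)"
    by (rule finite_positive_lower_bound[of "verts G" "\<lambda>v. Re (fst p $ v)"]) (use pos in auto)
  show ?thesis
  proof (rule DomI)
    show "\<alpha> * m > 0" using m \<alpha> by simp
    fix \<tau> :: "'v \<Rightarrow> real"
    have 1: "(\<Sum>v\<in>verts G. m * \<bar>\<tau> v\<bar>) \<le> (\<Sum>v\<in>verts G. Re (fst p $ v) * \<bar>\<tau> v\<bar>)"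
      by (intro sum_mono mult_right_mono m) auto
    have 2: "0 \<le> (\<Sum>e\<in>arcs G. Re (snd p $ e) * \<bar>\<tau> (tail G e) - \<tau> (head G e)\<bar>)"
      using pos by (intro sum_nonneg mult_nonneg_nonneg) (auto intro: less_imp_le)
    have le: "m * (\<Sum>v\<in>verts G. \<bar>\<tau> v\<bar>) \<le> (\<Sum>v\<in>verts G. Re (fst p $ v) * \<bar>\<tau> v\<bar>) +
        (\<Sum>e\<in>arcs G. Re (snd p $ e) * \<bar>\<tau> (tail G e) - \<tau> (head G e)\<bar>)"
      unfolding sum_distrib_left using 1 2 by linarith
    show "\<alpha> * m * diff_integral.total (verts G) \<tau> \<le> Re (diff_integral.rate (verts G) src tgt (zw p) \<tau>)"
      using mult_left_mono[OF le, of \<alpha>] \<alpha> unfolding zrate diff_integral.total_def by (simp only: mult.assoc)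
  qed
qed


subsection \<open>Existence of the continuations\<close>

text \<open>The continuations built from \<open>cval\<close>. They agree with the integrals wherever
  these converge, which proves existence; \<open>F0\<close> moreover agrees with its integral beyond
  the positive energies, in particular on rays that start at the hyperplane.\<close>

definition F0 where "F0 p = of_real \<alpha> ^ card (verts G) * diff_integral.cval (verts G) src tgt (zw p)"
definition C0 where "C0 a p = of_real \<alpha> ^ (card S - 1) * diff_integral.cval (S - {a}) src tgt (iw p)"
definition J0 where "J0 K p = of_real \<alpha> ^ card (verts K) * diff_integral.cval (verts K) src tgt (sw K p)"

lemma meromorphic_F0: "meromorphic_within E F0"
  unfolding F0_def[abs_def]
  by (rule meromorphic_within_cmult[OF diff_integral.meromorphic_pullback[OF cmap_zw csubspace_energy_space
        ones_positive(2) positive_zDom[OF ones_positive(1)]]])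

lemma F0_zDom: "zw p \<in> zDom \<Longrightarrow> F0 p = zono_integral G \<alpha> p"
  unfolding F0_def zono_integral_zval by (simp only: diff_integral.cval_Dom)

lemma zono_function_F0: "zono_function G \<alpha> F0"
  unfolding zono_function_def meromorphic_continuation_def
  using meromorphic_F0 F0_zDom[OF positive_zDom] by blast

lemma internal_block_C0:
  assumes a: "a \<in> S"
  shows "internal_block G \<alpha> S a (C0 a)"
  unfolding internal_block_def meromorphic_continuation_def
proof (intro conjI ballI)
  show "meromorphic_within Hp (C0 a)"
    unfolding C0_def[abs_def]
    by (rule meromorphic_within_cmult[OF diff_integral.meromorphic_pullback[OF cmap_iw csubspace_Hp
          base_in(2) iw_Dom[OF a base_in(1)]]])
  fix p assume "p \<in> {p \<in> Hp. integrable (lebP (S - {a})) (internal_integrand G \<alpha> S a p)}"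
  then have "iw p \<in> iDom a" using integrable_internal[OF a] by blast
  then show "C0 a p = internal_integral G \<alpha> S a p"
    unfolding C0_def internal_integral_ival[OF a] by (simp only: diff_integral.cval_Dom)
qed

lemma shifted_block_J0:
  assumes K: "K \<in> comps"
  shows "shifted_block G \<alpha> S K (J0 K)" "is_restriction E Hp (J0 K) (J0 K)"
proof -
  have b: "base \<in> E" using base_in(2) Hp_subset by blast
  show "shifted_block G \<alpha> S K (J0 K)"
    unfolding shifted_block_def meromorphic_continuation_def
  proof (intro conjI ballI)
    show "meromorphic_within E (J0 K)"
      unfolding J0_def[abs_def]
      by (rule meromorphic_within_cmult[OF diff_integral.meromorphic_pullback[OF cmap_sw csubspace_energy_space
            b sw_Dom[OF K base_in(1)]]])
    fix p assume "p \<in> {p \<in> E. integrable (lebP (verts K)) (shifted_integrand G \<alpha> S K p)}"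
    then have "sw K p \<in> sDom K" using integrable_shifted[OF K] by blast
    then show "J0 K p = shifted_integral G \<alpha> S K p"
      unfolding J0_def shifted_integral_sval[OF K] by (simp only: diff_integral.cval_Dom)
  qed
  show "is_restriction E Hp (J0 K) (J0 K)"
    unfolding J0_def[abs_def]
    by (rule is_restriction_cmult[OF diff_integral.is_restriction_pullback[OF cmap_sw csubspace_energy_space
          csubspace_Hp Hp_subset base_in(2) sw_Dom[OF K base_in(1)]]])
qed


subsection \<open>The residue\<close>

lemma continuous_on_zono: "continuous_on {q. zw q \<in> zDom} (zono_integral G \<alpha>)"
proof -
  have "continuous_on {q. zw q \<in> zDom} (\<lambda>q. zval (zw q))"
    by (rule holomorphic_within_continuous[OF holomorphic_within_cmap[OF diff_integral.holomorphic_ival cmap_zw]]) simp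
  then have "continuous_on {q. zw q \<in> zDom} (\<lambda>q. of_real \<alpha> ^ card (verts G) * zval (zw q))"
    by (rule continuous_on_mult_left)
  then show ?thesis unfolding zono_integral_zval[abs_def] .
qed

lemma continuous_on_shifted:
  assumes K: "K \<in> comps"
  shows "continuous_on (region c) (shifted_integral G \<alpha> S K)"
proof -
  have "continuous_on (region c) (\<lambda>q. sval K (sw K q))"
    by (rule holomorphic_within_continuous[OF holomorphic_within_cmap[OF diff_integral.holomorphic_ival cmap_sw]])
      (rule sw_Dom[OF K])
  then have "continuous_on (region c) (\<lambda>q. of_real \<alpha> ^ card (verts K) * sval K (sw K q))"
    by (rule continuous_on_mult_left)
  then show ?thesis unfolding shifted_integral_sval[OF K, abs_def] .
qed

lemma continuous_on_internal:
  assumes a: "a \<in> S"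
  shows "continuous_on (region (cvar a)) (internal_integral G \<alpha> S a)"
proof -
  have "continuous_on (region (cvar a)) (\<lambda>q. ival a (iw q))"
    by (rule holomorphic_within_continuous[OF holomorphic_within_cmap[OF diff_integral.holomorphic_ival cmap_iw]])
      (rule iw_Dom[OF a])
  then have "continuous_on (region (cvar a)) (\<lambda>q. of_real \<alpha> ^ (card S - 1) * ival a (iw q))"
    by (rule continuous_on_mult_left)
  then show ?thesis unfolding internal_integral_ival[OF a, abs_def] .
qed

lemma shifted_block_value:
  assumes J: "shifted_block G \<alpha> S K J" and K: "K \<in> comps" and q: "q \<in> E" "q \<in> region c"
  shows "J q = shifted_integral G \<alpha> S K q"
  using J q integrable_shifted[OF K, of q] sw_Dom[OF K q(2)]
  unfolding shifted_block_def meromorphic_continuation_def by blast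

lemma internal_block_value:
  assumes C: "internal_block G \<alpha> S a C" and a: "a \<in> S" and q: "q \<in> Hp" "q \<in> region (cvar a)"
  shows "C q = internal_integral G \<alpha> S a q"
  using C q integrable_internal[OF a, of q] iw_Dom[OF a q(2)]
  unfolding internal_block_def meromorphic_continuation_def by blast

text \<open>\<open>JH\<close> is tied to \<open>J\<close> only through a fraction
  \<open>k / l\<close> that represents \<open>J\<close> off the hyperplane. Off the hyperplane
  \<open>J\<close> is the block integral, which is continuous across it, so \<open>k / l\<close>
  equals the integral on the hyperplane as well.\<close>

lemma shifted_restriction_value:
  assumes K: "K \<in> comps" and a: "a \<in> S" and J: "shifted_block G \<alpha> S K J" and R: "is_restriction E Hp J JH"
    and z: "z \<in> Hp" "z \<in> region c"
  obtains V l where "open V" "z \<in> V" "continuous_on (Hp \<inter> V) l" "nondegenerate_on (Hp \<inter> V) l"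
    "\<And>q. q \<in> Hp \<inter> V \<Longrightarrow> l q \<noteq> 0 \<Longrightarrow> JH q = shifted_integral G \<alpha> S K q"
proof -
  interpret X: split_hyperplane E "Xform G S" "unit a" proj by (rule split_hyperplane_unit[OF a])
  let ?f = "shifted_integral G \<alpha> S K"
  obtain U k l where U: "open U" "z \<in> U" "holomorphic_within (E \<inter> U) k" "holomorphic_within (E \<inter> U) l"
    "nondegenerate_on (Hp \<inter> U) l" "\<And>q. q \<in> E \<inter> U - Hp \<Longrightarrow> l q \<noteq> 0 \<Longrightarrow> J q = k q / l q"
    "\<And>q. q \<in> Hp \<inter> U \<Longrightarrow> l q \<noteq> 0 \<Longrightarrow> JH q = k q / l q"
    by (rule is_restrictionE[OF R z(1)]) (rule that)
  let ?V = "U \<inter> region c"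
  have oV: "open ?V" using U(1) open_region by blast
  have cont: "continuous_on (E \<inter> ?V) k" "continuous_on (E \<inter> ?V) l" "continuous_on (E \<inter> ?V) ?f"
    using U(3,4) continuous_on_shifted[OF K, of c] by (auto dest!: holomorphic_within_continuous intro: continuous_on_subset)
  show ?thesis
  proof (rule that[of ?V l])
    show "open ?V" "z \<in> ?V" using oV U(2) z by auto
    show "continuous_on (Hp \<inter> ?V) l" by (rule continuous_on_subset[OF cont(2)]) (use Hp_subset in blast)
    show "nondegenerate_on (Hp \<inter> ?V) l" by (rule nondegenerate_on_subset[OF U(5) oV]) blast
    fix q assume q: "q \<in> Hp \<inter> ?V" "l q \<noteq> 0"
    then have qE: "q \<in> E \<inter> ?V" using Hp_subset by blast
    obtain V' where V': "open V'" "q \<in> V'" "V' \<subseteq> ?V" "\<And>q'. q' \<in> E \<inter> V' \<Longrightarrow> l q' \<noteq> 0"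
      by (rule nonzero_open[OF cont(2) oV qE q(2)]) (rule that)
    have sub: "E \<inter> V' \<subseteq> E \<inter> ?V" using V'(3) by blast
    have "k q = l q * ?f q"
    \<comment> \<open>X_S serves as the exceptional function: the equation is known off its zero set
      and extends to the hyperplane by continuity.\<close>
    proof (rule nondegenerate_on_eqI[OF V'(1) X.nondegenerate_X[OF V'(1)]])
      show "continuous_on (E \<inter> V') k" by (rule continuous_on_subset[OF cont(1) sub])
      show "continuous_on (E \<inter> V') (\<lambda>q. l q * ?f q)"
        by (intro continuous_on_mult continuous_on_subset[OF cont(2) sub] continuous_on_subset[OF cont(3) sub])
      show "q \<in> E \<inter> V'" using qE V' by blast
      fix x assume x: "x \<in> E \<inter> V'" "Xform G S x \<noteq> 0"
      then have "x \<notin> Hp" using Hp_X by blast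
      then have "x \<in> E \<inter> U - Hp" "x \<in> region c" using sub x(1) by blast+
      then have "?f x = k x / l x" using U(6)[OF _ V'(4)[OF x(1)]] shifted_block_value[OF J K, of x c] by auto
      then show "k x = l x * ?f x" using V'(4)[OF x(1)] by simp
    qed
    moreover have "JH q = k q / l q" using U(7) q by blast
    ultimately show "JH q = ?f q" using q(2) by simp
  qed
qed

text \<open>Applies \<open>is_restrictionI\<close> at the base point. Near that point the block
  functions can be replaced by convergent integrals, and the limit formula is available on each
  ray.\<close>

lemma residue:
  assumes F: "zono_function G \<alpha> F" and a: "a \<in> S" and C: "internal_block G \<alpha> S a C"
    and J: "\<And>K. K \<in> comps \<Longrightarrow> shifted_block G \<alpha> S K (J K)"
    and JH: "\<And>K. K \<in> comps \<Longrightarrow> is_restriction E Hp (J K) (JH K)"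
  shows "is_residue G S F (\<lambda>p. 2 * C p * (\<Prod>K\<in>comps. JH K p))"
proof -
  interpret X: split_hyperplane E "Xform G S" "unit a" proj by (rule split_hyperplane_unit[OF a])
  have H: "X.H = Hp" unfolding X.H_def hyperplane_def ..
  let ?W = "region (cvar a)" and ?D = "{q \<in> E. zw q \<in> zDom}"
  let ?Q = "\<lambda>q. Xform G S q * zono_integral G \<alpha> q" and ?R = "\<lambda>p. 2 * C p * (\<Prod>K\<in>comps. JH K p)"
  let ?L = "\<lambda>p. 2 * internal_integral G \<alpha> S a p * (\<Prod>K\<in>comps. shifted_integral G \<alpha> S K p)"
  have merF: "meromorphic_within E F" using F by (simp add: zono_function_def meromorphic_continuation_def)
  \<comment> \<open>An arbitrary continuation is tied to the integral only on positive energies,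
    which the rays need not meet; uniqueness replaces it by \<open>F0\<close>.\<close>
  have eqF: "meromorphic_eq E F F0"
    by (rule meromorphic_eqI[OF csubspace_energy_space merF meromorphic_F0 determining_positive_energies])
      (use F F0_zDom[OF positive_zDom] in \<open>simp add: zono_function_def meromorphic_continuation_def\<close>)
  have ozD: "open (zw -` zDom)" by (rule open_vimage[OF diff_integral.open_Dom cmap_continuous[OF cmap_zw]])
  have cR0: "continuous_on ?W ?L"
    by (intro continuous_intros continuous_on_internal[OF a] continuous_on_shifted)
  have "is_restriction E X.H (\<lambda>p. Xform G S p * F p) ?R"
  proof (rule X.is_restrictionI[where W = ?W and a = base and D = ?D and Q = ?Q and ?R0.0 = ?L])
    show "meromorphic_within E (\<lambda>p. Xform G S p * F p)"
      by (rule meromorphic_within_mult[OF meromorphic_within_holomorphic[OF holomorphic_within_cform[OF cform_Xform]] merF])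
    have "meromorphic_within Hp C" using C by (simp add: internal_block_def meromorphic_continuation_def)
    then show "meromorphic_within X.H ?R"
      unfolding H
      by (intro meromorphic_within_mult[OF meromorphic_within_cmult] meromorphic_within_prod
          meromorphic_within_restriction[OF JH Hp_subset])
    show "base \<in> X.H" unfolding H by (rule base_in)
    show "open ?W" by (rule open_region)
    show "base \<in> ?W" by (rule base_in)
    show "\<forall>\<^sub>F t in at_right 0. z + cscale (of_real t) (unit a) \<in> ?D" if z: "z \<in> X.H \<inter> ?W" for z
      using eventually_at_right_less[of "0::real"]
    proof eventually_elim
      case (elim t)
      then show ?case using X.pr_line(3)[of z] zw_Dom[OF a, of z t] z Hp_X[of z] unfolding H by blast
    qed
    show "((\<lambda>t. ?Q (z + cscale (of_real t) (unit a))) \<longlongrightarrow> ?L z) (at_right 0)" if z: "z \<in> X.H \<inter> ?W" for z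
      by (rule zono_residue_limit[OF a]) (use z Hp_X[of z] in \<open>unfold H, blast+\<close>)
  next
    fix U g h q
    assume U: "open U" "frac_rep E (\<lambda>p. Xform G S p * F p) U g h" and q: "q \<in> E \<inter> U \<inter> ?D"
    obtain U' k where U': "open U'" "q \<in> U'" "holomorphic_within (E \<inter> U') k" "nondegenerate_on (E \<inter> U') k"
       "\<forall>x\<in>E \<inter> U'. k x \<noteq> 0 \<longrightarrow> F x = F0 x"
      using eqF q unfolding meromorphic_eq_def by blast
    let ?V = "U \<inter> (U' \<inter> zw -` zDom)"
    have oV: "open ?V" using U U' ozD by blast
    show "g q = h q * ?Q q"
    proof (rule frac_rep_eq_continuous[OF U(2,1) oV])
      show "continuous_on (E \<inter> ?V) ?Q"
        by (intro continuous_on_mult cform_continuous[OF cform_Xform] continuous_on_subset[OF continuous_on_zono]) blast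
      show "continuous_on (E \<inter> ?V) k"
        by (rule continuous_on_subset[OF holomorphic_within_continuous[OF U'(3)]]) blast
      show "nondegenerate_on (E \<inter> ?V) k" by (rule nondegenerate_on_subset[OF U'(4) oV]) blast
      show "Xform G S x * F x = ?Q x" if "x \<in> E \<inter> ?V" "k x \<noteq> 0" for x
        using U'(5) that F0_zDom[of x] by auto
      show "q \<in> E \<inter> ?V" using q U'(2) by blast
    qed blast
  next
    fix U s t z
    assume U: "open U" "U \<subseteq> ?W" "frac_rep X.H ?R U s t" and z: "z \<in> X.H \<inter> U"
    have zH: "z \<in> Hp" "z \<in> ?W" using z U(2) unfolding H by auto
    \<comment> \<open>Each component brings its own neighbourhood and exceptional function; as there
      are finitely many, the neighbourhoods are intersected and the functions multiplied.\<close>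
    have ex: "\<exists>V l. open V \<and> z \<in> V \<and> continuous_on (Hp \<inter> V) l \<and> nondegenerate_on (Hp \<inter> V) l \<and>
        (\<forall>q\<in>Hp \<inter> V. l q \<noteq> 0 \<longrightarrow> JH K q = shifted_integral G \<alpha> S K q)" if K: "K \<in> comps" for K
      by (rule shifted_restriction_value[OF K a J[OF K] JH[OF K] zH]) blast
    obtain V where V: "\<forall>K\<in>comps. \<exists>l. open (V K) \<and> z \<in> V K \<and> continuous_on (Hp \<inter> V K) l \<and> nondegenerate_on (Hp \<inter> V K) l \<and>
        (\<forall>q\<in>Hp \<inter> V K. l q \<noteq> 0 \<longrightarrow> JH K q = shifted_integral G \<alpha> S K q)"
      using bchoice[OF ballI[OF ex]] by (rule exE)
    obtain l where l: "\<forall>K\<in>comps. open (V K) \<and> z \<in> V K \<and> continuous_on (Hp \<inter> V K) (l K) \<and> nondegenerate_on (Hp \<inter> V K) (l K) \<and>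
        (\<forall>q\<in>Hp \<inter> V K. l K q \<noteq> 0 \<longrightarrow> JH K q = shifted_integral G \<alpha> S K q)"
      using bchoice[OF V] by (rule exE)
    have Vl: "open (V K)" "z \<in> V K" "continuous_on (Hp \<inter> V K) (l K)" "nondegenerate_on (Hp \<inter> V K) (l K)"
        "\<And>q. q \<in> Hp \<inter> V K \<Longrightarrow> l K q \<noteq> 0 \<Longrightarrow> JH K q = shifted_integral G \<alpha> S K q" if "K \<in> comps" for K
      using bspec[OF l that] by blast+
    note finc = B.finite_graph_components
    let ?V = "U \<inter> (\<Inter>K\<in>comps. V K)"
    have oV: "open ?V" using U(1) Vl(1) finc by (intro open_Int open_INT) auto
    have c: "continuous_on (Hp \<inter> ?V) (l K)" if "K \<in> comps" for K
      by (rule continuous_on_subset[OF Vl(3)[OF that]]) (use that in blast)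
    show "s z = t z * ?L z"
    proof (rule frac_rep_eq_continuous[OF U(3)[unfolded H] U(1) oV])
      show "continuous_on (Hp \<inter> ?V) ?L" by (rule continuous_on_subset[OF cR0]) (use U(2) in blast)
      show "continuous_on (Hp \<inter> ?V) (\<lambda>q. \<Prod>K\<in>comps. l K q)" by (intro continuous_on_prod c)
      show "nondegenerate_on (Hp \<inter> ?V) (\<lambda>q. \<Prod>K\<in>comps. l K q)"
      proof (rule nondegenerate_on_prod[OF finc oV c])
        show "nondegenerate_on (Hp \<inter> ?V) (l K)" if "K \<in> comps" for K
          by (rule nondegenerate_on_subset[OF Vl(4)[OF that] oV]) (use that in blast)
      qed
      show "z \<in> Hp \<inter> ?V" using z zH(1) Vl(2) by blast
      fix q assume q: "q \<in> Hp \<inter> ?V" "(\<Prod>K\<in>comps. l K q) \<noteq> 0"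
      then have "l K q \<noteq> 0" if "K \<in> comps" for K using that finc by (meson prod_zero)
      then have "(\<Prod>K\<in>comps. JH K q) = (\<Prod>K\<in>comps. shifted_integral G \<alpha> S K q)"
        using q(1) by (intro prod.cong Vl(5)) auto
      moreover have "C q = internal_integral G \<alpha> S a q"
        by (rule internal_block_value[OF C a]) (use q(1) U(2) in auto)
      ultimately show "?R q = ?L q" by (simp only:)
    qed blast
  qed
  then show ?thesis unfolding is_residue_def H .
qed


subsection \<open>Independence of the reference vertex\<close>

text \<open>The linear weights sum to - X_S = 0 and edges depend only on differences, so the common
  translation \<open>s\<close> drops out. The position of \<open>a\<close> then plays the role of
  the pinned value 0.\<close>

lemma expo_shear_invariant:
  assumes a: "a \<in> S" and X: "Xform G S p = 0"
  shows "diff_integral.expo S src tgt (iw p) (shear S S a (s, \<rho>)) = iexpo a (iw p) \<rho>"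
proof -
  let ?c = "\<lambda>v. - (fst p $ v + eta G S p v)"
  define \<sigma> where "\<sigma> v = (if v = a then 0 else \<rho> v)" for v
  have sh: "shear S S a (s, \<rho>) v = s + \<sigma> v" if "v \<in> S" for v using that by (simp add: shear_def \<sigma>_def)
  have "(\<Sum>v\<in>S. ?c v) = 0" using X unfolding Xform_eta by (simp only: sum_negf minus_zero)
  then have "(\<Sum>v\<in>S. ?c v * of_real (s + \<sigma> v)) = (\<Sum>v\<in>S. ?c v * of_real (\<sigma> v))"
    by (simp only: of_real_add distrib_left sum.distrib sum_distrib_right[symmetric] mult_zero_left add_0_left)
  also have "\<dots> = (\<Sum>v\<in>S - {a}. ?c v * of_real (\<rho> v))"
    using a by (subst sum.remove[of S a]) (auto simp: \<sigma>_def intro!: sum.cong)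
  finally have 1: "(\<Sum>v\<in>S. ?c v * of_real (shear S S a (s, \<rho>) v)) = (\<Sum>v\<in>S - {a}. ?c v * of_real (\<rho> v))"
    by (simp only: sh cong: sum.cong)
  have 2: "(\<Sum>e\<in>arcs (G \<restriction> S). snd p $ e * of_real (lcosh ((if tail G e \<in> S then shear S S a (s, \<rho>) (tail G e) else 0) -
        (if head G e \<in> S then shear S S a (s, \<rho>) (head G e) else 0)))) =
    (\<Sum>e\<in>arcs (G \<restriction> S). snd p $ e * of_real (lcosh ((if tail G e \<in> S - {a} then \<rho> (tail G e) else 0) -
        (if head G e \<in> S - {a} then \<rho> (head G e) else 0))))"
    by (rule sum.cong) (auto simp: sh \<sigma>_def)
  show ?thesis unfolding iw_def expo_weights pot_eq 1 2 by simp
qed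

lemma internal_integral_reference:
  assumes a: "a \<in> S" and b: "b \<in> S" and p: "p \<in> Hp" "p \<in> region (cvar a)" "p \<in> region (cvar b)"
  shows "internal_integral G \<alpha> S a p = internal_integral G \<alpha> S b p"
proof (cases "a = b")
  case False
  note X = Hp_X[OF p(1)]
  let ?g = "\<lambda>\<tau>. exp (diff_integral.expo S src tgt (iw p) \<tau>)"
  \<comment> \<open>The indicator cuts the translation orbits down to segments of length 1 and makes
    the invariant integrand integrable over all of \<open>S\<close>.\<close>
  define h where "h \<tau> = indicator {0..1::real} (\<tau> a) *\<^sub>R ?g \<tau>" for \<tau>
  have fS: "finite S" by (rule finite)
  have ind: "has_bochner_integral lborel (\<lambda>s::real. indicator {c..c + 1} s *\<^sub>R w) w" for c and w :: complex
    using has_bochner_integral_indicator[of "{c..c + 1}" lborel w] by simp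
  have ha: "h (shear S S a (s, \<rho>)) = indicator {0..1} s *\<^sub>R exp (iexpo a (iw p) \<rho>)" for s \<rho>
    unfolding h_def expo_shear_invariant[OF a X] using a by (simp add: shear_def)
  \<comment> \<open>In coordinates relative to \<open>b\<close> one has \<tau> a = \<rho> a + s, so
    the cut becomes an interval for \<open>s\<close> that depends on \<rho> but still has length
    1.\<close>
  have hb: "h (shear S S b (s, \<rho>)) = indicator {- \<rho> a..- \<rho> a + 1} s *\<^sub>R exp (iexpo b (iw p) \<rho>)" for s \<rho>
    unfolding h_def expo_shear_invariant[OF b X] using a False by (auto simp: shear_def indicator_def)
  have ia: "integrable (lebP (S - {a})) (\<lambda>\<rho>. exp (iexpo a (iw p) \<rho>))"
    by (rule diff_integral.integrable_Dom[OF iw_Dom[OF a p(2)]])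
  have hm: "h \<in> borel_measurable (lebP S)"
  proof -
    have "(\<lambda>\<tau>. \<tau> a) \<in> measurable (lebP S) lborel" by (rule measurable_component_singleton[OF a])
    moreover have "(indicator {0..1} :: real \<Rightarrow> real) \<in> borel_measurable lborel" by measurable
    ultimately have "(\<lambda>\<tau>. indicator {0..1::real} (\<tau> a) :: real) \<in> borel_measurable (lebP S)"
      by (rule measurable_compose)
    moreover have "?g \<in> borel_measurable (lebP S)"
      using diff_integral.borel_measurable_expo[of S src tgt "iw p"] by measurable
    ultimately show ?thesis unfolding h_def[abs_def] by (rule borel_measurable_scaleR)
  qed
  have hi: "integrable (lebP S) h"
  proof -
    interpret Q: sigma_finite_measure "lebP (S - {a})" by (rule lbP.sigma_finite) simp
    interpret P: pair_sigma_finite "lborel :: real measure" "lebP (S - {a})" ..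
    have "integrable (lborel \<Otimes>\<^sub>M lebP (S - {a})) (\<lambda>z. h (shear S S a z))"
    proof (rule P.Fubini_integrable)
      show "(\<lambda>z. h (shear S S a z)) \<in> borel_measurable (lborel \<Otimes>\<^sub>M lebP (S - {a}))"
        by (rule measurable_compose[OF measurable_shear hm])
      show "integrable lborel (\<lambda>s. \<integral>\<rho>. norm (h (shear S S a (s, \<rho>))) \<partial>lebP (S - {a}))"
        unfolding ha norm_scaleR by simp
      show "AE s in lborel. integrable (lebP (S - {a})) (\<lambda>\<rho>. h (shear S S a (s, \<rho>)))"
        unfolding ha using ia by simp
    qed
    then show ?thesis using integral_shear(1)[OF fS a hm, of S] by blast
  qed
  have "ival a (iw p) = (\<integral>s. indicator {0..0 + 1::real} s *\<^sub>R ival a (iw p) \<partial>lborel)"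
    using has_bochner_integral_integral_eq[OF ind[of 0 "ival a (iw p)"]] by (simp only:)
  also have "\<dots> = (\<integral>s. (\<integral>\<rho>. h (shear S S a (s, \<rho>)) \<partial>lebP (S - {a})) \<partial>lborel)"
    unfolding ha diff_integral.ival_def by simp
  also have "\<dots> = integral\<^sup>L (lebP S) h" by (rule integral_shear_iterated(1)[OF fS a hi])
  also have "\<dots> = (\<integral>\<rho>. (\<integral>s. h (shear S S b (s, \<rho>)) \<partial>lborel) \<partial>lebP (S - {b}))"
    by (rule integral_shear_iterated(2)[OF fS b hi, symmetric])
  also have "\<dots> = ival b (iw p)"
    unfolding hb has_bochner_integral_integral_eq[OF ind] diff_integral.ival_def ..
  finally show ?thesis unfolding internal_integral_ival[OF a] internal_integral_ival[OF b] by (simp only:)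
qed simp

lemma internal_block_unique:
  assumes a: "a \<in> S" "b \<in> S" and C: "internal_block G \<alpha> S a C" "internal_block G \<alpha> S b C'"
  shows "meromorphic_eq Hp C C'"
proof -
  let ?B = "region (cvar a) \<inter> region (cvar b)"
  have m: "meromorphic_within Hp C" "meromorphic_within Hp C'"
    using C by (simp_all add: internal_block_def meromorphic_continuation_def)
  have "determining Hp (Hp \<inter> ?B) base"
    \<comment> \<open>The base point lies in the regions of both reference vertices, so both
      internal integrals converge on a common open piece of the hyperplane.\<close>
    by (rule determining_open[OF csubspace_Hp open_Int[OF open_region open_region]]) (use base_in in auto)
  then show ?thesis
  proof (rule meromorphic_eqI[OF csubspace_Hp m])
    fix q assume "q \<in> Hp \<inter> ?B"
    then have q: "q \<in> Hp" "q \<in> region (cvar a)" "q \<in> region (cvar b)" by auto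
    show "C q = C' q"
      unfolding internal_block_value[OF C(1) a(1) q(1,2)] internal_block_value[OF C(2) a(2) q(1,3)]
      by (rule internal_integral_reference[OF a q])
  qed
qed

end

theorem mainTheorem9:
  fixes G :: "('v::finite, 'e::finite) pre_digraph" and \<alpha> :: real and S :: "'v set"
  assumes "fin_digraph G" and "loopfree_digraph G" and "Digraph_Component.connected G"
    and "0 < \<alpha>"
    and "S \<subseteq> verts G" and "S \<noteq> {}" and "Digraph_Component.connected (G \<restriction> S)"
  defines "\<K> \<equiv> graph_components (G \<restriction> (verts G - S))"
  shows
    "(\<exists>F. zono_function G \<alpha> F) \<and>
     (\<forall>a\<in>S. \<exists>C. internal_block G \<alpha> S a C) \<and>
     (\<forall>K\<in>\<K>. \<exists>J JH. shifted_block G \<alpha> S K J \<and>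
        is_restriction (energy_space G) (hyperplane G S) J JH) \<and>
     (\<forall>F a C J JH. zono_function G \<alpha> F \<and> a \<in> S \<and> internal_block G \<alpha> S a C \<and>
        (\<forall>K\<in>\<K>. shifted_block G \<alpha> S K (J K) \<and>
           is_restriction (energy_space G) (hyperplane G S) (J K) (JH K)) \<longrightarrow>
        is_residue G S F (\<lambda>p. 2 * C p * (\<Prod>K\<in>\<K>. JH K p))) \<and>
     (\<forall>a\<in>S. \<forall>b\<in>S. \<forall>C C'. internal_block G \<alpha> S a C \<and> internal_block G \<alpha> S b C' \<longrightarrow>
        meromorphic_eq (hyperplane G S) C C')"
proof -
  interpret zono_setup G \<alpha> S by (rule zono_setup.intro) (fact assms)+
  show ?thesis
    unfolding \<K>_def
  proof (intro conjI ballI allI impI)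
    show "\<exists>F. zono_function G \<alpha> F" using zono_function_F0 by blast
    show "\<exists>C. internal_block G \<alpha> S a C" if "a \<in> S" for a using internal_block_C0[OF that] by blast
    show "\<exists>J JH. shifted_block G \<alpha> S K J \<and> is_restriction (energy_space G) (hyperplane G S) J JH"
      if "K \<in> graph_components (G \<restriction> (verts G - S))" for K
      using shifted_block_J0[OF that] by blast
    fix F a C J JH
    assume A: "zono_function G \<alpha> F \<and> a \<in> S \<and> internal_block G \<alpha> S a C \<and>
        (\<forall>K\<in>graph_components (G \<restriction> (verts G - S)). shifted_block G \<alpha> S K (J K) \<and>
           is_restriction (energy_space G) (hyperplane G S) (J K) (JH K))"
    show "is_residue G S F (\<lambda>p. 2 * C p * (\<Prod>K\<in>graph_components (G \<restriction> (verts G - S)). JH K p))"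
      by (rule residue[where a = a and J = J]) (use A in blast)+
  next
    fix a b C C' assume "a \<in> S" "b \<in> S" "internal_block G \<alpha> S a C \<and> internal_block G \<alpha> S b C'"
    then show "meromorphic_eq (hyperplane G S) C C'" using internal_block_unique by blast
  qed
qed

end
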